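(* Fix $\delta>0$. For a positive integer $N$, a positive integer $k$ and a real $\varrho\ge0$, let \[\mathcal{S}_{k,\varrho}(N)=\lim_{T\to\infty}\frac1T\int_0^T\Big|\sum_{n=1}^N\frac{\varrho^{\Omega(n)}}{n^{1/2+it}}\Big(1-\frac{\log n}{\log N}\Big)\Big|^{2k}dt .\] Then, uniformly for $0\le\varrho\le\sqrt{2-\delta}$ and positive integers $k=o(\sqrt{\log\log N})$, as $N\to\infty$, \[\mathcal{S}_{k,\varrho}(N)=a(k,\varrho)\gamma(k,\varrho)(\log N)^{k^2\varrho^2}+\mathcal{E}_{k,\varrho}(N),\] where \[\mathcal{E}_{k,\varrho}(N)\ll(\log N)^{k^2\varrho^2-1/2}\exp\big(-k^2\varrho^2\log k-k^2\varrho^2\log\log k+O_\delta(k^2)\big),\] and \[a(k,\varrho)=\prod_p\Big(1-\frac1p\Big)^{k^2\varrho^2}\sum_{j=0}^\infty\frac{d_k^2(p^j)\varrho^{2j}}{p^j},\] \[\gamma(k,\varrho)=\frac{1}{\Gamma(1+\varrho^2)^{k^2}}\int_{\mathcal{P}_{k,\varrho}}\prod_{i=1}^k\Big(1-\sum_{j=1}^kx_{ij}^{1/\varrho^2}\Big)\prod_{j=1}^k\Big(1-\sum_{i=1}^kx_{ij}^{1/\varrho^2}\Big)\,d\underline{x},\] with \[\mathcal{P}_{k,\varrho}=\Big\{(x_{ij})\in\mathbb{R}^{k^2}: x_{ij}\ge0,\ \sum_{i=1}^kx_{ij}^{1/\varrho^2}\le1\ (\forall j),\ \sum_{j=1}^kx_{ij}^{1/\varrho^2}\le1\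 (\forall i)\Big\}.\]
   Context: $\Omega(n)$ denotes the number of prime factors of $n$ counted with multiplicity (with $\varrho^{0}=1$). $d_k(p^j)=\binom{j+k-1}{j}$ is the $k$-fold divisor function at prime powers; products over $p$ run over primes. $d\underline{x}$ is Lebesgue measure on $\mathbb{R}^{k^2}$. $N$ and $k$ are assumed large enough that the iterated logarithms are positive. *)

theory Defs
  imports "HOL-Analysis.Analysis" "HOL-Computational_Algebra.Primes"
begin

definition bigOmega :: "nat \<Rightarrow> nat" where
  "bigOmega n = size (prime_factorization n)"

text \<open>k-fold divisor function at a prime power: d_k(p^j) = binom(j+k-1, j).\<close>
definition dk_pp :: "nat \<Rightarrow> nat \<Rightarrow> nat" where
  "dk_pp k j = (j + k - 1) choose j"

definition dirpoly :: "nat \<Rightarrow> real \<Rightarrow> real \<Rightarrow> complex" where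
  "dirpoly N \<rho> t = (\<Sum>n=1..N. complex_of_real (\<rho> ^ bigOmega n * (1 - ln (real n) / ln (real N)))
        / (of_nat n) powr (1/2 + \<i> * complex_of_real t))"

definition moment_S :: "nat \<Rightarrow> real \<Rightarrow> nat \<Rightarrow> real" where
  "moment_S k \<rho> N = Lim at_top (\<lambda>T::real. (1 / T) * integral {0..T} (\<lambda>t. cmod (dirpoly N \<rho> t) ^ (2 * k)))"

definition a_const :: "nat \<Rightarrow> real \<Rightarrow> real" where
  "a_const k \<rho> = (\<Prod>p. if prime p then
        (1 - 1 / real p) powr (real k ^ 2 * \<rho> ^ 2) *
        (\<Sum>j. real (dk_pp k j) ^ 2 * \<rho> ^ (2 * j) / real p ^ j)
      else 1)"

definition idx :: "nat \<Rightarrow> (nat \<times> nat) set" where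
  "idx k = {1..k} \<times> {1..k}"

definition P_set :: "nat \<Rightarrow> real \<Rightarrow> ((nat \<times> nat) \<Rightarrow> real) set" where
  "P_set k \<rho> = {x \<in> idx k \<rightarrow>\<^sub>E UNIV.
      (\<forall>ij\<in>idx k. x ij \<ge> 0) \<and>
      (\<forall>j\<in>{1..k}. (\<Sum>i=1..k. x (i, j) powr (1 / \<rho> ^ 2)) \<le> 1) \<and>
      (\<forall>i\<in>{1..k}. (\<Sum>j=1..k. x (i, j) powr (1 / \<rho> ^ 2)) \<le> 1)}"

text \<open>gamma(k,rho); for rho = 0 the formula is read as its limit rho -> 0+, which is 1.\<close>
definition gamma_const :: "nat \<Rightarrow> real \<Rightarrow> real" where
  "gamma_const k \<rho> = (if \<rho> = 0 then 1 else
     1 / Gamma (1 + \<rho> ^ 2) ^ (k ^ 2) *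
     integral\<^sup>L (Pi\<^sub>M (idx k) (\<lambda>_. lborel))
       (\<lambda>x. indicator (P_set k \<rho>) x *
            (\<Prod>i=1..k. 1 - (\<Sum>j=1..k. x (i, j) powr (1 / \<rho> ^ 2))) *
            (\<Prod>j=1..k. 1 - (\<Sum>i=1..k. x (i, j) powr (1 / \<rho> ^ 2)))))"

end

theory Submission
  imports Defs "HOL-Probability.Probability" "HOL-Library.Function_Algebras"
begin

text \<open>
  Write \<open>z = \<rho>\<^sup>2\<close>, \<open>L = log N\<close>. By orthogonality the moment is the sum over pairs of \<open>k\<close>-tuples with equal
  products, that is, a product over \<open>p \<le> N\<close> of local masses times the expectation of the window
  \<open>W(u) = \<Prod>\<^sub>c (1 - u\<^sub>c / L)\<^sub>+\<close> at a sum of independent vectors \<open>log p \<cdot> X\<^sub>p\<close> in \<open>2k\<close> coordinates.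
  For \<open>p > 8k\<^sup>2\<close> a Lindeberg argument replaces \<open>X\<^sub>p\<close> by \<open>k\<^sup>2\<close> independent Poisson variables, one for each
  position \<open>(i, j)\<close>, and for \<open>p \<le> 8k\<^sup>2\<close> by \<open>0\<close>. The position \<open>(i, j)\<close> then carries a copy of
  \<open>T = \<Sum>\<^sub>p log p \<cdot> Poisson(z \<lambda>\<^sub>p)\<close> with \<open>\<lambda>\<^sub>p = - log (1 - 1/p)\<close>, and a second Lindeberg argument over the positions replaces \<open>T\<close> by the image
  \<open>L v\<^bsup>1/z\<^esup>\<close> of a multiple of Lebesgue measure on \<open>[0, 1]\<close>, which produces the integral defining \<open>\<gamma>(k, \<rho>)\<close>.
  In a single coordinate the window is a combination of \<open>(x - t)\<^sub>+\<close> and \<open>(x - t)\<^sub>+\<^sup>2\<close>; the Stein-Chen identity relates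
  these two truncated moments of \<open>T\<close>, and the Laplace transform fixes the remaining constant.
  Both steps gain a factor \<open>1 / L\<close>. Since \<open>W(u) \<le> exp (2k\<^sup>2 - k \<Sum> u\<^sub>c / L)\<close>, every other position contributes at
  most \<open>O((L / (k log k))\<^sup>z)\<close>, which is the saving in \<open>k\<close>.
\<close>

section \<open>Sums over primes\<close>

text \<open>Uniformity in k is the obstacle: a loss of exp(O(k^2)) is allowed and nothing more,
  although 2k coordinates interact. The exponential majorant of the window is multiplicative, so in
  each replacement step the other summands are integrated independently; a supremum bound there
  would lose the powers of k and log k. The factor k comes from the rate k/L of the majorant, the
  factor log k from leaving out the primes up to 8k^2. That cutoff ensures k^2 z/p <= 1/4, so that a
  local mass is 1 + k^2 z/p up to a quadratic error; below it nothing is expanded, and the product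
  of the masses is exp(O(k^2)). With lambda_p = -log(1 - 1/p) the weight exp(-k^2 z lambda_p) is
  exactly the convergence factor in \<open>a_const\<close>, so the Euler product arises without
  error except for its tail beyond N. The bound on rho keeps z/2, the ratio at p = 2, away from the
  singularity 1 of the local series. Truncated moments of orders 1 and 2 suffice because a matrix
  position meets just two coordinates of the window.\<close>

definition lam :: "nat \<Rightarrow> real" where
  "lam p = - ln (1 - 1 / real p)"

definition pr :: "nat \<Rightarrow> nat set" where
  "pr n = {p. prime p \<and> p \<le> n}"

lemma finite_pr [simp]: "finite (pr n)"
  by (auto simp: pr_def)

lemma prD: "p \<in> pr n \<Longrightarrow> prime p" "p \<in> pr n \<Longrightarrow> p \<le> n" "p \<in> pr n \<Longrightarrow> 2 \<le> p"
  by (auto simp: pr_def prime_ge_2_nat)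

lemma lam_ge: "2 \<le> p \<Longrightarrow> 1 / real p \<le> lam p"
  using ln_one_minus_pos_upper_bound[of "1 / real p"] by (simp add: lam_def field_simps)

lemma lam_le: "2 \<le> p \<Longrightarrow> lam p \<le> 1 / real p + 2 / real p ^ 2"
  using ln_one_minus_pos_lower_bound[of "1 / real p"] by (simp add: lam_def power_divide)

lemma lam_pos: "2 \<le> p \<Longrightarrow> 0 < lam p"
  using lam_ge[of p] by (smt (verit) divide_pos_pos of_nat_0_less_iff zero_less_numeral order_less_le_trans)

lemma lam_le': assumes "2 \<le> p" shows "lam p \<le> 2 / real p"
proof -
  have "2 / real p ^ 2 \<le> 1 / real p" using assms by (simp add: field_simps power2_eq_square)
  with lam_le[OF assms] show ?thesis by simp
qed

section \<open>Legendre's formula and Chebyshev's bound\<close>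

lemma multiplicity_eq_card:
  assumes p: "prime (p::nat)" and m: "m \<in> {1..n}"
  shows "multiplicity p m = card {j\<in>{1..n}. p ^ j dvd m}"
proof -
  have m0: "m \<noteq> 0" using m by auto
  have nu: "\<not> is_unit p" using p by auto
  have dv: "p ^ j dvd m \<longleftrightarrow> j \<le> multiplicity p m" for j
    by (rule power_dvd_iff_le_multiplicity) (use m0 nu in auto)
  have "p ^ multiplicity p m dvd m" by (rule multiplicity_dvd)
  then have "p ^ multiplicity p m \<le> m" using m0 by (simp add: dvd_imp_le)
  moreover have "(2::nat) ^ multiplicity p m \<le> p ^ multiplicity p m"
    by (rule power_mono) (use prime_ge_2_nat[OF p] in auto)
  moreover have "multiplicity p m < 2 ^ multiplicity p m" by (rule less_exp)
  ultimately have "multiplicity p m < m" by (meson order_less_le_trans)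
  then have "multiplicity p m \<le> n" using m by auto
  then have "{j\<in>{1..n}. p ^ j dvd m} = {1..multiplicity p m}" unfolding dv by auto
  then show ?thesis by simp
qed

lemma card_multiples: assumes "0 < d" shows "card {m\<in>{1..n::nat}. d dvd m} = n div d"
proof -
  have "{m\<in>{1..n}. d dvd m} = (\<lambda>i. d * i) ` {1..n div d}"
  proof (intro set_eqI iffI)
    fix m assume "m \<in> {m\<in>{1..n}. d dvd m}"
    then obtain i where "m = d * i" "1 \<le> m" "m \<le> n" unfolding dvd_def by auto
    moreover from this have "i \<le> n div d" using assms by (simp add: less_eq_div_iff_mult_less_eq mult.commute)
    ultimately show "m \<in> (\<lambda>i. d * i) ` {1..n div d}" by (cases "i = 0") auto
  next
    fix m assume "m \<in> (\<lambda>i. d * i) ` {1..n div d}"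
    then obtain i where im: "i \<in> {1..n div d}" "m = d * i" by blast
    then have i: "m = d * i" "1 \<le> i" "i \<le> n div d" by simp_all
    have "d * i \<le> d * (n div d)" using i by simp
    also have "\<dots> \<le> n" by simp
    finally show "m \<in> {m\<in>{1..n}. d dvd m}" using assms i by simp
  qed
  also have "card \<dots> = n div d" using assms by (subst card_image) (auto simp: inj_on_def)
  finally show ?thesis .
qed

text \<open>Legendre's formula, by double counting the pairs (m, j) with p^j dividing m; the range
  of j may stop at n because 2^j > j.\<close>

lemma multiplicity_fact:
  assumes p: "prime (p::nat)"
  shows "multiplicity p (fact n) = (\<Sum>j=1..n. n div p ^ j)"
proof -
  have "multiplicity p (fact n :: nat) = multiplicity p (\<Prod>{1..n})" by (simp add: fact_prod)
  also have "\<dots> = (\<Sum>m\<in>{1..n}. multiplicity p m)"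
    using p by (subst prime_elem_multiplicity_prod_distrib) auto
  also have "\<dots> = (\<Sum>m\<in>{1..n}. card {j\<in>{1..n}. p ^ j dvd m})"
    by (intro sum.cong refl multiplicity_eq_card p)
  also have "\<dots> = (\<Sum>m\<in>{1..n}. \<Sum>j\<in>{1..n}. if p ^ j dvd m then 1 else 0)"
    by (simp add: sum.If_cases Int_def)
  also have "\<dots> = (\<Sum>j\<in>{1..n}. \<Sum>m\<in>{1..n}. if p ^ j dvd m then 1 else 0)" by (rule sum.swap)
  also have "\<dots> = (\<Sum>j\<in>{1..n}. card {m\<in>{1..n}. p ^ j dvd m})"
    by (simp add: sum.If_cases Int_def)
  also have "\<dots> = (\<Sum>j\<in>{1..n}. n div p ^ j)"
    using p by (intro sum.cong refl card_multiples) (simp add: prime_gt_0_nat)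
  finally show ?thesis .
qed

lemma ln_eq_sum_multiplicity:
  assumes x: "0 < x" and fac: "prime_factors x \<subseteq> pr n"
  shows "ln (real x) = (\<Sum>p\<in>pr n. real (multiplicity p x) * ln (real p))"
proof -
  have "real x = (\<Prod>p\<in>prime_factors x. real p ^ multiplicity p x)"
    using prime_factorization_nat[OF x] by (metis (no_types, lifting) of_nat_power of_nat_prod prod.cong)
  then have "ln (real x) = ln (\<Prod>p\<in>prime_factors x. real p ^ multiplicity p x)" by simp
  also have "\<dots> = (\<Sum>p\<in>prime_factors x. ln (real p ^ multiplicity p x))"
    by (rule ln_prod) (auto dest!: in_prime_factors_imp_prime prime_gt_0_nat)
  also have "\<dots> = (\<Sum>p\<in>prime_factors x. real (multiplicity p x) * ln (real p))"
    by (simp add: ln_realpow)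
  also have "\<dots> = (\<Sum>p\<in>pr n. real (multiplicity p x) * ln (real p))"
    by (rule sum.mono_neutral_left) (use fac in \<open>auto simp: prime_factors_multiplicity pr_def\<close>)
  finally show ?thesis .
qed

lemma prime_factors_fact_sub: "prime_factors (fact n :: nat) \<subseteq> pr n"
  by (auto simp: pr_def prime_factors_dvd prime_dvd_fact_iff)

lemma prime_factors_sub_pr: assumes "m \<in> {1..n}" shows "prime_factors m \<subseteq> pr n"
  using assms by (auto simp: pr_def prime_factors_dvd dest!: dvd_imp_le)

lemma central_binomial_le: "(2 * m + 1) choose m \<le> 4 ^ m"
proof -
  have "((2*m+1) choose m) + ((2*m+1) choose (m+1)) = (\<Sum>k\<in>{m,m+1}. (2*m+1) choose k)" by simp
  also have "\<dots> \<le> (\<Sum>k\<le>2*m+1. (2*m+1) choose k)" by (rule sum_mono2) auto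
  also have "\<dots> = 2 ^ (2*m+1)" by (rule choose_row_sum)
  also have "\<dots> = 2 * 4 ^ m" by (simp add: power_mult)
  finally have "((2*m+1) choose m) + ((2*m+1) choose (m+1)) \<le> 2 * 4 ^ m" .
  moreover have "((2*m+1) choose (m+1)) = ((2*m+1) choose m)"
    by (subst binomial_symmetric) auto
  ultimately show ?thesis by simp
qed

text \<open>Erdos's argument: the primes in (m+1, 2m+1] divide (2m+1)!/(m! (m+1)!), which is at most
  4^m because it occurs twice in a row of sum 2 * 4^m. The primes up to m+1 are left to the
  induction, and an even n > 2 adds no prime.\<close>

lemma chebyshev_theta: "(\<Sum>p\<in>pr n. ln (real p)) \<le> real n * ln 4"
proof (induction n rule: less_induct)
  case (less n)
  consider "n \<le> 1" | "n = 2" | "n > 2" "even n" | "n > 2" "odd n" by linarith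
  then show ?case
  proof cases
    case 1
    then have "pr n = {}" by (auto simp: pr_def dest!: prime_ge_2_nat)
    then show ?thesis by simp
  next
    case 2
    then have "pr n = {2}" by (auto simp: pr_def dest!: prime_ge_2_nat)
    moreover have "ln (2::real) \<le> 2 * ln 4"
    proof -
      have a: "ln (2::real) \<le> ln 4" by simp
      have b: "0 \<le> ln (4::real)" by simp
      from a b show ?thesis by linarith
    qed
    ultimately show ?thesis using 2 by simp
  next
    case 3
    then have "\<not> prime n" using prime_odd_nat by auto
    then have "pr n = pr (n - 1)" unfolding pr_def
      by (intro Collect_cong) (metis (no_types) One_nat_def Suc_leI Suc_pred diff_le_self le_eq_less_or_eq le_trans less_Suc_eq_le prime_gt_0_nat order_less_le_trans)
    then have "(\<Sum>p\<in>pr n. ln (real p)) \<le> real (n - 1) * ln 4" using less[of "n - 1"] 3 by simp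
    also have "\<dots> \<le> real n * ln 4" by (intro mult_right_mono) auto
    finally show ?thesis .
  next
    case 4
    then obtain m where m: "n = 2 * m + 1" by (auto elim: oddE)
    define x where "x = (2 * m + 1) choose m"
    have x0: "0 < x" by (auto simp: x_def)
    have fx: "fact n = x * (fact m * fact (m + 1))"
      using binomial_fact_lemma[of m "2*m+1"] by (simp add: x_def m mult_ac add.commute del: fact_Suc)
    have "x dvd fact n" by (simp add: fx)
    then have "prime_factors x \<subseteq> prime_factors (fact n)" by (intro dvd_prime_factors) auto
    then have sub: "prime_factors x \<subseteq> pr n" using prime_factors_fact_sub by blast
    have "(\<Sum>p\<in>pr n - pr (m + 1). ln (real p)) \<le> (\<Sum>p\<in>pr n - pr (m + 1). real (multiplicity p x) * ln (real p))"
    proof (rule sum_mono)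
      fix p assume p: "p \<in> pr n - pr (m + 1)"
      then have pp: "prime p" "p \<le> n" "\<not> p \<le> m + 1" by (auto simp: pr_def)
      have "p dvd fact n" using pp by (simp add: prime_dvd_fact_iff)
      moreover have "\<not> p dvd fact m" "\<not> p dvd fact (m + 1)" using pp prime_dvd_fact_iff[of p] 
        by (auto simp del: fact_Suc)
      ultimately have "p dvd x" using pp unfolding fx by (simp add: prime_dvd_mult_iff del: fact_Suc)
      then have "1 \<le> multiplicity p x" using pp x0 by (simp add: Suc_leI prime_multiplicity_gt_zero_iff prime_imp_prime_elem)
      moreover have "0 \<le> ln (real p)" using pp by simp
      ultimately show "ln (real p) \<le> real (multiplicity p x) * ln (real p)"
        by (metis mult_right_mono mult_1 of_nat_1 of_nat_mono)
    qed
    also have "\<dots> \<le> (\<Sum>p\<in>pr n. real (multiplicity p x) * ln (real p))"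
      by (rule sum_mono2) (auto intro!: mult_nonneg_nonneg dest: prD)
    also have "\<dots> = ln (real x)" by (rule ln_eq_sum_multiplicity[OF x0 sub, symmetric])
    also have "\<dots> \<le> ln (4 ^ m)"
    proof -
      have "real x \<le> real (4 ^ m)" unfolding x_def of_nat_le_iff by (rule central_binomial_le)
      then show ?thesis using x0 by (subst ln_le_cancel_iff) simp_all
    qed
    also have "\<dots> = real m * ln 4" by (simp add: ln_realpow)
    finally have a: "(\<Sum>p\<in>pr n - pr (m + 1). ln (real p)) \<le> real m * ln 4" .
    have b: "(\<Sum>p\<in>pr (m + 1). ln (real p)) \<le> real (m + 1) * ln 4" using less[of "m + 1"] m 4 by auto
    have "pr (m + 1) \<subseteq> pr n" using m by (auto simp: pr_def)
    then have "(\<Sum>p\<in>pr n. ln (real p)) = (\<Sum>p\<in>pr n - pr (m + 1). ln (real p)) + (\<Sum>p\<in>pr (m + 1). ln (real p))"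
      by (intro sum.subset_diff) auto
    with a b show ?thesis by (simp add: m algebra_simps)
  qed
qed

definition sq_sum :: real where "sq_sum = (\<Sum>n. 2 * real n powr (-3/2))"

text \<open>The bound log p <= 2 p^(1/2) leaves the summable exponent -3/2, so \<open>sq_sum\<close>
  is an absolute constant.\<close>

lemma sum_ln_div_square: 
  assumes "finite A" 
  shows "(\<Sum>p\<in>A. ln (real p) / real p ^ 2) \<le> sq_sum"
proof -
  have "(\<Sum>p\<in>A. ln (real p) / real p ^ 2) \<le> (\<Sum>p\<in>A. 2 * real p powr (-3/2))"
  proof (rule sum_mono)
    fix p assume "p \<in> A"
    show "ln (real p) / real p ^ 2 \<le> 2 * real p powr (-3/2)"
    proof (cases "p = 0")
      case False
      then have "ln (real p) \<le> 2 * real p powr (1/2)"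
        using ln_powr_bound[of "real p" "1/2"] by simp
      then have "ln (real p) / real p ^ 2 \<le> 2 * real p powr (1/2) / real p powr 2"
        using False by (simp add: divide_right_mono powr_numeral)
      also have "\<dots> = 2 * real p powr (1/2 - 2)" using False
        by (simp only: powr_diff times_divide_eq_right)
      also have "\<dots> = 2 * real p powr (-3/2)" by simp
      finally show ?thesis .
    qed auto
  qed
  also have "\<dots> \<le> sq_sum" unfolding sq_sum_def
    by (rule sum_le_suminf) (use assms in \<open>auto intro!: summable_mult simp: summable_real_powr_iff\<close>)
  finally show ?thesis .
qed

lemma sq_sum_nonneg: "0 \<le> sq_sum" using sum_ln_div_square[of "{}"] by simp

section \<open>Mertens' first theorem with an explicit constant\<close>

lemma ln_fact_bounds:
  assumes "1 \<le> n"
  shows "real n * ln (real n) - real n \<le> ln (fact n)" "ln (fact n) \<le> real n * ln (real n)"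
proof -
  have "fact n \<le> real n ^ n"
    by (metis fact_le_power le_refl of_nat_fact of_nat_le_iff of_nat_power)
  then have "ln (fact n) \<le> ln (real n ^ n)" using assms by (subst ln_le_cancel_iff) auto
  then show "ln (fact n) \<le> real n * ln (real n)" using assms by (simp add: ln_realpow)
  have "real n ^ n / fact n \<le> exp (real n)"
  proof -
    have "(\<Sum>i\<in>{n}. real n ^ i /\<^sub>R fact i) \<le> (\<Sum>i. real n ^ i /\<^sub>R fact i)"
      by (rule sum_le_suminf[OF summable_exp_generic]) auto
    then show ?thesis by (simp add: exp_def divide_inverse mult.commute)
  qed
  then have "ln (real n ^ n / fact n) \<le> ln (exp (real n))" using assms
    by (subst ln_le_cancel_iff) auto
  then have "ln (real n ^ n / fact n) \<le> real n" by simp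
  then show "real n * ln (real n) - real n \<le> ln (fact n)" using assms
    by (simp add: ln_div ln_realpow)
qed

definition mertens_K :: real where "mertens_K = 4 + 4 * sq_sum"

text \<open>log n! is evaluated twice, from n^n and the exponential series and from Legendre's
  exponents. The exponent of p lies between n/p - 1 and n/(p-1); Chebyshev's bound pays for the 1
  lost at each prime, and the difference between 1/(p-1) and lambda_p is O(1/p^2).\<close>

lemma mertens_nat:
  assumes n: "1 \<le> n"
  shows "\<bar>(\<Sum>p\<in>pr n. lam p * ln (real p)) - ln (real n)\<bar> \<le> 2 + 4 * sq_sum"
proof -
  have lf: "ln (fact n) = (\<Sum>p\<in>pr n. real (multiplicity p (fact n :: nat)) * ln (real p))"
    using ln_eq_sum_multiplicity[OF _ prime_factors_fact_sub, of n] by simp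
  have lo: "real n / real p - 1 \<le> real (multiplicity p (fact n :: nat))" if p: "p \<in> pr n" for p
  proof -
    have "n div p ^ 1 \<le> (\<Sum>j=1..n. n div p ^ j)" by (rule member_le_sum) (use n in auto)
    then have "n div p \<le> multiplicity p (fact n :: nat)" using multiplicity_fact[of p n] p prD by simp
    moreover have "real n / real p - 1 \<le> real (n div p)"
      using floor_divide_of_nat_eq[where 'a=real, of n p] by linarith
    ultimately show ?thesis by linarith
  qed
  have hi: "real (multiplicity p (fact n :: nat)) \<le> real n * (lam p + 2 / real p ^ 2)" if p: "p \<in> pr n" for p
  proof -
    have p2: "2 \<le> p" using p prD by blast
    have "real (multiplicity p (fact n :: nat)) = (\<Sum>j=1..n. real (n div p ^ j))"
      using multiplicity_fact[of p n] p prD by simp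
    also have "\<dots> \<le> (\<Sum>j=1..n. real n * (1 / real p) ^ j)"
      by (intro sum_mono) (metis of_nat_div_le_of_nat of_nat_power power_one_over divide_inverse inverse_eq_divide)
    also have "\<dots> = real n * (\<Sum>j=1..n. (1 / real p) ^ j)" by (simp add: sum_distrib_left)
    also have "(\<Sum>j=1..n. (1 / real p) ^ j) \<le> 1 / (real p - 1)"
    proof -
      have "(\<Sum>j=1..n. (1 / real p) ^ j) = (\<Sum>j<n. (1 / real p) * (1 / real p) ^ j)"
        by (rule sum.reindex_bij_witness[of _ Suc "\<lambda>i. i - 1"]) (auto simp: power_Suc[symmetric] simp del: power_Suc)
      also have "\<dots> \<le> (\<Sum>j. (1 / real p) * (1 / real p) ^ j)"
        using p2 by (intro sum_le_suminf summable_mult summable_geometric) auto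
      also have "\<dots> = (1 / real p) * (1 / (1 - 1 / real p))"
        using p2 by (subst suminf_mult) (auto intro!: summable_geometric simp: suminf_geometric)
      also have "\<dots> = 1 / (real p - 1)" using p2 by (simp add: field_simps)
      finally show ?thesis .
    qed
    also have "1 / (real p - 1) \<le> 1 / real p + 2 / real p ^ 2"
      using p2 by (simp add: field_simps power2_eq_square)
    also have "\<dots> \<le> lam p + 2 / real p ^ 2" using lam_ge[OF p2] by simp
    finally show ?thesis by (simp add: mult_left_mono)
  qed
  have lnp: "0 \<le> ln (real p)" if "p \<in> pr n" for p using prD(3)[OF that] by simp
  have up: "(\<Sum>p\<in>pr n. lam p * ln (real p)) \<le> ln (real n) + 2 + 4 * sq_sum"
  proof -
    have "real n * (\<Sum>p\<in>pr n. ln (real p) / real p) - (\<Sum>p\<in>pr n. ln (real p)) 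
        = (\<Sum>p\<in>pr n. (real n / real p - 1) * ln (real p))"
      by (simp add: sum_distrib_left sum_subtractf algebra_simps)
    also have "\<dots> \<le> ln (fact n)" unfolding lf by (intro sum_mono mult_right_mono lo lnp)
    also have "\<dots> \<le> real n * ln (real n)" by (rule ln_fact_bounds[OF n])
    finally have "real n * (\<Sum>p\<in>pr n. ln (real p) / real p) \<le> real n * (ln (real n) + ln 4)"
      using chebyshev_theta[of n] by (simp add: algebra_simps)
    then have a: "(\<Sum>p\<in>pr n. ln (real p) / real p) \<le> ln (real n) + ln 4" using n by simp
    have "(\<Sum>p\<in>pr n. lam p * ln (real p)) \<le> (\<Sum>p\<in>pr n. (1 / real p + 2 / real p ^ 2) * ln (real p))"
      by (intro sum_mono mult_right_mono lnp lam_le) (auto dest: prD)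
    also have "\<dots> = (\<Sum>p\<in>pr n. ln (real p) / real p) + 2 * (\<Sum>p\<in>pr n. ln (real p) / real p ^ 2)"
      by (simp add: sum_distrib_left sum.distrib algebra_simps)
    also have "\<dots> \<le> ln (real n) + ln 4 + 2 * sq_sum" 
      using a sum_ln_div_square[of "pr n"] by simp
    also have "ln (4::real) \<le> 2"
    proof -
      have "ln (4::real) = 2 * ln 2" using ln_realpow[of 2 2] by simp
      then show ?thesis using ln_2_less_1 by linarith
    qed
    finally show ?thesis using sq_sum_nonneg by simp
  qed
  have dn: "ln (real n) - 1 - 2 * sq_sum \<le> (\<Sum>p\<in>pr n. lam p * ln (real p))"
  proof -
    have "real n * ln (real n) - real n \<le> ln (fact n)" by (rule ln_fact_bounds[OF n])
    also have "\<dots> \<le> (\<Sum>p\<in>pr n. (real n * (lam p + 2 / real p ^ 2)) * ln (real p))"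
      unfolding lf by (intro sum_mono mult_right_mono hi lnp)
    also have "\<dots> = real n * ((\<Sum>p\<in>pr n. lam p * ln (real p)) + 2 * (\<Sum>p\<in>pr n. ln (real p) / real p ^ 2))"
      by (simp add: sum_distrib_left sum.distrib algebra_simps)
    finally have "real n * (ln (real n) - 1) \<le> real n * ((\<Sum>p\<in>pr n. lam p * ln (real p)) + 2 * (\<Sum>p\<in>pr n. ln (real p) / real p ^ 2))"
      by (simp add: algebra_simps)
    then have "ln (real n) - 1 \<le> (\<Sum>p\<in>pr n. lam p * ln (real p)) + 2 * (\<Sum>p\<in>pr n. ln (real p) / real p ^ 2)"
      using n by simp
    then show ?thesis using sum_ln_div_square[of "pr n"] by simp
  qed
  show ?thesis using up dn sq_sum_nonneg by (simp add: abs_le_iff)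
qed

section \<open>Euler products and partial sums of zeta to the right of 1\<close>

lemma powr_neg_power: "0 < p \<Longrightarrow> (real p powr (-s)) ^ j = real (p ^ j) powr (-s)"
  by (simp add: powr_powr powr_realpow[symmetric] mult.commute powr_power)

text \<open>In the expanded product every n <= N occurs exactly once, by unique factorisation with
  primes and exponents at most N; the other terms are nonnegative.\<close>

lemma euler_product_ge:
  assumes s: "0 < s"
  shows "(\<Sum>n=1..N. real n powr (-s)) \<le> (\<Prod>p\<in>pr N. 1 / (1 - real p powr (-s)))"
proof -
  define \<phi> where "\<phi> = (\<lambda>n. \<lambda>p\<in>pr N. multiplicity p n)"
  have rep: "n = (\<Prod>p\<in>pr N. p ^ multiplicity p n)" if n: "n \<in> {1..N}" for n
  proof -
    have "n = (\<Prod>p\<in>prime_factors n. p ^ multiplicity p n)" using n by (intro prime_factorization_nat) auto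
    also have "\<dots> = (\<Prod>p\<in>pr N. p ^ multiplicity p n)"
      by (rule prod.mono_neutral_left) (use prime_factors_sub_pr[OF n] in \<open>auto simp: prime_factors_multiplicity pr_def\<close>)
    finally show ?thesis .
  qed
  have inj: "inj_on \<phi> {1..N}"
  proof (rule inj_onI)
    fix a b assume ab: "a \<in> {1..N}" "b \<in> {1..N}" "\<phi> a = \<phi> b"
    have "multiplicity p a = multiplicity p b" if "p \<in> pr N" for p
      using fun_cong[OF ab(3), of p] that by (simp add: \<phi>_def)
    then have "(\<Prod>p\<in>pr N. p ^ multiplicity p a) = (\<Prod>p\<in>pr N. p ^ multiplicity p b)" by simp
    then show "a = b" using rep ab by metis
  qed
  have sub: "\<phi> ` {1..N} \<subseteq> (pr N \<rightarrow>\<^sub>E {..N})"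
  proof
    fix g assume "g \<in> \<phi> ` {1..N}"
    then obtain n where n: "n \<in> {1..N}" "g = \<phi> n" by blast
    have "multiplicity p n \<le> N" if "p \<in> pr N" for p
    proof -
      have "card {j\<in>{1..N}. p ^ j dvd n} \<le> card {1..N}" by (rule card_mono) auto
      then show ?thesis using multiplicity_eq_card[of p n N] n prD(1)[OF that] by simp
    qed
    then show "g \<in> (pr N \<rightarrow>\<^sub>E {..N})" using n by (auto simp: \<phi>_def)
  qed
  have q: "0 \<le> real p powr (-s)" "real p powr (-s) < 1" if "p \<in> pr N" for p
    using prD(3)[OF that] s by (auto simp: powr_less_one)
  have "(\<Sum>n=1..N. real n powr (-s)) = (\<Sum>n=1..N. \<Prod>p\<in>pr N. (real p powr (-s)) ^ (\<phi> n p))"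
  proof (rule sum.cong)
    fix n assume n: "n \<in> {1..N}"
    have "real n powr (-s) = real (\<Prod>p\<in>pr N. p ^ multiplicity p n) powr (-s)" using rep[OF n] by simp
    also have "\<dots> = (\<Prod>p\<in>pr N. real (p ^ multiplicity p n) powr (-s))"
      by (simp add: prod_powr_distrib flip: of_nat_power)
    also have "\<dots> = (\<Prod>p\<in>pr N. (real p powr (-s)) ^ (\<phi> n p))"
      by (intro prod.cong refl) (auto simp: \<phi>_def powr_neg_power dest!: prD(3))
    finally show "real n powr (-s) = (\<Prod>p\<in>pr N. (real p powr (-s)) ^ (\<phi> n p))" .
  qed simp
  also have "\<dots> = (\<Sum>g\<in>\<phi> ` {1..N}. \<Prod>p\<in>pr N. (real p powr (-s)) ^ g p)"
    using sum.reindex[OF inj, of "\<lambda>g. \<Prod>p\<in>pr N. (real p powr (-s)) ^ g p"] by (simp only: o_def)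
  also have "\<dots> \<le> (\<Sum>g\<in>pr N \<rightarrow>\<^sub>E {..N}. \<Prod>p\<in>pr N. (real p powr (-s)) ^ g p)"
    by (rule sum_mono2[OF _ sub]) (auto intro!: finite_PiE prod_nonneg)
  also have "\<dots> = (\<Prod>p\<in>pr N. \<Sum>j\<le>N. (real p powr (-s)) ^ j)"
    by (rule prod_sum_PiE[symmetric]) auto
  also have "\<dots> \<le> (\<Prod>p\<in>pr N. 1 / (1 - real p powr (-s)))"
  proof (intro prod_mono conjI)
    fix p assume p: "p \<in> pr N"
    show "0 \<le> (\<Sum>j\<le>N. (real p powr (-s)) ^ j)" by (intro sum_nonneg) auto
    have "(\<Sum>j\<le>N. (real p powr (-s)) ^ j) \<le> (\<Sum>j. (real p powr (-s)) ^ j)"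
      using q[OF p] by (intro sum_le_suminf summable_geometric) auto
    also have "\<dots> = 1 / (1 - real p powr (-s))" using q[OF p] by (intro suminf_geometric) auto
    finally show "(\<Sum>j\<le>N. (real p powr (-s)) ^ j) \<le> 1 / (1 - real p powr (-s))" .
  qed
  finally show ?thesis .
qed

text \<open>Distinct exponent functions give distinct integers, so a product of truncated geometric
  series is a sum over a finite set of positive integers; then the truncation J tends to infinity.
  The hypothesis on finite sets stands for the value of zeta.\<close>

lemma euler_product_le:
  assumes s: "0 < s" and Z: "\<And>F. finite F \<Longrightarrow> 0 \<notin> F \<Longrightarrow> (\<Sum>n\<in>F. real n powr (-s)) \<le> Z"
  shows "(\<Prod>p\<in>pr N. 1 / (1 - real p powr (-s))) \<le> Z"
proof -
  have q: "0 \<le> real p powr (-s)" "real p powr (-s) < 1" if "p \<in> pr N" for p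
    using prD(3)[OF that] s by (auto simp: powr_less_one)
  define \<psi> where "\<psi> = (\<lambda>g. \<Prod>p\<in>pr N. p ^ (g p :: nat))"
  have bound: "(\<Prod>p\<in>pr N. \<Sum>j<J. (real p powr (-s)) ^ j) \<le> Z" for J
  proof -
    have inj: "inj_on \<psi> (pr N \<rightarrow>\<^sub>E {..<J})"
    proof (rule inj_onI)
      fix f g assume fg: "f \<in> (pr N \<rightarrow>\<^sub>E {..<J})" "g \<in> (pr N \<rightarrow>\<^sub>E {..<J})" "\<psi> f = \<psi> g"
      have "f p = g p" if p: "p \<in> pr N" for p
      proof -
        have "multiplicity p (\<psi> h) = h p" for h
          unfolding \<psi>_def using p prD by (subst multiplicity_prod_prime_powers) auto
        then show ?thesis using fg(3) by metis
      qed
      then show "f = g" using fg by (intro PiE_ext)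
    qed
    have "(\<Prod>p\<in>pr N. \<Sum>j<J. (real p powr (-s)) ^ j) = (\<Sum>g\<in>pr N \<rightarrow>\<^sub>E {..<J}. \<Prod>p\<in>pr N. (real p powr (-s)) ^ g p)"
      by (rule prod_sum_PiE) auto
    also have "\<dots> = (\<Sum>g\<in>pr N \<rightarrow>\<^sub>E {..<J}. real (\<psi> g) powr (-s))"
    proof (rule sum.cong)
      fix g assume "g \<in> pr N \<rightarrow>\<^sub>E {..<J}"
      have "(\<Prod>p\<in>pr N. (real p powr (-s)) ^ g p) = (\<Prod>p\<in>pr N. real (p ^ g p) powr (-s))"
        by (intro prod.cong refl powr_neg_power) (auto dest!: prD(3))
      also have "\<dots> = real (\<psi> g) powr (-s)"
        unfolding \<psi>_def by (simp add: prod_powr_distrib flip: of_nat_power)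
      finally show "(\<Prod>p\<in>pr N. (real p powr (-s)) ^ g p) = real (\<psi> g) powr (-s)" .
    qed simp
    also have "\<dots> = (\<Sum>n\<in>\<psi> ` (pr N \<rightarrow>\<^sub>E {..<J}). real n powr (-s))"
      by (simp only: sum.reindex[OF inj] o_def)
    also have "\<dots> \<le> Z"
      by (rule Z) (auto intro!: finite_PiE simp: \<psi>_def dest!: prD(3))
    finally show ?thesis .
  qed
  have "(\<lambda>J. \<Prod>p\<in>pr N. \<Sum>j<J. (real p powr (-s)) ^ j) \<longlonglongrightarrow> (\<Prod>p\<in>pr N. 1 / (1 - real p powr (-s)))"
  proof (rule tendsto_prod)
    fix p assume "p \<in> pr N"
    then have "(\<lambda>j. (real p powr (-s)) ^ j) sums (1 / (1 - real p powr (-s)))" using q by (intro geometric_sums) auto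
    then show "(\<lambda>J. \<Sum>j<J. (real p powr (-s)) ^ j) \<longlonglongrightarrow> 1 / (1 - real p powr (-s))" by (simp add: sums_def)
  qed
  then show ?thesis by (rule LIMSEQ_le_const2) (use bound in auto)
qed

text \<open>The mean value theorem for x^(-sigma) takes the place of the integral test; the bounds
  for both partial sums below telescope from it.\<close>

lemma powr_diff_bounds:
  assumes "0 < \<sigma>" "0 < (x::real)"
  shows "(x powr (-\<sigma>) - (x + 1) powr (-\<sigma>)) / \<sigma> \<le> x powr (-1-\<sigma>)"
    and "(x + 1) powr (-1-\<sigma>) \<le> (x powr (-\<sigma>) - (x + 1) powr (-\<sigma>)) / \<sigma>"
proof -
  have "\<exists>t>x. t < x + 1 \<and> (x + 1) powr (-\<sigma>) - x powr (-\<sigma>) = (x + 1 - x) * ((-\<sigma>) * t powr (-\<sigma> - 1))"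
    by (rule MVT2) (use assms in \<open>auto intro!: derivative_eq_intros\<close>)
  then obtain t where t: "t > x" "t < x + 1" "(x + 1) powr (-\<sigma>) - x powr (-\<sigma>) = (-\<sigma>) * t powr (-\<sigma> - 1)" by auto
  then have e: "(x powr (-\<sigma>) - (x + 1) powr (-\<sigma>)) / \<sigma> = t powr (-\<sigma> - 1)" using assms by (simp add: field_simps)
  have ee: "-\<sigma> - 1 = -1 - \<sigma>" by simp
  have "t powr (-\<sigma> - 1) \<le> x powr (-\<sigma>-1)" using t assms by (intro powr_mono2') auto
  then show "(x powr (-\<sigma>) - (x + 1) powr (-\<sigma>)) / \<sigma> \<le> x powr (-1-\<sigma>)" unfolding e
    by (simp only: ee)
  have "(x + 1) powr (-\<sigma>-1) \<le> t powr (-\<sigma>-1)" using t assms by (intro powr_mono2') auto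
  then show "(x + 1) powr (-1-\<sigma>) \<le> (x powr (-\<sigma>) - (x + 1) powr (-\<sigma>)) / \<sigma>" unfolding e
    by (simp only: ee)
qed

lemma zeta_partial_le:
  assumes "0 < \<sigma>"
  shows "(\<Sum>n=1..N. real n powr (-1-\<sigma>)) \<le> 1 + 1 / \<sigma>"
proof -
  have *: "(\<Sum>n=1..Suc N. real n powr (-1-\<sigma>)) \<le> 1 + (1 - real (Suc N) powr (-\<sigma>)) / \<sigma>" for N
  proof (induction N)
    case (Suc N)
    have "(\<Sum>n=1..Suc (Suc N). real n powr (-1-\<sigma>)) = (\<Sum>n=1..Suc N. real n powr (-1-\<sigma>)) + (real (Suc N) + 1) powr (-1-\<sigma>)"
      by (simp add: algebra_simps)
    also have "\<dots> \<le> 1 + (1 - real (Suc N) powr (-\<sigma>)) / \<sigma> + (real (Suc N) powr (-\<sigma>) - (real (Suc N) + 1) powr (-\<sigma>)) / \<sigma>"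
      by (intro add_mono Suc.IH powr_diff_bounds assms) auto
    also have "\<dots> = 1 + (1 - real (Suc (Suc N)) powr (-\<sigma>)) / \<sigma>"
      by (simp add: diff_divide_distrib algebra_simps)
    finally show ?case .
  qed simp
  have "(\<Sum>n=1..N. real n powr (-1-\<sigma>)) \<le> (\<Sum>n=1..Suc N. real n powr (-1-\<sigma>))" by simp
  also have "\<dots> \<le> 1 + (1 - real (Suc N) powr (-\<sigma>)) / \<sigma>" by (rule *)
  also have "\<dots> \<le> 1 + 1 / \<sigma>" using assms by (simp add: divide_right_mono)
  finally show ?thesis .
qed

lemma zeta_partial_ge:
  assumes "0 < \<sigma>"
  shows "(1 - real (Suc N) powr (-\<sigma>)) / \<sigma> \<le> (\<Sum>n=1..N. real n powr (-1-\<sigma>))"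
proof (induction N)
  case (Suc N)
  have "(1 - real (Suc (Suc N)) powr (-\<sigma>)) / \<sigma> 
      = (1 - real (Suc N) powr (-\<sigma>)) / \<sigma> + (real (Suc N) powr (-\<sigma>) - (real (Suc N) + 1) powr (-\<sigma>)) / \<sigma>"
      by (simp add: diff_divide_distrib algebra_simps)
  also have "\<dots> \<le> (\<Sum>n=1..N. real n powr (-1-\<sigma>)) + real (Suc N) powr (-1-\<sigma>)"
    by (intro add_mono Suc.IH powr_diff_bounds assms) auto
  finally show ?case by simp
qed simp

text \<open>Minus the logarithm of the Euler factor of 1/zeta... taken at 1 + sigma, that is, the
  exact local term of log zeta(1 + sigma). The Laplace transform of T produces \<open>lam p\<close>
  times p^(-sigma) instead; both lie in the same interval of length 2/p^2, uniformly in
  sigma.\<close>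

definition lam_at :: "real \<Rightarrow> nat \<Rightarrow> real" where
  "lam_at \<sigma> p = - ln (1 - real p powr (-1-\<sigma>))"

lemma powr_neg_bounds:
  assumes "0 \<le> \<sigma>" "2 \<le> p"
  shows "0 < real p powr (-1-\<sigma>)" "real p powr (-1-\<sigma>) \<le> 1 / real p" "real p powr (-1-\<sigma>) \<le> 1 / 2" 
    "(real p powr (-1-\<sigma>))\<^sup>2 \<le> 1 / (real p)\<^sup>2"
proof -
  show a: "0 < real p powr (-1-\<sigma>)" using assms by simp
  have "real p powr (-1-\<sigma>) \<le> real p powr (-1)" using assms by (intro powr_mono) auto
  also have "\<dots> = 1 / real p" using assms by (simp add: powr_minus_divide)
  finally show b: "real p powr (-1-\<sigma>) \<le> 1 / real p" .
  also have "1 / real p \<le> 1 / 2" using assms by (simp add: field_simps)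
  finally show "real p powr (-1-\<sigma>) \<le> 1 / 2" .
  have "(real p powr (-1-\<sigma>))\<^sup>2 \<le> (1 / real p)\<^sup>2" using a b by (intro power_mono) auto
  then show "(real p powr (-1-\<sigma>))\<^sup>2 \<le> 1 / (real p)\<^sup>2" by (simp add: power_divide)
qed

lemma lam_at_bounds:
  assumes "0 \<le> \<sigma>" "2 \<le> p"
  shows "real p powr (-1-\<sigma>) \<le> lam_at \<sigma> p" "lam_at \<sigma> p \<le> real p powr (-1-\<sigma>) + 2 / (real p)\<^sup>2" "0 < lam_at \<sigma> p"
proof -
  note b = powr_neg_bounds[OF assms]
  show a: "real p powr (-1-\<sigma>) \<le> lam_at \<sigma> p"
    using ln_one_minus_pos_upper_bound[of "real p powr (-1-\<sigma>)"] b by (simp add: lam_at_def)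
  then show "0 < lam_at \<sigma> p" using b by linarith
  have "lam_at \<sigma> p \<le> real p powr (-1-\<sigma>) + 2 * (real p powr (-1-\<sigma>))\<^sup>2"
    using ln_one_minus_pos_lower_bound[of "real p powr (-1-\<sigma>)"] b by (simp add: lam_at_def)
  then show "lam_at \<sigma> p \<le> real p powr (-1-\<sigma>) + 2 / (real p)\<^sup>2" using b(4) by simp
qed

lemma lam_powr_bounds:
  assumes "0 \<le> \<sigma>" "2 \<le> p"
  shows "real p powr (-1-\<sigma>) \<le> lam p * real p powr (-\<sigma>)" 
    "lam p * real p powr (-\<sigma>) \<le> real p powr (-1-\<sigma>) + 2 / (real p)\<^sup>2"
proof -
  have p: "0 < real p powr (-\<sigma>)" "real p powr (-\<sigma>) \<le> 1" using assms powr_mono[of "-\<sigma>" 0 "real p"] by auto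
  have e: "real p powr (-1-\<sigma>) = 1 / real p * real p powr (-\<sigma>)"
    using assms by (simp add: powr_diff powr_minus powr_minus_divide field_simps)
  show "real p powr (-1-\<sigma>) \<le> lam p * real p powr (-\<sigma>)" 
    unfolding e by (intro mult_right_mono lam_ge assms) auto
  have "lam p * real p powr (-\<sigma>) \<le> (1 / real p + 2 / (real p)\<^sup>2) * real p powr (-\<sigma>)"
    by (intro mult_right_mono lam_le assms) auto
  also have "\<dots> = real p powr (-1-\<sigma>) + 2 / (real p)\<^sup>2 * real p powr (-\<sigma>)" by (simp add: e algebra_simps)
  also have "\<dots> \<le> real p powr (-1-\<sigma>) + 2 / (real p)\<^sup>2" using p by (intro add_left_mono mult_left_le) auto
  finally show "lam p * real p powr (-\<sigma>) \<le> real p powr (-1-\<sigma>) + 2 / (real p)\<^sup>2" .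
qed

lemma exp_sum_lam_at:
  assumes "0 \<le> \<sigma>"
  shows "exp (\<Sum>p\<in>pr N. lam_at \<sigma> p) = (\<Prod>p\<in>pr N. 1 / (1 - real p powr (-(1+\<sigma>))))"
proof -
  have "exp (lam_at \<sigma> p) = 1 / (1 - real p powr (-(1+\<sigma>)))" if "p \<in> pr N" for p
  proof -
    have "real p powr (-1-\<sigma>) \<le> 1/2" using powr_neg_bounds(3)[OF assms prD(3)[OF that]] .
    then show ?thesis by (simp add: lam_at_def exp_minus field_simps)
  qed
  then show ?thesis by (simp add: exp_sum)
qed

lemma sum_lam_at_le:
  assumes s: "0 < \<sigma>"
  shows "(\<Sum>p\<in>pr N. lam_at \<sigma> p) \<le> ln (1 + 1 / \<sigma>)"
proof -
  have "exp (\<Sum>p\<in>pr N. lam_at \<sigma> p) \<le> 1 + 1 / \<sigma>"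
    unfolding exp_sum_lam_at[OF less_imp_le[OF s]]
  proof (rule euler_product_le)
    fix F :: "nat set" assume F: "finite F" "0 \<notin> F"
    then have "F \<subseteq> {1..Max F}" by (auto simp: Suc_le_eq intro: gr0I)
    then have "(\<Sum>n\<in>F. real n powr (-(1+\<sigma>))) \<le> (\<Sum>n=1..Max F. real n powr (-(1+\<sigma>)))"
      by (intro sum_mono2) auto
    also have "\<dots> \<le> 1 + 1 / \<sigma>" using zeta_partial_le[OF s, of "Max F"] by simp
    finally show "(\<Sum>n\<in>F. real n powr (-(1+\<sigma>))) \<le> 1 + 1 / \<sigma>" .
  qed (use s in auto)
  then show ?thesis using s by (metis add_pos_pos divide_pos_pos ln_ge_iff zero_less_one)
qed

lemma sum_lam_at_ge:
  assumes s: "0 < \<sigma>" and N: "1 \<le> N"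
  shows "ln ((1 - real (Suc N) powr (-\<sigma>)) / \<sigma>) \<le> (\<Sum>p\<in>pr N. lam_at \<sigma> p)"
proof -
  have "(1 - real (Suc N) powr (-\<sigma>)) / \<sigma> \<le> (\<Sum>n=1..N. real n powr (-1-\<sigma>))" by (rule zeta_partial_ge[OF s])
  also have "\<dots> \<le> exp (\<Sum>p\<in>pr N. lam_at \<sigma> p)"
    unfolding exp_sum_lam_at[OF less_imp_le[OF s]] using euler_product_ge[of "1+\<sigma>" N] s by simp
  finally have le: "(1 - real (Suc N) powr (-\<sigma>)) / \<sigma> \<le> exp (\<Sum>p\<in>pr N. lam_at \<sigma> p)" .
  have "real (Suc N) powr (-\<sigma>) < 1" using s N by (intro powr_less_one) auto
  then have "0 < (1 - real (Suc N) powr (-\<sigma>)) / \<sigma>" using s by simp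
  then show ?thesis using le by (metis ln_exp ln_mono exp_gt_zero)
qed

definition inv_sq_sum :: real where "inv_sq_sum = (\<Sum>n. 2 * (1 / real n ^ 2))"

lemma summable_inv_sq: "summable (\<lambda>n. 2 * (1 / real n ^ 2))"
  using inverse_power_summable[of 2, where 'a=real] by (intro summable_mult) (simp add: inverse_eq_divide)

lemma inv_sq_sum: "finite A \<Longrightarrow> (\<Sum>p\<in>A. 2 / (real p)\<^sup>2) \<le> inv_sq_sum"
  using sum_le_suminf[OF summable_inv_sq, of A] by (simp add: inv_sq_sum_def)

lemma inv_sq_sum_nonneg: "0 \<le> inv_sq_sum" using inv_sq_sum[of "{}"] by simp

text \<open>log zeta(1 + sigma) is at most log(1 + 1/sigma), and sigma <= 1 lets the 1 be absorbed
  into a factor 2. \<open>inv_sq_sum\<close> pays for passing from \<open>lam_at\<close> to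
  \<open>lam\<close>.\<close>

lemma sum_lam_powr_le:
  assumes "0 < \<sigma>" "\<sigma> \<le> 1"
  shows "(\<Sum>p\<in>pr N. lam p * real p powr (-\<sigma>)) \<le> ln (1 / \<sigma>) + (1 + inv_sq_sum)"
proof -
  have "(\<Sum>p\<in>pr N. lam p * real p powr (-\<sigma>)) \<le> (\<Sum>p\<in>pr N. lam_at \<sigma> p + 2 / (real p)\<^sup>2)"
  proof (rule sum_mono)
    fix p assume "p \<in> pr N"
    then have "2 \<le> p" by (rule prD)
    then show "lam p * real p powr (-\<sigma>) \<le> lam_at \<sigma> p + 2 / (real p)\<^sup>2"
      using lam_powr_bounds[of \<sigma> p] lam_at_bounds[of \<sigma> p] assms by simp
  qed
  also have "\<dots> \<le> ln (1 + 1 / \<sigma>) + inv_sq_sum"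
    unfolding sum.distrib by (intro add_mono sum_lam_at_le inv_sq_sum assms) auto
  also have "ln (1 + 1 / \<sigma>) \<le> ln (2 * (1 / \<sigma>))" using assms by (subst ln_le_cancel_iff) (auto simp: field_simps)
  also have "\<dots> = ln 2 + ln (1 / \<sigma>)" using assms by (subst ln_mult) auto
  also have "ln 2 \<le> (1::real)" using ln_2_less_1 by simp
  finally show ?thesis by simp
qed

text \<open>At s = 1 the Euler product dominates the harmonic sum, which is at least ln n, so no
  error term appears.\<close>

lemma sum_lam_ge:
  assumes "2 \<le> n"
  shows "ln (ln (real n)) \<le> (\<Sum>p\<in>pr n. lam p)"
proof -
  have lam0: "lam_at 0 p = lam p" for p by (simp add: lam_at_def lam_def powr_minus_divide)
  have "ln (real n) \<le> ln (real n + 1)" using assms by simp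
  also have "\<dots> \<le> harm n" by (rule ln_le_harm)
  also have "\<dots> = (\<Sum>m=1..n. real m powr (-1))" by (simp add: harm_def powr_minus)
  also have "\<dots> \<le> exp (\<Sum>p\<in>pr n. lam p)"
    using exp_sum_lam_at[of 0 n] euler_product_ge[of 1 n] by (simp add: lam0)
  finally have "ln (real n) \<le> exp (\<Sum>p\<in>pr n. lam p)" .
  moreover have "0 < ln (real n)" using assms by simp
  ultimately show ?thesis by (metis ln_exp ln_mono exp_gt_zero)
qed

text \<open>From p^(-sigma) >= 1 - sigma log p and Mertens. With n = 8k^2 and sigma of order k/L the
  subtracted term is bounded, and removing the small primes from \<open>sum_lam_powr_le\<close> then
  saves ln ln n; this is the origin of the factor log k.\<close>

lemma sum_lam_powr_ge:
  assumes n: "2 \<le> n" and s: "0 \<le> \<sigma>"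
  shows "ln (ln (real n)) - \<sigma> * (ln (real n) + (2 + 4 * sq_sum)) \<le> (\<Sum>p\<in>pr n. lam p * real p powr (-\<sigma>))"
proof -
  have "(\<Sum>p\<in>pr n. lam p) - \<sigma> * (\<Sum>p\<in>pr n. lam p * ln (real p)) = (\<Sum>p\<in>pr n. lam p * (1 - \<sigma> * ln (real p)))"
    by (simp add: sum_distrib_left sum_subtractf algebra_simps)
  also have "\<dots> \<le> (\<Sum>p\<in>pr n. lam p * real p powr (-\<sigma>))"
  proof (intro sum_mono mult_left_mono)
    fix p assume "p \<in> pr n"
    then have p: "2 \<le> p" by (rule prD)
    show "0 \<le> lam p" using lam_pos[OF p] by simp
    show "1 - \<sigma> * ln (real p) \<le> real p powr (-\<sigma>)"
      using exp_ge_add_one_self[of "- \<sigma> * ln (real p)"] p by (simp add: powr_def)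
  qed
  finally have "(\<Sum>p\<in>pr n. lam p) - \<sigma> * (\<Sum>p\<in>pr n. lam p * ln (real p)) \<le> (\<Sum>p\<in>pr n. lam p * real p powr (-\<sigma>))" .
  moreover have "\<sigma> * (\<Sum>p\<in>pr n. lam p * ln (real p)) \<le> \<sigma> * (ln (real n) + (2 + 4 * sq_sum))"
    by (intro mult_left_mono s) (use mertens_nat[of n] n in auto)
  ultimately show ?thesis using sum_lam_ge[OF n] by linarith
qed

section \<open>Prime sums with weight p^(-sigma) as sigma tends to 0\<close>

definition lam_pow :: "real \<Rightarrow> nat \<Rightarrow> real" where
  "lam_pow \<sigma> p = (if prime p then lam p * real p powr (-\<sigma>) else 0)"

lemma sum_prime_if: "(\<Sum>p<Suc n. if prime p then f p else 0) = (\<Sum>p\<in>pr n. f p :: real)"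
proof -
  have "pr n = {p \<in> {..<Suc n}. prime p}" by (auto simp: pr_def)
  then show ?thesis by (simp only: sum.inter_filter[OF finite_lessThan])
qed

lemma prime_sum_bounded_summable:
  assumes nn: "\<And>p. prime p \<Longrightarrow> 0 \<le> f p" and le: "\<And>n. (\<Sum>p\<in>pr n. f p) \<le> B"
  shows "summable (\<lambda>p. if prime p then f p else 0)" "(\<lambda>n. \<Sum>p\<in>pr n. f p) \<longlonglongrightarrow> (\<Sum>p. if prime p then f p else 0 :: real)"
proof -
  show s: "summable (\<lambda>p. if prime p then f p else 0)"
  proof (rule summableI_nonneg_bounded)
    fix n
    have "(\<Sum>p<n. if prime p then f p else 0) \<le> (\<Sum>p<Suc n. if prime p then f p else 0)" using nn by simp
    then show "(\<Sum>p<n. if prime p then f p else 0) \<le> B" using le[of n] by (simp only: sum_prime_if)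
  qed (use nn in auto)
  then have "(\<lambda>n. \<Sum>p<n. if prime p then f p else 0) \<longlonglongrightarrow> (\<Sum>p. if prime p then f p else 0)" by (rule summable_LIMSEQ)
  then have "(\<lambda>n. \<Sum>p<Suc n. if prime p then f p else 0) \<longlonglongrightarrow> (\<Sum>p. if prime p then f p else 0)" by (rule LIMSEQ_Suc)
  then show "(\<lambda>n. \<Sum>p\<in>pr n. f p) \<longlonglongrightarrow> (\<Sum>p. if prime p then f p else 0)" by (simp only: sum_prime_if)
qed

lemma lam_at_suminf_bounds:
  assumes s: "0 < \<sigma>"
  shows "summable (\<lambda>p. if prime p then lam_at \<sigma> p else 0)" 
    "ln (1 / \<sigma>) \<le> (\<Sum>p. if prime p then lam_at \<sigma> p else 0)" "(\<Sum>p. if prime p then lam_at \<sigma> p else 0) \<le> ln (1 + 1 / \<sigma>)"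
proof -
  have nn: "0 \<le> lam_at \<sigma> p" if "prime p" for p using lam_at_bounds(3)[of \<sigma> p] s prime_ge_2_nat[OF that] by simp
  note * = prime_sum_bounded_summable[of "lam_at \<sigma>", OF nn sum_lam_at_le[OF s]]
  show "summable (\<lambda>p. if prime p then lam_at \<sigma> p else 0)" by (rule *)
  show "(\<Sum>p. if prime p then lam_at \<sigma> p else 0) \<le> ln (1 + 1 / \<sigma>)"
    by (rule LIMSEQ_le_const2[OF *(2)]) (use sum_lam_at_le[OF s] in auto)
  have t: "(\<lambda>N. real (Suc N) powr (-\<sigma>)) \<longlonglongrightarrow> 0"
    using s by (intro tendsto_neg_powr filterlim_compose[OF filterlim_real_sequentially filterlim_Suc]) auto
  have "(\<lambda>N. ln ((1 - real (Suc N) powr (-\<sigma>)) / \<sigma>)) \<longlonglongrightarrow> ln ((1 - 0) / \<sigma>)"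
    using s by (intro tendsto_ln tendsto_divide tendsto_diff tendsto_const t) auto
  then show "ln (1 / \<sigma>) \<le> (\<Sum>p. if prime p then lam_at \<sigma> p else 0)"
    using LIMSEQ_le[OF _ *(2), of _ "ln (1 / \<sigma>)"] sum_lam_at_ge[OF s] by auto
qed

lemma summable_lam_pow:
  assumes s: "0 < \<sigma>" shows "summable (lam_pow \<sigma>)"
proof -
  have "summable (\<lambda>p. (if prime p then lam_at \<sigma> p else 0) + 2 * (1 / real p ^ 2))"
    by (intro summable_add lam_at_suminf_bounds(1) s summable_inv_sq)
  then show ?thesis
  proof (rule summable_comparison_test'[where N = 0])
    fix p :: nat
    show "norm (lam_pow \<sigma> p) \<le> (if prime p then lam_at \<sigma> p else 0) + 2 * (1 / real p ^ 2)"
      using lam_powr_bounds[of \<sigma> p] lam_at_bounds[of \<sigma> p] powr_neg_bounds[of \<sigma> p] s prime_ge_2_nat[of p]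
      by (auto simp: lam_pow_def)
  qed
qed

text \<open>The bounds 1/sigma <= zeta(1 + sigma) <= 1 + 1/sigma give the limit for
  \<open>lam_at\<close>. Exchanging \<open>lam_at\<close> for \<open>lam_pow\<close> costs a factor
  tending to 1: both terms tend to lambda_p as sigma -> 0, their difference is dominated by 2/p^2,
  and Tannery's theorem applies.\<close>

lemma lam_pow_limit: "((\<lambda>\<sigma>. \<sigma> * exp (suminf (lam_pow \<sigma>))) \<longlongrightarrow> 1) (at_right 0)"
proof -
  define d where "d = (\<lambda>p \<sigma>. lam_pow \<sigma> p - (if prime p then lam_at \<sigma> p else 0))"
  have ev: "\<forall>\<^sub>F \<sigma> in at_right 0. 0 < (\<sigma>::real)" by (simp add: eventually_at_right_less)
  have "((\<lambda>\<sigma>. \<Sum>p. d p \<sigma>) \<longlongrightarrow> (\<Sum>p. 0 :: real)) (at_right 0)"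
  proof (rule conjunct2[OF conjunct2[OF tannerys_theorem]])
    show "((d p) \<longlongrightarrow> 0) (at_right 0)" for p
    proof (cases "prime p")
      case True
      then have p: "2 \<le> p" by (rule prime_ge_2_nat)
      have "((\<lambda>\<sigma>. lam p * real p powr (-\<sigma>) + ln (1 - real p powr (-1-\<sigma>))) \<longlongrightarrow> 
          lam p * real p powr (-0) + ln (1 - real p powr (-1-0))) (at_right 0)"
        using p by (intro tendsto_intros) (auto simp: powr_minus_divide)
      moreover have "lam p * real p powr (-0) + ln (1 - real p powr (-1-0)) = 0"
        using p by (simp add: lam_def powr_minus_divide)
      ultimately show ?thesis using True by (simp add: d_def lam_pow_def lam_at_def)
    qed (simp add: d_def lam_pow_def)
    have "\<forall>\<^sub>F (k, \<sigma>) in sequentially \<times>\<^sub>F at_right 0. 0 < (\<sigma>::real)"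
      using ev by (simp add: eventually_prod2)
    then show "\<forall>\<^sub>F (p, \<sigma>) in sequentially \<times>\<^sub>F at_right 0. norm (d p \<sigma>) \<le> 2 * (1 / real p ^ 2)"
    proof (rule eventually_mono, clarify)
      fix p :: nat and \<sigma> :: real assume s: "0 < \<sigma>"
      show "norm (d p \<sigma>) \<le> 2 * (1 / real p ^ 2)"
        using lam_powr_bounds[of \<sigma> p] lam_at_bounds[of \<sigma> p] s prime_ge_2_nat[of p]
        by (auto simp: d_def lam_pow_def abs_le_iff)
    qed
  qed (use summable_inv_sq in auto)
  then have d0: "((\<lambda>\<sigma>. exp (\<Sum>p. d p \<sigma>)) \<longlongrightarrow> 1) (at_right 0)" using tendsto_exp[of "\<lambda>\<sigma>. \<Sum>p. d p \<sigma>" 0] by simp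
  have e1: "((\<lambda>\<sigma>. \<sigma> * exp (\<Sum>p. if prime p then lam_at \<sigma> p else 0)) \<longlongrightarrow> 1) (at_right 0)"
  proof (rule tendsto_sandwich)
    show "\<forall>\<^sub>F \<sigma> in at_right 0. 1 \<le> \<sigma> * exp (\<Sum>p. if prime p then lam_at \<sigma> p else 0)"
      using ev
    proof eventually_elim
      case (elim \<sigma>)
      have "exp (ln (1 / \<sigma>)) \<le> exp (\<Sum>p. if prime p then lam_at \<sigma> p else 0)"
        using lam_at_suminf_bounds(2)[OF elim] by simp
      then show ?case using elim by (simp add: field_simps)
    qed
    show "\<forall>\<^sub>F \<sigma> in at_right 0. \<sigma> * exp (\<Sum>p. if prime p then lam_at \<sigma> p else 0) \<le> 1 + \<sigma>"
      using ev
    proof eventually_elim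
      case (elim \<sigma>)
      have "exp (\<Sum>p. if prime p then lam_at \<sigma> p else 0) \<le> exp (ln (1 + 1 / \<sigma>))"
        using lam_at_suminf_bounds(3)[OF elim] by simp
      also have "\<dots> = 1 + 1 / \<sigma>" using elim by (intro exp_ln) (auto intro!: add_pos_pos)
      finally show ?case using elim by (simp add: field_simps)
    qed
    show "((\<lambda>\<sigma>. 1 + \<sigma>) \<longlongrightarrow> (1::real)) (at_right 0)" by (rule tendsto_eq_intros refl | simp)+
  qed auto
  have "((\<lambda>\<sigma>. (\<sigma> * exp (\<Sum>p. if prime p then lam_at \<sigma> p else 0)) * exp (\<Sum>p. d p \<sigma>)) \<longlongrightarrow> 1 * 1) (at_right 0)"
    by (intro tendsto_mult e1 d0)
  moreover have "\<forall>\<^sub>F \<sigma> in at_right 0. (\<sigma> * exp (\<Sum>p. if prime p then lam_at \<sigma> p else 0)) * exp (\<Sum>p. d p \<sigma>) = \<sigma> * exp (suminf (lam_pow \<sigma>))"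
    using ev
  proof eventually_elim
    case (elim \<sigma>)
    have "(\<Sum>p. d p \<sigma>) = suminf (lam_pow \<sigma>) - (\<Sum>p. if prime p then lam_at \<sigma> p else 0)"
      unfolding d_def by (rule suminf_diff[symmetric]) (intro summable_lam_pow lam_at_suminf_bounds elim)+
    then show ?case by (simp add: exp_diff)
  qed
  ultimately have "((\<lambda>\<sigma>. \<sigma> * exp (suminf (lam_pow \<sigma>))) \<longlongrightarrow> 1 * 1) (at_right 0)"
    by (rule Lim_transform_eventually)
  then show ?thesis by simp
qed

section \<open>Convolutions of discrete distributions\<close>

definition cpmf :: "'a::comm_monoid_add pmf \<Rightarrow> 'a pmf \<Rightarrow> 'a pmf" where
  "cpmf A B = bind_pmf A (\<lambda>x. bind_pmf B (\<lambda>y. return_pmf (x + y)))"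

text \<open>Convolution is a commutative monoid operation on discrete laws with the point mass at 0
  as unit. The law of a finite independent sum is its big operator, and exchange of double sums or
  removal of trivial summands are instances of the generic theory.\<close>

definition csum :: "('i \<Rightarrow> 'a::comm_monoid_add pmf) \<Rightarrow> 'i set \<Rightarrow> 'a pmf" where
  "csum = comm_monoid_set.F cpmf (return_pmf 0)"

lemma cpmf_comm: "cpmf A B = cpmf B A"
  unfolding cpmf_def by (subst bind_commute_pmf) (simp add: add.commute)

lemma csum_monoid: "comm_monoid_set cpmf (return_pmf 0)"
proof
  show "cpmf (cpmf a b) c = cpmf a (cpmf b c)" for a b c :: "'a pmf"
    by (simp add: cpmf_def bind_assoc_pmf bind_return_pmf add.assoc)
  show "cpmf a b = cpmf b a" for a b :: "'a pmf" by (rule cpmf_comm)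
  show "cpmf a (return_pmf 0) = a" for a :: "'a pmf"
    by (simp add: cpmf_def bind_return_pmf bind_return_pmf')
qed

lemma csum_empty [simp]: "csum X {} = return_pmf 0"
  by (simp add: csum_def comm_monoid_set.empty[OF csum_monoid])

lemma csum_insert: "finite A \<Longrightarrow> q \<notin> A \<Longrightarrow> csum X (insert q A) = cpmf (X q) (csum X A)"
  by (simp add: csum_def comm_monoid_set.insert[OF csum_monoid])

lemma csum_swap: "csum (\<lambda>i. csum (g i) B) A = csum (\<lambda>j. csum (\<lambda>i. g i j) A) B"
  unfolding csum_def by (rule comm_monoid_set.swap[OF csum_monoid])

lemma csum_cong: "A = B \<Longrightarrow> (\<And>x. x \<in> B \<Longrightarrow> g x = h x) \<Longrightarrow> csum g A = csum h B"
  unfolding csum_def by (rule comm_monoid_set.cong[OF csum_monoid])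

lemma csum_mono_neutral:
  "finite T \<Longrightarrow> S \<subseteq> T \<Longrightarrow> (\<And>i. i \<in> T - S \<Longrightarrow> g i = return_pmf 0) \<Longrightarrow> csum g T = csum g S"
  unfolding csum_def by (rule comm_monoid_set.mono_neutral_right[OF csum_monoid]) auto

lemma map_pmf_cpmf:
  assumes "\<And>x y. f (x + y) = f x + f y"
  shows "map_pmf f (cpmf A B) = cpmf (map_pmf f A) (map_pmf f B)"
  by (simp add: cpmf_def map_bind_pmf bind_map_pmf assms)

lemma map_pmf_csum:
  assumes "\<And>x y. f (x + y) = f x + f y" "f 0 = 0" "finite A"
  shows "map_pmf f (csum X A) = csum (\<lambda>i. map_pmf f (X i)) A"
  using assms(3) by induction (simp_all add: assms csum_insert map_pmf_cpmf)

text \<open>Realises the convolution on a product space, where the exponents at all primes are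
  visible at once; the expansion of the moment takes place there.\<close>

lemma csum_map_Pi_pmf:
  assumes "finite P"
  shows "csum (\<lambda>p. map_pmf (\<phi> p) (X p)) P = map_pmf (\<lambda>x. \<Sum>p\<in>P. \<phi> p (x p)) (Pi_pmf P d X)"
  using assms
proof induction
  case (insert q P)
  have "(\<Sum>p\<in>P. \<phi> p (if p = q then y else f p)) = (\<Sum>p\<in>P. \<phi> p (f p))" for y f
    using insert by (intro sum.cong) auto
  then show ?case using insert
    by (simp add: csum_insert cpmf_def Pi_pmf_insert' map_bind_pmf bind_map_pmf)
qed simp

lemma set_csum_subset:
  assumes "finite P" "0 \<in> C" "\<And>u v. u \<in> C \<Longrightarrow> v \<in> C \<Longrightarrow> u + v \<in> C" "\<And>p. p \<in> P \<Longrightarrow> set_pmf (X p) \<subseteq> C"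
  shows "set_pmf (csum X P) \<subseteq> C"
  using assms(1,4)
proof induction
  case (insert q P)
  then show ?case by (auto simp: csum_insert cpmf_def intro!: assms(3))
qed (use assms in auto)

section \<open>Expectations of bounded functions and of convolutions\<close>

lemma pmf_integrable_bounded:
  fixes G :: "'a \<Rightarrow> real"
  assumes "\<And>x. x \<in> set_pmf A \<Longrightarrow> \<bar>G x\<bar> \<le> c"
  shows "integrable (measure_pmf A) G"
  by (rule measure_pmf.integrable_const_bound[where B = c]) (use assms in \<open>auto simp: AE_measure_pmf_iff\<close>)

lemma pmf_expectation_bounds:
  fixes G :: "'a \<Rightarrow> real"
  assumes "\<And>x. x \<in> set_pmf A \<Longrightarrow> 0 \<le> G x \<and> G x \<le> c"
  shows "0 \<le> measure_pmf.expectation A G \<and> measure_pmf.expectation A G \<le> c"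
proof
  show "0 \<le> measure_pmf.expectation A G"
    by (intro integral_nonneg_AE) (use assms in \<open>auto simp: AE_measure_pmf_iff\<close>)
  have "measure_pmf.expectation A G \<le> measure_pmf.expectation A (\<lambda>_. c)"
    by (intro integral_mono_AE pmf_integrable_bounded[of _ _ "\<bar>c\<bar>"]) (use assms in \<open>fastforce simp: AE_measure_pmf_iff\<close>)+
  then show "measure_pmf.expectation A G \<le> c" by simp
qed

lemma pmf_expectation_mono:
  fixes F G :: "'a \<Rightarrow> real"
  assumes "\<And>x. x \<in> set_pmf A \<Longrightarrow> F x \<le> G x" "integrable (measure_pmf A) F" "integrable (measure_pmf A) G"
  shows "measure_pmf.expectation A F \<le> measure_pmf.expectation A G"
  by (intro integral_mono_AE) (use assms in \<open>auto simp: AE_measure_pmf_iff\<close>)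

lemma pmf_expectation_cong:
  fixes F G :: "'a \<Rightarrow> real"
  assumes "\<And>x. x \<in> set_pmf A \<Longrightarrow> F x = G x"
  shows "measure_pmf.expectation A F = measure_pmf.expectation A G"
  by (intro integral_cong_AE) (use assms in \<open>auto simp: AE_measure_pmf_iff\<close>)

lemma nn_integral_pmf_eq_expectation:
  fixes G :: "'a \<Rightarrow> real"
  assumes "\<And>x. x \<in> set_pmf A \<Longrightarrow> 0 \<le> G x \<and> G x \<le> c"
  shows "(\<integral>\<^sup>+x. ennreal (G x) \<partial>measure_pmf A) = ennreal (measure_pmf.expectation A G)"
  by (rule nn_integral_eq_integral)
    (use assms in \<open>auto simp: AE_measure_pmf_iff intro!: pmf_integrable_bounded[of _ _ c]\<close>)

lemma expectation_cpmf:
  fixes G :: "'a::comm_monoid_add \<Rightarrow> real"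
  assumes b: "\<And>x y. x \<in> set_pmf A \<Longrightarrow> y \<in> set_pmf B \<Longrightarrow> 0 \<le> G (x + y) \<and> G (x + y) \<le> c"
  shows "measure_pmf.expectation (cpmf A B) G = measure_pmf.expectation A (\<lambda>x. measure_pmf.expectation B (\<lambda>y. G (x + y)))"
proof -
  have s: "0 \<le> G x \<and> G x \<le> c" if "x \<in> set_pmf (cpmf A B)" for x
    using that b by (auto simp: cpmf_def)
  have i: "0 \<le> measure_pmf.expectation B (\<lambda>y. G (x + y)) \<and> measure_pmf.expectation B (\<lambda>y. G (x + y)) \<le> c" 
    if "x \<in> set_pmf A" for x
    using b that by (intro pmf_expectation_bounds) auto
  have "ennreal (measure_pmf.expectation (cpmf A B) G) = (\<integral>\<^sup>+x. ennreal (G x) \<partial>measure_pmf (cpmf A B))"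
    by (rule nn_integral_pmf_eq_expectation[symmetric, OF s])
  also have "\<dots> = (\<integral>\<^sup>+x. \<integral>\<^sup>+y. ennreal (G (x + y)) \<partial>measure_pmf B \<partial>measure_pmf A)"
    by (simp add: cpmf_def)
  also have "\<dots> = (\<integral>\<^sup>+x. ennreal (measure_pmf.expectation B (\<lambda>y. G (x + y))) \<partial>measure_pmf A)"
    by (intro nn_integral_cong_AE) (use b in \<open>auto simp: AE_measure_pmf_iff intro!: nn_integral_pmf_eq_expectation\<close>)
  also have "\<dots> = ennreal (measure_pmf.expectation A (\<lambda>x. measure_pmf.expectation B (\<lambda>y. G (x + y))))"
    by (rule nn_integral_pmf_eq_expectation[OF i])
  finally show ?thesis
    using pmf_expectation_bounds[of "cpmf A B" G c, OF s] pmf_expectation_bounds[of A _ c, OF i] by simp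
qed

text \<open>Replacement for unnormalised local measures: \<open>m p\<close> is a mass and
  \<open>R p\<close> bounds the damped mass \<open>m p\<close> times E \<open>D\<close>. An exchange
  made while the other summands add up to u costs a multiple of \<open>D u\<close>; since
  \<open>D\<close> is multiplicative, averaging over those summands splits into local quantities.
  \<open>C\<close> is a cone carrying all the laws.\<close>

locale lindeberg =
  fixes P :: "'p set" and C :: "'v::comm_monoid_add set" and G D :: "'v \<Rightarrow> real" and m R :: "'p \<Rightarrow> real"
  assumes C0: "0 \<in> C" and Cadd: "\<And>u v. u \<in> C \<Longrightarrow> v \<in> C \<Longrightarrow> u + v \<in> C"
    and G: "\<And>u. u \<in> C \<Longrightarrow> 0 \<le> G u \<and> G u \<le> 1"
    and D: "\<And>u. u \<in> C \<Longrightarrow> 0 \<le> D u \<and> D u \<le> 1"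
    and Dadd: "\<And>u v. u \<in> C \<Longrightarrow> v \<in> C \<Longrightarrow> D (u + v) = D u * D v"
    and D0: "D 0 = 1"
    and m: "\<And>p. p \<in> P \<Longrightarrow> 0 \<le> m p" and R: "\<And>p. p \<in> P \<Longrightarrow> 1 \<le> R p"
begin

lemma expectation_csum_D:
  assumes "finite Q" "Q \<subseteq> P" "\<And>p. p \<in> Q \<Longrightarrow> set_pmf (X p) \<subseteq> C"
    "\<And>p. p \<in> Q \<Longrightarrow> m p * measure_pmf.expectation (X p) D \<le> R p"
  shows "0 \<le> measure_pmf.expectation (csum X Q) D \<and> (\<Prod>p\<in>Q. m p) * measure_pmf.expectation (csum X Q) D \<le> (\<Prod>p\<in>Q. R p)"
  using assms
proof (induction Q)
  case empty
  then show ?case by (simp add: D0)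
next
  case (insert q Q)
  have sQ: "set_pmf (csum X Q) \<subseteq> C" using insert by (intro set_csum_subset C0 Cadd) auto
  have sq: "set_pmf (X q) \<subseteq> C" using insert by auto
  have nq: "0 \<le> measure_pmf.expectation (X q) D" using pmf_expectation_bounds[of "X q" D 1] sq D by auto
  have "measure_pmf.expectation (csum X (insert q Q)) D = measure_pmf.expectation (X q) (\<lambda>x. measure_pmf.expectation (csum X Q) (\<lambda>y. D (x + y)))"
    unfolding csum_insert[OF insert(1,2)] by (rule expectation_cpmf[of _ _ _ 1]) (use sQ sq D Cadd in blast)
  also have "\<dots> = measure_pmf.expectation (X q) (\<lambda>x. measure_pmf.expectation (csum X Q) (\<lambda>y. D x * D y))"
    by (intro pmf_expectation_cong) (use sQ sq Dadd in blast)
  also have "\<dots> = measure_pmf.expectation (X q) D * measure_pmf.expectation (csum X Q) D" by simp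
  finally have e: "measure_pmf.expectation (csum X (insert q Q)) D = measure_pmf.expectation (X q) D * measure_pmf.expectation (csum X Q) D" .
  have IH: "0 \<le> measure_pmf.expectation (csum X Q) D" "(\<Prod>p\<in>Q. m p) * measure_pmf.expectation (csum X Q) D \<le> (\<Prod>p\<in>Q. R p)"
    using insert by auto
  have "(\<Prod>p\<in>insert q Q. m p) * measure_pmf.expectation (csum X (insert q Q)) D 
      = (m q * measure_pmf.expectation (X q) D) * ((\<Prod>p\<in>Q. m p) * measure_pmf.expectation (csum X Q) D)"
    using insert(1,2) by (simp add: e mult_ac)
  also have "\<dots> \<le> R q * (\<Prod>p\<in>Q. R p)"
    using insert.prems insert(1) IH nq m[of q] R[of q] by (intro mult_mono) (auto intro!: mult_nonneg_nonneg prod_nonneg m)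
  finally show ?case using insert(1,2) IH nq by (simp add: e)
qed

text \<open>Summands are exchanged one at a time. The base point u and the factor \<open>D u\<close>
  belong to the induction, because an exchange takes place after other summands have been
  added.\<close>

lemma lindeberg_swap:
  assumes "finite Q" "Q \<subseteq> P"
    "\<And>p. p \<in> Q \<Longrightarrow> set_pmf (X p) \<subseteq> C" "\<And>p. p \<in> Q \<Longrightarrow> set_pmf (Y p) \<subseteq> C"
    "\<And>p. p \<in> Q \<Longrightarrow> m p * measure_pmf.expectation (X p) D \<le> R p"
    "\<And>p. p \<in> Q \<Longrightarrow> m p * measure_pmf.expectation (Y p) D \<le> R p"
    "\<And>p. p \<in> Q \<Longrightarrow> 0 \<le> \<epsilon> p"
    "\<And>p u. p \<in> Q \<Longrightarrow> u \<in> C \<Longrightarrow> \<bar>measure_pmf.expectation (X p) (\<lambda>x. G (u + x)) - measure_pmf.expectation (Y p) (\<lambda>x. G (u + x))\<bar> \<le> \<epsilon> p * D u"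
    "u \<in> C"
  shows "(\<Prod>p\<in>Q. m p) * \<bar>measure_pmf.expectation (csum X Q) (\<lambda>x. G (u + x)) - measure_pmf.expectation (csum Y Q) (\<lambda>x. G (u + x))\<bar>
     \<le> (\<Sum>p\<in>Q. m p * \<epsilon> p) * (\<Prod>p\<in>Q. R p) * D u"
  using assms
proof (induction Q arbitrary: u)
  case empty
  then show ?case by simp
next
  case (insert q Q)
  let ?E = "measure_pmf.expectation"
  have sXQ: "set_pmf (csum X Q) \<subseteq> C" using insert by (intro set_csum_subset C0 Cadd) auto
  have sYQ: "set_pmf (csum Y Q) \<subseteq> C" using insert by (intro set_csum_subset C0 Cadd) auto
  have sXq: "set_pmf (X q) \<subseteq> C" and sYq: "set_pmf (Y q) \<subseteq> C" using insert by auto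
  have uC: "u \<in> C" by fact
  let ?M = "\<Prod>p\<in>Q. m p" let ?R = "\<Prod>p\<in>Q. R p" let ?S = "\<Sum>p\<in>Q. m p * \<epsilon> p"
  have M0: "0 \<le> ?M" using insert.prems(1) by (intro prod_nonneg) (auto intro!: m)
  have R1: "1 \<le> ?R" using insert.prems(1) by (intro prod_ge_1) (auto intro!: R)
  have mq: "0 \<le> m q" "1 \<le> R q" using insert.prems(1) m R by auto
  have S0: "0 \<le> ?S" using insert.prems by (intro sum_nonneg mult_nonneg_nonneg) (auto intro!: m)
  have Dx: "integrable (measure_pmf A) (\<lambda>x. c * D x)" if "set_pmf A \<subseteq> C" for A c
    by (rule pmf_integrable_bounded[of _ _ "\<bar>c\<bar>"]) (use that D in \<open>fastforce simp: abs_mult mult_left_le\<close>)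
  have bd: "0 \<le> G (u + (x + y)) \<and> G (u + (x + y)) \<le> 1" if "x \<in> C" "y \<in> C" for x y
    using that Cadd uC G by blast
  have inB: "0 \<le> ?E B (\<lambda>y. G (v + y)) \<and> ?E B (\<lambda>y. G (v + y)) \<le> 1" if "set_pmf B \<subseteq> C" "v \<in> C" for B v
    by (intro pmf_expectation_bounds) (use that Cadd G in blast)
  have intB: "integrable (measure_pmf A) (\<lambda>x. ?E B (\<lambda>y. G (v + x + y)))" if "set_pmf A \<subseteq> C" "set_pmf B \<subseteq> C" "v \<in> C" for A B v
  proof (rule pmf_integrable_bounded[of _ _ 1])
    fix x assume "x \<in> set_pmf A"
    then have "v + x \<in> C" using that Cadd by blast
    from inB[OF that(2) this] show "\<bar>?E B (\<lambda>y. G (v + x + y))\<bar> \<le> 1" by simp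
  qed
  have split: "?E (cpmf A B) (\<lambda>x. G (u + x)) = ?E A (\<lambda>x. ?E B (\<lambda>y. G (u + x + y)))" 
    if "set_pmf A \<subseteq> C" "set_pmf B \<subseteq> C" for A B
    by (subst expectation_cpmf[of _ _ _ 1]) (use that bd in \<open>blast, simp add: add.assoc\<close>)
  \<comment> \<open>The hybrid between the two sides is X at q with Y on the rest. \<open>E1\<close>
    exchanges the rest, by the induction hypothesis at u + x; \<open>E2\<close> exchanges q with the
    other Y already in place.\<close>
  define E1 where "E1 = ?E (X q) (\<lambda>x. ?E (csum X Q) (\<lambda>y. G (u + x + y)) - ?E (csum Y Q) (\<lambda>y. G (u + x + y)))"
  define E2 where "E2 = ?E (csum Y Q) (\<lambda>y. ?E (X q) (\<lambda>x. G (u + y + x)) - ?E (Y q) (\<lambda>x. G (u + y + x)))"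
  have "?E (csum X (insert q Q)) (\<lambda>x. G (u + x)) - ?E (csum Y (insert q Q)) (\<lambda>x. G (u + x))
      = (?E (cpmf (X q) (csum X Q)) (\<lambda>x. G (u + x)) - ?E (cpmf (X q) (csum Y Q)) (\<lambda>x. G (u + x)))
      + (?E (cpmf (csum Y Q) (X q)) (\<lambda>x. G (u + x)) - ?E (cpmf (csum Y Q) (Y q)) (\<lambda>x. G (u + x)))"
    unfolding csum_insert[OF insert(1,2)] cpmf_comm[of "csum Y Q"] by simp
  also have "\<dots> = E1 + E2"
    unfolding E1_def E2_def
    using sXQ sYQ sXq sYq uC
    by (simp add: split Bochner_Integration.integral_diff intB)
  finally have tot: "?E (csum X (insert q Q)) (\<lambda>x. G (u + x)) - ?E (csum Y (insert q Q)) (\<lambda>x. G (u + x)) = E1 + E2" .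
  have "?M * \<bar>E1\<bar> \<le> ?S * ?R * D u * ?E (X q) D"
  proof -
    have "?M * \<bar>E1\<bar> = \<bar>?E (X q) (\<lambda>x. ?M * (?E (csum X Q) (\<lambda>y. G (u + x + y)) - ?E (csum Y Q) (\<lambda>y. G (u + x + y))))\<bar>"
      using M0 by (simp add: E1_def abs_mult)
    also have "\<dots> \<le> ?E (X q) (\<lambda>x. \<bar>?M * (?E (csum X Q) (\<lambda>y. G (u + x + y)) - ?E (csum Y Q) (\<lambda>y. G (u + x + y)))\<bar>)"
      by (rule integral_abs_bound)
    also have "\<dots> \<le> ?E (X q) (\<lambda>x. ?S * ?R * D u * D x)"
    proof (rule pmf_expectation_mono)
      fix x assume x: "x \<in> set_pmf (X q)"
      then have xC: "x \<in> C" "u + x \<in> C" using sXq uC Cadd by auto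
      have "?M * \<bar>?E (csum X Q) (\<lambda>y. G (u + x + y)) - ?E (csum Y Q) (\<lambda>y. G (u + x + y))\<bar> \<le> ?S * ?R * D (u + x)"
        using insert.prems xC by (intro insert.IH) auto
      then show "\<bar>?M * (?E (csum X Q) (\<lambda>y. G (u + x + y)) - ?E (csum Y Q) (\<lambda>y. G (u + x + y)))\<bar> \<le> ?S * ?R * D u * D x"
        using M0 Dadd[OF uC xC(1)] by (simp add: abs_mult mult_ac)
    next
      show "integrable (measure_pmf (X q)) (\<lambda>x. \<bar>?M * (?E (csum X Q) (\<lambda>y. G (u + x + y)) - ?E (csum Y Q) (\<lambda>y. G (u + x + y)))\<bar>)"
        using sXQ sYQ sXq sYq uC by (intro integrable_abs integrable_mult_right Bochner_Integration.integrable_diff intB)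
      show "integrable (measure_pmf (X q)) (\<lambda>x. ?S * ?R * D u * D x)" by (rule Dx[OF sXq])
    qed
    also have "\<dots> = ?S * ?R * D u * ?E (X q) D" by simp
    finally show ?thesis .
  qed
  then have "m q * (?M * \<bar>E1\<bar>) \<le> m q * (?S * ?R * D u * ?E (X q) D)" using mq by (intro mult_left_mono)
  also have "\<dots> = (?S * ?R * D u) * (m q * ?E (X q) D)" by (simp add: mult_ac)
  also have "\<dots> \<le> (?S * ?R * D u) * R q"
    using insert.prems(4)[of q] S0 R1 D[OF uC] by (intro mult_left_mono mult_nonneg_nonneg) auto
  finally have b1: "m q * ?M * \<bar>E1\<bar> \<le> ?S * (R q * ?R) * D u" by (simp add: mult_ac)
  have EY: "0 \<le> ?E (csum Y Q) D" "?M * ?E (csum Y Q) D \<le> ?R"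
    using expectation_csum_D[of Q Y] insert by auto
  have "\<bar>E2\<bar> \<le> \<epsilon> q * D u * ?E (csum Y Q) D"
  proof -
    have "\<bar>E2\<bar> \<le> ?E (csum Y Q) (\<lambda>y. \<bar>?E (X q) (\<lambda>x. G (u + y + x)) - ?E (Y q) (\<lambda>x. G (u + y + x))\<bar>)"
      unfolding E2_def by (rule integral_abs_bound)
    also have "\<dots> \<le> ?E (csum Y Q) (\<lambda>y. \<epsilon> q * D u * D y)"
    proof (rule pmf_expectation_mono)
      fix y assume y: "y \<in> set_pmf (csum Y Q)"
      then have yC: "y \<in> C" "u + y \<in> C" using sYQ uC Cadd by auto
      show "\<bar>?E (X q) (\<lambda>x. G (u + y + x)) - ?E (Y q) (\<lambda>x. G (u + y + x))\<bar> \<le> \<epsilon> q * D u * D y"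
        using insert.prems(7)[OF _ yC(2), of q] Dadd[OF uC yC(1)] by (simp add: mult_ac)
    next
      show "integrable (measure_pmf (csum Y Q)) (\<lambda>y. \<bar>?E (X q) (\<lambda>x. G (u + y + x)) - ?E (Y q) (\<lambda>x. G (u + y + x))\<bar>)"
        using sXQ sYQ sXq sYq uC by (intro integrable_abs Bochner_Integration.integrable_diff intB)
      show "integrable (measure_pmf (csum Y Q)) (\<lambda>y. \<epsilon> q * D u * D y)" by (rule Dx[OF sYQ])
    qed
    also have "\<dots> = \<epsilon> q * D u * ?E (csum Y Q) D" by simp
    finally show ?thesis .
  qed
  then have "m q * ?M * \<bar>E2\<bar> \<le> m q * ?M * (\<epsilon> q * D u * ?E (csum Y Q) D)" using mq M0 by (intro mult_left_mono) auto
  also have "\<dots> = m q * \<epsilon> q * D u * (?M * ?E (csum Y Q) D)" by (simp add: mult_ac)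
  also have "\<dots> \<le> m q * \<epsilon> q * D u * ?R"
    using EY mq insert.prems(6)[of q] D[OF uC] by (intro mult_left_mono mult_nonneg_nonneg) auto
  \<comment> \<open>Here the factor of q is absent; 1 <= \<open>R q\<close> restores it, so that
    both errors carry the full product.\<close>
  also have "\<dots> \<le> m q * \<epsilon> q * D u * (R q * ?R)"
    using EY mq R1 insert.prems(6)[of q] D[OF uC] by (intro mult_left_mono mult_nonneg_nonneg) auto
  finally have b2: "m q * ?M * \<bar>E2\<bar> \<le> m q * \<epsilon> q * (R q * ?R) * D u" by (simp add: mult_ac)
  have "m q * ?M * \<bar>E1 + E2\<bar> \<le> m q * ?M * (\<bar>E1\<bar> + \<bar>E2\<bar>)" using mq M0 by (intro mult_left_mono) auto
  also have "\<dots> \<le> (m q * \<epsilon> q + ?S) * (R q * ?R) * D u" using b1 b2 by (simp add: algebra_simps)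
  finally show ?case using insert(1,2) by (simp add: tot mult.assoc)
qed

end

section \<open>Poisson and compound Poisson laws\<close>

lemma nn_integral_poisson:
  assumes "0 < r" 
  shows "(\<integral>\<^sup>+n. f n \<partial>measure_pmf (poisson_pmf r)) = (\<Sum>n. ennreal (r ^ n / fact n * exp (-r)) * f n)"
  by (simp add: nn_integral_measure_pmf nn_integral_count_space_nat pmf_poisson[OF assms])

text \<open>The Stein-Chen identity, a shift of index: (n+1) r^(n+1)/(n+1)! = r * r^n/n!.
  Nonnegative integrals make it valid for every f without a check of integrability.\<close>

lemma poisson_stein:
  assumes r: "0 < r"
  shows "(\<integral>\<^sup>+n. ennreal (real n) * f n \<partial>measure_pmf (poisson_pmf r)) = ennreal r * (\<integral>\<^sup>+n. f (Suc n) \<partial>measure_pmf (poisson_pmf r))"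
proof -
  let ?g = "\<lambda>n. ennreal (r ^ n / fact n * exp (-r)) * (ennreal (real n) * f n)"
  have "(\<Sum>n. ?g n) = (\<Sum>n. ?g (Suc n))"
    using suminf_offset[of ?g 1] by simp
  also have "\<dots> = (\<Sum>n. ennreal r * (ennreal (r ^ n / fact n * exp (-r)) * f (Suc n)))"
  proof (rule suminf_cong)
    fix n
    have e: "r ^ Suc n / fact (Suc n) * exp (-r) * real (Suc n) = r * (r ^ n / fact n * exp (-r))"
    proof -
      have "fact (Suc n) = real (Suc n) * fact n" by simp
      then show ?thesis by (simp del: of_nat_Suc fact_Suc)
    qed
    have "?g (Suc n) = ennreal (r ^ Suc n / fact (Suc n) * exp (-r) * real (Suc n)) * f (Suc n)"
      using r by (subst ennreal_mult) (auto simp: mult.assoc simp del: power_Suc fact_Suc of_nat_Suc)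
    also have "\<dots> = ennreal r * (ennreal (r ^ n / fact n * exp (-r)) * f (Suc n))"
      unfolding e using r by (subst ennreal_mult) (auto simp: mult.assoc)
    finally show "?g (Suc n) = ennreal r * (ennreal (r ^ n / fact n * exp (-r)) * f (Suc n))" .
  qed
  finally show ?thesis using r by (simp add: nn_integral_poisson ennreal_suminf_cmult)
qed

lemma poisson_laplace:
  assumes r: "0 < r" and that: "0 \<le> w"
  shows "(\<integral>\<^sup>+n. ennreal (w ^ n) \<partial>measure_pmf (poisson_pmf r)) = ennreal (exp (r * (w - 1)))"
proof -
  have "(\<integral>\<^sup>+n. ennreal (w ^ n) \<partial>measure_pmf (poisson_pmf r)) = (\<Sum>n. ennreal (exp (-r) * ((r * w) ^ n /\<^sub>R fact n)))"
    using r that by (simp add: nn_integral_poisson ennreal_mult[symmetric] power_mult_distrib divide_inverse mult_ac)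
  also have "\<dots> = ennreal (exp (-r) * exp (r * w))"
  proof (rule suminf_ennreal_eq)
    show "(\<lambda>n. exp (-r) * ((r * w) ^ n /\<^sub>R fact n)) sums (exp (-r) * exp (r * w))"
      by (intro sums_mult exp_converges)
  qed (use r that in auto)
  also have "exp (-r) * exp (r * w) = exp (r * (w - 1))" by (simp add: exp_add[symmetric] algebra_simps)
  finally show ?thesis .
qed

lemma poisson_mean:
  assumes r: "0 < r"
  shows "integrable (measure_pmf (poisson_pmf r)) real" "measure_pmf.expectation (poisson_pmf r) real = r"
proof -
  have e: "(\<integral>\<^sup>+n. ennreal (real n) \<partial>measure_pmf (poisson_pmf r)) = ennreal r"
    using poisson_stein[OF r, of "\<lambda>_. 1"] by (simp add: measure_pmf.emeasure_space_1[unfolded space_measure_pmf])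
  show "integrable (measure_pmf (poisson_pmf r)) real"
    by (rule integrableI_nn_integral_finite[of _ _ r]) (use e r in auto)
  show "measure_pmf.expectation (poisson_pmf r) real = r"
    by (rule integral_eq_nn_integral[THEN trans]) (use e r in auto)
qed

definition cpoisson :: "('p \<Rightarrow> real) \<Rightarrow> ('p \<Rightarrow> real) \<Rightarrow> 'p set \<Rightarrow> real pmf" where
  "cpoisson r a A = csum (\<lambda>p. map_pmf (\<lambda>n. real n * a p) (poisson_pmf (r p))) A"

lemma set_cpoisson:
  assumes "finite A" "\<And>p. p \<in> A \<Longrightarrow> 0 \<le> a p"
  shows "set_pmf (cpoisson r a A) \<subseteq> {0..}"
  unfolding cpoisson_def by (rule set_csum_subset) (use assms in auto)

lemma cpoisson_nonneg: "finite A \<Longrightarrow> (\<And>p. p \<in> A \<Longrightarrow> 0 \<le> a p) \<Longrightarrow> t \<in> set_pmf (cpoisson r a A) \<Longrightarrow> 0 \<le> t"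
  using set_cpoisson[of A a r] by auto

lemma nn_integral_cpoisson_insert:
  assumes "finite A" "q \<notin> A"
  shows "(\<integral>\<^sup>+t. f t \<partial>measure_pmf (cpoisson r a (insert q A))) = 
     (\<integral>\<^sup>+n. \<integral>\<^sup>+t. f (real n * a q + t) \<partial>measure_pmf (cpoisson r a A) \<partial>measure_pmf (poisson_pmf (r q)))"
  using assms by (simp add: cpoisson_def csum_insert cpmf_def)

text \<open>The part \<open>real n * a q\<close> is treated by the Poisson identity in n, the rest
  by induction applied to f shifted by that part; hence f is arbitrary in the induction.\<close>

lemma cpoisson_stein:
  assumes "finite A" "\<And>p. p \<in> A \<Longrightarrow> 0 \<le> a p" "\<And>p. p \<in> A \<Longrightarrow> 0 < r p"
  shows "(\<integral>\<^sup>+t. ennreal t * f t \<partial>measure_pmf (cpoisson r a A)) 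
    = (\<Sum>p\<in>A. ennreal (r p * a p) * (\<integral>\<^sup>+t. f (t + a p) \<partial>measure_pmf (cpoisson r a A)))"
  using assms
proof (induction A arbitrary: f)
  case empty
  then show ?case by (simp add: cpoisson_def)
next
  case (insert q A)
  let ?R = "cpoisson r a A" and ?Q = "poisson_pmf (r q)"
  have aq: "0 \<le> a q" "0 < r q" "0 \<le> r q" using insert.prems less_imp_le by auto
  have "(\<integral>\<^sup>+t. ennreal t * f t \<partial>measure_pmf (cpoisson r a (insert q A))) =
     (\<integral>\<^sup>+n. \<integral>\<^sup>+t. ennreal (real n * a q + t) * f (real n * a q + t) \<partial>measure_pmf ?R \<partial>measure_pmf ?Q)"
    using insert by (simp add: nn_integral_cpoisson_insert)
  also have "\<dots> = (\<integral>\<^sup>+n. \<integral>\<^sup>+t. ennreal (real n * a q) * f (real n * a q + t) + ennreal t * f (real n * a q + t) \<partial>measure_pmf ?R \<partial>measure_pmf ?Q)"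
  proof (rule nn_integral_cong, rule nn_integral_cong_AE, rule AE_pmfI)
    fix n t assume "t \<in> set_pmf ?R"
    then have "0 \<le> t" using cpoisson_nonneg insert by (metis insertCI)
    then show "ennreal (real n * a q + t) * f (real n * a q + t) = ennreal (real n * a q) * f (real n * a q + t) + ennreal t * f (real n * a q + t)"
      using aq by (simp add: ennreal_plus distrib_right)
  qed
  also have "\<dots> = (\<integral>\<^sup>+n. ennreal (real n * a q) * (\<integral>\<^sup>+t. f (real n * a q + t) \<partial>measure_pmf ?R) \<partial>measure_pmf ?Q) 
      + (\<integral>\<^sup>+n. \<integral>\<^sup>+t. ennreal t * f (real n * a q + t) \<partial>measure_pmf ?R \<partial>measure_pmf ?Q)"
    by (simp add: nn_integral_add nn_integral_cmult)
  also have "(\<integral>\<^sup>+n. ennreal (real n * a q) * (\<integral>\<^sup>+t. f (real n * a q + t) \<partial>measure_pmf ?R) \<partial>measure_pmf ?Q)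
      = ennreal (a q) * (\<integral>\<^sup>+n. ennreal (real n) * (\<integral>\<^sup>+t. f (real n * a q + t) \<partial>measure_pmf ?R) \<partial>measure_pmf ?Q)"
    using aq by (simp add: ennreal_mult nn_integral_cmult[symmetric] mult_ac)
  also have "\<dots> = ennreal (r q * a q) * (\<integral>\<^sup>+n. (\<integral>\<^sup>+t. f (real (Suc n) * a q + t) \<partial>measure_pmf ?R) \<partial>measure_pmf ?Q)"
    using aq by (simp add: poisson_stein ennreal_mult mult_ac)
  also have "(\<integral>\<^sup>+n. (\<integral>\<^sup>+t. f (real (Suc n) * a q + t) \<partial>measure_pmf ?R) \<partial>measure_pmf ?Q) 
     = (\<integral>\<^sup>+t. f (t + a q) \<partial>measure_pmf (cpoisson r a (insert q A)))"
    using insert(1,2) by (simp add: nn_integral_cpoisson_insert algebra_simps)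
  also have "(\<integral>\<^sup>+n. \<integral>\<^sup>+t. ennreal t * f (real n * a q + t) \<partial>measure_pmf ?R \<partial>measure_pmf ?Q)
     = (\<integral>\<^sup>+n. (\<Sum>p\<in>A. ennreal (r p * a p) * (\<integral>\<^sup>+t. f (real n * a q + (t + a p)) \<partial>measure_pmf ?R)) \<partial>measure_pmf ?Q)"
    using insert by simp
  also have "\<dots> = (\<Sum>p\<in>A. ennreal (r p * a p) * (\<integral>\<^sup>+t. f (t + a p) \<partial>measure_pmf (cpoisson r a (insert q A))))"
    using insert(1,2) by (simp add: nn_integral_sum nn_integral_cmult nn_integral_cpoisson_insert add.assoc)
  finally show ?case using insert(1,2) by simp
qed

lemma cpoisson_laplace_nn:
  assumes "finite A" "\<And>p. p \<in> A \<Longrightarrow> 0 < r p"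
  shows "(\<integral>\<^sup>+t. ennreal (exp (-(s * t))) \<partial>measure_pmf (cpoisson r a A)) = ennreal (exp (\<Sum>p\<in>A. r p * (exp (-(s * a p)) - 1)))"
  using assms
proof (induction A)
  case empty
  then show ?case by (simp add: cpoisson_def)
next
  case (insert q A)
  have "(\<integral>\<^sup>+t. ennreal (exp (-(s * t))) \<partial>measure_pmf (cpoisson r a (insert q A))) = 
    (\<integral>\<^sup>+n. \<integral>\<^sup>+t. ennreal (exp (-(s * a q)) ^ n) * ennreal (exp (-(s * t))) \<partial>measure_pmf (cpoisson r a A) \<partial>measure_pmf (poisson_pmf (r q)))"
    using insert(1,2) by (simp add: nn_integral_cpoisson_insert ennreal_mult[symmetric] exp_of_nat_mult[symmetric] exp_add[symmetric] algebra_simps)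
  also have "\<dots> = ennreal (exp (r q * (exp (-(s * a q)) - 1))) * ennreal (exp (\<Sum>p\<in>A. r p * (exp (-(s * a p)) - 1)))"
    using insert by (simp add: nn_integral_cmult nn_integral_multc poisson_laplace)
  finally show ?case using insert(1,2) by (simp add: ennreal_mult[symmetric] exp_add)
qed

lemma cpoisson_laplace:
  assumes "finite A" "\<And>p. p \<in> A \<Longrightarrow> 0 < r p" "\<And>p. p \<in> A \<Longrightarrow> 0 \<le> a p" "0 \<le> s"
  shows "measure_pmf.expectation (cpoisson r a A) (\<lambda>t. exp (-(s * t))) = exp (\<Sum>p\<in>A. r p * (exp (-(s * a p)) - 1))"
proof -
  have b: "0 \<le> exp (-(s * t)) \<and> exp (-(s * t)) \<le> 1" if "t \<in> set_pmf (cpoisson r a A)" for t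
    using cpoisson_nonneg[OF assms(1,3) that] assms(4) by simp
  have "ennreal (measure_pmf.expectation (cpoisson r a A) (\<lambda>t. exp (-(s * t)))) = ennreal (exp (\<Sum>p\<in>A. r p * (exp (-(s * a p)) - 1)))"
    using nn_integral_pmf_eq_expectation[of "cpoisson r a A" _ 1, OF b] cpoisson_laplace_nn[of A r a s] assms by simp
  then show ?thesis using pmf_expectation_bounds[of "cpoisson r a A" _ 1, OF b] by simp
qed

section \<open>Truncated moments of a Poisson sum over rough primes\<close>

definition PA :: "nat \<Rightarrow> nat \<Rightarrow> nat set" where
  "PA y N = pr N - pr y"

text \<open>Twice the Mertens error, for the cutoffs exp s and y; 1 for rounding exp s down to an
  integer; ln y for the omitted primes up to y.\<close>

definition theta_err :: "nat \<Rightarrow> real" where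
  "theta_err y = 2 * (2 + 4 * sq_sum) + 1 + ln (real y)"

lemma finite_PA [simp]: "finite (PA y N)" by (simp add: PA_def)

lemma PAD: "p \<in> PA y N \<Longrightarrow> 2 \<le> p" "p \<in> PA y N \<Longrightarrow> 0 < lam p" "p \<in> PA y N \<Longrightarrow> 0 \<le> ln (real p)"
  "p \<in> PA y N \<Longrightarrow> 0 < ln (real p)"  "p \<in> PA y N \<Longrightarrow> 0 < p"
  by (auto simp: PA_def dest!: prD(3) intro: lam_pos)

lemma theta_err_ge1: "1 \<le> y \<Longrightarrow> 1 \<le> theta_err y"
  using sq_sum_nonneg by (simp add: theta_err_def)

text \<open>In its use, S is the Mertens sum up to n = floor(exp s), D the part above y, I the
  overlap with the primes up to y (all of S when n <= y), J the full sum up to y, K the Mertens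
  error, w = ln y and l = ln n.\<close>

lemma sandwich_aux:
  "(S::real) = D + I \<Longrightarrow> 0 \<le> I \<Longrightarrow> I \<le> J \<Longrightarrow> J \<le> w + K \<Longrightarrow> \<bar>S - l\<bar> \<le> K \<Longrightarrow> l \<le> s \<Longrightarrow> s \<le> 1 + l \<Longrightarrow> 0 \<le> w 
    \<Longrightarrow> \<bar>D - s\<bar> \<le> 2 * K + 1 + w"
  by linarith

lemma theta_bound:
  assumes s: "0 \<le> s" "s \<le> ln (real N)" and y: "1 \<le> y" and N: "1 \<le> N"
  shows "\<bar>(\<Sum>p\<in>{p\<in>PA y N. ln (real p) \<le> s}. lam p * ln (real p)) - s\<bar> \<le> theta_err y"
proof -
  \<comment> \<open>Primes with log p <= s are the primes up to n. Since exp s < n + 1 <= 2n, the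
    logarithm of n is within 1 of s.\<close>
  define n where "n = nat \<lfloor>exp s\<rfloor>"
  have n1: "1 \<le> n" using s by (simp add: n_def le_nat_floor)
  have nle: "real n \<le> exp s" "exp s < real n + 1" using s by (auto simp: n_def of_nat_nat)
  have "exp s \<le> real N" using s N by (metis exp_le_cancel_iff exp_ln of_nat_0_less_iff less_le_trans zero_less_one)
  then have nN: "n \<le> N" using nle(1) by linarith
  have set: "{p\<in>PA y N. ln (real p) \<le> s} = pr n - pr y"
  proof -
    have "ln (real p) \<le> s \<longleftrightarrow> p \<le> n" if "2 \<le> p" for p
    proof -
      have "ln (real p) \<le> s \<longleftrightarrow> real p \<le> exp s" using that by (metis exp_le_cancel_iff exp_ln of_nat_0_less_iff less_le_trans zero_less_numeral)
      also have "\<dots> \<longleftrightarrow> p \<le> n" using nle by linarith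
      finally show ?thesis .
    qed
    then show ?thesis using nN by (auto simp: PA_def pr_def dest: prime_ge_2_nat)
  qed
  have nn: "0 \<le> lam p * ln (real p)" if "p \<in> pr m" for p m
    using prD(3)[OF that] lam_pos[of p] by simp
  have "(\<Sum>p\<in>pr n. lam p * ln (real p)) = (\<Sum>p\<in>pr n - pr y. lam p * ln (real p)) + (\<Sum>p\<in>pr n \<inter> pr y. lam p * ln (real p))"
    by (subst sum.union_disjoint[symmetric]) (auto intro!: arg_cong[where f="sum _"])
  moreover have "0 \<le> (\<Sum>p\<in>pr n \<inter> pr y. lam p * ln (real p))" by (intro sum_nonneg) (auto intro: nn)
  moreover have "(\<Sum>p\<in>pr n \<inter> pr y. lam p * ln (real p)) \<le> (\<Sum>p\<in>pr y. lam p * ln (real p))" 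
    by (intro sum_mono2) (auto intro: nn)
  moreover have "(\<Sum>p\<in>pr y. lam p * ln (real p)) \<le> ln (real y) + (2 + 4 * sq_sum)"
    using mertens_nat[OF y] by linarith
  moreover note mertens_nat[OF n1]
  moreover have "ln (real n) \<le> s" using n1 nle by (metis ln_exp ln_mono of_nat_0_less_iff less_le_trans zero_less_one)
  moreover have "s \<le> 1 + ln (real n)"
  proof -
    have "exp s \<le> 2 * real n" using nle n1 by linarith
    then have "ln (exp s) \<le> ln (2 * real n)" by (intro ln_mono) auto
    also have "\<dots> = ln 2 + ln (real n)" using n1 by (subst ln_mult) auto
    finally show ?thesis using ln_2_less_1 by simp
  qed
  moreover have "0 \<le> ln (real y)" using y by simp
  ultimately show ?thesis unfolding set theta_err_def by (rule sandwich_aux)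
qed

text \<open>Integration of \<open>theta_bound\<close> over s from 0 to u: the truncation (u - log
  p)_+ is the integral of the indicator of log p <= s, and the main term s integrates to
  u^2/2.\<close>

lemma Theta_bound:
  assumes u: "0 \<le> u" "u \<le> ln (real N)" and y: "1 \<le> y" and N: "1 \<le> N"
  shows "\<bar>(\<Sum>p\<in>PA y N. lam p * ln (real p) * max 0 (u - ln (real p))) - u\<^sup>2 / 2\<bar> \<le> theta_err y * u"
proof -
  let ?c = "\<lambda>p. lam p * ln (real p)"
  have 1: "((\<lambda>s. if ln (real p) \<le> s then 1 else 0) has_integral max 0 (u - ln (real p))) {0..u}" if p: "p \<in> PA y N" for p
  proof (cases "ln (real p) \<le> u")
    case True
    have h: "((\<lambda>s. if s \<in> {ln (real p)..u} then 1 else 0) has_integral (u - ln (real p))) {0..u}"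
      using has_integral_const_real[of "1::real" "ln (real p)" u] True PAD(3)[OF p]
      by (subst has_integral_restrict) auto
    have "((\<lambda>s. if ln (real p) \<le> s then 1 else 0) has_integral (u - ln (real p))) {0..u}"
      by (rule has_integral_eq[OF _ h]) auto
    then show ?thesis using True by simp
  next
    case False
    have "((\<lambda>s. if ln (real p) \<le> s then 1 else (0::real)) has_integral 0) {0..u}"
      by (rule has_integral_eq[OF _ has_integral_0]) (use False in auto)
    then show ?thesis using False by simp
  qed
  have "((\<lambda>s. (\<Sum>p\<in>PA y N. ?c p * (if ln (real p) \<le> s then 1 else 0)) - s) has_integral 
      (\<Sum>p\<in>PA y N. ?c p * max 0 (u - ln (real p))) - (u\<^sup>2 - 0\<^sup>2) / 2) {0..u}"
    by (intro has_integral_diff has_integral_sum has_integral_mult_right 1 ident_has_integral u) auto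
  then have "norm ((\<Sum>p\<in>PA y N. ?c p * max 0 (u - ln (real p))) - (u\<^sup>2 - 0\<^sup>2) / 2) \<le> theta_err y * Henstock_Kurzweil_Integration.content {0..u}"
  proof (rule has_integral_bound_real[rotated 2])
    show "0 \<le> theta_err y" using theta_err_ge1[OF y] by simp
    fix s assume s: "s \<in> {0..u} - {}"
    have "(\<Sum>p\<in>PA y N. ?c p * (if ln (real p) \<le> s then 1 else 0)) = (\<Sum>p\<in>PA y N. if ln (real p) \<le> s then ?c p else 0)"
      by (intro sum.cong) auto
    also have "\<dots> = (\<Sum>p\<in>{p\<in>PA y N. ln (real p) \<le> s}. ?c p)"
      by (rule sum.inter_filter[symmetric]) simp
    finally show "norm ((\<Sum>p\<in>PA y N. ?c p * (if ln (real p) \<le> s then 1 else 0)) - s) \<le> theta_err y"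
      using theta_bound[of s N y] s u y N by simp
  qed simp
  then show ?thesis using u by simp
qed

locale rough =
  fixes z :: real and y :: nat
  assumes z0: "0 < z" and z2: "z \<le> 2" and y1: "1 \<le> y"
begin

definition TT :: "nat \<Rightarrow> real pmf" where
  "TT N = cpoisson (\<lambda>p. z * lam p) (\<lambda>p. ln (real p)) (PA y N)"

text \<open>Cancels the normalising factors exp(-z lambda_p) of the Poisson laws.
  \<open>wt N\<close> times the law of T is the convolution exponential of z times the sum of masses
  lambda_p at log p, and below x it depends on the primes up to exp x only.\<close>

definition wt :: "nat \<Rightarrow> real" where
  "wt N = exp (z * (\<Sum>p\<in>PA y N. lam p))"

text \<open>With the factor 1/m! the moment of order 1 is the derivative in x of the moment of order
  2.\<close>

definition Am :: "nat \<Rightarrow> nat \<Rightarrow> real \<Rightarrow> real" where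
  "Am m N x = wt N * measure_pmf.expectation (TT N) (\<lambda>t. (max 0 (x - t)) ^ m / fact m)"

lemma TT_nonneg: "t \<in> set_pmf (TT N) \<Longrightarrow> 0 \<le> t"
  unfolding TT_def by (rule cpoisson_nonneg[of "PA y N" "\<lambda>p. ln (real p)"]) (auto intro: PAD)

lemma wt_pos: "0 < wt N" by (simp add: wt_def)

lemma max_bounds:
  assumes "t \<in> set_pmf (TT N)" "0 \<le> x"
  shows "0 \<le> (max 0 (x - t)) ^ m" "(max 0 (x - t)) ^ m \<le> x ^ m"
  using TT_nonneg[OF assms(1)] assms(2) by (auto intro!: power_mono)

lemma TT_integrable:
  assumes "\<And>t. 0 \<le> t \<Longrightarrow> \<bar>f t\<bar> \<le> c" shows "integrable (measure_pmf (TT N)) (f :: real \<Rightarrow> real)"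
  by (rule pmf_integrable_bounded[of _ _ c]) (use assms TT_nonneg in auto)

lemma Am2_integrable: "integrable (measure_pmf (TT N)) (\<lambda>t. (max 0 (x - t))\<^sup>2 / 2)"
proof (rule TT_integrable[of _ "x\<^sup>2"])
  fix t :: real assume "0 \<le> t"
  then have "(max 0 (x - t))\<^sup>2 \<le> x\<^sup>2" by (cases "0 \<le> x - t") (auto intro!: power_mono)
  moreover have "0 \<le> (max 0 (x - t))\<^sup>2" by simp
  ultimately show "\<bar>(max 0 (x - t))\<^sup>2 / 2\<bar> \<le> x\<^sup>2" by linarith
qed

lemma Am1_integrable: "integrable (measure_pmf (TT N)) (\<lambda>t. max 0 (x - t))"
  by (rule TT_integrable[of _ "\<bar>x\<bar>"]) auto

lemma stein_identity:
  assumes x: "0 \<le> x"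
  shows "measure_pmf.expectation (TT N) (\<lambda>t. t * max 0 (x - t)) 
    = z * measure_pmf.expectation (TT N) (\<lambda>t. \<Sum>p\<in>PA y N. lam p * ln (real p) * max 0 (x - t - ln (real p)))"
proof -
  let ?E = "measure_pmf.expectation (TT N)"
  have b1: "0 \<le> t * max 0 (x - t) \<and> t * max 0 (x - t) \<le> x * x" if "t \<in> set_pmf (TT N)" for t
  proof (cases "t \<le> x")
    case True
    then show ?thesis using TT_nonneg[OF that] x by (auto intro!: mult_mono)
  qed (use x in \<open>auto simp: max_def\<close>)
  have b2: "0 \<le> max 0 (x - (t + a)) \<and> max 0 (x - (t + a)) \<le> x" if "t \<in> set_pmf (TT N)" "0 \<le> a" for t a
    using TT_nonneg[OF that(1)] that(2) x by auto
  have "ennreal (?E (\<lambda>t. t * max 0 (x - t))) = (\<integral>\<^sup>+t. ennreal (t * max 0 (x - t)) \<partial>measure_pmf (TT N))"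
    by (rule nn_integral_pmf_eq_expectation[OF b1, symmetric])
  also have "\<dots> = (\<integral>\<^sup>+t. ennreal t * ennreal (max 0 (x - t)) \<partial>measure_pmf (TT N))"
    by (rule nn_integral_cong_AE, rule AE_pmfI, rule ennreal_mult) (auto intro: TT_nonneg)
  also have "\<dots> = (\<Sum>p\<in>PA y N. ennreal (z * lam p * ln (real p)) * (\<integral>\<^sup>+t. ennreal (max 0 (x - (t + ln (real p)))) \<partial>measure_pmf (TT N)))"
    unfolding TT_def by (rule cpoisson_stein) (use z0 in \<open>auto dest: PAD\<close>)
  also have "\<dots> = (\<Sum>p\<in>PA y N. ennreal (z * lam p * ln (real p)) * ennreal (?E (\<lambda>t. max 0 (x - (t + ln (real p))))))"
    by (intro sum.cong refl arg_cong2[where f="(*)"] nn_integral_pmf_eq_expectation[of _ _ x] b2) (auto intro: PAD)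
  also have "\<dots> = (\<Sum>p\<in>PA y N. ennreal (z * lam p * ln (real p) * ?E (\<lambda>t. max 0 (x - (t + ln (real p))))))"
    by (intro sum.cong refl ennreal_mult[symmetric]) 
       (use z0 in \<open>auto intro!: mult_nonneg_nonneg integral_nonneg dest: PAD intro: less_imp_le\<close>)
  also have "\<dots> = ennreal (\<Sum>p\<in>PA y N. z * lam p * ln (real p) * ?E (\<lambda>t. max 0 (x - (t + ln (real p)))))"
    by (rule sum_ennreal)
       (use z0 in \<open>auto intro!: mult_nonneg_nonneg integral_nonneg dest: PAD intro: less_imp_le\<close>)
  finally have "?E (\<lambda>t. t * max 0 (x - t)) = (\<Sum>p\<in>PA y N. z * lam p * ln (real p) * ?E (\<lambda>t. max 0 (x - (t + ln (real p)))))"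
  proof (rule ennreal_inj[THEN iffD1, rotated 2])
    show "0 \<le> ?E (\<lambda>t. t * max 0 (x - t))" using pmf_expectation_bounds[of "TT N" _ "x*x", OF b1] by simp
    show "0 \<le> (\<Sum>p\<in>PA y N. z * lam p * ln (real p) * ?E (\<lambda>t. max 0 (x - (t + ln (real p)))))"
      by (rule sum_nonneg)
       (use z0 in \<open>auto intro!: mult_nonneg_nonneg integral_nonneg dest: PAD intro: less_imp_le\<close>)
  qed
  also have "\<dots> = z * (\<Sum>p\<in>PA y N. ?E (\<lambda>t. lam p * ln (real p) * max 0 (x - t - ln (real p))))"
    by (simp add: sum_distrib_left mult.assoc diff_diff_eq)
  also have "(\<Sum>p\<in>PA y N. ?E (\<lambda>t. lam p * ln (real p) * max 0 (x - t - ln (real p))))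
     = ?E (\<lambda>t. \<Sum>p\<in>PA y N. lam p * ln (real p) * max 0 (x - t - ln (real p)))"
    by (rule Bochner_Integration.integral_sum[symmetric], rule integrable_mult_right, rule TT_integrable[of _ x])
       (use x in \<open>auto dest: PAD(3)\<close>)
  finally show ?thesis .
qed

text \<open>Pointwise x(x - t)_+ - t(x - t)_+ = (x - t)_+^2, so the left side of the Stein identity
  is x A_1 - 2 A_2 before weighting. By \<open>Theta_bound\<close> the prime sum on its right side
  is A_2 up to O(A_1). What remains is Euler's homogeneity equation x A_1 = (2 + z) A_2 with an
  error of lower order.\<close>

lemma Am_recursion:
  assumes x: "0 \<le> x" "x \<le> ln (real N)" and N: "1 \<le> N"
  shows "\<bar>x * Am 1 N x - (2 + z) * Am 2 N x\<bar> \<le> z * theta_err y * Am 1 N x"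
proof -
  let ?E = "measure_pmf.expectation (TT N)"
  let ?\<Theta> = "\<lambda>u. \<Sum>p\<in>PA y N. lam p * ln (real p) * max 0 (u - ln (real p))"
  let ?E1 = "?E (\<lambda>t. max 0 (x - t))" and ?E2 = "?E (\<lambda>t. (max 0 (x - t))\<^sup>2 / 2)"
  have i1: "integrable (measure_pmf (TT N)) (\<lambda>t. max 0 (x - t))" by (rule TT_integrable[of _ x]) (use x in auto)
  have i2: "integrable (measure_pmf (TT N)) (\<lambda>t. (max 0 (x - t))\<^sup>2 / 2)"
    by (rule Am2_integrable)
  have i2': "integrable (measure_pmf (TT N)) (\<lambda>t. (max 0 (x - t))\<^sup>2)"
    using integrable_mult_right[OF i2, of 2] by simp
  have i3: "integrable (measure_pmf (TT N)) (\<lambda>t. ?\<Theta> (x - t))"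
    by (intro Bochner_Integration.integrable_sum integrable_mult_right TT_integrable[of _ x]) (use x in \<open>auto dest: PAD(3)\<close>)
  have "x * ?E1 - 2 * ?E2 = ?E (\<lambda>t. x * max 0 (x - t) - 2 * ((max 0 (x - t))\<^sup>2 / 2))"
    using i1 i2 i2' by (subst Bochner_Integration.integral_diff) auto
  also have "\<dots> = ?E (\<lambda>t. t * max 0 (x - t))"
    by (intro Bochner_Integration.integral_cong refl) (auto simp: max_def power2_eq_square algebra_simps)
  also have "\<dots> = z * ?E (\<lambda>t. ?\<Theta> (x - t))" by (rule stein_identity[OF x(1)])
  finally have e: "x * ?E1 - 2 * ?E2 = z * ?E (\<lambda>t. ?\<Theta> (x - t))" .
  have "\<bar>?E (\<lambda>t. ?\<Theta> (x - t)) - ?E2\<bar> = \<bar>?E (\<lambda>t. ?\<Theta> (x - t) - (max 0 (x - t))\<^sup>2 / 2)\<bar>"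
    using i2 i2' i3 by (subst Bochner_Integration.integral_diff) auto
  also have "\<dots> \<le> ?E (\<lambda>t. \<bar>?\<Theta> (x - t) - (max 0 (x - t))\<^sup>2 / 2\<bar>)" by (rule integral_abs_bound)
  also have "\<dots> \<le> ?E (\<lambda>t. theta_err y * max 0 (x - t))"
  proof (rule pmf_expectation_mono)
    fix t assume "t \<in> set_pmf (TT N)"
    then have t: "0 \<le> t" by (rule TT_nonneg)
    show "\<bar>?\<Theta> (x - t) - (max 0 (x - t))\<^sup>2 / 2\<bar> \<le> theta_err y * max 0 (x - t)"
    proof (cases "t \<le> x")
      case True
      then show ?thesis using Theta_bound[of "x - t" N y] t x y1 N by simp
    next
      case False
      then have "?\<Theta> (x - t) = 0" by (intro sum.neutral) (auto simp: max_def dest: PAD(3))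
      then show ?thesis using False by (simp add: max_def)
    qed
  qed (use i1 i2 i2' i3 in auto)
  also have "\<dots> = theta_err y * ?E1" by simp
  finally have "z * \<bar>?E (\<lambda>t. ?\<Theta> (x - t)) - ?E2\<bar> \<le> z * (theta_err y * ?E1)" using z0 by simp
  moreover have "\<bar>z * a - z * b\<bar> = z * \<bar>a - b\<bar>" for a b :: real
    using z0 by (simp add: abs_mult flip: right_diff_distrib)
  ultimately have "\<bar>z * ?E (\<lambda>t. ?\<Theta> (x - t)) - z * ?E2\<bar> \<le> z * theta_err y * ?E1"
    by (simp only: mult.assoc)
  moreover have "x * ?E1 - (2 + z) * ?E2 = z * ?E (\<lambda>t. ?\<Theta> (x - t)) - z * ?E2"
    unfolding distrib_right using e by linarith
  ultimately have "\<bar>x * ?E1 - (2 + z) * ?E2\<bar> \<le> z * theta_err y * ?E1" by (simp only:)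
  then have "wt N * \<bar>x * ?E1 - (2 + z) * ?E2\<bar> \<le> wt N * (z * theta_err y * ?E1)"
    using wt_pos[of N] by (intro mult_left_mono) auto
  moreover have "wt N * \<bar>x * ?E1 - (2 + z) * ?E2\<bar> = \<bar>wt N * (x * ?E1 - (2 + z) * ?E2)\<bar>"
    using wt_pos[of N] by (simp add: abs_mult)
  ultimately show ?thesis by (simp add: Am_def algebra_simps fact_2)
qed

lemma wt_laplace:
  assumes s: "0 \<le> \<sigma>"
  shows "wt N * measure_pmf.expectation (TT N) (\<lambda>t. exp (-(\<sigma> * t))) = exp (z * (\<Sum>p\<in>PA y N. lam p * real p powr (-\<sigma>)))"
proof -
  have "measure_pmf.expectation (TT N) (\<lambda>t. exp (-(\<sigma> * t))) = exp (\<Sum>p\<in>PA y N. z * lam p * (exp (-(\<sigma> * ln (real p))) - 1))"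
    unfolding TT_def by (rule cpoisson_laplace) (use z0 s in \<open>auto dest: PAD\<close>)
  also have "(\<Sum>p\<in>PA y N. z * lam p * (exp (-(\<sigma> * ln (real p))) - 1)) = (\<Sum>p\<in>PA y N. z * lam p * (real p powr (-\<sigma>) - 1))"
    by (intro sum.cong refl) (auto simp: powr_def dest: PAD(5))
  finally show ?thesis
    by (simp add: wt_def exp_add[symmetric] sum_distrib_left sum.distrib[symmetric] sum_subtractf algebra_simps)
qed

definition Bc :: real where "Bc = exp (1 + 2 * (1 + inv_sq_sum))"

lemma Bc_ge1: "1 \<le> Bc" using inv_sq_sum_nonneg by (simp add: Bc_def)

lemma Am_nonneg: "0 \<le> x \<Longrightarrow> 0 \<le> Am m N x"
  unfolding Am_def using wt_pos[of N] by (auto intro!: mult_nonneg_nonneg integral_nonneg)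

text \<open>Rankin's method with sigma = 1/max(1, x): e exp(-sigma t) is at least 1 for t <= x. The
  factor e and the constant of \<open>sum_lam_powr_le\<close>, taken twice since z <= 2, make up
  \<open>Bc\<close>.\<close>

lemma Am_le:
  assumes x: "0 \<le> x" and m: "0 < m"
  shows "Am m N x \<le> Bc * x ^ m * (max 1 x) powr z"
proof -
  let ?E = "measure_pmf.expectation (TT N)"
  define \<sigma> where "\<sigma> = 1 / max 1 x"
  have s: "0 < \<sigma>" "\<sigma> \<le> 1" "\<sigma> * x \<le> 1" using x by (auto simp: \<sigma>_def max_def field_simps)
  have "?E (\<lambda>t. (max 0 (x - t)) ^ m / fact m) \<le> ?E (\<lambda>t. x ^ m * exp 1 * exp (-(\<sigma> * t)))"
  proof (rule pmf_expectation_mono)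
    fix t assume t': "t \<in> set_pmf (TT N)"
    then have t: "0 \<le> t" by (rule TT_nonneg)
    show "(max 0 (x - t)) ^ m / fact m \<le> x ^ m * exp 1 * exp (-(\<sigma> * t))"
    proof (cases "t \<le> x")
      case True
      have "(max 0 (x - t)) ^ m / fact m \<le> (max 0 (x - t)) ^ m / 1"
        by (intro divide_left_mono) (auto simp: fact_ge_1)
      also have "\<dots> \<le> x ^ m * 1" using max_bounds[OF t' x, of m] by simp
      also have "x ^ m * 1 \<le> x ^ m * (exp 1 * exp (-(\<sigma> * t)))"
      proof (intro mult_left_mono)
      have "\<sigma> * t \<le> \<sigma> * x" using s True by (intro mult_left_mono) auto
      then have "\<sigma> * t \<le> 1" using s by linarith
      then show "1 \<le> exp 1 * exp (-(\<sigma> * t))" by (simp add: exp_add[symmetric])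
      qed (use x in auto)
      finally show ?thesis by (simp add: mult.assoc)
    next
      case False
      then show ?thesis using m x by (simp add: max_def zero_power)
    qed
  next
    show "integrable (measure_pmf (TT N)) (\<lambda>t. (max 0 (x - t)) ^ m / fact m)"
    proof (intro integrable_divide pmf_integrable_bounded[of _ _ "x ^ m"])
      fix t assume "t \<in> set_pmf (TT N)"
      then show "\<bar>max 0 (x - t) ^ m\<bar> \<le> x ^ m" using max_bounds[of t N x m] x by simp
    qed
    show "integrable (measure_pmf (TT N)) (\<lambda>t. x ^ m * exp 1 * exp (-(\<sigma> * t)))"
      by (intro integrable_mult_right TT_integrable[of _ 1]) (use s in auto)
  qed
  also have "\<dots> = x ^ m * exp 1 * ?E (\<lambda>t. exp (-(\<sigma> * t)))" by simp
  finally have "Am m N x \<le> wt N * (x ^ m * exp 1 * ?E (\<lambda>t. exp (-(\<sigma> * t))))"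
    unfolding Am_def using wt_pos[of N] by (intro mult_left_mono) auto
  also have "\<dots> = x ^ m * exp 1 * exp (z * (\<Sum>p\<in>PA y N. lam p * real p powr (-\<sigma>)))"
    using wt_laplace[of \<sigma> N] s by (simp add: mult_ac)
  also have "\<dots> \<le> x ^ m * exp 1 * exp (2 * (1 + inv_sq_sum) + z * ln (max 1 x))"
  proof (intro mult_left_mono)
    have "(\<Sum>p\<in>PA y N. lam p * real p powr (-\<sigma>)) \<le> (\<Sum>p\<in>pr N. lam p * real p powr (-\<sigma>))"
      unfolding PA_def by (rule sum_mono2) (auto dest!: prD(3) intro!: mult_nonneg_nonneg lam_pos[THEN less_imp_le])
    also have "\<dots> \<le> ln (1 / \<sigma>) + (1 + inv_sq_sum)" by (rule sum_lam_powr_le[OF s(1,2)])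
    finally have "z * (\<Sum>p\<in>PA y N. lam p * real p powr (-\<sigma>)) \<le> z * (ln (1 / \<sigma>) + (1 + inv_sq_sum))" using z0 by simp
    also have "\<dots> = z * ln (max 1 x) + z * (1 + inv_sq_sum)" by (simp add: \<sigma>_def distrib_left)
    also have "\<dots> \<le> z * ln (max 1 x) + 2 * (1 + inv_sq_sum)"
      using z2 inv_sq_sum_nonneg by (intro add_left_mono mult_right_mono) auto
    finally show "exp (z * (\<Sum>p\<in>PA y N. lam p * real p powr (-\<sigma>))) \<le> exp (2 * (1 + inv_sq_sum) + z * ln (max 1 x))" by simp
  qed (use x in auto)
  also have "\<dots> = Bc * x ^ m * (max 1 x) powr z"
  proof -
    have b: "Bc = exp 1 * exp (2 * (1 + inv_sq_sum))" by (simp only: Bc_def exp_add)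
    have p: "(max 1 x) powr z = exp (z * ln (max 1 x))" by (simp add: powr_def max_def)
    show ?thesis unfolding b p exp_add by (simp only: mult_ac)
  qed
  finally show ?thesis .
qed

lemma quadratic_taylor: "\<bar>(max 0 (x + h - t))\<^sup>2 / 2 - (max 0 (x - t))\<^sup>2 / 2 - h * max 0 (x - t)\<bar> \<le> h\<^sup>2 / (2::real)"
proof -
  define a where "a = x - t"
  have "\<bar>(max 0 (a + h))\<^sup>2 / 2 - (max 0 a)\<^sup>2 / 2 - h * max 0 a\<bar> \<le> h\<^sup>2 / 2"
  proof (cases "0 \<le> a"; cases "0 \<le> a + h")
    assume *: "0 \<le> a" "\<not> 0 \<le> a + h"
    then have "(- a\<^sup>2 / 2 - h * a) \<ge> 0" "(- a\<^sup>2 / 2 - h * a) \<le> h\<^sup>2/2"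
      using mult_nonneg_nonneg[of a "-(a + h) - h"] zero_le_power2[of "a + h"] by (auto simp: power2_eq_square algebra_simps)
    then show ?thesis using * by (simp add: max_def)
  next
    assume *: "\<not> 0 \<le> a" "0 \<le> a + h"
    then have "(a + h)\<^sup>2 \<le> h\<^sup>2" by (intro power_mono) auto
    then show ?thesis using * by (simp add: max_def)
  qed (auto simp: max_def power2_eq_square algebra_simps)
  then show ?thesis by (simp add: a_def algebra_simps)
qed

text \<open>The first-order Taylor expansion of the truncated square has an error of at most h^2/2
  uniformly in t, so it survives the expectation.\<close>

lemma Am2_deriv: "(Am 2 N has_real_derivative Am 1 N x) (at x)"
proof -
  let ?E = "measure_pmf.expectation (TT N)"
  let ?d = "\<lambda>h. Am 2 N (x + h) - Am 2 N x - h * Am 1 N x"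
  have d: "\<bar>?d h\<bar> \<le> wt N * h\<^sup>2" for h
  proof -
    have "?d h = wt N * ?E (\<lambda>t. (max 0 (x + h - t))\<^sup>2 / 2 - (max 0 (x - t))\<^sup>2 / 2 - h * max 0 (x - t))"
      unfolding Am_def by (simp add: Am1_integrable Am2_integrable fact_2 algebra_simps del: max_less_iff_conj)
    then have "\<bar>?d h\<bar> = wt N * \<bar>?E (\<lambda>t. (max 0 (x + h - t))\<^sup>2 / 2 - (max 0 (x - t))\<^sup>2 / 2 - h * max 0 (x - t))\<bar>"
      using wt_pos[of N] by (simp add: abs_mult)
    also have "\<dots> \<le> wt N * ?E (\<lambda>t. \<bar>(max 0 (x + h - t))\<^sup>2 / 2 - (max 0 (x - t))\<^sup>2 / 2 - h * max 0 (x - t)\<bar>)"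
      using wt_pos[of N] by (intro mult_left_mono integral_abs_bound) auto
    also have "\<dots> \<le> wt N * ?E (\<lambda>t. h\<^sup>2 / 2)"
      using wt_pos[of N] quadratic_taylor[of x h]
      by (intro mult_left_mono pmf_expectation_mono integrable_abs Bochner_Integration.integrable_diff Am2_integrable integrable_mult_right Am1_integrable) auto
    also have "\<dots> \<le> wt N * h\<^sup>2" using wt_pos[of N] by simp
    finally show ?thesis .
  qed
  have "((\<lambda>h. (Am 2 N (x + h) - Am 2 N x) / h - Am 1 N x) \<longlongrightarrow> 0) (at 0)"
  proof (rule Lim_null_comparison)
    show "\<forall>\<^sub>F h in at 0. norm ((Am 2 N (x + h) - Am 2 N x) / h - Am 1 N x) \<le> wt N * \<bar>h\<bar>"
      unfolding eventually_at_filter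
    proof (intro always_eventually allI impI)
      fix h :: real assume h: "h \<noteq> 0"
      have "(Am 2 N (x + h) - Am 2 N x) / h - Am 1 N x = ?d h / h" using h by (simp add: field_simps)
      then have "norm ((Am 2 N (x + h) - Am 2 N x) / h - Am 1 N x) = \<bar>?d h\<bar> / \<bar>h\<bar>" by simp
      also have "\<dots> \<le> wt N * h\<^sup>2 / \<bar>h\<bar>" by (intro divide_right_mono d) auto
      also have "\<dots> = wt N * \<bar>h\<bar>" using h by (simp add: power2_eq_square abs_if)
      finally show "norm ((Am 2 N (x + h) - Am 2 N x) / h - Am 1 N x) \<le> wt N * \<bar>h\<bar>" .
    qed
    show "((\<lambda>h. wt N * \<bar>h\<bar>) \<longlongrightarrow> 0) (at 0)" by (rule tendsto_eq_intros refl | simp)+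
  qed
  then show ?thesis by (simp add: DERIV_def LIM_zero_iff)
qed

text \<open>The homogeneity equation has the solutions x^(2+z); dividing by this power leaves a
  function whose derivative is O(1/x^2), hence one with a limit.\<close>

definition HH :: "nat \<Rightarrow> real \<Rightarrow> real" where "HH N x = Am 2 N x * x powr (-(2+z))"

lemma HH_deriv_bound:
  assumes x: "1 \<le> x" "x \<le> ln (real N)" and N: "1 \<le> N"
  shows "\<exists>d. (HH N has_real_derivative d) (at x) \<and> \<bar>d\<bar> \<le> (z * theta_err y * Bc) / x\<^sup>2"
proof (intro exI conjI)
  let ?d = "Am 1 N x * x powr (-(2+z)) + (-(2+z)) * x powr (-(2+z)-1) * Am 2 N x"
  show "(HH N has_real_derivative ?d) (at x)"
    unfolding HH_def using x by (auto intro!: derivative_eq_intros Am2_deriv)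
  have x1: "x powr (-(2+z)) = x * x powr (-(2+z)-1)" using x by (subst powr_mult_base) auto
  have "?d = (x * Am 1 N x - (2 + z) * Am 2 N x) * x powr (-(2+z)-1)"
    unfolding x1 by (simp add: algebra_simps)
  then have "\<bar>?d\<bar> = \<bar>x * Am 1 N x - (2 + z) * Am 2 N x\<bar> * x powr (-(2+z)-1)" by (simp add: abs_mult)
  also have "\<dots> \<le> z * theta_err y * Am 1 N x * x powr (-(2+z)-1)"
    using x N by (intro mult_right_mono Am_recursion) auto
  also have "\<dots> \<le> z * theta_err y * (Bc * x ^ 1 * (max 1 x) powr z) * x powr (-(2+z)-1)"
    using x z0 theta_err_ge1[OF y1] by (intro mult_right_mono mult_left_mono Am_le) auto
  also have "\<dots> = z * theta_err y * Bc * (x powr 1 * x powr z * x powr (-(2+z)-1))" using x by (simp add: mult_ac max_def)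
  also have "x powr 1 * x powr z * x powr (-(2+z)-1) = 1 / x\<^sup>2"
  proof -
    have "x powr 1 * x powr z * x powr (-(2+z)-1) = x powr (1 + z + (-(2+z)-1))" by (simp only: powr_add)
    also have "1 + z + (-(2+z)-1) = -2" by simp
    also have "x powr (-2) = 1 / x\<^sup>2" using x by (simp add: powr_minus_divide)
    finally show ?thesis .
  qed
  finally show "\<bar>?d\<bar> \<le> (z * theta_err y * Bc) / x\<^sup>2" by simp
qed

lemma HH_diff:
  assumes "1 \<le> a" "a \<le> b" "b \<le> ln (real N)" and N: "1 \<le> N"
  shows "\<bar>HH N b - HH N a\<bar> \<le> (z * theta_err y * Bc) * (1 / a - 1 / b)"
proof -
  let ?C = "z * theta_err y * Bc"
  \<comment> \<open>The derivative C/x^2 of -C/x dominates that of both signs of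
    \<open>HH N\<close>, so both sums are nondecreasing; the two signs together bound the absolute
    value.\<close>
  have gen: "- ?C / a + c * HH N a \<le> - ?C / b + c * HH N b" if c: "\<bar>c\<bar> = 1" for c
  proof (rule DERIV_nonneg_imp_nondecreasing[OF assms(2)])
    fix x assume x: "a \<le> x" "x \<le> b"
    with HH_deriv_bound[of x N] assms obtain d where d: "(HH N has_real_derivative d) (at x)" "\<bar>d\<bar> \<le> ?C / x\<^sup>2" by auto
    have "((\<lambda>x. - ?C / x + c * HH N x) has_real_derivative (?C / x\<^sup>2 + c * d)) (at x)"
      using x assms by (auto intro!: derivative_eq_intros d(1) simp: power2_eq_square)
    moreover have "\<bar>c * d\<bar> \<le> ?C / x\<^sup>2" using d(2) c by (simp add: abs_mult)
    then have "0 \<le> ?C / x\<^sup>2 + c * d" by linarith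
    ultimately show "\<exists>y. ((\<lambda>x. - ?C / x + c * HH N x) has_real_derivative y) (at x) \<and> 0 \<le> y" by blast
  qed
  from gen[of 1] gen[of "-1"] show ?thesis by (simp add: abs_le_iff algebra_simps)
qed

text \<open>One jump of size \<open>a q\<close> >= x already empties the truncated moment, so just
  the event that the Poisson variable at q is 0 contributes, with probability exp(-r q).\<close>

lemma expectation_cpoisson_insert_large:
  assumes "finite A" "q \<notin> A" "\<And>p. p \<in> insert q A \<Longrightarrow> 0 \<le> a p" "0 < r q" "x \<le> a q" "0 \<le> x" "0 < m"
  shows "measure_pmf.expectation (cpoisson r a (insert q A)) (\<lambda>t. (max 0 (x - t)) ^ m)
     = exp (- r q) * measure_pmf.expectation (cpoisson r a A) (\<lambda>t. (max 0 (x - t)) ^ m)"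
proof -
  have b: "0 \<le> (max 0 (x - t)) ^ m \<and> (max 0 (x - t)) ^ m \<le> x ^ m" if "0 \<le> t" for t
    using that assms by (auto intro!: power_mono)
  have b1: "0 \<le> (max 0 (x - t)) ^ m \<and> (max 0 (x - t)) ^ m \<le> x ^ m" if "t \<in> set_pmf (cpoisson r a (insert q A))" for t
    by (rule b, rule cpoisson_nonneg[OF _ _ that]) (use assms in auto)
  have b2: "0 \<le> (max 0 (x - t)) ^ m \<and> (max 0 (x - t)) ^ m \<le> x ^ m" if "t \<in> set_pmf (cpoisson r a A)" for t
    by (rule b, rule cpoisson_nonneg[OF _ _ that]) (use assms in auto)
  let ?e = "measure_pmf.expectation (cpoisson r a A) (\<lambda>t. (max 0 (x - t)) ^ m)"
  have e0: "0 \<le> ?e" using pmf_expectation_bounds[of "cpoisson r a A" _ "x ^ m", OF b2] by simp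
  have "ennreal (measure_pmf.expectation (cpoisson r a (insert q A)) (\<lambda>t. (max 0 (x - t)) ^ m))
      = (\<integral>\<^sup>+t. ennreal ((max 0 (x - t)) ^ m) \<partial>measure_pmf (cpoisson r a (insert q A)))"
    by (rule nn_integral_pmf_eq_expectation[OF b1, symmetric])
  also have "\<dots> = (\<integral>\<^sup>+n. \<integral>\<^sup>+t. ennreal ((max 0 (x - (real n * a q + t))) ^ m) \<partial>measure_pmf (cpoisson r a A) \<partial>measure_pmf (poisson_pmf (r q)))"
    by (rule nn_integral_cpoisson_insert[OF assms(1,2)])
  also have "\<dots> = (\<integral>\<^sup>+n. ennreal ?e * indicator {0} n \<partial>measure_pmf (poisson_pmf (r q)))"
  proof (rule nn_integral_cong)
    fix n :: nat
    show "(\<integral>\<^sup>+t. ennreal ((max 0 (x - (real n * a q + t))) ^ m) \<partial>measure_pmf (cpoisson r a A)) = ennreal ?e * indicator {0} n"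
    proof (cases "n = 0")
      case True
      then show ?thesis using nn_integral_pmf_eq_expectation[of "cpoisson r a A" _ "x ^ m", OF b2] by simp
    next
      case False
      have "(\<integral>\<^sup>+t. ennreal ((max 0 (x - (real n * a q + t))) ^ m) \<partial>measure_pmf (cpoisson r a A)) = (\<integral>\<^sup>+t. 0 \<partial>measure_pmf (cpoisson r a A))"
      proof (intro nn_integral_cong_AE AE_pmfI)
        fix t assume t: "t \<in> set_pmf (cpoisson r a A)"
        have "0 \<le> t" by (rule cpoisson_nonneg[OF _ _ t]) (use assms in auto)
        moreover have "1 * a q \<le> real n * a q" using False assms by (intro mult_right_mono) auto
        ultimately have "x - (real n * a q + t) \<le> 0" using assms by linarith
        then have "max 0 (x - (real n * a q + t)) = 0" by simp
        then show "ennreal ((max 0 (x - (real n * a q + t))) ^ m) = 0" using assms by simp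
      qed
      then show ?thesis using False by simp
    qed
  qed
  also have "\<dots> = ennreal ?e * ennreal (exp (- r q))"
    using assms by (subst nn_integral_cmult) (auto simp: emeasure_pmf_single)
  also have "\<dots> = ennreal (exp (- r q) * ?e)" using e0 by (simp add: ennreal_mult mult.commute)
  finally show ?thesis 
    using e0 pmf_expectation_bounds[of "cpoisson r a (insert q A)" _ "x ^ m", OF b1] by simp
qed

text \<open>A new prime beyond N multiplies the expectation by exp(-z lambda_p) and
  \<open>wt\<close> by the inverse, so it leaves no trace. The passage to infinite N is therefore a
  matter of eventually constant sequences.\<close>

lemma Am_consistent:
  assumes "N \<le> N'" "x \<le> ln (real N)" "0 \<le> x" "1 \<le> N" "0 < m"
  shows "Am m N' x = Am m N x"
  using assms(1)
proof (induction rule: dec_induct)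
  case (step n)
  have "Am m (Suc n) x = Am m n x"
  proof (cases "prime (Suc n) \<and> y < Suc n")
    case True
    have ins: "PA y (Suc n) = insert (Suc n) (PA y n)" using True by (auto simp: PA_def pr_def le_Suc_eq)
    have ni: "Suc n \<notin> PA y n" by (auto simp: PA_def pr_def)
    have q2: "2 \<le> Suc n" using True prime_ge_2_nat by blast
    have "ln (real N) \<le> ln (real (Suc n))" using assms step by (intro ln_mono) auto
    then have xq: "x \<le> ln (real (Suc n))" using assms by linarith
    have "measure_pmf.expectation (TT (Suc n)) (\<lambda>t. (max 0 (x - t)) ^ m)
       = exp (- (z * lam (Suc n))) * measure_pmf.expectation (TT n) (\<lambda>t. (max 0 (x - t)) ^ m)"
      unfolding TT_def ins
      by (rule expectation_cpoisson_insert_large) (use ni z0 lam_pos[OF q2] xq assms in \<open>auto dest: PAD(3)\<close>)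
    moreover have "wt (Suc n) = exp (z * lam (Suc n)) * wt n"
      using ni by (simp add: wt_def ins distrib_left exp_add)
    ultimately show ?thesis by (simp add: Am_def exp_minus field_simps)
  next
    case False
    then have "PA y (Suc n) = PA y n" by (auto simp: PA_def pr_def le_Suc_eq)
    then show ?thesis by (simp add: Am_def wt_def TT_def)
  qed
  with step show ?case by simp
qed simp

end

section \<open>The Tauberian constant of the second truncated moment\<close>

context rough
begin

text \<open>By \<open>Am_consistent\<close> every N with x <= log N gives this value; the ceiling of
  exp x is such an N.\<close>

definition A2inf :: "real \<Rightarrow> real" where
  "A2inf x = Am 2 (nat \<lceil>exp x\<rceil>) x"

lemma A2inf_eq:
  assumes "x \<le> ln (real N)" "0 \<le> x" "1 \<le> N"
  shows "Am 2 N x = A2inf x"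
proof -
  define M where "M = nat \<lceil>exp x\<rceil>"
  have M: "exp x \<le> real M" by (simp add: M_def real_nat_ceiling_ge)
  then have "0 < real M" using exp_gt_zero less_le_trans by blast
  then have M1: "1 \<le> M" by simp
  have "ln (exp x) \<le> ln (real M)" using M by (intro ln_mono) auto
  then have xM: "x \<le> ln (real M)" by simp
  have "Am 2 N x = Am 2 M x"
    using Am_consistent[of N M x 2] Am_consistent[of M N x 2] xM M1 assms by (cases "N \<le> M") auto
  then show ?thesis by (simp add: A2inf_def M_def)
qed

lemma eventually_large_ln: "\<forall>\<^sub>F N in sequentially. x \<le> ln (real N) \<and> 1 \<le> N"
proof -
  have "filterlim (\<lambda>N. ln (real N)) at_top sequentially"
    by (rule filterlim_compose[OF ln_at_top filterlim_real_sequentially])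
  then have "\<forall>\<^sub>F N in sequentially. x \<le> ln (real N)" by (simp add: filterlim_at_top)
  then show ?thesis using eventually_ge_at_top[of 1] by (rule eventually_conj)
qed

lemma A2inf_bounds:
  assumes "0 \<le> x"
  shows "0 \<le> A2inf x" "A2inf x \<le> Bc * x ^ 2 * (max 1 x) powr z"
  using Am_nonneg[OF assms] Am_le[OF assms] by (auto simp: A2inf_def)

definition Hinf :: "real \<Rightarrow> real" where "Hinf x = A2inf x * x powr (-(2+z))"

abbreviation (input) KK :: real where "KK \<equiv> z * theta_err y * Bc"

lemma KK_nonneg: "0 \<le> KK" using z0 theta_err_ge1[OF y1] Bc_ge1 by auto

lemma Hinf_diff:
  assumes "1 \<le> a" "a \<le> b"
  shows "\<bar>Hinf b - Hinf a\<bar> \<le> KK * (1 / a - 1 / b)"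
proof -
  obtain N where N: "b \<le> ln (real N)" "1 \<le> N" using eventually_happens'[OF _ eventually_large_ln[of b]] by auto
  have "Hinf b = HH N b" "Hinf a = HH N a"
    using assms N A2inf_eq[of b N] A2inf_eq[of a N] by (auto simp: Hinf_def HH_def)
  then show ?thesis using HH_diff[OF assms N] by simp
qed

text \<open>\<open>Hinf_diff\<close> makes the values at integers a Cauchy sequence, and letting b
  tend to infinity in it gives the rate of convergence.\<close>

lemma Hinf_limit: "\<exists>H. \<forall>x\<ge>1. \<bar>Hinf x - H\<bar> \<le> KK / x"
proof -
  have d: "\<bar>Hinf b - Hinf a\<bar> \<le> KK / a" if "1 \<le> a" "a \<le> b" for a b
  proof -
    have "KK * (1 / a - 1 / b) \<le> KK * (1 / a)" using that KK_nonneg by (intro mult_left_mono) auto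
    then show ?thesis using Hinf_diff[OF that] by simp
  qed
  have "Cauchy (\<lambda>n. Hinf (real n))"
  proof (rule CauchyI)
    fix e :: real assume e: "0 < e"
    obtain M where M: "KK / e < real M" using reals_Archimedean2 by blast
    show "\<exists>M. \<forall>m\<ge>M. \<forall>n\<ge>M. norm (Hinf (real m) - Hinf (real n)) < e"
    proof (intro exI allI impI)
      fix m n assume mn: "Suc M \<le> m" "Suc M \<le> n"
      have g: "KK / real a < e" if "Suc M \<le> a" for a
      proof -
        have "KK < e * real M" using M e by (simp add: field_simps)
        also have "\<dots> \<le> e * real a" using that e by (intro mult_left_mono) auto
        finally show ?thesis using that by (simp add: field_simps)
      qed
      show "norm (Hinf (real m) - Hinf (real n)) < e"
      proof (cases "m \<le> n")
        case True
        then have "\<bar>Hinf (real n) - Hinf (real m)\<bar> \<le> KK / real m" using mn by (intro d) auto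
        then show ?thesis using g[OF mn(1)] by simp
      next
        case False
        then have "\<bar>Hinf (real m) - Hinf (real n)\<bar> \<le> KK / real n" using mn by (intro d) auto
        then show ?thesis using g[OF mn(2)] by simp
      qed
    qed
  qed
  then obtain H where H: "(\<lambda>n. Hinf (real n)) \<longlonglongrightarrow> H" using Cauchy_convergent convergent_def by blast
  have "\<bar>Hinf x - H\<bar> \<le> KK / x" if x: "1 \<le> x" for x
  proof -
    have "(\<lambda>n. \<bar>Hinf (real n) - Hinf x\<bar>) \<longlonglongrightarrow> \<bar>H - Hinf x\<bar>" by (intro tendsto_intros H)
    moreover have "\<forall>\<^sub>F n in sequentially. \<bar>Hinf (real n) - Hinf x\<bar> \<le> KK / x"
      using eventually_ge_at_top[of "nat \<lceil>x\<rceil>"]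
    proof eventually_elim
      case (elim n)
      then have "x \<le> real n" by linarith
      then show ?case using d[OF x] by simp
    qed
    ultimately have "\<bar>H - Hinf x\<bar> \<le> KK / x" by (intro tendsto_upperbound) auto
    then show ?thesis by (simp add: abs_minus_commute)
  qed
  then show ?thesis by blast
qed

text \<open>Writes exp(-a) as a Laplace integral of truncated squares, so that averaging over T
  turns the known transform of T into a transform of \<open>Am 2\<close>.\<close>

lemma laplace_quadratic:
  fixes a :: real
  assumes a: "0 \<le> a"
  shows "(\<integral>\<^sup>+w. ennreal (indicator {0..} w * (exp (-w) * ((max 0 (w - a))\<^sup>2 / 2))) \<partial>lborel) = ennreal (exp (-a))"
proof -
  have "(\<integral>\<^sup>+w. ennreal (indicator {0..} w * (exp (-w) * ((max 0 (w - a))\<^sup>2 / 2))) \<partial>lborel)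
     = (\<integral>\<^sup>+w. ennreal (exp (-w) * ((w - a)\<^sup>2 / 2)) * indicator {a..} w \<partial>lborel)"
    using a by (intro nn_integral_cong) (auto simp: indicator_def max_def)
  also have "\<dots> = ennreal (0 - (- (exp (-a) * ((a - a)\<^sup>2 / 2 + (a - a) + 1))))"
  proof (rule nn_integral_FTC_atLeast[where F = "\<lambda>w. - (exp (-w) * ((w - a)\<^sup>2 / 2 + (w - a) + 1))" and T = 0])
    fix x
    show "((\<lambda>w. - (exp (-w) * ((w - a)\<^sup>2 / 2 + (w - a) + 1))) has_real_derivative exp (-x) * ((x - a)\<^sup>2 / 2)) (at x)"
      by (auto intro!: derivative_eq_intros simp: field_simps power2_eq_square)
  next
    show "((\<lambda>w. - (exp (-w) * ((w - a)\<^sup>2 / 2 + (w - a) + 1))) \<longlongrightarrow> 0) at_top" by real_asymp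
  qed auto
  finally show ?thesis by simp
qed

lemma Am2_borel [measurable]: "Am 2 N \<in> borel_measurable borel"
proof (rule borel_measurable_continuous_onI)
  show "continuous_on UNIV (Am 2 N)"
    using Am2_deriv by (intro continuous_at_imp_continuous_on ballI) (rule DERIV_isCont)
qed

lemma A2inf_borel: "(\<lambda>x. indicator {0..} x * A2inf x) \<in> borel_measurable borel"
proof (rule borel_measurable_LIMSEQ_real)
  show "(\<lambda>N. indicator {0..} x * Am 2 N x) \<longlonglongrightarrow> indicator {0..} x * A2inf x" for x :: real
  proof (rule tendsto_eventually)
    show "\<forall>\<^sub>F N in sequentially. indicator {0..} x * Am 2 N x = indicator {0..} x * A2inf x"
      using eventually_large_ln[of x] by eventually_elim (auto simp: indicator_def intro: A2inf_eq)
  qed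
qed auto

text \<open>Majorant for all dominated convergence below: the integrands grow like w^(2+z), and z <=
  2 gives degree 4.\<close>

definition dom_fun :: "real \<Rightarrow> real" where
  "dom_fun w = indicator {0..} w * (exp (-w) * (1 + w) ^ 4)"

lemma gamma_integrable:
  assumes "0 < (s::real)"
  shows "integrable lborel (\<lambda>t. indicator {0..} t * t powr (s - 1) / exp t)"
    and "(LINT t|lborel. indicator {0..} t * t powr (s - 1) / exp t) = Gamma s"
proof -
  let ?f = "\<lambda>t::real. indicator {0..} t * t powr (s - 1) / exp t"
  have nn: "(\<integral>\<^sup>+t. ennreal (?f t) \<partial>lborel) = ennreal (Gamma s)" by (rule Gamma_conv_nn_integral_real[OF assms, symmetric])
  show "integrable lborel ?f"
    by (rule integrableI_nn_integral_finite[OF _ _ nn]) (use assms in \<open>auto intro!: less_imp_le Gamma_real_pos\<close>)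
  show "(LINT t|lborel. ?f t) = Gamma s"
    by (subst integral_eq_nn_integral) (use assms nn in \<open>auto intro!: less_imp_le Gamma_real_pos\<close>)
qed

lemma dom_fun_integrable: "integrable lborel dom_fun"
proof -
  have i: "integrable lborel (\<lambda>t. 8 * (indicator {0..} t * t powr (1 - 1) / exp t) + 8 * (indicator {0..} t * t powr (5 - 1) / exp (t::real)))"
    by (intro Bochner_Integration.integrable_add integrable_mult_right gamma_integrable(1)) auto
  show ?thesis
  proof (rule Bochner_Integration.integrable_bound[OF i])
    show "dom_fun \<in> borel_measurable lborel" unfolding dom_fun_def[abs_def] by measurable
    show "AE x in lborel. norm (dom_fun x) \<le> norm (8 * (indicator {0..} x * x powr (1 - 1) / exp x) + 8 * (indicator {0..} x * x powr (5 - 1) / exp x))"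
    proof (rule AE_mp[OF AE_lborel_singleton[of 0]], intro always_eventually allI impI)
      fix x :: real assume x0: "x \<noteq> 0"
      show "norm (dom_fun x) \<le> norm (8 * (indicator {0..} x * x powr (1 - 1) / exp x) + 8 * (indicator {0..} x * x powr (5 - 1) / exp x))"
      proof (cases "0 < x")
        case True
        have "(1 + x) ^ 2 \<le> 2 + 2 * x ^ 2" using zero_le_power2[of "1 - x"] by (simp add: power2_eq_square algebra_simps)
        then have "((1 + x) ^ 2) ^ 2 \<le> (2 + 2 * x ^ 2) ^ 2" by (intro power_mono) auto
        also have "\<dots> \<le> 8 + 8 * x ^ 4" using zero_le_power2[of "1 - x ^ 2"] by (simp add: power2_eq_square power4_eq_xxxx algebra_simps)
        finally have "(1 + x) ^ 4 \<le> 8 + 8 * x ^ 4" by (simp flip: power_mult)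
        then have "exp (-x) * (1 + x) ^ 4 \<le> exp (-x) * (8 + 8 * x ^ 4)" by (intro mult_left_mono) auto
        also have "\<dots> = 8 * (1 / exp x) + 8 * (x ^ 4 / exp x)" by (simp add: exp_minus field_simps)
        finally show ?thesis using True by (simp add: dom_fun_def powr_numeral)
      next
        case False
        then show ?thesis using x0 by (simp add: dom_fun_def)
      qed
    qed
  qed
qed

text \<open>Fubini for \<open>laplace_quadratic\<close> at a = sigma t; pulling out sigma turns (w -
  sigma t)_+^2/2 into sigma^2 times the integrand of \<open>Am 2\<close> at w/sigma.\<close>

lemma laplace_Am:
  assumes s: "0 < \<sigma>"
  shows "(\<integral>\<^sup>+w. ennreal (indicator {0..} w * (exp (-w) * \<sigma>\<^sup>2 * Am 2 N (w / \<sigma>))) \<partial>lborel) 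
    = ennreal (exp (z * (\<Sum>p\<in>PA y N. lam p * real p powr (-\<sigma>))))"
proof -
  let ?f = "\<lambda>t w. indicator {0..} w * (exp (-w) * ((max 0 (w - \<sigma> * t))\<^sup>2 / 2)) :: real"
  have "ennreal (exp (z * (\<Sum>p\<in>PA y N. lam p * real p powr (-\<sigma>)))) = ennreal (wt N) * (\<integral>\<^sup>+t. ennreal (exp (-(\<sigma> * t))) \<partial>measure_pmf (TT N))"
  proof -
    have "(\<integral>\<^sup>+t. ennreal (exp (-(\<sigma> * t))) \<partial>measure_pmf (TT N)) = ennreal (measure_pmf.expectation (TT N) (\<lambda>t. exp (-(\<sigma> * t))))"
      by (rule nn_integral_pmf_eq_expectation[of _ _ 1]) (use s TT_nonneg in auto)
    then show ?thesis using wt_laplace[of \<sigma> N] s wt_pos[of N] by (simp add: ennreal_mult[symmetric])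
  qed
  also have "(\<integral>\<^sup>+t. ennreal (exp (-(\<sigma> * t))) \<partial>measure_pmf (TT N)) = (\<integral>\<^sup>+t. \<integral>\<^sup>+w. ennreal (?f t w) \<partial>lborel \<partial>measure_pmf (TT N))"
    by (intro nn_integral_cong_AE AE_pmfI laplace_quadratic[symmetric]) (use s TT_nonneg in auto)
  also have "\<dots> = (\<integral>\<^sup>+w. \<integral>\<^sup>+t. ennreal (?f t w) \<partial>measure_pmf (TT N) \<partial>lborel)"
  proof (rule pair_sigma_finite.Fubini'[symmetric])
    show "pair_sigma_finite (measure_pmf (TT N)) lborel"
      by (intro pair_sigma_finite.intro measure_pmf.sigma_finite_measure_axioms sigma_finite_lborel)
    have [measurable]: "fst \<in> borel_measurable (measure_pmf (TT N) \<Otimes>\<^sub>M (lborel :: real measure))"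
      by (rule measurable_compose[OF measurable_fst]) auto
    have [measurable]: "snd \<in> borel_measurable (measure_pmf (TT N) \<Otimes>\<^sub>M (lborel :: real measure))"
      by (rule measurable_compose[OF measurable_snd]) auto
    show "(\<lambda>(t, w). ennreal (?f t w)) \<in> borel_measurable (measure_pmf (TT N) \<Otimes>\<^sub>M lborel)"
      unfolding case_prod_beta by measurable
  qed
  also have "ennreal (wt N) * \<dots> = (\<integral>\<^sup>+w. ennreal (wt N) * (\<integral>\<^sup>+t. ennreal (?f t w) \<partial>measure_pmf (TT N)) \<partial>lborel)"
  proof (rule nn_integral_cmult[symmetric])
    show "(\<lambda>w. \<integral>\<^sup>+t. ennreal (?f t w) \<partial>measure_pmf (TT N)) \<in> borel_measurable lborel"
    proof (rule sigma_finite_measure.borel_measurable_nn_integral[OF measure_pmf.sigma_finite_measure_axioms])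
      have [measurable]: "fst \<in> borel_measurable ((lborel :: real measure) \<Otimes>\<^sub>M measure_pmf (TT N))"
        by (rule measurable_compose[OF measurable_fst]) auto
      have [measurable]: "snd \<in> borel_measurable ((lborel :: real measure) \<Otimes>\<^sub>M measure_pmf (TT N))"
        by (rule measurable_compose[OF measurable_snd]) auto
      show "(\<lambda>(w, t). ennreal (?f t w)) \<in> borel_measurable (lborel \<Otimes>\<^sub>M measure_pmf (TT N))"
        unfolding case_prod_beta by measurable
    qed
  qed
  also have "\<dots> = (\<integral>\<^sup>+w. ennreal (indicator {0..} w * (exp (-w) * \<sigma>\<^sup>2 * Am 2 N (w / \<sigma>))) \<partial>lborel)"
  proof (rule nn_integral_cong)
    fix w :: real
    show "ennreal (wt N) * (\<integral>\<^sup>+t. ennreal (?f t w) \<partial>measure_pmf (TT N)) = ennreal (indicator {0..} w * (exp (-w) * \<sigma>\<^sup>2 * Am 2 N (w / \<sigma>)))"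
    proof (cases "0 \<le> w")
      case True
      have f: "?f t w = exp (-w) * \<sigma>\<^sup>2 * ((max 0 (w / \<sigma> - t))\<^sup>2 / 2)" for t
      proof -
        have "max 0 (w - \<sigma> * t) = \<sigma> * max 0 (w / \<sigma> - t)" using s by (simp add: max_def field_simps)
        then show ?thesis using True by (simp add: power_mult_distrib)
      qed
      have "(\<integral>\<^sup>+t. ennreal (?f t w) \<partial>measure_pmf (TT N)) = ennreal (measure_pmf.expectation (TT N) (\<lambda>t. ?f t w))"
        unfolding f by (rule nn_integral_eq_integral[OF integrable_mult_right[OF Am2_integrable]]) auto
      also have "measure_pmf.expectation (TT N) (\<lambda>t. ?f t w) = exp (-w) * \<sigma>\<^sup>2 * measure_pmf.expectation (TT N) (\<lambda>t. (max 0 (w / \<sigma> - t))\<^sup>2 / 2)"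
        unfolding f by (rule Bochner_Integration.integral_mult_right) (rule Am2_integrable)
      finally show ?thesis using wt_pos[of N] True
        by (simp add: ennreal_mult[symmetric] Am_def fact_2 integral_nonneg mult_ac)
    qed simp
  qed
  finally show ?thesis by simp
qed

lemma laplace_Am_real:
  assumes s: "0 < \<sigma>"
  shows "(LINT w|lborel. indicator {0..} w * (exp (-w) * \<sigma>\<^sup>2 * Am 2 N (w / \<sigma>)))
    = exp (z * (\<Sum>p\<in>PA y N. lam p * real p powr (-\<sigma>)))"
proof -
  have nn: "0 \<le> indicator {0..} w * (exp (-w) * \<sigma>\<^sup>2 * Am 2 N (w / \<sigma>))" for w
    using s by (cases "0 \<le> w") (auto intro!: mult_nonneg_nonneg Am_nonneg)
  show ?thesis
    by (subst integral_eq_nn_integral) (use nn laplace_Am[OF s, of N] in \<open>auto simp del: indicator_simps\<close>)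
qed

text \<open>sigma max(1, w/sigma) = max(sigma, w) <= 1 + w removes sigma, which makes the domination
  uniform.\<close>

lemma max_powr_bound: 
  assumes w: "0 \<le> w" and s: "0 < \<sigma>" "\<sigma> \<le> 1"
  shows "\<sigma> powr z * (w\<^sup>2 * (max 1 (w / \<sigma>)) powr z) \<le> (1 + w) ^ 4"
proof -
  have "\<sigma> powr z * (max 1 (w / \<sigma>)) powr z = (max \<sigma> w) powr z"
    using s w by (subst powr_mult[symmetric]) (auto simp: max_def field_simps)
  also have "\<dots> \<le> (1 + w) powr z" using s w z0 by (intro powr_mono2) auto
  also have "\<dots> \<le> (1 + w) powr 2" using w z2 by (intro powr_mono) auto
  also have "\<dots> = (1 + w)\<^sup>2" using w by (simp add: powr_numeral)
  finally have a: "\<sigma> powr z * (max 1 (w / \<sigma>)) powr z \<le> (1 + w)\<^sup>2" .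
  have "w\<^sup>2 * (\<sigma> powr z * (max 1 (w / \<sigma>)) powr z) \<le> (1 + w)\<^sup>2 * (1 + w)\<^sup>2"
    using w a by (intro mult_mono power_mono) auto
  also have "\<dots> = (1 + w) ^ 4" by (simp flip: power_add)
  finally show ?thesis by (simp add: mult_ac)
qed

text \<open>For fixed sigma let N tend to infinity: on the left the integrand is eventually constant
  at each w and dominated, on the right the sum over all primes appears less the part up to
  y.\<close>

lemma laplace_A2inf:
  assumes s: "0 < \<sigma>" "\<sigma> \<le> 1"
  shows "(LINT w|lborel. indicator {0..} w * (exp (-w) * \<sigma>\<^sup>2 * A2inf (w / \<sigma>)))
    = exp (z * (suminf (lam_pow \<sigma>) - (\<Sum>p\<in>pr y. lam p * real p powr (-\<sigma>))))"
proof -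
  let ?s = "\<lambda>N w. indicator {0..} w * (exp (-w) * \<sigma>\<^sup>2 * Am 2 N (w / \<sigma>)) :: real"
  let ?f = "\<lambda>w. indicator {0..} w * (exp (-w) * \<sigma>\<^sup>2 * A2inf (w / \<sigma>)) :: real"
  have 1: "(\<lambda>N. LINT w|lborel. ?s N w) \<longlonglongrightarrow> (LINT w|lborel. ?f w)"
  proof (rule integral_dominated_convergence)
    show "integrable lborel (\<lambda>w. (\<sigma> powr (-z) * Bc) * dom_fun w)"
      by (intro integrable_mult_right dom_fun_integrable)
    have "(\<lambda>w. (indicator {0..} (w / \<sigma>) * A2inf (w / \<sigma>)) * (exp (-w) * \<sigma>\<^sup>2)) \<in> borel_measurable lborel"
      using measurable_compose[OF _ A2inf_borel, of "\<lambda>w. w / \<sigma>" lborel] by measurable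
    moreover have "(\<lambda>w. (indicator {0..} (w / \<sigma>) * A2inf (w / \<sigma>)) * (exp (-w) * \<sigma>\<^sup>2)) = ?f"
      using s by (auto simp: fun_eq_iff indicator_def zero_le_divide_iff)
    ultimately show "?f \<in> borel_measurable lborel" by simp
    show "?s N \<in> borel_measurable lborel" for N by measurable
    show "AE w in lborel. (\<lambda>N. ?s N w) \<longlonglongrightarrow> ?f w"
    proof (intro always_eventually allI)
      fix w :: real
      have "\<forall>\<^sub>F N in sequentially. ?s N w = ?f w"
        using eventually_large_ln[of "w / \<sigma>"]
        by eventually_elim (use s in \<open>auto simp: indicator_def A2inf_eq\<close>)
      then show "(\<lambda>N. ?s N w) \<longlonglongrightarrow> ?f w" by (rule tendsto_eventually)
    qed
    show "AE w in lborel. norm (?s N w) \<le> (\<sigma> powr (-z) * Bc) * dom_fun w" for N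
    proof (intro always_eventually allI)
      fix w :: real
      show "norm (?s N w) \<le> (\<sigma> powr (-z) * Bc) * dom_fun w"
      proof (cases "0 \<le> w")
        case True
        then have x0: "0 \<le> w / \<sigma>" using s by simp
        have "Am 2 N (w / \<sigma>) \<le> Bc * (w / \<sigma>) ^ 2 * (max 1 (w / \<sigma>)) powr z" using x0 by (intro Am_le) auto
        then have "\<sigma>\<^sup>2 * Am 2 N (w / \<sigma>) \<le> \<sigma>\<^sup>2 * (Bc * (w / \<sigma>) ^ 2 * (max 1 (w / \<sigma>)) powr z)" by (intro mult_left_mono) auto
        also have "\<dots> = Bc * (w\<^sup>2 * (max 1 (w / \<sigma>)) powr z)" using s by (simp add: power_divide)
        also have "\<dots> = Bc * (\<sigma> powr (-z) * (\<sigma> powr z * (w\<^sup>2 * (max 1 (w / \<sigma>)) powr z)))"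
          using s by (simp add: powr_minus)
        also have "\<dots> \<le> Bc * (\<sigma> powr (-z) * (1 + w) ^ 4)"
          using Bc_ge1 by (intro mult_left_mono max_powr_bound True s) auto
        finally have "exp (-w) * (\<sigma>\<^sup>2 * Am 2 N (w / \<sigma>)) \<le> exp (-w) * (Bc * (\<sigma> powr (-z) * (1 + w) ^ 4))"
          by (intro mult_left_mono) auto
        then show ?thesis using True Am_nonneg[OF x0, of 2 N] by (simp add: dom_fun_def abs_mult mult_ac)
      qed (simp add: dom_fun_def)
    qed
  qed
  have 2: "(\<lambda>N. exp (z * (\<Sum>p\<in>PA y N. lam p * real p powr (-\<sigma>)))) \<longlonglongrightarrow> exp (z * (suminf (lam_pow \<sigma>) - (\<Sum>p\<in>pr y. lam p * real p powr (-\<sigma>))))"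
  proof -
    have a: "(\<lambda>n. \<Sum>p\<in>pr n. lam p * real p powr (-\<sigma>)) \<longlonglongrightarrow> suminf (lam_pow \<sigma>)"
      unfolding lam_pow_def[abs_def]
      by (rule prime_sum_bounded_summable(2)[OF _ sum_lam_powr_le[OF s]]) (auto intro!: mult_nonneg_nonneg less_imp_le[OF lam_pos] prime_ge_2_nat)
    have "(\<lambda>n. exp (z * ((\<Sum>p\<in>pr n. lam p * real p powr (-\<sigma>)) - (\<Sum>p\<in>pr y. lam p * real p powr (-\<sigma>))))) 
        \<longlonglongrightarrow> exp (z * (suminf (lam_pow \<sigma>) - (\<Sum>p\<in>pr y. lam p * real p powr (-\<sigma>))))"
      by (intro tendsto_intros a)
    then show ?thesis
    proof (rule Lim_transform_eventually)
      show "\<forall>\<^sub>F n in sequentially. exp (z * ((\<Sum>p\<in>pr n. lam p * real p powr (-\<sigma>)) - (\<Sum>p\<in>pr y. lam p * real p powr (-\<sigma>))))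
         = exp (z * (\<Sum>p\<in>PA y n. lam p * real p powr (-\<sigma>)))"
        using eventually_ge_at_top[of y]
      proof eventually_elim
        case (elim n)
        then have "pr y \<subseteq> pr n" by (auto simp: pr_def)
        then show ?case by (simp add: PA_def sum_diff)
      qed
    qed
  qed
  show ?thesis using 1 2 unfolding laplace_Am_real[OF s(1)] by (rule LIMSEQ_unique)
qed

text \<open>The contribution of the primes up to y, which T omits: without them zeta(1 + sigma)^z
  behaves like \<open>cy\<close> sigma^(-z).\<close>

definition cy :: real where "cy = exp (- (z * (\<Sum>p\<in>pr y. lam p)))"

text \<open>As sigma tends to 0, sigma^(2+z) \<open>A2inf\<close> (w/sigma) tends to H w^(2+z), so
  the Laplace integral times sigma^z tends to H Gamma(3+z). Its explicit value times sigma^z tends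
  to \<open>cy\<close>, because sigma exp(suminf of \<open>lam_pow\<close>) tends to 1. The rate for
  H is known beforehand, so this limit is needed for the constant alone.\<close>

lemma Hinf_value:
  assumes H: "\<And>x. 1 \<le> x \<Longrightarrow> \<bar>Hinf x - H\<bar> \<le> KK / x"
  shows "H = cy / Gamma (3 + z)"
proof -
  define \<sigma> :: "nat \<Rightarrow> real" where "\<sigma> = (\<lambda>n. 1 / real (Suc n))"
  have s: "0 < \<sigma> n" "\<sigma> n \<le> 1" for n by (auto simp: \<sigma>_def)
  have s0: "\<sigma> \<longlonglongrightarrow> 0" unfolding \<sigma>_def using LIMSEQ_inverse_real_of_nat by (simp add: inverse_eq_divide)
  have sr: "filterlim \<sigma> (at_right 0) sequentially"
    unfolding filterlim_at
  proof (intro conjI always_eventually allI s0)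
    fix n
    show "\<sigma> n \<in> {0<..}" "\<sigma> n \<noteq> 0" using s(1)[of n] by auto
  qed
  let ?s = "\<lambda>n w. indicator {0..} w * (exp (-w) * ((\<sigma> n) powr z * ((\<sigma> n)\<^sup>2 * A2inf (w / \<sigma> n)))) :: real"
  let ?f = "\<lambda>w. H * (indicator {0..} w * w powr ((3 + z) - 1) / exp w) :: real"
  have 1: "(\<lambda>n. LINT w|lborel. ?s n w) \<longlonglongrightarrow> (LINT w|lborel. ?f w)"
  proof (rule integral_dominated_convergence)
    show "integrable lborel (\<lambda>w. Bc * dom_fun w)"
      by (intro integrable_mult_right dom_fun_integrable)
    show "?f \<in> borel_measurable lborel" by measurable
    show "?s n \<in> borel_measurable lborel" for n
    proof -
      have meas: "(\<lambda>w. (indicator {0..} (w / \<sigma> n) * A2inf (w / \<sigma> n)) * (exp (-w) * (\<sigma> n powr z * (\<sigma> n)\<^sup>2))) \<in> borel_measurable lborel"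
        by (intro borel_measurable_times measurable_compose[OF _ A2inf_borel]) measurable
      have eq: "(\<lambda>w. (indicator {0..} (w / \<sigma> n) * A2inf (w / \<sigma> n)) * (exp (-w) * (\<sigma> n powr z * (\<sigma> n)\<^sup>2))) = ?s n"
      proof (rule ext)
        fix w
        have "indicator {0..} (w / \<sigma> n) = (indicator {0..} w :: real)"
          using s(1)[of n] by (simp add: indicator_def zero_le_divide_iff)
        then show "indicator {0..} (w / \<sigma> n) * A2inf (w / \<sigma> n) * (exp (-w) * (\<sigma> n powr z * (\<sigma> n)\<^sup>2)) = ?s n w"
          by (simp only: mult_ac)
      qed
      show ?thesis using meas unfolding eq .
    qed
    show "AE w in lborel. (\<lambda>n. ?s n w) \<longlonglongrightarrow> ?f w"
    proof (rule AE_mp[OF AE_lborel_singleton[of 0]], intro always_eventually allI impI)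
      fix w :: real assume w0: "w \<noteq> 0"
      show "(\<lambda>n. ?s n w) \<longlonglongrightarrow> ?f w"
      proof (cases "0 < w")
        case True
        have e: "?s n w = exp (-w) * (w powr (2 + z) * Hinf (w / \<sigma> n))" for n
        proof -
          have "w powr (2 + z) = (\<sigma> n) powr (2 + z) * (w / \<sigma> n) powr (2 + z)"
            using s[of n] True by (subst powr_mult[symmetric]) auto
          moreover have "(w / \<sigma> n) powr (2 + z) * (w / \<sigma> n) powr (-(2+z)) = 1"
            using s[of n] True by (subst powr_add[symmetric]) auto
          moreover have "\<sigma> n powr (2 + z) = \<sigma> n powr z * (\<sigma> n)\<^sup>2"
            using s[of n] by (simp add: powr_add powr_numeral)
          ultimately have "w powr (2 + z) * Hinf (w / \<sigma> n) = \<sigma> n powr z * (\<sigma> n)\<^sup>2 * A2inf (w / \<sigma> n)"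
            by (simp add: Hinf_def)
          then show ?thesis using True by (simp add: mult.assoc)
        qed
        have f: "?f w = exp (-w) * (w powr (2 + z) * H)" using True by (simp add: exp_minus field_simps)
        have "(\<lambda>n. Hinf (w / \<sigma> n)) \<longlonglongrightarrow> H"
        proof (rule LIM_zero_cancel, rule Lim_null_comparison)
          have "filterlim (\<lambda>n. w / \<sigma> n) at_top sequentially"
            unfolding \<sigma>_def using True
            by real_asymp
          then have "\<forall>\<^sub>F n in sequentially. 1 \<le> w / \<sigma> n" by (simp add: filterlim_at_top)
          then show "\<forall>\<^sub>F n in sequentially. norm (Hinf (w / \<sigma> n) - H) \<le> KK / w * \<sigma> n"
          proof eventually_elim
            case (elim n)
            then show ?case using H[OF elim] s[of n] by simp
          qed
          show "(\<lambda>n. KK / w * \<sigma> n) \<longlonglongrightarrow> 0" using tendsto_mult[OF tendsto_const s0, of "KK / w"] by simp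
        qed
        then show ?thesis unfolding e f by (intro tendsto_intros)
      next
        case False
        then show ?thesis using w0 by simp
      qed
    qed
    show "AE w in lborel. norm (?s n w) \<le> Bc * dom_fun w" for n
    proof (intro always_eventually allI)
      fix w :: real
      show "norm (?s n w) \<le> Bc * dom_fun w"
      proof (cases "0 \<le> w")
        case True
        let ?t = "\<sigma> n"
        have x0: "0 \<le> w / ?t" using s[of n] True by simp
        have "?t\<^sup>2 * A2inf (w / ?t) \<le> ?t\<^sup>2 * (Bc * (w / ?t) ^ 2 * (max 1 (w / ?t)) powr z)" using x0 by (intro mult_left_mono A2inf_bounds) auto
        also have "\<dots> = Bc * (w\<^sup>2 * (max 1 (w / ?t)) powr z)" using s[of n] by (simp add: power_divide)
        finally have "?t powr z * (?t\<^sup>2 * A2inf (w / ?t)) \<le> ?t powr z * (Bc * (w\<^sup>2 * (max 1 (w / ?t)) powr z))"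
          by (intro mult_left_mono) auto
        also have "\<dots> = Bc * (?t powr z * (w\<^sup>2 * (max 1 (w / ?t)) powr z))" by (simp add: mult_ac)
        also have "\<dots> \<le> Bc * (1 + w) ^ 4"
          using Bc_ge1 by (intro mult_left_mono max_powr_bound True s) auto
        finally have "exp (-w) * (?t powr z * (?t\<^sup>2 * A2inf (w / ?t))) \<le> exp (-w) * (Bc * (1 + w) ^ 4)"
          by (intro mult_left_mono) auto
        then show ?thesis using True A2inf_bounds(1)[OF x0] by (simp add: dom_fun_def abs_mult mult_ac)
      qed (simp add: dom_fun_def)
    qed
  qed
  have lim: "(LINT w|lborel. ?f w) = H * Gamma (3 + z)"
    using gamma_integrable[of "3 + z"] z0 by (subst Bochner_Integration.integral_mult_right) auto
  have seq: "(LINT w|lborel. ?s n w) = (\<sigma> n * exp (suminf (lam_pow (\<sigma> n)))) powr z * exp (- (z * (\<Sum>p\<in>pr y. lam p * real p powr (-\<sigma> n))))" for n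
  proof -
    have "(LINT w|lborel. ?s n w) = (LINT w|lborel. (\<sigma> n) powr z * (indicator {0..} w * (exp (-w) * (\<sigma> n)\<^sup>2 * A2inf (w / \<sigma> n))))"
      by (intro Bochner_Integration.integral_cong refl) (simp add: mult_ac)
    also have "\<dots> = (\<sigma> n) powr z * (LINT w|lborel. (indicator {0..} w * (exp (-w) * (\<sigma> n)\<^sup>2 * A2inf (w / \<sigma> n))))"
      by (rule integral_mult_right_zero)
    also have "\<dots> = (\<sigma> n) powr z * exp (z * (suminf (lam_pow (\<sigma> n)) - (\<Sum>p\<in>pr y. lam p * real p powr (-\<sigma> n))))"
      by (simp only: laplace_A2inf[OF s])
    also have "\<dots> = (\<sigma> n * exp (suminf (lam_pow (\<sigma> n)))) powr z * exp (- (z * (\<Sum>p\<in>pr y. lam p * real p powr (-\<sigma> n))))"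
      using s[of n] by (subst powr_mult) (auto simp: exp_powr_real right_diff_distrib exp_diff exp_minus mult.commute divide_inverse)
    finally show ?thesis .
  qed
  have "(\<lambda>n. (\<sigma> n * exp (suminf (lam_pow (\<sigma> n)))) powr z * exp (- (z * (\<Sum>p\<in>pr y. lam p * real p powr (-\<sigma> n)))))
      \<longlonglongrightarrow> 1 powr z * exp (- (z * (\<Sum>p\<in>pr y. lam p * real p powr (- 0))))"
    by (intro tendsto_intros s0 filterlim_compose[OF lam_pow_limit sr]) (auto dest!: prD(3))
  then have "(\<lambda>n. LINT w|lborel. ?s n w) \<longlonglongrightarrow> 1 powr z * exp (- (z * (\<Sum>p\<in>pr y. lam p * real p powr (- 0))))"
    by (simp only: seq)
  moreover have "(\<Sum>p\<in>pr y. lam p * real p powr (- 0)) = (\<Sum>p\<in>pr y. lam p)"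
    by (intro sum.cong refl) (auto dest!: prD(3))
  ultimately have "H * Gamma (3 + z) = cy" using LIMSEQ_unique[OF 1] lim by (simp add: cy_def)
  moreover have "Gamma (3 + z) > 0" using z0 by (intro Gamma_real_pos) auto
  ultimately show ?thesis by (simp add: field_simps)
qed

lemma Am2_asymp:
  assumes x: "1 \<le> x" "x \<le> ln (real N)" and N: "1 \<le> N"
  shows "\<bar>Am 2 N x - cy * x powr (2 + z) / Gamma (3 + z)\<bar> \<le> KK * x powr (1 + z)"
proof -
  obtain H where H: "\<And>x. 1 \<le> x \<Longrightarrow> \<bar>Hinf x - H\<bar> \<le> KK / x" using Hinf_limit by auto
  have e: "x powr (2 + z) * x powr (-(2+z)) = 1" using x by (subst powr_add[symmetric]) auto
  have "Am 2 N x = x powr (2 + z) * Hinf x" using A2inf_eq[of x N] x N e by (simp add: Hinf_def)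
  then have "Am 2 N x - cy * x powr (2 + z) / Gamma (3 + z) = x powr (2 + z) * (Hinf x - H)"
    using Hinf_value[OF H] by (simp add: algebra_simps)
  then have "\<bar>Am 2 N x - cy * x powr (2 + z) / Gamma (3 + z)\<bar> = x powr (2 + z) * \<bar>Hinf x - H\<bar>" by (simp add: abs_mult)
  also have "\<dots> \<le> x powr (2 + z) * (KK / x)" using H[OF x(1)] by (intro mult_left_mono) auto
  also have "\<dots> = KK * (x powr (2 + z) / x powr 1)" using x by simp
  also have "x powr (2 + z) / x powr 1 = x powr (1 + z)" by (subst powr_diff[symmetric]) (simp add: algebra_simps)
  finally show ?thesis .
qed

text \<open>The first moment comes from the second through the recursion, without differentiating an
  asymptotic formula. Of the 5, one unit is the recursion error and 4 >= 2 + z multiplies the error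
  of \<open>Am2_asymp\<close>.\<close>

lemma Am1_asymp:
  assumes x: "1 \<le> x" "x \<le> ln (real N)" and N: "1 \<le> N"
  shows "\<bar>Am 1 N x - cy * x powr (1 + z) / Gamma (2 + z)\<bar> \<le> 5 * KK * x powr z"
proof -
  have G: "Gamma (3 + z) = (2 + z) * Gamma (2 + z)"
    using Gamma_plus1[of "2 + z"] z0 by (force simp: add.commute dest: nonpos_Ints_nonpos)
  have G0: "0 < Gamma (2 + z)" using z0 by (intro Gamma_real_pos) auto
  have xx: "x powr (2 + z) = x * x powr (1 + z)" "x powr (1 + z) = x * x powr z" using x by (auto simp: powr_mult_base add.assoc)
  have eq0: "x * (Am 1 N x - cy * x powr (1 + z) / Gamma (2 + z))
    = (x * Am 1 N x - (2 + z) * Am 2 N x) + (2 + z) * (Am 2 N x - cy * x powr (2 + z) / Gamma (3 + z))"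
  proof -
    have "(2 + z) * (cy * x powr (2 + z) / Gamma (3 + z)) = x * (cy * x powr (1 + z) / Gamma (2 + z))"
    proof -
      have "a * (c * (x * P) / (a * g)) = x * (c * P / g)" if "a \<noteq> 0" for a c P g :: real using that by simp
      then show ?thesis unfolding G xx(1) using z0 by auto
    qed
    then show ?thesis by (simp only: right_diff_distrib)
  qed
  have "x * \<bar>Am 1 N x - cy * x powr (1 + z) / Gamma (2 + z)\<bar> 
    = \<bar>x * (Am 1 N x - cy * x powr (1 + z) / Gamma (2 + z))\<bar>"
    using x by (simp add: abs_mult)
  also have "\<dots> = \<bar>(x * Am 1 N x - (2 + z) * Am 2 N x) + (2 + z) * (Am 2 N x - cy * x powr (2 + z) / Gamma (3 + z))\<bar>"
    by (simp only: eq0)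
  also have "\<dots> \<le> \<bar>x * Am 1 N x - (2 + z) * Am 2 N x\<bar> + (2 + z) * \<bar>Am 2 N x - cy * x powr (2 + z) / Gamma (3 + z)\<bar>"
  proof -
    have "\<bar>(2 + z) * V\<bar> = (2 + z) * \<bar>V\<bar>" for V using z0 by (simp add: abs_mult)
    then show ?thesis using abs_triangle_ineq[of "x * Am 1 N x - (2 + z) * Am 2 N x" "(2 + z) * (Am 2 N x - cy * x powr (2 + z) / Gamma (3 + z))"]
      by (simp only:)
  qed
  also have "\<dots> \<le> z * theta_err y * (Bc * x ^ 1 * (max 1 x) powr z) + (2 + 2) * (KK * x powr (1 + z))"
  proof (intro add_mono mult_mono Am2_asymp x N)
    have "\<bar>x * Am 1 N x - (2 + z) * Am 2 N x\<bar> \<le> z * theta_err y * Am 1 N x" using x N by (intro Am_recursion) auto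
    also have "\<dots> \<le> z * theta_err y * (Bc * x ^ 1 * (max 1 x) powr z)"
      using x z0 theta_err_ge1[OF y1] by (intro mult_left_mono Am_le) auto
    finally show "\<bar>x * Am 1 N x - (2 + z) * Am 2 N x\<bar> \<le> z * theta_err y * (Bc * x ^ 1 * (max 1 x) powr z)" .
  qed (use z0 z2 in auto)
  also have "\<dots> = x * (5 * KK * x powr z)" using x by (simp add: xx(2) max_def algebra_simps)
  finally show ?thesis using x by (simp add: mult_le_cancel_left_pos)
qed

lemma cy_bounds: "0 < cy" "cy \<le> 1"
proof -
  have "0 \<le> z * (\<Sum>p\<in>pr y. lam p)" using z0 by (intro mult_nonneg_nonneg sum_nonneg) (auto dest!: prD(3) intro: less_imp_le lam_pos)
  then show "0 < cy" "cy \<le> 1" by (auto simp: cy_def)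
qed

end

lemma Gamma_lower: "\<exists>g>0. \<forall>t\<in>{1..5::real}. g \<le> Gamma t"
proof -
  have "continuous_on {1..5::real} Gamma" by (rule continuous_on_Gamma) (auto elim!: nonpos_Ints_cases)
  then obtain m where "m \<in> {1..5}" "\<forall>t\<in>{1..5::real}. Gamma m \<le> Gamma t"
    using continuous_attains_inf[of "{1..5::real}" Gamma] by auto
  then show ?thesis by (intro exI[of _ "Gamma m"]) (auto intro!: Gamma_real_pos)
qed

text \<open>The range [1, 5] contains 1 + z and m + 1 + z for m <= 2 and 0 < z <= 2, which makes the
  bound uniform in z.\<close>

definition gam_inf :: real where "gam_inf = (SOME g. g > 0 \<and> (\<forall>t\<in>{1..5::real}. g \<le> Gamma t))"

lemma gam_inf: "0 < gam_inf" "1 \<le> t \<Longrightarrow> t \<le> 5 \<Longrightarrow> gam_inf \<le> Gamma t"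
proof -
  have "gam_inf > 0 \<and> (\<forall>t\<in>{1..5::real}. gam_inf \<le> Gamma t)" unfolding gam_inf_def
    by (rule someI_ex) (use Gamma_lower in blast)
  then show "0 < gam_inf" "1 \<le> t \<Longrightarrow> t \<le> 5 \<Longrightarrow> gam_inf \<le> Gamma t" by auto
qed

context rough begin

definition B1 :: real where "B1 = 10 * Bc + 1 / gam_inf"

text \<open>Having 1 + x on the right covers x < 1, where no asymptotics are available but both
  terms are bounded, the moment by \<open>Bc\<close> and the main term by 1/\<open>gam_inf\<close>.
  The 10 \<open>Bc\<close> in \<open>B1\<close> is 5 z \<open>Bc\<close> with z <= 2.\<close>

lemma Am_asymp:
  assumes x: "0 \<le> x" "x \<le> ln (real N)" and N: "1 \<le> N" and m: "m = 1 \<or> m = 2"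
  shows "\<bar>Am m N x - cy * x powr (real m + z) / Gamma (real m + 1 + z)\<bar> \<le> B1 * theta_err y * (1 + x) powr (real m - 1 + z)"
proof (cases "1 \<le> x")
  case True
  have "\<bar>Am m N x - cy * x powr (real m + z) / Gamma (real m + 1 + z)\<bar> \<le> 5 * KK * x powr (real m - 1 + z)"
  proof -
    have "KK * x powr (1 + z) \<le> 5 * KK * x powr (1 + z)"
      using z0 theta_err_ge1[OF y1] Bc_ge1 by (intro mult_right_mono) auto
    then show ?thesis using Am1_asymp[OF True x(2) N] Am2_asymp[OF True x(2) N] m by auto
  qed
  also have "\<dots> \<le> 5 * KK * (1 + x) powr (real m - 1 + z)"
    using True z0 m KK_nonneg by (intro mult_left_mono powr_mono2) auto
  also have "5 * KK \<le> 5 * (2 * theta_err y * Bc)"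
    using z2 Bc_ge1 theta_err_ge1[OF y1] by (intro mult_left_mono mult_right_mono) auto
  also have "\<dots> \<le> B1 * theta_err y" using gam_inf(1) theta_err_ge1[OF y1] by (simp add: B1_def algebra_simps)
  finally show ?thesis by (simp add: mult_right_mono)
next
  case False
  have mm: "0 < m" "m \<le> 2" using m by auto
  have "Am m N x \<le> Bc * x ^ m * (max 1 x) powr z" by (rule Am_le[OF x(1) mm(1)])
  also have "\<dots> \<le> Bc * 1 * 1" using False x Bc_ge1 by (intro mult_mono) (auto simp: power_le_one max_def)
  finally have a: "Am m N x \<le> Bc" by simp
  have G: "gam_inf \<le> Gamma (real m + 1 + z)" using z0 z2 m by (intro gam_inf) auto
  have "cy * x powr (real m + z) / Gamma (real m + 1 + z) \<le> (1 * 1) / gam_inf"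
    using cy_bounds False x z0 G gam_inf(1) by (intro frac_le mult_mono powr_le1) auto
  moreover have "0 \<le> cy * x powr (real m + z) / Gamma (real m + 1 + z)" using cy_bounds G gam_inf(1) by auto
  ultimately have "\<bar>Am m N x - cy * x powr (real m + z) / Gamma (real m + 1 + z)\<bar> \<le> Bc + 1 / gam_inf"
    using a Am_nonneg[OF x(1), of m N] Bc_ge1 gam_inf(1) by (simp add: abs_le_iff)
  also have "\<dots> \<le> B1 * 1 * 1" using Bc_ge1 by (simp add: B1_def)
  also have "\<dots> \<le> B1 * theta_err y * (1 + x) powr (real m - 1 + z)"
    using theta_err_ge1[OF y1] x z0 mm Bc_ge1 gam_inf(1) 
    by (intro mult_mono ge_one_powr_ge_zero) (auto simp: B1_def)
  finally show ?thesis .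
qed

end

section \<open>The moment as an expectation\<close>

type_synonym vec = "bool \<times> nat \<Rightarrow> real"

text \<open>Coordinate \<open>(b, i)\<close> of a vector belongs to the \<open>i\<close>-th entry of the first (\<open>b = False\<close>) or second
  (\<open>b = True\<close>) of two \<open>k\<close>-tuples; the matrix position \<open>(i, j)\<close> acts on \<open>(False, i)\<close> and \<open>(True, j)\<close>.\<close>
definition coords :: "nat \<Rightarrow> (bool \<times> nat) set" where
  "coords k = UNIV \<times> {1..k}"

text \<open>The inner maximum keeps each factor in [0, 1] for arbitrary real vectors, so bounds need
  no hypothesis on signs.\<close>

definition window :: "nat \<Rightarrow> real \<Rightarrow> vec \<Rightarrow> real" where
  "window k L u = (\<Prod>c\<in>coords k. max 0 (1 - max 0 (u c) / L))"

definition len :: "nat \<Rightarrow> vec \<Rightarrow> real" where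
  "len k u = (\<Sum>c\<in>coords k. u c)"

text \<open>Multiplicative in u. Where the window is nonzero the length is at most 2kL, so the rate
  k/L costs exp(2k^2); in return a position carrying t, which has length 2t, is weighted by
  exp(-2kt/L).\<close>

definition damping :: "nat \<Rightarrow> real \<Rightarrow> vec \<Rightarrow> real" where
  "damping k L u = exp (- (real k / L * len k u))"

definition nonneg_vecs :: "vec set" where "nonneg_vecs = {u. \<forall>c. 0 \<le> u c}"

lemma nonneg_vecs_nonneg: "u \<in> nonneg_vecs \<Longrightarrow> 0 \<le> u c" unfolding nonneg_vecs_def by blast

lemma finite_coords [simp]: "finite (coords k)" by (simp add: coords_def)

lemma card_coords: "card (coords k) = 2 * k" by (simp add: coords_def card_cartesian_product)

lemma len_add: "len k (u + v) = len k u + len k v"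
  by (simp add: len_def sum.distrib)

lemma len_nonneg: "u \<in> nonneg_vecs \<Longrightarrow> 0 \<le> len k u"
  by (auto simp: len_def nonneg_vecs_def intro: sum_nonneg)

lemma nonneg_vecs_0: "0 \<in> nonneg_vecs" and nonneg_vecs_add: "u \<in> nonneg_vecs \<Longrightarrow> v \<in> nonneg_vecs \<Longrightarrow> u + v \<in> nonneg_vecs"
  by (auto simp: nonneg_vecs_def)

lemma damping_add: "damping k L (u + v) = damping k L u * damping k L v"
  by (simp add: damping_def len_add distrib_left exp_add[symmetric])

lemma damping_bounds: "0 < L \<Longrightarrow> u \<in> nonneg_vecs \<Longrightarrow> 0 \<le> damping k L u \<and> damping k L u \<le> 1"
  using len_nonneg[of u k] by (simp add: damping_def)

lemma damping_0: "damping k L 0 = 1" by (simp add: damping_def len_def)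

lemma window_factor_bounds: "0 < L \<Longrightarrow> 0 \<le> max 0 (1 - max 0 x / L) \<and> max 0 (1 - max 0 x / L) \<le> (1::real)"
  by (auto simp: max_def)

lemma window_bounds: "0 < L \<Longrightarrow> 0 \<le> window k L u \<and> window k L u \<le> 1"
  unfolding window_def using window_factor_bounds[of L] by (auto intro!: prod_nonneg prod_le_1)

lemma window_eq_0: assumes "0 < L" "c \<in> coords k" "L \<le> u c" shows "window k L u = 0"
  unfolding window_def using assms by (intro prod_zero) (auto intro!: bexI[of _ c] simp: max_def field_simps)

lemma exp_damping_ge_1:
  assumes L: "0 < L" and u: "\<And>c. c \<in> coords k \<Longrightarrow> u c \<le> L"
  shows "1 \<le> exp (2 * real k ^ 2) * damping k L u"
proof -
  have "len k u \<le> of_nat (card (coords k)) * L" unfolding len_def by (rule sum_bounded_above) (use u in auto)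
  then have "len k u \<le> 2 * real k * L" by (simp add: card_coords)
  then have "real k / L * len k u \<le> real k / L * (2 * real k * L)" using L by (intro mult_left_mono) auto
  also have "\<dots> = 2 * real k ^ 2" using L by (simp add: power2_eq_square)
  finally have "exp 0 \<le> exp (2 * real k ^ 2 + - (real k / L * len k u))" by (subst exp_le_cancel_iff) linarith
  then show ?thesis by (simp only: exp_add damping_def exp_zero)
qed

text \<open>A difference of products of factors in [0, 1] is at most the sum of the differences of
  factors, here at most the length of h divided by L. The damping then enters by multiplying with a
  quantity that is at least 1.\<close>

lemma window_lipschitz:
  assumes L: "0 < L" and u: "u \<in> nonneg_vecs" and h: "h \<in> nonneg_vecs"
  shows "\<bar>window k L (u + h) - window k L u\<bar> \<le> exp (2 * real k ^ 2) / L * len k h * damping k L u"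
proof (cases "\<exists>c\<in>coords k. L \<le> u c")
  \<comment> \<open>A coordinate that has left the window stays outside when h is added, so both
    values vanish.\<close>
  case True
  then obtain c where c: "c \<in> coords k" "L \<le> u c" by blast
  have "0 \<le> h c" using h by (rule nonneg_vecs_nonneg)
  then have "L \<le> (u + h) c" using c by simp
  then have "window k L (u + h) = 0" "window k L u = 0" using window_eq_0 L c by blast+
  then show ?thesis using L len_nonneg[OF h] damping_bounds[OF L u] by simp
next
  case False
  have 1: "1 \<le> exp (2 * real k ^ 2) * damping k L u" by (rule exp_damping_ge_1[OF L]) (use False in \<open>meson le_cases\<close>)
  have "\<bar>window k L (u + h) - window k L u\<bar> \<le> (\<Sum>c\<in>coords k. \<bar>max 0 (1 - max 0 ((u + h) c) / L) - max 0 (1 - max 0 (u c) / L)\<bar>)"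
    unfolding window_def using norm_prod_diff[of "coords k" "\<lambda>c. max 0 (1 - max 0 ((u + h) c) / L)" "\<lambda>c. max 0 (1 - max 0 (u c) / L)"] 
      window_factor_bounds[OF L] by (simp del: plus_fun_apply)
  also have "\<dots> \<le> (\<Sum>c\<in>coords k. h c / L)"
  proof (rule sum_mono)
    fix c
    have "0 \<le> u c" "0 \<le> h c" using u h by (auto intro: nonneg_vecs_nonneg)
    then have a: "max 0 (1 - max 0 ((u + h) c) / L) = max 0 ((1 - u c / L) - h c / L)" "max 0 (1 - max 0 (u c) / L) = max 0 (1 - u c / L)" "0 \<le> h c / L"
      using L by (simp_all add: add_divide_distrib algebra_simps)
    have "\<bar>max 0 (A - B) - max 0 A\<bar> \<le> B" if "0 \<le> B" for A B :: real using that by (simp add: max_def)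
    from this[OF a(3)] show "\<bar>max 0 (1 - max 0 ((u + h) c) / L) - max 0 (1 - max 0 (u c) / L)\<bar> \<le> h c / L"
      unfolding a(1,2) .
  qed
  also have "\<dots> = len k h / L * 1" by (simp add: len_def sum_divide_distrib)
  also have "\<dots> \<le> len k h / L * (exp (2 * real k ^ 2) * damping k L u)"
    using 1 L len_nonneg[OF h] by (intro mult_left_mono) auto
  finally show ?thesis by (simp add: mult_ac)
qed

section \<open>Local masses and the law of the exponents of one prime\<close>

definition comps :: "nat \<Rightarrow> nat \<Rightarrow> (nat \<Rightarrow> nat) set" where
  "comps k j = {a \<in> {1..k} \<rightarrow>\<^sub>E UNIV. (\<Sum>i=1..k. a i) = j}"

text \<open>Stars and bars for lists, carried over to extensional functions on {1..k}.\<close>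

lemma card_comps: "finite (comps k j) \<and> card (comps k j) = dk_pp k j"
proof -
  let ?S = "{l::nat list. length l = k \<and> sum_list l = j}"
  have bij: "bij_betw (\<lambda>l. \<lambda>i\<in>{1..k}. l ! (i - 1)) ?S (comps k j)"
  proof (rule bij_betw_byWitness[where f' = "\<lambda>a. map (\<lambda>i. a (Suc i)) [0..<k]"])
    show "\<forall>l\<in>?S. map (\<lambda>i. (\<lambda>i\<in>{1..k}. l ! (i - 1)) (Suc i)) [0..<k] = l"
      by (auto intro!: nth_equalityI)
    show "\<forall>a\<in>comps k j. (\<lambda>i\<in>{1..k}. map (\<lambda>i. a (Suc i)) [0..<k] ! (i - 1)) = a"
      by (auto simp: comps_def fun_eq_iff restrict_def PiE_def extensional_def)
    have sum: "(\<Sum>i=1..k. g (i - 1)) = (\<Sum>i<k. g i)" for g :: "nat \<Rightarrow> nat"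
      by (rule sum.reindex_bij_witness[of _ Suc "\<lambda>i. i - 1"]) auto
    show "(\<lambda>l. \<lambda>i\<in>{1..k}. l ! (i - 1)) ` ?S \<subseteq> comps k j"
    proof
      fix a assume "a \<in> (\<lambda>l. \<lambda>i\<in>{1..k}. l ! (i - 1)) ` ?S"
      then obtain l where l: "length l = k" "sum_list l = j" and a: "a = (\<lambda>i\<in>{1..k}. l ! (i - 1))" by auto
      have "(\<Sum>i=1..k. a i) = (\<Sum>i=1..k. l ! (i - 1))" by (simp add: a)
      also have "\<dots> = j" using sum[of "\<lambda>i. l ! i"] l by (simp add: sum_list_sum_nth atLeast0LessThan)
      finally show "a \<in> comps k j" using a by (auto simp: comps_def)
    qed
    show "(\<lambda>a. map (\<lambda>i. a (Suc i)) [0..<k]) ` comps k j \<subseteq> ?S"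
    proof
      fix l assume "l \<in> (\<lambda>a. map (\<lambda>i. a (Suc i)) [0..<k]) ` comps k j"
      then obtain a where a: "a \<in> comps k j" "l = map (\<lambda>i. a (Suc i)) [0..<k]" by auto
      have "sum_list l = (\<Sum>i<k. a (Suc i))" by (simp add: a(2) interv_sum_list_conv_sum_set_nat atLeast0LessThan)
      also have "\<dots> = (\<Sum>i=1..k. a (Suc (i - 1)))" by (rule sum[symmetric])
      also have "\<dots> = (\<Sum>i=1..k. a i)" by (intro sum.cong) auto
      finally show "l \<in> ?S" using a by (simp add: comps_def)
    qed
  qed
  have "card ?S = dk_pp k j" unfolding dk_pp_def by (rule card_length_sum_list)
  moreover have "finite ?S"
  proof (rule finite_subset)
    show "?S \<subseteq> {l. set l \<subseteq> {..j} \<and> length l = k}" by (auto dest: member_le_sum_list)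
    show "finite {l. set l \<subseteq> {..j} \<and> length l = k}" by (rule finite_lists_length_eq) simp
  qed
  ultimately show ?thesis using bij_betw_finite[OF bij] bij_betw_same_card[OF bij] by simp
qed

lemma dk_pp_pos: "1 \<le> k \<Longrightarrow> 0 < dk_pp k j" by (simp add: dk_pp_def)

lemma comps_nonempty: "1 \<le> k \<Longrightarrow> comps k j \<noteq> {}"
  using card_comps[of k j] dk_pp_pos[of k j] by auto

definition mass :: "nat \<Rightarrow> real \<Rightarrow> real" where
  "mass k r = (\<Sum>j. real (dk_pp k j) ^ 2 * r ^ j)"

text \<open>The binomial series of (1 - x)^(-k), read off from the total mass 1 of the negative
  binomial law.\<close>

lemma negbin_sums:
  assumes "0 \<le> x" "x < 1"
  shows "(\<lambda>j. real (dk_pp k j) * x ^ j) sums ((1 - x) powr (- real k))"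
proof -
  have p: "1 - x \<in> {0<..1}" using assms by auto
  have "(\<lambda>j. pmf (neg_binomial_pmf k (1 - x)) j) sums 1"
    using sums_integral_count_space_nat[of "pmf (neg_binomial_pmf k (1 - x))"] integrable_pmf[of UNIV "neg_binomial_pmf k (1 - x)"]
      integral_pmf[of UNIV "neg_binomial_pmf k (1 - x)"] by simp
  then have "(\<lambda>j. (1 - x) powr (- real k) * pmf (neg_binomial_pmf k (1 - x)) j) sums ((1 - x) powr (- real k) * 1)"
    by (rule sums_mult)
  moreover have "(1 - x) powr (- real k) * pmf (neg_binomial_pmf k (1 - x)) j = real (dk_pp k j) * x ^ j" for j
    using assms by (simp add: pmf_neg_binomial[OF p] dk_pp_def powr_minus powr_realpow)
  ultimately show ?thesis by simp
qed

text \<open>With x the square root of r, the sum of the squares of the terms d_k(p^j) x^j is at most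
  the square of their sum. The exponent 2k is what later makes the product over p <= 8k^2 only
  exp(O(k^2)).\<close>

lemma mass_partial_le:
  assumes x: "0 \<le> x" "x < 1" and A: "finite A"
  shows "(\<Sum>j\<in>A. real (dk_pp k j) ^ 2 * (x\<^sup>2) ^ j) \<le> (1 - x) powr (- (2 * real k))"
proof -
  have "(\<Sum>j\<in>A. real (dk_pp k j) ^ 2 * (x\<^sup>2) ^ j) = (\<Sum>j\<in>A. (real (dk_pp k j) * x ^ j)\<^sup>2)"
    by (simp add: power_mult_distrib flip: power_mult) (simp add: mult.commute)
  also have "\<dots> \<le> (\<Sum>j\<in>A. real (dk_pp k j) * x ^ j)\<^sup>2"
    using A x by (induction A rule: finite_induct) (auto simp: power2_sum intro!: mult_nonneg_nonneg sum_nonneg add_mono add_increasing2)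
  also have "\<dots> \<le> ((1 - x) powr (- real k))\<^sup>2"
  proof (rule power_mono)
    show "(\<Sum>j\<in>A. real (dk_pp k j) * x ^ j) \<le> (1 - x) powr (- real k)"
      using sum_le_suminf[OF sums_summable[OF negbin_sums[OF x]] A] sums_unique[OF negbin_sums[OF x, of k]] x by auto
  qed (use x in \<open>auto intro: sum_nonneg\<close>)
  also have "\<dots> = (1 - x) powr (- (2 * real k))" using x by (simp add: powr_power mult.commute)
  finally show ?thesis .
qed

lemma mass_summable:
  assumes r: "0 \<le> r" "r < 1"
  shows "summable (\<lambda>j. real (dk_pp k j) ^ 2 * r ^ j)"
proof (rule summableI_nonneg_bounded)
  have "r < 1\<^sup>2" using r by simp
  then have "sqrt r < 1" using r real_less_lsqrt by fastforce
  then show "(\<Sum>j<n. real (dk_pp k j) ^ 2 * r ^ j) \<le> (1 - sqrt r) powr (- (2 * real k))" for n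
    using mass_partial_le[of "sqrt r" "{..<n}" k] r by simp
qed (use r in auto)

lemma mass_le:
  assumes x: "0 \<le> x" "x < 1" shows "mass k (x\<^sup>2) \<le> (1 - x) powr (- (2 * real k))"
  unfolding mass_def
proof (rule suminf_le_const)
  have "x\<^sup>2 < 1" using x by (simp add: abs_square_less_1)
  then show "summable (\<lambda>j. real (dk_pp k j) ^ 2 * (x\<^sup>2) ^ j)" by (intro mass_summable) auto
qed (use mass_partial_le[OF x] in auto)

lemma mass_ge_1:
  assumes r: "0 \<le> r" "r < 1" and k: "1 \<le> k" shows "1 \<le> mass k r"
proof -
  have "(\<Sum>j\<in>{0}. real (dk_pp k j) ^ 2 * r ^ j) \<le> mass k r"
    unfolding mass_def by (rule sum_le_suminf[OF mass_summable[OF r]]) (use r in auto)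
  then show ?thesis by (simp add: dk_pp_def)
qed

definition Jpmf :: "nat \<Rightarrow> real \<Rightarrow> nat pmf" where
  "Jpmf k r = embed_pmf (\<lambda>j. real (dk_pp k j) ^ 2 * r ^ j / mass k r)"

lemma pmf_Jpmf:
  assumes r: "0 \<le> r" "r < 1" and k: "1 \<le> k"
  shows "pmf (Jpmf k r) j = real (dk_pp k j) ^ 2 * r ^ j / mass k r"
  unfolding Jpmf_def
proof (rule pmf_embed_pmf)
  have m: "1 \<le> mass k r" by (rule mass_ge_1[OF assms])
  show "0 \<le> real (dk_pp k x) ^ 2 * r ^ x / mass k r" for x using r m by auto
  have "(\<lambda>j. real (dk_pp k j) ^ 2 * r ^ j / mass k r) sums (mass k r / mass k r)"
    unfolding mass_def by (intro sums_divide summable_sums mass_summable r)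
  then have "(\<lambda>j. real (dk_pp k j) ^ 2 * r ^ j / mass k r) sums 1" using m by simp
  then have "(\<Sum>j. ennreal (real (dk_pp k j) ^ 2 * r ^ j / mass k r)) = ennreal 1"
    by (rule suminf_ennreal_eq[rotated]) (use r m in auto)
  then show "(\<integral>\<^sup>+x. ennreal (real (dk_pp k x) ^ 2 * r ^ x / mass k r) \<partial>count_space UNIV) = 1"
    by (simp only: nn_integral_count_space_nat ennreal_1)
qed

text \<open>The exponents of p in two k-tuples with equal products are two compositions of a common
  j. There are d_k(p^j)^2 such pairs; choosing j first and then the pair uniformly gives each pair
  the weight r^j divided by the mass.\<close>

definition XX :: "nat \<Rightarrow> real \<Rightarrow> ((nat \<Rightarrow> nat) \<times> (nat \<Rightarrow> nat)) pmf" where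
  "XX k r = bind_pmf (Jpmf k r) (\<lambda>j. pair_pmf (pmf_of_set (comps k j)) (pmf_of_set (comps k j)))"

lemma pmf_of_comps:
  assumes "1 \<le> k"
  shows "pmf (pmf_of_set (comps k j)) a = (if a \<in> comps k j then 1 / real (dk_pp k j) else 0)"
  using pmf_of_set[OF comps_nonempty[OF assms, of j]] card_comps[of k j] by (simp add: indicator_def)

lemma comps_sum: "a \<in> comps k j \<Longrightarrow> (\<Sum>i=1..k. a i) = j" by (simp add: comps_def)

lemma pmf_XX:
  assumes r: "0 \<le> r" "r < 1" and k: "1 \<le> k"
  shows "pmf (XX k r) (a, b) = (if a \<in> comps k (\<Sum>i=1..k. a i) \<and> b \<in> comps k (\<Sum>i=1..k. a i) then r ^ (\<Sum>i=1..k. a i) / mass k r else 0)"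
proof -
  let ?n = "\<Sum>i=1..k. a i"
  have "pmf (XX k r) (a, b) = measure_pmf.expectation (Jpmf k r) (\<lambda>j. pmf (pmf_of_set (comps k j)) a * pmf (pmf_of_set (comps k j)) b)"
    by (simp add: XX_def pmf_bind pmf_pair)
  also have "\<dots> = (\<Sum>j\<in>{?n}. pmf (Jpmf k r) j * (pmf (pmf_of_set (comps k j)) a * pmf (pmf_of_set (comps k j)) b))"
    by (rule integral_measure_pmf[where A = "{?n}", THEN trans]) (auto simp: pmf_of_comps[OF k] dest!: comps_sum split: if_splits)
  also have "\<dots> = (if a \<in> comps k ?n \<and> b \<in> comps k ?n then r ^ ?n / mass k r else 0)"
    using dk_pp_pos[OF k, of ?n]
    by (simp add: pmf_of_comps[OF k] pmf_Jpmf[OF assms] power2_eq_square)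
  finally show ?thesis .
qed

definition vecp :: "nat \<Rightarrow> nat \<Rightarrow> (nat \<Rightarrow> nat) \<times> (nat \<Rightarrow> nat) \<Rightarrow> vec" where
  "vecp k p ab = (\<lambda>(c, i). if i \<in> {1..k} then real (if c then snd ab i else fst ab i) * ln (real p) else 0)"

definition Xp :: "nat \<Rightarrow> real \<Rightarrow> nat \<Rightarrow> vec pmf" where
  "Xp k z p = map_pmf (vecp k p) (XX k (z / real p))"

section \<open>Orthogonality and factorisation of the moment\<close>

lemma mean_cos_sum:
  assumes "finite A"
  shows "((\<lambda>T. (1 / T) * integral {0..T} (\<lambda>t. \<Sum>x\<in>A. c x * cos (t * \<theta> x))) \<longlongrightarrow> (\<Sum>x\<in>A. if \<theta> x = 0 then c x else (0::real))) at_top"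
proof -
  define I where "I = (\<lambda>T \<theta>. if \<theta> = 0 then T else sin (T * \<theta>) / (\<theta>::real))"
  have i: "((\<lambda>t. cos (t * \<theta>)) has_integral I T \<theta>) {0..T}" if "0 \<le> T" for T \<theta>
  proof (cases "\<theta> = 0")
    case True
    then show ?thesis using that has_integral_const_real[of "1::real" 0 T] by (simp add: I_def)
  next
    case False
    have "((\<lambda>t. cos (t * \<theta>)) has_integral (sin (T * \<theta>) / \<theta> - sin (0 * \<theta>) / \<theta>)) {0..T}"
      by (rule fundamental_theorem_of_calculus[OF that])
        (use False in \<open>auto intro!: derivative_eq_intros simp: has_real_derivative_iff_has_vector_derivative[symmetric]\<close>)
    then show ?thesis using False by (simp add: I_def)
  qed
  have "((\<lambda>T. \<Sum>x\<in>A. c x * (I T (\<theta> x) / T)) \<longlongrightarrow> (\<Sum>x\<in>A. c x * (if \<theta> x = 0 then 1 else 0))) at_top"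
  proof (intro tendsto_sum tendsto_mult tendsto_const)
    fix x
    show "((\<lambda>T. I T (\<theta> x) / T) \<longlongrightarrow> (if \<theta> x = 0 then 1 else 0)) at_top"
    proof (cases "\<theta> x = 0")
      case True
      have "\<forall>\<^sub>F T in at_top. I T (\<theta> x) / T = 1" using eventually_gt_at_top[of "0::real"]
        by eventually_elim (use True in \<open>simp add: I_def\<close>)
      then show ?thesis using True by (simp add: tendsto_eventually)
    next
      case False
      have "((\<lambda>T. I T (\<theta> x) / T) \<longlongrightarrow> 0) at_top"
      proof (rule Lim_null_comparison)
        show "\<forall>\<^sub>F T in at_top. norm (I T (\<theta> x) / T) \<le> (1 / \<bar>\<theta> x\<bar>) / T" using eventually_gt_at_top[of "0::real"]
        proof eventually_elim
          case (elim T)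
          have "norm (I T (\<theta> x) / T) = \<bar>sin (T * \<theta> x)\<bar> / \<bar>\<theta> x\<bar> / T" using elim False by (simp add: I_def abs_mult)
          also have "\<dots> \<le> 1 / \<bar>\<theta> x\<bar> / T" using elim by (intro divide_right_mono abs_sin_le_one) auto
          finally show ?case .
        qed
        show "((\<lambda>T. (1 / \<bar>\<theta> x\<bar>) / T) \<longlongrightarrow> 0) at_top"
          by (rule real_tendsto_divide_at_top[OF tendsto_const filterlim_ident])
      qed
      then show ?thesis using False by simp
    qed
  qed
  moreover have "\<forall>\<^sub>F T in at_top. (\<Sum>x\<in>A. c x * (I T (\<theta> x) / T)) = (1 / T) * integral {0..T} (\<lambda>t. \<Sum>x\<in>A. c x * cos (t * \<theta> x))"
    using eventually_gt_at_top[of "0::real"]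
  proof eventually_elim
    case (elim T)
    have "((\<lambda>t. \<Sum>x\<in>A. c x * cos (t * \<theta> x)) has_integral (\<Sum>x\<in>A. c x * I T (\<theta> x))) {0..T}"
      by (intro has_integral_sum assms has_integral_mult_right i) (use elim in auto)
    then show ?case by (simp add: integral_unique sum_divide_distrib)
  qed
  ultimately have "((\<lambda>T. (1 / T) * integral {0..T} (\<lambda>t. \<Sum>x\<in>A. c x * cos (t * \<theta> x))) \<longlongrightarrow> (\<Sum>x\<in>A. c x * (if \<theta> x = 0 then 1 else 0))) at_top"
    by (rule Lim_transform_eventually)
  moreover have "(\<Sum>x\<in>A. c x * (if \<theta> x = 0 then 1 else 0)) = (\<Sum>x\<in>A. if \<theta> x = 0 then c x else 0)"
    by (intro sum.cong) auto
  ultimately show ?thesis by simp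
qed

definition wn :: "nat \<Rightarrow> real \<Rightarrow> nat \<Rightarrow> real" where
  "wn N \<rho> n = \<rho> ^ bigOmega n * (1 - ln (real n) / ln (real N)) / sqrt (real n)"

lemma of_nat_powr_half:
  assumes "1 \<le> n"
  shows "(of_nat n :: complex) powr (1/2 + \<i> * complex_of_real t) = of_real (sqrt (real n)) * cis (t * ln (real n))"
proof -
  have n: "0 < real n" using assms by simp
  have "(of_nat n :: complex) powr (1/2 + \<i> * complex_of_real t) = exp ((1/2 + \<i> * of_real t) * of_real (ln (real n)))"
    using assms Ln_of_real[OF n] by (simp add: powr_def)
  also have "(1/2 + \<i> * of_real t) * of_real (ln (real n)) = complex_of_real (ln (real n) / 2) + \<i> * of_real (t * ln (real n))"
    by (simp add: algebra_simps)
  also have "exp \<dots> = of_real (exp (ln (real n) / 2)) * cis (t * ln (real n))"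
    by (simp only: exp_add cis_conv_exp exp_of_real)
  also have "exp (ln (real n) / 2) = sqrt (real n)"
  proof -
    have "ln (sqrt (real n)) = ln (real n) / 2" using n by (simp add: ln_sqrt)
    then have "exp (ln (real n) / 2) = exp (ln (sqrt (real n)))" by (simp only:)
    also have "\<dots> = sqrt (real n)" using n by (intro exp_ln) simp
    finally show ?thesis .
  qed
  finally show ?thesis .
qed

lemma dirpoly_cis: "dirpoly N \<rho> t = (\<Sum>n=1..N. of_real (wn N \<rho> n) * cis (- (t * ln (real n))))"
  unfolding dirpoly_def
proof (rule sum.cong)
  fix n assume "n \<in> {1..N}"
  then have n: "1 \<le> n" by simp
  have "x / (s * cis a) = x / s * cis (- a)" for x s :: complex and a
    by (simp add: divide_inverse flip: cis_inverse)
  then show "complex_of_real (\<rho> ^ bigOmega n * (1 - ln (real n) / ln (real N))) / (of_nat n) powr (1/2 + \<i> * complex_of_real t)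
     = of_real (wn N \<rho> n) * cis (- (t * ln (real n)))"
    unfolding of_nat_powr_half[OF n] by (simp add: wn_def)
qed simp

lemma cmod_sum_cis_squared:
  assumes "finite F"
  shows "(cmod (\<Sum>f\<in>F. of_real (c f) * cis (- (t * l f))))\<^sup>2 = (\<Sum>(f,g)\<in>F\<times>F. c f * c g * cos (t * (l f - l g)))"
proof -
  have "(cmod (\<Sum>f\<in>F. of_real (c f) * cis (- (t * l f))))\<^sup>2 = (\<Sum>f\<in>F. c f * cos (t * l f))\<^sup>2 + (\<Sum>f\<in>F. c f * sin (t * l f))\<^sup>2"
    by (simp add: cmod_power2 sum_negf)
  also have "\<dots> = (\<Sum>f\<in>F. \<Sum>g\<in>F. c f * c g * (cos (t * l f) * cos (t * l g) + sin (t * l f) * sin (t * l g)))"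
    by (simp add: power2_eq_square sum_product sum.distrib[symmetric] algebra_simps)
  also have "\<dots> = (\<Sum>(f,g)\<in>F\<times>F. c f * c g * cos (t * (l f - l g)))"
    by (simp add: sum.cartesian_product cos_diff right_diff_distrib)
  finally show ?thesis .
qed

text \<open>Orthogonality is applied to the k-th power, whose frequencies are the logarithms of the
  products f(1)...f(k); the mean of cos(t theta) vanishes unless theta = 0, that is, unless two
  products agree.\<close>

lemma moment_S_eq:
  assumes N: "2 \<le> N"
  shows "moment_S k \<rho> N = (\<Sum>(f,g)\<in>({1..k} \<rightarrow>\<^sub>E {1..N}) \<times> ({1..k} \<rightarrow>\<^sub>E {1..N}). 
     if (\<Prod>i=1..k. f i) = (\<Prod>i=1..k. g i) then (\<Prod>i=1..k. wn N \<rho> (f i)) * (\<Prod>i=1..k. wn N \<rho> (g i)) else 0)"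
proof -
  let ?F = "{1..k} \<rightarrow>\<^sub>E {1..N}"
  let ?c = "\<lambda>f. \<Prod>i=1..k. wn N \<rho> (f i)"
  let ?l = "\<lambda>f. \<Sum>i=1..k. ln (real (f i))"
  have fin: "finite ?F" by (intro finite_PiE) auto
  have cis_prod: "(\<Prod>i\<in>A. cis (h i)) = cis (\<Sum>i\<in>A. h i)" if "finite A" for h :: "nat \<Rightarrow> real" and A
    using that by induction (auto simp: cis_mult)
  have pw: "dirpoly N \<rho> t ^ k = (\<Sum>f\<in>?F. of_real (?c f) * cis (- (t * ?l f)))" for t
  proof -
    have "dirpoly N \<rho> t ^ k = (\<Prod>i\<in>{1..k}. \<Sum>n\<in>{1..N}. of_real (wn N \<rho> n) * cis (- (t * ln (real n))))"
      by (simp add: dirpoly_cis)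
    also have "\<dots> = (\<Sum>f\<in>?F. \<Prod>i\<in>{1..k}. of_real (wn N \<rho> (f i)) * cis (- (t * ln (real (f i)))))"
      by (rule prod_sum_PiE) auto
    also have "\<dots> = (\<Sum>f\<in>?F. of_real (?c f) * cis (- (t * ?l f)))"
      by (intro sum.cong refl) (simp only: prod.distrib cis_prod[OF finite_atLeastAtMost] of_real_prod sum_negf sum_distrib_left)
    finally show ?thesis .
  qed
  have "cmod (dirpoly N \<rho> t) ^ (2 * k) = (\<Sum>x\<in>?F \<times> ?F. (?c (fst x) * ?c (snd x)) * cos (t * (?l (fst x) - ?l (snd x))))" for t
  proof -
    have "cmod (dirpoly N \<rho> t) ^ (2 * k) = (cmod (dirpoly N \<rho> t ^ k))\<^sup>2"
      by (simp add: norm_power mult.commute flip: power_mult)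
    also have "\<dots> = (\<Sum>(f,g)\<in>?F\<times>?F. ?c f * ?c g * cos (t * (?l f - ?l g)))"
      unfolding pw by (rule cmod_sum_cis_squared[OF fin])
    finally show ?thesis by (simp only: case_prod_unfold)
  qed
  then have "moment_S k \<rho> N = Lim at_top (\<lambda>T::real. (1 / T) * integral {0..T} (\<lambda>t. \<Sum>x\<in>?F \<times> ?F. (?c (fst x) * ?c (snd x)) * cos (t * (?l (fst x) - ?l (snd x)))))"
    unfolding moment_S_def by (simp only:)
  also have "\<dots> = (\<Sum>x\<in>?F \<times> ?F. if ?l (fst x) - ?l (snd x) = 0 then ?c (fst x) * ?c (snd x) else 0)"
    by (rule tendsto_Lim[OF _ mean_cos_sum]) (use fin in auto)
  also have "\<dots> = (\<Sum>x\<in>?F \<times> ?F. if (\<Prod>i=1..k. fst x i) = (\<Prod>i=1..k. snd x i) then ?c (fst x) * ?c (snd x) else 0)"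
  proof (rule sum.cong)
    fix x assume x: "x \<in> ?F \<times> ?F"
    have p: "0 < real (\<Prod>i=1..k. f i)" "?l f = ln (real (\<Prod>i=1..k. f i))" if "f \<in> ?F" for f
    proof -
      have "\<forall>i\<in>{1..k}. 0 < f i" using that by (force simp: PiE_iff)
      then show "0 < real (\<Prod>i=1..k. f i)" unfolding of_nat_prod by (intro prod_pos) auto
      show "?l f = ln (real (\<Prod>i=1..k. f i))" unfolding of_nat_prod
        by (rule ln_prod[symmetric]) (use \<open>\<forall>i\<in>{1..k}. 0 < f i\<close> in auto)
    qed
    have "?l (fst x) - ?l (snd x) = 0 \<longleftrightarrow> ln (real (\<Prod>i=1..k. fst x i)) = ln (real (\<Prod>i=1..k. snd x i))"
      using x p(2) by (metis SigmaE eq_iff_diff_eq_0 fst_conv snd_conv)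
    also have "\<dots> \<longleftrightarrow> (\<Prod>i=1..k. fst x i) = (\<Prod>i=1..k. snd x i)"
      using x p(1)[of "fst x"] p(1)[of "snd x"] by (subst ln_inj_iff) (auto simp del: of_nat_prod)
    finally show "(if ?l (fst x) - ?l (snd x) = 0 then ?c (fst x) * ?c (snd x) else 0) = 
      (if (\<Prod>i=1..k. fst x i) = (\<Prod>i=1..k. snd x i) then ?c (fst x) * ?c (snd x) else 0)" by simp
  qed simp
  finally show ?thesis by (simp only: case_prod_unfold)
qed

definition vecn :: "nat \<Rightarrow> (nat \<Rightarrow> nat) \<Rightarrow> (nat \<Rightarrow> nat) \<Rightarrow> vec" where
  "vecn k f g = (\<lambda>(c, i). if i \<in> {1..k} then ln (real (if c then g i else f i)) else 0)"

lemma bigOmega_eq: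
  assumes m: "m \<in> {1..n}" shows "bigOmega m = (\<Sum>p\<in>pr n. multiplicity p m)"
proof -
  have "bigOmega m = (\<Sum>p\<in>prime_factors m. multiplicity p m)"
    unfolding bigOmega_def size_multiset_overloaded_eq
    by (intro sum.cong refl) (auto simp: count_prime_factorization prime_factors_multiplicity)
  also have "\<dots> = (\<Sum>p\<in>pr n. multiplicity p m)"
    by (rule sum.mono_neutral_left) (use prime_factors_sub_pr[OF m] in \<open>auto simp: prime_factors_multiplicity pr_def\<close>)
  finally show ?thesis .
qed

lemma prod_primes_eq:
  assumes m: "m \<in> {1..n}" shows "(\<Prod>p\<in>pr n. p ^ multiplicity p m) = m"
proof -
  have "m = (\<Prod>p\<in>prime_factors m. p ^ multiplicity p m)" using m by (intro prime_factorization_nat) auto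
  also have "\<dots> = (\<Prod>p\<in>pr n. p ^ multiplicity p m)"
    by (rule prod.mono_neutral_left) (use prime_factors_sub_pr[OF m] in \<open>auto simp: prime_factors_multiplicity pr_def\<close>)
  finally show ?thesis by simp
qed

lemma window_vecn:
  assumes N: "2 \<le> N" and f: "f \<in> {1..k} \<rightarrow>\<^sub>E {1..N}" and g: "g \<in> {1..k} \<rightarrow>\<^sub>E {1..N}"
  shows "window k (ln (real N)) (vecn k f g) = (\<Prod>i=1..k. 1 - ln (real (f i)) / ln (real N)) * (\<Prod>i=1..k. 1 - ln (real (g i)) / ln (real N))"
proof -
  have L: "0 < ln (real N)" using N by simp
  have h: "max 0 (1 - max 0 (ln (real (h i))) / ln (real N)) = 1 - ln (real (h i)) / ln (real N)" 
    if "h \<in> {1..k} \<rightarrow>\<^sub>E {1..N}" "i \<in> {1..k}" for h i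
  proof -
    have "h i \<in> {1..N}" using that by (auto simp: PiE_iff)
    then have "0 \<le> ln (real (h i))" "ln (real (h i)) \<le> ln (real N)" by auto
    then show ?thesis using L by (simp add: max_def field_simps)
  qed
  have "window k (ln (real N)) (vecn k f g) = (\<Prod>(c,i)\<in>UNIV \<times> {1..k}. max 0 (1 - max 0 (vecn k f g (c,i)) / ln (real N)))"
    by (simp add: window_def coords_def case_prod_unfold)
  also have "\<dots> = (\<Prod>c\<in>(UNIV::bool set). \<Prod>i=1..k. max 0 (1 - max 0 (vecn k f g (c,i)) / ln (real N)))"
    by (rule prod.cartesian_product[symmetric])
  also have "\<dots> = (\<Prod>i=1..k. max 0 (1 - max 0 (ln (real (f i))) / ln (real N))) * (\<Prod>i=1..k. max 0 (1 - max 0 (ln (real (g i))) / ln (real N)))"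
    by (simp add: UNIV_bool vecn_def)
  also have "\<dots> = (\<Prod>i=1..k. 1 - ln (real (f i)) / ln (real N)) * (\<Prod>i=1..k. 1 - ln (real (g i)) / ln (real N))"
    by (intro arg_cong2[where f = "(*)"] prod.cong refl h f g)
  finally show ?thesis .
qed

text \<open>Encodes a pair of tuples by its prime exponents as a point of the product space. Off
  \<open>pr N\<close> it takes the default value of the product law, and the restrictions match the
  extensional functions in \<open>comps\<close>.\<close>

definition phi :: "nat \<Rightarrow> nat \<Rightarrow> (nat \<Rightarrow> nat) \<times> (nat \<Rightarrow> nat) \<Rightarrow> nat \<Rightarrow> (nat \<Rightarrow> nat) \<times> (nat \<Rightarrow> nat)" where
  "phi k N fg = (\<lambda>p. if p \<in> pr N then (\<lambda>i\<in>{1..k}. multiplicity p (fst fg i), \<lambda>i\<in>{1..k}. multiplicity p (snd fg i)) else ((\<lambda>_. 0), (\<lambda>_. 0)))"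

definition prs :: "nat \<Rightarrow> nat \<Rightarrow> ((nat \<Rightarrow> nat) \<times> (nat \<Rightarrow> nat)) set" where
  "prs k N = {(f, g) \<in> ({1..k} \<rightarrow>\<^sub>E {1..N}) \<times> ({1..k} \<rightarrow>\<^sub>E {1..N}). (\<Prod>i=1..k. f i) = (\<Prod>i=1..k. g i)}"

lemma finite_prs: "finite (prs k N)"
  by (rule finite_subset[of _ "({1..k} \<rightarrow>\<^sub>E {1..N}) \<times> ({1..k} \<rightarrow>\<^sub>E {1..N})"]) (auto simp: prs_def intro!: finite_PiE)

lemma phi_inj: "inj_on (phi k N) (prs k N)"
proof (rule inj_onI)
  fix x x' assume x: "x \<in> prs k N" "x' \<in> prs k N" "phi k N x = phi k N x'"
  obtain f g where fg: "x = (f, g)" by force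
  obtain f' g' where fg': "x' = (f', g')" by force
  have P: "f \<in> {1..k} \<rightarrow>\<^sub>E {1..N}" "g \<in> {1..k} \<rightarrow>\<^sub>E {1..N}" "f' \<in> {1..k} \<rightarrow>\<^sub>E {1..N}" "g' \<in> {1..k} \<rightarrow>\<^sub>E {1..N}"
    using x fg fg' by (auto simp: prs_def)
  have m: "multiplicity p (f i) = multiplicity p (f' i)" "multiplicity p (g i) = multiplicity p (g' i)" if "p \<in> pr N" "i \<in> {1..k}" for p i
    using fun_cong[OF x(3), of p] that by (auto simp: phi_def fg fg' fun_eq_iff restrict_def split: if_splits)
  have e: "a i = b i" if "a \<in> {1..k} \<rightarrow>\<^sub>E {1..N}" "b \<in> {1..k} \<rightarrow>\<^sub>E {1..N}" "i \<in> {1..k}" "\<And>p. p \<in> pr N \<Longrightarrow> multiplicity p (a i) = multiplicity p (b i)" for a b i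
  proof -
    have ai: "a i \<in> {1..N}" "b i \<in> {1..N}" using that by (auto simp: PiE_iff)
    have "a i = (\<Prod>p\<in>pr N. p ^ multiplicity p (a i))" by (rule prod_primes_eq[OF ai(1), symmetric])
    also have "\<dots> = (\<Prod>p\<in>pr N. p ^ multiplicity p (b i))" using that(4) by (intro prod.cong) auto
    also have "\<dots> = b i" by (rule prod_primes_eq[OF ai(2)])
    finally show ?thesis .
  qed
  have "f = f'" by (rule PiE_ext[OF P(1,3)]) (use e[OF P(1,3)] m in auto)
  moreover have "g = g'" by (rule PiE_ext[OF P(2,4)]) (use e[OF P(2,4)] m in auto)
  ultimately show "x = x'" by (simp add: fg fg')
qed

lemma multiplicity_prod_fun:
  fixes k N :: nat
  assumes f: "f \<in> {1..k} \<rightarrow>\<^sub>E {1..N}" and p: "p \<in> pr N"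
  shows "multiplicity p (\<Prod>i=1..k. f i) = (\<Sum>i=1..k. multiplicity p (f i))"
proof -
  have "0 \<notin> f ` {1..k}" using f by (force simp: PiE_iff)
  then show ?thesis using prD(1)[OF p] by (subst prime_elem_multiplicity_prod_distrib) auto
qed

lemma vec_phi:
  assumes "(f, g) \<in> prs k N"
  shows "(\<Sum>p\<in>pr N. vecp k p (phi k N (f, g) p)) = vecn k f g"
proof
  fix ci :: "bool \<times> nat"
  obtain c i where ci: "ci = (c, i)" by force
  have ev: "(\<Sum>p\<in>A. F p) x = (\<Sum>p\<in>A. F p x)" for F :: "nat \<Rightarrow> vec" and A x
    by (induction A rule: infinite_finite_induct) auto
  show "(\<Sum>p\<in>pr N. vecp k p (phi k N (f, g) p)) ci = vecn k f g ci"
  proof (cases "i \<in> {1..k}")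
    case True
    define m where "m = (if c then g i else f i)"
    have m: "m \<in> {1..N}" using assms True by (auto simp: prs_def m_def PiE_iff)
    have "(\<Sum>p\<in>pr N. vecp k p (phi k N (f, g) p)) ci = (\<Sum>p\<in>pr N. real (multiplicity p m) * ln (real p))"
      unfolding ev ci using True by (intro sum.cong) (auto simp: vecp_def phi_def m_def)
    also have "\<dots> = ln (real m)" using m by (intro ln_eq_sum_multiplicity[symmetric] prime_factors_sub_pr) auto
    finally show ?thesis using True by (simp add: ci vecn_def m_def)
  next
    case False
    then show ?thesis unfolding ev ci vecp_def vecn_def by auto
  qed
qed

lemma sqrt_prod: "sqrt (\<Prod>x\<in>A. h x) = (\<Prod>x\<in>A. sqrt (h x))"
  by (induction A rule: infinite_finite_induct) (auto simp: real_sqrt_mult)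

text \<open>rho^Omega(n)/sqrt n is completely multiplicative. As the two products agree, each prime
  has the same total exponent on both sides, and the two factors rho/sqrt p combine to
  rho^2/p.\<close>

lemma moment_weight:
  assumes N: "2 \<le> N" and fg: "(f, g) \<in> prs k N" and rho: "0 \<le> \<rho>"
  shows "(\<Prod>i=1..k. wn N \<rho> (f i)) * (\<Prod>i=1..k. wn N \<rho> (g i)) 
    = window k (ln (real N)) (vecn k f g) * (\<Prod>p\<in>pr N. (\<rho>\<^sup>2 / real p) ^ (\<Sum>i=1..k. multiplicity p (f i)))"
proof -
  have P: "f \<in> {1..k} \<rightarrow>\<^sub>E {1..N}" "g \<in> {1..k} \<rightarrow>\<^sub>E {1..N}" and eq: "(\<Prod>i=1..k. f i) = (\<Prod>i=1..k. g i)"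
    using fg by (auto simp: prs_def)
  have ar: "(\<Prod>i=1..k. \<rho> ^ bigOmega (h i) / sqrt (real (h i))) = (\<Prod>p\<in>pr N. (\<rho> / sqrt (real p)) ^ (\<Sum>i=1..k. multiplicity p (h i)))"
    if h: "h \<in> {1..k} \<rightarrow>\<^sub>E {1..N}" for h
  proof -
    have "\<rho> ^ bigOmega (h i) / sqrt (real (h i)) = (\<Prod>p\<in>pr N. (\<rho> / sqrt (real p)) ^ multiplicity p (h i))" if i: "i \<in> {1..k}" for i
    proof -
      have hi: "h i \<in> {1..N}" using h i by (auto simp: PiE_iff)
      have "sqrt (real (h i)) = sqrt (\<Prod>p\<in>pr N. real p ^ multiplicity p (h i))"
        using arg_cong[OF prod_primes_eq[OF hi], of real] by simp
      also have "\<dots> = (\<Prod>p\<in>pr N. sqrt (real p) ^ multiplicity p (h i))"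
        by (simp add: sqrt_prod real_sqrt_power)
      finally have s: "sqrt (real (h i)) = (\<Prod>p\<in>pr N. sqrt (real p) ^ multiplicity p (h i))" .
      show ?thesis unfolding s bigOmega_eq[OF hi] by (simp add: power_sum prod_dividef power_divide)
    qed
    then have "(\<Prod>i=1..k. \<rho> ^ bigOmega (h i) / sqrt (real (h i))) = (\<Prod>i=1..k. \<Prod>p\<in>pr N. (\<rho> / sqrt (real p)) ^ multiplicity p (h i))"
      by (intro prod.cong) auto
    also have "\<dots> = (\<Prod>p\<in>pr N. \<Prod>i=1..k. (\<rho> / sqrt (real p)) ^ multiplicity p (h i))" by (rule prod.swap)
    also have "\<dots> = (\<Prod>p\<in>pr N. (\<rho> / sqrt (real p)) ^ (\<Sum>i=1..k. multiplicity p (h i)))" by (simp add: power_sum)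
    finally show ?thesis .
  qed
  have split: "(\<Prod>i=1..k. wn N \<rho> (h i)) = (\<Prod>i=1..k. \<rho> ^ bigOmega (h i) / sqrt (real (h i))) * (\<Prod>i=1..k. 1 - ln (real (h i)) / ln (real N))" for h
    by (simp add: wn_def prod.distrib[symmetric])
  have sums: "(\<Sum>i=1..k. multiplicity p (g i)) = (\<Sum>i=1..k. multiplicity p (f i))" if "p \<in> pr N" for p
    using multiplicity_prod_fun[OF P(1) that] multiplicity_prod_fun[OF P(2) that] eq by simp
  have "(\<Prod>p\<in>pr N. (\<rho> / sqrt (real p)) ^ (\<Sum>i=1..k. multiplicity p (f i))) * (\<Prod>p\<in>pr N. (\<rho> / sqrt (real p)) ^ (\<Sum>i=1..k. multiplicity p (g i)))
      = (\<Prod>p\<in>pr N. (\<rho>\<^sup>2 / real p) ^ (\<Sum>i=1..k. multiplicity p (f i)))"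
    unfolding prod.distrib[symmetric]
  proof (rule prod.cong)
    fix p assume p: "p \<in> pr N"
    have "\<rho> / sqrt (real p) * (\<rho> / sqrt (real p)) = \<rho>\<^sup>2 / real p" by (simp add: power2_eq_square)
    then show "(\<rho> / sqrt (real p)) ^ (\<Sum>i=1..k. multiplicity p (f i)) * (\<rho> / sqrt (real p)) ^ (\<Sum>i=1..k. multiplicity p (g i)) = (\<rho>\<^sup>2 / real p) ^ (\<Sum>i=1..k. multiplicity p (f i))"
      unfolding sums[OF p] by (metis power_mult_distrib)
  qed simp
  then show ?thesis unfolding split ar[OF P(1)] ar[OF P(2)] window_vecn[OF N P] by (simp add: mult_ac)
qed

text \<open>The weight of a pair of tuples is, up to the product of the masses, the probability of
  its exponent family under independent local laws.\<close>

lemma moment_S_expectation: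
  assumes N: "2 \<le> N" and k: "1 \<le> k" and rho: "0 < \<rho>" "\<rho>\<^sup>2 < 2"
  shows "moment_S k \<rho> N = (\<Prod>p\<in>pr N. mass k (\<rho>\<^sup>2 / real p)) * 
     measure_pmf.expectation (csum (Xp k (\<rho>\<^sup>2)) (pr N)) (window k (ln (real N)))"
proof -
  let ?L = "ln (real N)"
  let ?d = "((\<lambda>_. 0), (\<lambda>_. 0)) :: (nat \<Rightarrow> nat) \<times> (nat \<Rightarrow> nat)"
  let ?Pi = "Pi_pmf (pr N) ?d (\<lambda>p. XX k (\<rho>\<^sup>2 / real p))"
  let ?M = "\<Prod>p\<in>pr N. mass k (\<rho>\<^sup>2 / real p)"
  have L: "0 < ?L" using N by simp
  have r: "0 \<le> \<rho>\<^sup>2 / real p" "\<rho>\<^sup>2 / real p < 1" if "p \<in> pr N" for p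
    using prD(3)[OF that] rho by (auto simp: field_simps)
  have m1: "1 \<le> mass k (\<rho>\<^sup>2 / real p)" if "p \<in> pr N" for p by (rule mass_ge_1[OF r[OF that] k])
  have M0: "?M \<noteq> 0" using m1 by (force simp: prod_zero_iff)
  \<comment> \<open>An outcome is an arbitrary family of exponents. If the window is nonzero, the 2k
    integers built from it are less than N, so the family comes from a pair in
    \<open>prs k N\<close>.\<close>
  have support: "x \<in> phi k N ` prs k N" if x: "x \<in> set_pmf ?Pi" and W: "window k ?L (\<Sum>p\<in>pr N. vecp k p (x p)) \<noteq> 0" for x
  proof -
    have nz: "pmf ?Pi x \<noteq> 0" using x by (simp add: set_pmf_iff)
    then have dflt: "x p = ?d" if "p \<notin> pr N" for p using that by (auto simp: pmf_Pi split: if_splits)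
    have xp: "pmf (XX k (\<rho>\<^sup>2 / real p)) (x p) \<noteq> 0" if "p \<in> pr N" for p using nz that by (auto simp: pmf_Pi split: if_splits)
    have comp: "fst (x p) \<in> comps k (\<Sum>i=1..k. fst (x p) i)" "snd (x p) \<in> comps k (\<Sum>i=1..k. fst (x p) i)" if "p \<in> pr N" for p
      using xp[OF that] pmf_XX[OF r[OF that] k, of "fst (x p)" "snd (x p)"] by (auto split: if_splits)
    define F where "F = (\<lambda>c i. \<Prod>p\<in>pr N. p ^ ((if c then snd (x p) i else fst (x p) i)))"
    define f where "f = (\<lambda>i\<in>{1..k}. F False i)"
    define g where "g = (\<lambda>i\<in>{1..k}. F True i)"
    have Fpos: "0 < F c i" for c i unfolding F_def by (auto intro!: prod_pos dest: prD(3))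
    have lnF: "ln (real (F c i)) = (\<Sum>p\<in>pr N. vecp k p (x p)) (c, i)" if i: "i \<in> {1..k}" for c i
    proof -
      have ev: "(\<Sum>p\<in>A. G p) x = (\<Sum>p\<in>A. G p x)" for G :: "nat \<Rightarrow> vec" and A x
        by (induction A rule: infinite_finite_induct) auto
      have "ln (real (F c i)) = (\<Sum>p\<in>pr N. ln (real p ^ (if c then snd (x p) i else fst (x p) i)))"
        unfolding F_def of_nat_prod of_nat_power by (rule ln_prod) (auto dest!: prD(3))
      also have "\<dots> = (\<Sum>p\<in>pr N. vecp k p (x p) (c, i))"
        by (intro sum.cong refl) (use i in \<open>auto simp: vecp_def ln_realpow dest!: prD(3)\<close>)
      finally show ?thesis by (simp add: ev)
    qed
    have FN: "F c i \<in> {1..N}" if i: "i \<in> {1..k}" for c i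
    proof -
      have "\<not> ?L \<le> (\<Sum>p\<in>pr N. vecp k p (x p)) (c, i)"
        using window_eq_0[OF L, of "(c, i)" k] W i by (auto simp: coords_def)
      then have "ln (real (F c i)) < ln (real N)" using lnF[OF i] by simp
      then have "real (F c i) < real N" using Fpos[of c i] N by (subst (asm) ln_less_cancel_iff) auto
      then show ?thesis using Fpos[of c i] by auto
    qed
    have mult: "multiplicity p (F c i) = (if c then snd (x p) i else fst (x p) i)" if p: "p \<in> pr N" for p c i
      unfolding F_def using p by (subst multiplicity_prod_prime_powers) (auto dest: prD)
    have PF: "f \<in> {1..k} \<rightarrow>\<^sub>E {1..N}" "g \<in> {1..k} \<rightarrow>\<^sub>E {1..N}" unfolding f_def g_def using FN by auto
    have eq: "(\<Prod>i=1..k. f i) = (\<Prod>i=1..k. g i)"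
    proof -
      have "(\<Prod>i=1..k. F c i) = (\<Prod>p\<in>pr N. p ^ (\<Sum>i=1..k. if c then snd (x p) i else fst (x p) i))" for c
        unfolding F_def by (subst prod.swap) (simp add: power_sum)
      moreover have "(\<Sum>i=1..k. snd (x p) i) = (\<Sum>i=1..k. fst (x p) i)" if "p \<in> pr N" for p
        using comp(2)[OF that] by (rule comps_sum)
      ultimately have "(\<Prod>i=1..k. F True i) = (\<Prod>i=1..k. F False i)" by simp
      then show ?thesis by (simp add: f_def g_def)
    qed
    have "x = phi k N (f, g)"
    proof
      fix p
      show "x p = phi k N (f, g) p"
      proof (cases "p \<in> pr N")
        case True
        have "fst (x p) = (\<lambda>i\<in>{1..k}. multiplicity p (f i))"
          by (rule PiE_ext[where k = "{1..k}" and s = "\<lambda>_. UNIV"])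
             (use comp(1)[OF True] mult[OF True] in \<open>auto simp: comps_def f_def\<close>)
        moreover have "snd (x p) = (\<lambda>i\<in>{1..k}. multiplicity p (g i))"
          by (rule PiE_ext[where k = "{1..k}" and s = "\<lambda>_. UNIV"])
             (use comp(2)[OF True] mult[OF True] in \<open>auto simp: comps_def g_def\<close>)
        ultimately show ?thesis using True by (simp add: phi_def prod_eq_iff)
      next
        case False
        then show ?thesis using dflt by (simp add: phi_def)
      qed
    qed
    moreover have "(f, g) \<in> prs k N" using PF eq by (simp add: prs_def)
    ultimately show ?thesis by blast
  qed
  have pmfphi: "pmf ?Pi (phi k N (f, g)) = (\<Prod>p\<in>pr N. (\<rho>\<^sup>2 / real p) ^ (\<Sum>i=1..k. multiplicity p (f i))) / ?M"
    if fg: "(f, g) \<in> prs k N" for f g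
  proof -
    have P: "f \<in> {1..k} \<rightarrow>\<^sub>E {1..N}" "g \<in> {1..k} \<rightarrow>\<^sub>E {1..N}" and eq: "(\<Prod>i=1..k. f i) = (\<Prod>i=1..k. g i)"
      using fg by (auto simp: prs_def)
    have "pmf (XX k (\<rho>\<^sup>2 / real p)) (phi k N (f, g) p) = (\<rho>\<^sup>2 / real p) ^ (\<Sum>i=1..k. multiplicity p (f i)) / mass k (\<rho>\<^sup>2 / real p)"
      if p: "p \<in> pr N" for p
    proof -
      have "(\<Sum>i=1..k. multiplicity p (g i)) = (\<Sum>i=1..k. multiplicity p (f i))"
        using multiplicity_prod_fun[OF P(1) p] multiplicity_prod_fun[OF P(2) p] eq by simp
      then show ?thesis using p by (simp add: phi_def pmf_XX[OF r[OF p] k] comps_def)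
    qed
    then show ?thesis by (simp add: pmf_Pi phi_def[of k N "(f,g)"] prod_dividef[symmetric])
  qed
  have "measure_pmf.expectation (csum (Xp k (\<rho>\<^sup>2)) (pr N)) (window k ?L) 
     = measure_pmf.expectation ?Pi (\<lambda>x. window k ?L (\<Sum>p\<in>pr N. vecp k p (x p)))"
    unfolding Xp_def[abs_def] by (subst csum_map_Pi_pmf[where d = ?d]) auto
  \<comment> \<open>The infinite product space reduces to a finite sum, since the window vanishes
    off the image of \<open>phi\<close>.\<close>
  also have "\<dots> = (\<Sum>x\<in>phi k N ` prs k N. window k ?L (\<Sum>p\<in>pr N. vecp k p (x p)) * pmf ?Pi x)"
    by (rule integral_measure_pmf_real) (use finite_prs support in auto)
  also have "\<dots> = (\<Sum>x\<in>prs k N. window k ?L (\<Sum>p\<in>pr N. vecp k p (phi k N x p)) * pmf ?Pi (phi k N x))"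
    by (subst sum.reindex[OF phi_inj]) (simp add: o_def)
  also have "\<dots> = (\<Sum>(f,g)\<in>prs k N. (\<Prod>i=1..k. wn N \<rho> (f i)) * (\<Prod>i=1..k. wn N \<rho> (g i)) / ?M)"
  proof (rule sum.cong, simp, clarify)
    fix f g assume fg: "(f, g) \<in> prs k N"
    show "window k ?L (\<Sum>p\<in>pr N. vecp k p (phi k N (f, g) p)) * pmf ?Pi (phi k N (f, g)) = (\<Prod>i=1..k. wn N \<rho> (f i)) * (\<Prod>i=1..k. wn N \<rho> (g i)) / ?M"
      unfolding vec_phi[OF fg] pmfphi[OF fg] moment_weight[OF N fg less_imp_le[OF rho(1)]] by simp
  qed
  also have "\<dots> = (\<Sum>(f,g)\<in>prs k N. (\<Prod>i=1..k. wn N \<rho> (f i)) * (\<Prod>i=1..k. wn N \<rho> (g i))) / ?M"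
    by (simp add: sum_divide_distrib case_prod_unfold)
  finally have e: "?M * measure_pmf.expectation (csum (Xp k (\<rho>\<^sup>2)) (pr N)) (window k ?L) = (\<Sum>(f,g)\<in>prs k N. (\<Prod>i=1..k. wn N \<rho> (f i)) * (\<Prod>i=1..k. wn N \<rho> (g i)))"
    using M0 by simp
  have "moment_S k \<rho> N = (\<Sum>x\<in>({1..k} \<rightarrow>\<^sub>E {1..N}) \<times> ({1..k} \<rightarrow>\<^sub>E {1..N}). 
     if (\<Prod>i=1..k. fst x i) = (\<Prod>i=1..k. snd x i) then (\<Prod>i=1..k. wn N \<rho> (fst x i)) * (\<Prod>i=1..k. wn N \<rho> (snd x i)) else 0)"
    unfolding moment_S_eq[OF N] by (simp only: case_prod_unfold)
  also have "\<dots> = (\<Sum>x\<in>prs k N. (\<Prod>i=1..k. wn N \<rho> (fst x i)) * (\<Prod>i=1..k. wn N \<rho> (snd x i)))"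
    by (subst sum.inter_filter[symmetric]) (auto intro!: finite_PiE sum.cong simp: prs_def)
  finally show ?thesis using e by (simp add: case_prod_unfold)
qed

section \<open>Local comparison with Poisson variables\<close>

lemma expectation_csum_mult:
  fixes D :: "'v::comm_monoid_add \<Rightarrow> real"
  assumes "finite Q" "0 \<in> C" "\<And>u v. u \<in> C \<Longrightarrow> v \<in> C \<Longrightarrow> u + v \<in> C"
    and sub: "\<And>p. p \<in> Q \<Longrightarrow> set_pmf (X p) \<subseteq> C" and D: "\<And>u. u \<in> C \<Longrightarrow> 0 \<le> D u \<and> D u \<le> 1"
    and Dadd: "\<And>u v. D (u + v) = D u * D v" and D0: "D 0 = 1"
  shows "measure_pmf.expectation (csum X Q) D = (\<Prod>p\<in>Q. measure_pmf.expectation (X p) D)"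
  using assms(1) sub
proof (induction Q)
  case (insert q Q)
  have sQ: "set_pmf (csum X Q) \<subseteq> C" by (rule set_csum_subset[OF insert(1) assms(2,3)]) (use insert in auto)
  have sq: "set_pmf (X q) \<subseteq> C" using insert by auto
  have "measure_pmf.expectation (csum X (insert q Q)) D = measure_pmf.expectation (X q) (\<lambda>x. measure_pmf.expectation (csum X Q) (\<lambda>y. D (x + y)))"
    unfolding csum_insert[OF insert(1,2)] by (rule expectation_cpmf[of _ _ _ 1]) (use sQ sq D assms in blast)
  also have "\<dots> = measure_pmf.expectation (X q) D * measure_pmf.expectation (csum X Q) D" by (simp add: Dadd)
  finally show ?case using insert by simp
qed (simp add: D0)

section \<open>First-order expansion of Poisson increments\<close>

lemma pmf_nat_expectation:
  fixes h :: "nat \<Rightarrow> real"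
  assumes h: "\<And>j. 0 \<le> h j" and s: "(\<lambda>j. pmf p j * h j) sums s"
  shows "integrable (measure_pmf p) h" "measure_pmf.expectation p h = s"
proof -
  have "(\<integral>\<^sup>+j. ennreal (h j) \<partial>measure_pmf p) = (\<Sum>j. ennreal (pmf p j * h j))"
    by (simp add: nn_integral_measure_pmf nn_integral_count_space_nat ennreal_mult h)
  also have "\<dots> = ennreal s" by (rule suminf_ennreal_eq[OF _ s]) (simp add: h)
  finally have nn: "(\<integral>\<^sup>+j. ennreal (h j) \<partial>measure_pmf p) = ennreal s" .
  have s0: "0 \<le> s" using sums_le[OF _ sums_zero s] h by auto
  show "integrable (measure_pmf p) h" by (rule integrableI_nn_integral_finite[OF _ _ nn]) (auto simp: h s0)
  show "measure_pmf.expectation p h = s" by (subst integral_eq_nn_integral) (auto simp: h nn s0)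
qed

lemma poisson_second_factorial:
  assumes r: "0 < r"
  shows "integrable (measure_pmf (poisson_pmf r)) (\<lambda>n. real n * real (n - 1))"
    "measure_pmf.expectation (poisson_pmf r) (\<lambda>n. real n * real (n - 1)) = r ^ 2"
proof -
  have "(\<integral>\<^sup>+n. ennreal (real n * real (n - 1)) \<partial>measure_pmf (poisson_pmf r)) = (\<integral>\<^sup>+n. ennreal (real n) * ennreal (real (n - 1)) \<partial>measure_pmf (poisson_pmf r))"
    by (simp add: ennreal_mult)
  also have "\<dots> = ennreal r * (\<integral>\<^sup>+n. ennreal (real n) \<partial>measure_pmf (poisson_pmf r))"
    by (subst poisson_stein[OF r]) simp
  also have "(\<integral>\<^sup>+n. ennreal (real n) \<partial>measure_pmf (poisson_pmf r)) = ennreal r"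
    using poisson_stein[OF r, of "\<lambda>_. 1"] by (simp add: measure_pmf.emeasure_space_1[unfolded space_measure_pmf])
  finally have e: "(\<integral>\<^sup>+n. ennreal (real n * real (n - 1)) \<partial>measure_pmf (poisson_pmf r)) = ennreal (r ^ 2)"
    using r by (simp add: ennreal_mult[symmetric] power2_eq_square)
  show "integrable (measure_pmf (poisson_pmf r)) (\<lambda>n. real n * real (n - 1))"
    by (rule integrableI_nn_integral_finite[OF _ _ e]) auto
  show "measure_pmf.expectation (poisson_pmf r) (\<lambda>n. real n * real (n - 1)) = r ^ 2"
    by (subst integral_eq_nn_integral) (use e in auto)
qed

definition sc :: "real \<Rightarrow> vec \<Rightarrow> vec" where "sc t v = (\<lambda>c. t * v c)"

lemma sc_nonneg_vecs: "0 \<le> t \<Longrightarrow> v \<in> nonneg_vecs \<Longrightarrow> sc t v \<in> nonneg_vecs" by (auto simp: sc_def nonneg_vecs_def)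
lemma len_sc: "len k (sc t v) = t * len k v" by (simp add: len_def sc_def sum_distrib_left)
lemma sc_0: "sc 0 v = 0" by (simp add: sc_def fun_eq_iff)
lemma sc_1: "sc 1 v = v" by (simp add: sc_def)

text \<open>The linear interpolation n(G(v+e) - G(v)) is exact at n = 0 and n = 1. For n >= 2 the
  Lipschitz bound gives an error of order n <= n(n-1), whose expectation is r^2.\<close>

lemma poisson_first_order:
  assumes r: "0 < r" and c: "0 \<le> c" and e: "e \<in> nonneg_vecs" and v: "v \<in> nonneg_vecs"
    and lip: "\<And>u h. u \<in> nonneg_vecs \<Longrightarrow> h \<in> nonneg_vecs \<Longrightarrow> \<bar>G (u + h) - G u\<bar> \<le> c * len k h"
    and G: "\<And>u. 0 \<le> G u \<and> G u \<le> 1"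
  shows "\<bar>measure_pmf.expectation (poisson_pmf r) (\<lambda>n. G (v + sc (real n) e)) - G v - r * (G (v + e) - G v)\<bar> \<le> 2 * c * len k e * r ^ 2"
proof -
  let ?E = "measure_pmf.expectation (poisson_pmf r)"
  let ?g = "\<lambda>n. G (v + sc (real n) e) - G v - real n * (G (v + e) - G v)"
  have l0: "0 \<le> len k e" by (rule len_nonneg[OF e])
  have iG: "integrable (measure_pmf (poisson_pmf r)) (\<lambda>n. G (v + sc (real n) e))"
    by (rule pmf_integrable_bounded[of _ _ 1]) (use G in \<open>simp add: abs_of_nonneg\<close>)
  have "?E (\<lambda>n. G (v + sc (real n) e)) - G v - r * (G (v + e) - G v) = ?E ?g"
    using iG poisson_mean[OF r] by (simp add: Bochner_Integration.integral_diff)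
  then have "\<bar>?E (\<lambda>n. G (v + sc (real n) e)) - G v - r * (G (v + e) - G v)\<bar> = \<bar>?E ?g\<bar>" by simp
  also have "\<dots> \<le> ?E (\<lambda>n. \<bar>?g n\<bar>)" by (rule integral_abs_bound)
  also have "\<dots> \<le> ?E (\<lambda>n. 2 * c * len k e * (real n * real (n - 1)))"
  proof (rule pmf_expectation_mono)
    fix n :: nat
    consider "n = 0" | "n = 1" | "2 \<le> n" by linarith
    then show "\<bar>?g n\<bar> \<le> 2 * c * len k e * (real n * real (n - 1))"
    proof cases
      case 3
      have "\<bar>G (v + sc (real n) e) - G v\<bar> \<le> c * (real n * len k e)"
        using lip[OF v sc_nonneg_vecs[OF _ e, of "real n"]] by (simp add: len_sc)
      moreover have "\<bar>real n * (G (v + e) - G v)\<bar> \<le> real n * (c * len k e)"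
        using lip[OF v e] by (simp add: abs_mult mult_left_mono)
      ultimately have "\<bar>?g n\<bar> \<le> 2 * c * len k e * real n" by (simp add: algebra_simps)
      also have "\<dots> = 2 * c * len k e * (real n * 1)" by simp
      also have "\<dots> \<le> 2 * c * len k e * (real n * real (n - 1))"
        using 3 c l0 by (intro mult_left_mono) auto
      finally show ?thesis .
    qed (auto simp: sc_0 sc_1)
  next
    show "integrable (measure_pmf (poisson_pmf r)) (\<lambda>n. \<bar>?g n\<bar>)"
      using iG poisson_mean[OF r] by (intro integrable_abs Bochner_Integration.integrable_diff) auto
    show "integrable (measure_pmf (poisson_pmf r)) (\<lambda>n. 2 * c * len k e * (real n * real (n - 1)))"
      by (intro integrable_mult_right poisson_second_factorial r)
  qed
  also have "\<dots> = 2 * c * len k e * r ^ 2"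
    by (simp only: integral_mult_right_zero poisson_second_factorial(2)[OF r])
  finally show ?thesis .
qed

lemma csum_poisson_len:
  assumes "finite A" and r: "0 < r" and e: "\<And>a. a \<in> A \<Longrightarrow> e a \<in> nonneg_vecs \<and> len k (e a) = l" and l: "0 \<le> l"
  shows "(\<integral>\<^sup>+q. ennreal (len k q) \<partial>measure_pmf (csum (\<lambda>a. map_pmf (\<lambda>n. sc (real n) (e a)) (poisson_pmf r)) A)) = ennreal (real (card A) * r * l)"
    and "set_pmf (csum (\<lambda>a. map_pmf (\<lambda>n. sc (real n) (e a)) (poisson_pmf r)) A) \<subseteq> nonneg_vecs"
proof -
  have sub: "set_pmf (csum (\<lambda>a. map_pmf (\<lambda>n. sc (real n) (e a)) (poisson_pmf r)) B) \<subseteq> nonneg_vecs" if "B \<subseteq> A" for B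
    by (rule set_csum_subset[OF finite_subset[OF that assms(1)] nonneg_vecs_0 nonneg_vecs_add]) (use e that sc_nonneg_vecs in auto)
  then show "set_pmf (csum (\<lambda>a. map_pmf (\<lambda>n. sc (real n) (e a)) (poisson_pmf r)) A) \<subseteq> nonneg_vecs" by blast
  have "(\<integral>\<^sup>+q. ennreal (len k q) \<partial>measure_pmf (csum (\<lambda>a. map_pmf (\<lambda>n. sc (real n) (e a)) (poisson_pmf r)) B)) = ennreal (real (card B) * r * l)"
    if "B \<subseteq> A" for B
    using finite_subset[OF that assms(1)] that
  proof (induction B)
    case empty
    then show ?case by (simp add: len_def)
  next
    case (insert b B)
    let ?Q = "csum (\<lambda>a. map_pmf (\<lambda>n. sc (real n) (e a)) (poisson_pmf r)) B"
    have eb: "e b \<in> nonneg_vecs" "len k (e b) = l" using e insert by auto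
    have "(\<integral>\<^sup>+q. ennreal (len k q) \<partial>measure_pmf (csum (\<lambda>a. map_pmf (\<lambda>n. sc (real n) (e a)) (poisson_pmf r)) (insert b B)))
      = (\<integral>\<^sup>+n. \<integral>\<^sup>+q. ennreal (len k (sc (real n) (e b) + q)) \<partial>measure_pmf ?Q \<partial>measure_pmf (poisson_pmf r))"
      using insert(1,2) by (simp add: csum_insert cpmf_def)
    also have "\<dots> = (\<integral>\<^sup>+n. \<integral>\<^sup>+q. ennreal (real n) * ennreal l + ennreal (len k q) \<partial>measure_pmf ?Q \<partial>measure_pmf (poisson_pmf r))"
    proof (rule nn_integral_cong, rule nn_integral_cong_AE, rule AE_pmfI)
      fix n q assume "q \<in> set_pmf ?Q"
      then have "q \<in> nonneg_vecs" using sub[of B] insert by auto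
      then show "ennreal (len k (sc (real n) (e b) + q)) = ennreal (real n) * ennreal l + ennreal (len k q)"
        using len_nonneg[of q k] l by (simp add: len_add len_sc eb ennreal_mult[symmetric] ennreal_plus[symmetric] del: ennreal_plus)
    qed
    also have "\<dots> = ennreal r * ennreal l + ennreal (real (card B) * r * l)"
    proof -
      have "(\<integral>\<^sup>+n. ennreal (real n) \<partial>measure_pmf (poisson_pmf r)) = ennreal r"
        using poisson_stein[OF r, of "\<lambda>_. 1"] by (simp add: measure_pmf.emeasure_space_1[unfolded space_measure_pmf])
      then show ?thesis using insert by (simp add: nn_integral_add nn_integral_multc measure_pmf.emeasure_space_1[unfolded space_measure_pmf])
    qed
    also have "\<dots> = ennreal (real (card (insert b B)) * r * l)"
      using insert(1,2) r l by (simp add: ennreal_mult[symmetric] ennreal_plus[symmetric] algebra_simps del: ennreal_plus)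
    finally show ?case .
  qed
  from this[of A] show "(\<integral>\<^sup>+q. ennreal (len k q) \<partial>measure_pmf (csum (\<lambda>a. map_pmf (\<lambda>n. sc (real n) (e a)) (poisson_pmf r)) A)) = ennreal (real (card A) * r * l)" by simp
qed

text \<open>The expansion is linear in the positions because interactions between two of them are of
  second order in r; there are at most \<open>card A\<close> squared such pairs.\<close>

lemma csum_poisson_first_order:
  assumes "finite A" and r: "0 < r" and c: "0 \<le> c" and e: "\<And>a. a \<in> A \<Longrightarrow> e a \<in> nonneg_vecs \<and> len k (e a) = l" and l: "0 \<le> l"
    and lip: "\<And>u h. u \<in> nonneg_vecs \<Longrightarrow> h \<in> nonneg_vecs \<Longrightarrow> \<bar>G (u + h) - G u\<bar> \<le> c * len k h"
    and G: "\<And>u. 0 \<le> G u \<and> G u \<le> 1" and u: "u \<in> nonneg_vecs"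
  shows "\<bar>measure_pmf.expectation (csum (\<lambda>a. map_pmf (\<lambda>n. sc (real n) (e a)) (poisson_pmf r)) A) (\<lambda>q. G (u + q)) - G u - r * (\<Sum>a\<in>A. G (u + e a) - G u)\<bar>
    \<le> 2 * c * l * r ^ 2 * real (card A) ^ 2"
  using assms(1) e
proof (induction A)
  case (insert b A)
  let ?Q = "csum (\<lambda>a. map_pmf (\<lambda>n. sc (real n) (e a)) (poisson_pmf r)) A"
  let ?P = "poisson_pmf r"
  let ?E = "measure_pmf.expectation"
  have eb: "e b \<in> nonneg_vecs" "len k (e b) = l" using insert by auto
  have sQ: "set_pmf ?Q \<subseteq> nonneg_vecs" by (rule csum_poisson_len(2)[OF insert(1) r _ l, of e k]) (use insert in auto)
  have nnQ: "(\<integral>\<^sup>+q. ennreal (len k q) \<partial>measure_pmf ?Q) = ennreal (real (card A) * r * l)"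
    by (rule csum_poisson_len(1)[OF insert(1) r _ l]) (use insert in auto)
  have lQ: "AE q in measure_pmf ?Q. 0 \<le> len k q" using sQ by (auto simp: AE_measure_pmf_iff intro: len_nonneg)
  have iQ: "integrable (measure_pmf ?Q) (len k)"
    by (rule integrableI_nn_integral_finite[OF _ lQ nnQ]) (use r l in auto)
  have EQ: "?E ?Q (len k) = real (card A) * r * l"
    using r l nnQ lQ by (subst integral_eq_nn_integral) auto
  have aG: "\<bar>G x\<bar> \<le> 1" for x using G[of x] by simp
  have iG: "integrable (measure_pmf B) (\<lambda>x. G (f x))" for B :: "'z pmf" and f by (rule pmf_integrable_bounded[of _ _ 1]) (rule aG)
  have "?E (csum (\<lambda>a. map_pmf (\<lambda>n. sc (real n) (e a)) ?P) (insert b A)) (\<lambda>q. G (u + q)) 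
      = ?E ?Q (\<lambda>q. ?E ?P (\<lambda>n. G (u + q + sc (real n) (e b))))"
    unfolding csum_insert[OF insert(1,2)] by (subst cpmf_comm, subst expectation_cpmf[of _ _ _ 1]) (auto simp: G add.assoc)
  \<comment> \<open>Three errors: the expansion in the new Poisson variable at u + q, the induction
    hypothesis, and the change of the increment in direction b when u + q is replaced by u.\<close>
  then have tot: "?E (csum (\<lambda>a. map_pmf (\<lambda>n. sc (real n) (e a)) ?P) (insert b A)) (\<lambda>q. G (u + q)) - G u - r * (\<Sum>a\<in>insert b A. G (u + e a) - G u)
     = ?E ?Q (\<lambda>q. ?E ?P (\<lambda>n. G (u + q + sc (real n) (e b))) - G (u + q) - r * (G (u + q + e b) - G (u + q)))
     + (?E ?Q (\<lambda>q. G (u + q)) - G u - r * (\<Sum>a\<in>A. G (u + e a) - G u))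
     + r * ?E ?Q (\<lambda>q. (G (u + q + e b) - G (u + q)) - (G (u + e b) - G u))"
  proof -
    have i1: "integrable (measure_pmf ?Q) (\<lambda>q. ?E ?P (\<lambda>n. G (u + q + sc (real n) (e b))))"
    proof (rule pmf_integrable_bounded[of _ _ 1])
      fix q show "\<bar>?E ?P (\<lambda>n. G (u + q + sc (real n) (e b)))\<bar> \<le> 1"
        using pmf_expectation_bounds[of ?P "\<lambda>n. G (u + q + sc (real n) (e b))" 1] G by simp
    qed
    show ?thesis unfolding \<open>?E (csum _ (insert b A)) _ = _\<close>
      using i1 iG[of ?Q] insert(1,2) by (simp add: Bochner_Integration.integral_diff algebra_simps)
  qed
  have b1: "\<bar>?E ?Q (\<lambda>q. ?E ?P (\<lambda>n. G (u + q + sc (real n) (e b))) - G (u + q) - r * (G (u + q + e b) - G (u + q)))\<bar> \<le> 2 * c * l * r ^ 2"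
  proof -
    have "\<bar>?E ?Q (\<lambda>q. ?E ?P (\<lambda>n. G (u + q + sc (real n) (e b))) - G (u + q) - r * (G (u + q + e b) - G (u + q)))\<bar>
       \<le> ?E ?Q (\<lambda>q. \<bar>?E ?P (\<lambda>n. G (u + q + sc (real n) (e b))) - G (u + q) - r * (G (u + q + e b) - G (u + q))\<bar>)"
      by (rule integral_abs_bound)
    also have "\<dots> \<le> 2 * c * l * r ^ 2"
    proof (rule conjunct2[OF pmf_expectation_bounds], intro conjI)
      fix q assume "q \<in> set_pmf ?Q"
      then have "q \<in> nonneg_vecs" using sQ by blast
      then have uq: "u + q \<in> nonneg_vecs" by (rule nonneg_vecs_add[OF u])
      show "\<bar>?E ?P (\<lambda>n. G (u + q + sc (real n) (e b))) - G (u + q) - r * (G (u + q + e b) - G (u + q))\<bar> \<le> 2 * c * l * r ^ 2"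
        using poisson_first_order[OF r c eb(1) uq lip G] unfolding eb(2) .
    qed simp
    finally show ?thesis .
  qed
  have b3: "\<bar>?E ?Q (\<lambda>q. (G (u + q + e b) - G (u + q)) - (G (u + e b) - G u))\<bar> \<le> 2 * c * (real (card A) * r * l)"
  proof -
    have "\<bar>?E ?Q (\<lambda>q. (G (u + q + e b) - G (u + q)) - (G (u + e b) - G u))\<bar> \<le> ?E ?Q (\<lambda>q. \<bar>(G (u + q + e b) - G (u + q)) - (G (u + e b) - G u)\<bar>)"
      by (rule integral_abs_bound)
    also have "\<dots> \<le> ?E ?Q (\<lambda>q. 2 * c * len k q)"
    proof (rule pmf_expectation_mono)
      fix q assume "q \<in> set_pmf ?Q"
      then have q: "q \<in> nonneg_vecs" using sQ by blast
      have l12: "\<bar>G (u + e b + q) - G (u + e b)\<bar> \<le> c * len k q" "\<bar>G (u + q) - G u\<bar> \<le> c * len k q"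
        by (rule lip[OF nonneg_vecs_add[OF u eb(1)] q], rule lip[OF u q])
      have eqn: "u + q + e b = u + e b + q" by (simp add: add_ac)
      show "\<bar>(G (u + q + e b) - G (u + q)) - (G (u + e b) - G u)\<bar> \<le> 2 * c * len k q"
        unfolding eqn using l12 by linarith
    qed (use iG iQ in \<open>auto intro!: integrable_abs Bochner_Integration.integrable_diff\<close>)
    also have "\<dots> = 2 * c * (real (card A) * r * l)" using EQ by simp
    finally show ?thesis .
  qed
  have IH: "\<bar>?E ?Q (\<lambda>q. G (u + q)) - G u - r * (\<Sum>a\<in>A. G (u + e a) - G u)\<bar> \<le> 2 * c * l * r ^ 2 * real (card A) ^ 2"
    by (rule insert.IH) (use insert.prems in auto)
  have b3': "\<bar>r * ?E ?Q (\<lambda>q. (G (u + q + e b) - G (u + q)) - (G (u + e b) - G u))\<bar> \<le> r * (2 * c * (real (card A) * r * l))"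
    using b3 r by (simp add: abs_mult)
  \<comment> \<open>In units of 2 c l r^2 this reads 1 + n^2 + n <= (n + 1)^2 with n =
    \<open>card A\<close>.\<close>
  have "2 * c * l * r ^ 2 + 2 * c * l * r ^ 2 * real (card A) ^ 2 + r * (2 * c * (real (card A) * r * l)) \<le> 2 * c * l * r ^ 2 * real (card (insert b A)) ^ 2"
  proof -
    have "2 * c * l * r ^ 2 * real (card (insert b A)) ^ 2 - (2 * c * l * r ^ 2 + 2 * c * l * r ^ 2 * real (card A) ^ 2 + r * (2 * c * (real (card A) * r * l)))
       = 2 * c * l * r ^ 2 * real (card A)"
      using insert(1,2) by (simp add: power2_eq_square algebra_simps)
    moreover have "0 \<le> 2 * c * l * r ^ 2 * real (card A)" using c l by auto
    ultimately show ?thesis by linarith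
  qed
  then show ?case unfolding tot using b1 IH b3' by linarith
qed simp

section \<open>First-order expansion of the arithmetic local law\<close>

lemma dk_pp_le: "1 \<le> k \<Longrightarrow> dk_pp k j \<le> k ^ j"
proof (induction j)
  case (Suc j)
  \<comment> \<open>The absorption identity for binomials, followed by j + k <= (j + 1) k.\<close>
  have "Suc j * dk_pp k (Suc j) = (j + k) * dk_pp k j"
    using Suc_times_binomial[of j "j + k - 1"] Suc.prems by (simp add: dk_pp_def)
  also have "\<dots> \<le> (Suc j * k) * k ^ j"
  proof (rule mult_mono)
    have "j * 1 \<le> j * k" using Suc.prems by (intro mult_left_mono) auto
    then show "j + k \<le> Suc j * k" by simp
  qed (use Suc in auto)
  also have "\<dots> = Suc j * k ^ Suc j" by (simp only: power_Suc mult.assoc)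
  finally have "Suc j * dk_pp k (Suc j) \<le> Suc j * k ^ Suc j" .
  then show ?case by (simp only: Suc_mult_le_cancel1)
qed (simp add: dk_pp_def)

lemma dk_term_le:
  assumes k: "1 \<le> k" and r: "0 \<le> r"
  shows "real (dk_pp k j) ^ 2 * r ^ j \<le> (real k ^ 2 * r) ^ j"
proof -
  have "real (dk_pp k j) \<le> real k ^ j" using dk_pp_le[OF k, of j] by (metis of_nat_le_iff of_nat_power)
  then have "real (dk_pp k j) ^ 2 \<le> (real k ^ j) ^ 2" by (intro power_mono) auto
  then have "real (dk_pp k j) ^ 2 * r ^ j \<le> (real k ^ j) ^ 2 * r ^ j" using r by (intro mult_right_mono) auto
  also have "\<dots> = (real k ^ 2 * r) ^ j" by (simp add: power_mult_distrib flip: power_mult) (simp add: mult.commute)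
  finally show ?thesis .
qed

lemma dk_1: "dk_pp k 1 = k" by (cases k) (auto simp: dk_pp_def)

text \<open>For w <= 1/4 both series are geometric: j + 2 <= 2 * 2^j turns the weighted one into a
  series of ratio 2w <= 1/2.\<close>

lemma tail_bounds:
  assumes w: "0 \<le> w" "w \<le> 1/4"
  shows "summable (\<lambda>j. w ^ (j + 2))" "(\<Sum>j. w ^ (j + 2)) \<le> 2 * w\<^sup>2"
    "summable (\<lambda>j. real (j + 2) * w ^ (j + 2))" "(\<Sum>j. real (j + 2) * w ^ (j + 2)) \<le> 4 * w\<^sup>2"
proof -
  have s: "(\<lambda>j. w\<^sup>2 * w ^ j) sums (w\<^sup>2 * (1 / (1 - w)))" using w by (intro sums_mult geometric_sums) auto
  then have s': "(\<lambda>j. w ^ (j + 2)) sums (w\<^sup>2 * (1 / (1 - w)))"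
    by (simp only: power_add mult.commute[of "w\<^sup>2"])
  show "summable (\<lambda>j. w ^ (j + 2))" using s' by (rule sums_summable)
  have "w\<^sup>2 * (1 / (1 - w)) \<le> w\<^sup>2 * 2" using w by (intro mult_left_mono) (auto simp: field_simps)
  then show "(\<Sum>j. w ^ (j + 2)) \<le> 2 * w\<^sup>2" using sums_unique[OF s'] by simp
  have t: "(\<lambda>j. 2 * w\<^sup>2 * (2 * w) ^ j) sums (2 * w\<^sup>2 * (1 / (1 - 2 * w)))" using w by (intro sums_mult geometric_sums) auto
  have le: "real (j + 2) * w ^ (j + 2) \<le> 2 * w\<^sup>2 * (2 * w) ^ j" for j
  proof -
    have "j + 2 \<le> 2 * 2 ^ j" by (induction j) auto
    then have "real (j + 2) \<le> 2 * 2 ^ j" by (metis of_nat_le_iff of_nat_mult of_nat_numeral of_nat_power)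
    then have "real (j + 2) * w ^ (j + 2) \<le> 2 * 2 ^ j * w ^ (j + 2)" using w by (intro mult_right_mono) auto
    also have "\<dots> = 2 * w\<^sup>2 * (2 * w) ^ j" by (simp add: power_add power_mult_distrib power2_eq_square)
    finally show ?thesis .
  qed
  show sm: "summable (\<lambda>j. real (j + 2) * w ^ (j + 2))"
    by (rule summable_comparison_test'[OF sums_summable[OF t], of 0]) (use le w in auto)
  have "(\<Sum>j. real (j + 2) * w ^ (j + 2)) \<le> 2 * w\<^sup>2 * (1 / (1 - 2 * w))"
    using suminf_le[OF le sm sums_summable[OF t]] sums_unique[OF t] by simp
  also have "\<dots> \<le> 2 * w\<^sup>2 * 2" using w by (intro mult_left_mono) (auto simp: field_simps)
  finally show "(\<Sum>j. real (j + 2) * w ^ (j + 2)) \<le> 4 * w\<^sup>2" by simp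
qed

text \<open>With w = k^2 r the j-th term is at most w^j and the term j = 1 equals w, since d_k(p) =
  k; the rest is a geometric tail.\<close>

lemma mass_small:
  assumes k: "1 \<le> k" and r: "0 \<le> r" and w: "real k ^ 2 * r \<le> 1/4"
  shows "mass k r \<le> 1 + real k ^ 2 * r + 2 * (real k ^ 2 * r)\<^sup>2" "1 + real k ^ 2 * r \<le> mass k r" "r < 1"
proof -
  let ?w = "real k ^ 2 * r"
  have w0: "0 \<le> ?w" using r by simp
  have "1 * r \<le> ?w" using k r by (intro mult_right_mono) auto
  then show r1: "r < 1" using w by simp
  let ?f = "\<lambda>j. real (dk_pp k j) ^ 2 * r ^ j"
  have sm: "summable ?f" by (rule mass_summable[OF r r1])
  have sm2: "summable (\<lambda>j. ?f (j + 2))" by (rule summable_ignore_initial_segment[OF sm])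
  have "mass k r = (\<Sum>j. ?f (j + 2)) + (\<Sum>j<2. ?f j)" unfolding mass_def by (rule suminf_split_initial_segment[OF sm])
  also have "(\<Sum>j<2. ?f j) = 1 + ?w" using dk_1[of k] by (simp add: numeral_2_eq_2 dk_pp_def)
  finally have e: "mass k r = (\<Sum>j. ?f (j + 2)) + (1 + ?w)" .
  have "(\<Sum>j. ?f (j + 2)) \<le> (\<Sum>j. ?w ^ (j + 2))"
    by (rule suminf_le[OF _ sm2 tail_bounds(1)[OF w0 w]]) (rule dk_term_le[OF k r])
  also have "\<dots> \<le> 2 * ?w\<^sup>2" by (rule tail_bounds(2)[OF w0 w])
  finally show "mass k r \<le> 1 + ?w + 2 * ?w\<^sup>2" using e by simp
  have "0 \<le> (\<Sum>j. ?f (j + 2))" by (rule suminf_nonneg[OF sm2]) (use r in auto)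
  then show "1 + ?w \<le> mass k r" using e by simp
qed

lemma XX_sum: 
  assumes "1 \<le> k"
  shows "map_pmf (\<lambda>ab. \<Sum>i=1..k. fst ab i) (XX k r) = Jpmf k r"
proof -
  have "map_pmf (\<lambda>ab. \<Sum>i=1..k. fst ab i) (pair_pmf (pmf_of_set (comps k j)) (pmf_of_set (comps k j))) = return_pmf j" for j
  proof -
    have "map_pmf (\<lambda>ab. \<Sum>i=1..k. fst ab i) (pair_pmf (pmf_of_set (comps k j)) (pmf_of_set (comps k j))) 
       = map_pmf (\<lambda>ab. j) (pair_pmf (pmf_of_set (comps k j)) (pmf_of_set (comps k j)))"
      by (rule map_pmf_cong) (use assms comps_nonempty card_comps in \<open>auto simp: set_pmf_of_set dest: comps_sum\<close>)
    then show ?thesis by simp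
  qed
  then show ?thesis by (simp add: XX_def map_bind_pmf bind_return_pmf')
qed

lemma set_XX:
  assumes "1 \<le> k" "(a, b) \<in> set_pmf (XX k r)"
  shows "a \<in> comps k (\<Sum>i=1..k. a i)" "b \<in> comps k (\<Sum>i=1..k. a i)"
proof -
  obtain j where j: "a \<in> comps k j" "b \<in> comps k j"
    using assms comps_nonempty card_comps by (auto simp: XX_def set_pmf_of_set)
  show "a \<in> comps k (\<Sum>i=1..k. a i)" "b \<in> comps k (\<Sum>i=1..k. a i)"
    unfolding comps_sum[OF j(1)] by (rule j)+
qed

lemma vecp_nonneg_vecs: "vecp k p ab \<in> nonneg_vecs" if "1 \<le> p"
  using that by (auto simp: vecp_def nonneg_vecs_def)

lemma len_vecp:
  assumes "a \<in> comps k j" "b \<in> comps k j"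
  shows "len k (vecp k p (a, b)) = 2 * real j * ln (real p)"
proof -
  have "len k (vecp k p (a, b)) = (\<Sum>c\<in>(UNIV::bool set). \<Sum>i=1..k. vecp k p (a, b) (c, i))"
    unfolding len_def coords_def by (simp add: sum.cartesian_product case_prod_unfold)
  also have "\<dots> = (\<Sum>i=1..k. real (a i) * ln (real p)) + (\<Sum>i=1..k. real (b i) * ln (real p))"
    by (simp add: UNIV_bool vecp_def)
  also have "\<dots> = real (\<Sum>i=1..k. a i) * ln (real p) + real (\<Sum>i=1..k. b i) * ln (real p)"
    by (simp add: sum_distrib_right)
  also have "\<dots> = 2 * real j * ln (real p)" unfolding comps_sum[OF assms(1)] comps_sum[OF assms(2)] by simp
  finally show ?thesis .
qed

lemma len_Xp:
  assumes "1 \<le> k" "ab \<in> set_pmf (XX k r)"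
  shows "len k (vecp k p ab) = 2 * real (\<Sum>i=1..k. fst ab i) * ln (real p)"
  using len_vecp set_XX[of k "fst ab" "snd ab" r] assms by (metis prod.collapse)

lemma expectation_J:
  assumes k: "1 \<le> k" and r: "0 \<le> r" "r < 1" and h: "\<And>j. 0 \<le> h j" and s: "(\<lambda>j. real (dk_pp k j) ^ 2 * r ^ j * h j) sums s"
  shows "integrable (measure_pmf (Jpmf k r)) h" "mass k r * measure_pmf.expectation (Jpmf k r) h = s"
proof -
  have m: "1 \<le> mass k r" by (rule mass_ge_1[OF r k])
  have "(\<lambda>j. real (dk_pp k j) ^ 2 * r ^ j * h j / mass k r) sums (s / mass k r)" by (rule sums_divide[OF s])
  then have *: "(\<lambda>j. pmf (Jpmf k r) j * h j) sums (s / mass k r)" by (simp add: pmf_Jpmf[OF r k])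
  show "integrable (measure_pmf (Jpmf k r)) h" by (rule pmf_nat_expectation(1)[OF h *])
  show "mass k r * measure_pmf.expectation (Jpmf k r) h = s" using pmf_nat_expectation(2)[OF h *] m by simp
qed

lemma expectation_XX_J:
  assumes "1 \<le> k"
  shows "measure_pmf.expectation (XX k r) (\<lambda>ab. h (\<Sum>i=1..k. fst ab i)) = measure_pmf.expectation (Jpmf k r) (h :: nat \<Rightarrow> real)"
    "integrable (measure_pmf (XX k r)) (\<lambda>ab. h (\<Sum>i=1..k. fst ab i)) \<longleftrightarrow> integrable (measure_pmf (Jpmf k r)) h"
  by (simp_all flip: XX_sum[OF assms])

text \<open>An outcome with total exponent j has length 2 j log p, so damping multiplies its weight
  by p^(-2kj/L) and changes the ratio r of the local series into r p^(-2k/L).\<close>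

lemma mass_Xp_laplace:
  assumes k: "1 \<le> k" and L: "0 < L" and p: "2 \<le> p" and r: "0 \<le> z / real p" "z / real p < 1"
  shows "mass k (z / real p) * measure_pmf.expectation (Xp k z p) (damping k L) = mass k (z / real p * real p powr (- (2 * real k / L)))"
proof -
  let ?w = "real p powr (- (2 * real k / L))"
  have w: "0 \<le> ?w" "?w \<le> 1" using p L powr_mono[of "- (2 * real k / L)" 0 "real p"] by auto
  have "measure_pmf.expectation (Xp k z p) (damping k L) = measure_pmf.expectation (XX k (z / real p)) (\<lambda>ab. damping k L (vecp k p ab))"
    by (simp add: Xp_def)
  also have "\<dots> = measure_pmf.expectation (XX k (z / real p)) (\<lambda>ab. ?w ^ (\<Sum>i=1..k. fst ab i))"
  proof (rule pmf_expectation_cong)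
    fix ab assume ab: "ab \<in> set_pmf (XX k (z / real p))"
    let ?n = "\<Sum>i=1..k. fst ab i"
    have "damping k L (vecp k p ab) = exp (- (real k / L * (2 * real ?n * ln (real p))))" 
      unfolding damping_def len_Xp[OF k ab] ..
    also have "\<dots> = exp (- (2 * real k / L) * ln (real p)) ^ ?n" by (subst exp_of_nat_mult[symmetric]) (simp add: mult_ac)
    also have "exp (- (2 * real k / L) * ln (real p)) = ?w" using p by (simp add: powr_def)
    finally show "damping k L (vecp k p ab) = ?w ^ ?n" .
  qed
  also have "\<dots> = measure_pmf.expectation (Jpmf k (z / real p)) (\<lambda>n. ?w ^ n)" by (rule expectation_XX_J[OF k])
  finally have e: "measure_pmf.expectation (Xp k z p) (damping k L) = measure_pmf.expectation (Jpmf k (z / real p)) (\<lambda>n. ?w ^ n)" .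
  have "z / real p * ?w \<le> z / real p * 1" by (intro mult_left_mono w r)
  then have "z / real p * ?w < 1" using r by linarith
  moreover have "0 \<le> z / real p * ?w" by (rule mult_nonneg_nonneg[OF r(1) w(1)])
  ultimately have "(\<lambda>j. real (dk_pp k j) ^ 2 * (z / real p * ?w) ^ j) sums mass k (z / real p * ?w)"
    unfolding mass_def by (intro summable_sums mass_summable)
  then have "(\<lambda>j. real (dk_pp k j) ^ 2 * (z / real p) ^ j * ?w ^ j) sums mass k (z / real p * ?w)" by (simp only: power_mult_distrib mult.assoc)
  from expectation_J(2)[OF k r _ this] show ?thesis unfolding e by simp
qed

definition uv :: "nat \<times> nat \<Rightarrow> vec" where
  "uv ij = (\<lambda>c. if c = (False, fst ij) \<or> c = (True, snd ij) then 1 else 0)"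

lemma uv_nonneg_vecs: "uv ij \<in> nonneg_vecs" by (auto simp: uv_def nonneg_vecs_def)

lemma idx_finite [simp]: "finite (idx k)" by (simp add: idx_def)
lemma idx_card: "card (idx k) = k ^ 2" by (simp add: idx_def card_cartesian_product power2_eq_square)

lemma len_uv: assumes "ij \<in> idx k" shows "len k (uv ij) = 2"
proof -
  have "len k (uv ij) = (\<Sum>c\<in>{(False, fst ij), (True, snd ij)}. uv ij c)"
    unfolding len_def by (rule sum.mono_neutral_right) (use assms in \<open>auto simp: coords_def idx_def uv_def\<close>)
  also have "\<dots> = 2" by (simp add: uv_def)
  finally show ?thesis .
qed

definition ee :: "nat \<Rightarrow> nat \<times> nat \<Rightarrow> vec" where "ee p ij = sc (ln (real p)) (uv ij)"

lemma ee_nonneg_vecs: "1 \<le> p \<Longrightarrow> ee p ij \<in> nonneg_vecs" unfolding ee_def by (intro sc_nonneg_vecs uv_nonneg_vecs) simp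
lemma len_ee: "ij \<in> idx k \<Longrightarrow> len k (ee p ij) = 2 * ln (real p)" by (simp add: ee_def len_sc len_uv)

definition unitf :: "nat \<Rightarrow> nat \<Rightarrow> nat \<Rightarrow> nat" where
  "unitf k i = (\<lambda>m\<in>{1..k}. if m = i then 1 else 0)"

lemma comps_1: "comps k 1 = unitf k ` {1..k}"
proof (intro set_eqI iffI)
  fix a assume a: "a \<in> comps k 1"
  then have s: "(\<Sum>i=1..k. a i) = 1" by (rule comps_sum)
  then obtain i where i: "i \<in> {1..k}" "a i = 1" "\<forall>j\<in>{1..k}. j \<noteq> i \<longrightarrow> a j = 0"
    using sum_eq_1_iff[of "{1..k}" a] by auto
  have "a = unitf k i"
    by (rule PiE_ext[where k = "{1..k}" and s = "\<lambda>_. UNIV"]) (use a i in \<open>auto simp: comps_def unitf_def\<close>)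
  then show "a \<in> unitf k ` {1..k}" using i by blast
next
  fix a assume "a \<in> unitf k ` {1..k}"
  then obtain i where i: "i \<in> {1..k}" "a = unitf k i" by blast
  have "(\<Sum>m=1..k. unitf k i m) = (\<Sum>m\<in>{1..k}. if m = i then 1 else 0)" by (intro sum.cong) (auto simp: unitf_def)
  also have "\<dots> = 1" using i by (subst sum.delta) auto
  finally show "a \<in> comps k 1" using i by (simp add: comps_def) (simp add: unitf_def)
qed

lemma unitf_inj: "inj_on (unitf k) {1..k}"
proof (rule inj_onI)
  fix i j assume ij: "i \<in> {1..k}" "j \<in> {1..k}" "unitf k i = unitf k j"
  have "unitf k i i = unitf k j i" by (rule fun_cong[OF ij(3)])
  moreover have "unitf k i i = 1" "unitf k j i = (if i = j then 1 else 0)" using ij(1) by (simp_all add: unitf_def)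
  ultimately show "i = j" by (metis zero_neq_one)
qed

lemma vecp_unitf:
  assumes "i \<in> {1..k}" "j \<in> {1..k}"
  shows "vecp k p (unitf k i, unitf k j) = ee p (i, j)"
  using assms by (auto simp: vecp_def ee_def sc_def uv_def unitf_def fun_eq_iff)

lemma abs_combine2: "\<bar>x - s\<bar> \<le> d \<Longrightarrow> \<bar>e\<bar> \<le> f \<Longrightarrow> \<bar>x + e - s\<bar> \<le> d + (f :: real)"
  by linarith

text \<open>Outcomes are sorted by the total exponent: 0 leaves u unchanged, 1 gives precisely the
  k^2 increments \<open>ee p (i, j)\<close> with weight r/m each, and 2 or more is a tail. The 6 is
  2 + 4, from replacing r/m by r and from the tail.\<close>

lemma X_first_order:
  assumes k: "1 \<le> k" and p: "2 \<le> p" and r: "0 \<le> z / real p" and w: "real k ^ 2 * (z / real p) \<le> 1/4" and c: "0 \<le> c"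
    and lip: "\<And>u h. u \<in> nonneg_vecs \<Longrightarrow> h \<in> nonneg_vecs \<Longrightarrow> \<bar>G (u + h) - G u\<bar> \<le> c * len k h"
    and G: "\<And>u. 0 \<le> G u \<and> G u \<le> 1" and u: "u \<in> nonneg_vecs"
  shows "\<bar>measure_pmf.expectation (Xp k z p) (\<lambda>q. G (u + q)) - G u - z / real p * (\<Sum>ij\<in>idx k. G (u + ee p ij) - G u)\<bar>
    \<le> c * (2 * ln (real p)) * (6 * (real k ^ 2 * (z / real p))\<^sup>2)"
proof -
  define r where "r = z / real p"
  define w where "w = real k ^ 2 * r"
  define m where "m = mass k r"
  let ?E = "measure_pmf.expectation (XX k r)"
  have w0: "0 \<le> w" "w \<le> 1/4" unfolding w_def r_def by (rule mult_nonneg_nonneg[OF _ r], simp, rule w)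
  have r0: "0 \<le> r" unfolding r_def by (rule r)
  note ms = mass_small[OF k r0, folded w_def, OF w0(2), folded m_def]
  have m1: "1 \<le> m" using ms w0 by linarith
  have lp: "0 \<le> ln (real p)" using p by simp
  define n where "n = (\<lambda>ab :: (nat \<Rightarrow> nat) \<times> (nat \<Rightarrow> nat). \<Sum>i=1..k. fst ab i)"
  define H where "H = (\<lambda>ab. G (u + vecp k p ab) - G u)"
  have aH: "\<bar>H ab\<bar> \<le> 1" for ab unfolding H_def using G[of u] G[of "u + vecp k p ab"] by linarith
  have vC: "vecp k p ab \<in> nonneg_vecs" for ab by (rule vecp_nonneg_vecs) (use p in simp)
  have H0: "H ab = 0" if "ab \<in> set_pmf (XX k r)" "n ab = 0" for ab
  proof -
    have "fst ab \<in> comps k 0" "snd ab \<in> comps k 0" using set_XX[OF k, of "fst ab" "snd ab" r] that by (auto simp: n_def)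
    then have "\<forall>i\<in>{1..k}. fst ab i = 0 \<and> snd ab i = 0" using comps_sum by fastforce
    then have "vecp k p ab = 0" by (auto simp: vecp_def fun_eq_iff)
    then show ?thesis by (simp add: H_def)
  qed
  \<comment> \<open>Total exponent 1 and total exponent at least 2; exponent 0 contributes nothing
    because the vector is then 0.\<close>
  define H1 where "H1 = (\<lambda>ab. if n ab = 1 then H ab else 0)"
  define H2 where "H2 = (\<lambda>ab. if 2 \<le> n ab then H ab else 0)"
  have iH: "integrable (measure_pmf (XX k r)) H1" "integrable (measure_pmf (XX k r)) H2"
    by (rule pmf_integrable_bounded[of _ _ 1], use aH in \<open>simp add: H1_def H2_def\<close>)+
  have "?E H = ?E (\<lambda>ab. H1 ab + H2 ab)"
  proof (rule pmf_expectation_cong)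
    fix ab assume ab: "ab \<in> set_pmf (XX k r)"
    consider "n ab = 0" | "n ab = 1" | "2 \<le> n ab" by linarith
    then show "H ab = H1 ab + H2 ab" by cases (use H0[OF ab] in \<open>auto simp: H1_def H2_def\<close>)
  qed
  then have EH: "?E H = ?E H1 + ?E H2" using iH by simp
  define S where "S = (\<Sum>ij\<in>idx k. G (u + ee p ij) - G u)"
  have E1: "?E H1 = r / m * S"
  proof -
    have "?E H1 = (\<Sum>ab\<in>comps k 1 \<times> comps k 1. H1 ab * pmf (XX k r) ab)"
    proof (rule integral_measure_pmf_real)
      show "finite (comps k 1 \<times> comps k 1)" using card_comps by auto
      fix ab assume "ab \<in> set_pmf (XX k r)" "H1 ab \<noteq> 0"
      then have "n ab = 1" "ab \<in> set_pmf (XX k r)" by (auto simp: H1_def split: if_splits)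
      then show "ab \<in> comps k 1 \<times> comps k 1" using set_XX[OF k, of "fst ab" "snd ab" r] by (simp add: n_def mem_Times_iff)
    qed
    also have "\<dots> = (\<Sum>ab\<in>comps k 1 \<times> comps k 1. H ab * (r / m))"
    proof (rule sum.cong)
      fix ab assume ab: "ab \<in> comps k 1 \<times> comps k 1"
      then have "n ab = 1" by (auto simp: n_def dest: comps_sum)
      moreover have "pmf (XX k r) (fst ab, snd ab) = r / m"
        using ab pmf_XX[OF r0 ms(3) k, of "fst ab" "snd ab"] comps_sum[of "fst ab" k 1] by (auto simp: m_def)
      ultimately show "H1 ab * pmf (XX k r) ab = H ab * (r / m)" by (simp add: H1_def)
    qed simp
    also have "\<dots> = (r / m) * (\<Sum>(a,b)\<in>comps k 1 \<times> comps k 1. H (a, b))"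
      unfolding case_prod_unfold prod.collapse by (simp only: sum_distrib_right[symmetric] mult.commute)
    also have "(\<Sum>(a,b)\<in>comps k 1 \<times> comps k 1. H (a, b)) = (\<Sum>a\<in>comps k 1. \<Sum>b\<in>comps k 1. H (a, b))"
      by (rule sum.cartesian_product[symmetric])
    also have "\<dots> = (\<Sum>i\<in>{1..k}. \<Sum>j\<in>{1..k}. H (unitf k i, unitf k j))"
      unfolding comps_1 by (simp only: sum.reindex[OF unitf_inj] o_def)
    also have "\<dots> = (\<Sum>i\<in>{1..k}. \<Sum>j\<in>{1..k}. G (u + ee p (i, j)) - G u)"
      by (intro sum.cong refl) (simp add: H_def vecp_unitf)
    also have "\<dots> = S" unfolding S_def idx_def by (simp add: sum.cartesian_product case_prod_unfold)
    finally show ?thesis .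
  qed
  have S: "\<bar>S\<bar> \<le> real k ^ 2 * (c * (2 * ln (real p)))"
  proof -
    have "\<bar>S\<bar> \<le> (\<Sum>ij\<in>idx k. \<bar>G (u + ee p ij) - G u\<bar>)" unfolding S_def by (rule sum_abs)
    also have "\<dots> \<le> (\<Sum>ij\<in>idx k. c * (2 * ln (real p)))"
    proof (rule sum_mono)
      fix ij assume "ij \<in> idx k"
      then show "\<bar>G (u + ee p ij) - G u\<bar> \<le> c * (2 * ln (real p))" using lip[OF u ee_nonneg_vecs, of p ij] p by (simp add: len_ee)
    qed
    also have "\<dots> = real k ^ 2 * (c * (2 * ln (real p)))" by (simp add: idx_card)
    finally show ?thesis .
  qed
  \<comment> \<open>The Lipschitz bound for the tail is proportional to the total exponent, so its
    mean restricted to j >= 2 is needed; it is at most 4 w^2 before division by the mass, which is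
    at least 1.\<close>
  define h where "h = (\<lambda>j::nat. if 2 \<le> j then real j else 0)"
  have hs: "\<exists>s. (\<lambda>j. real (dk_pp k j) ^ 2 * r ^ j * h j) sums s \<and> s \<le> 4 * w\<^sup>2"
  proof -
    let ?f = "\<lambda>j. real (dk_pp k j) ^ 2 * r ^ j * h j"
    have le: "?f (j + 2) \<le> real (j + 2) * w ^ (j + 2)" for j
      using mult_right_mono[OF dk_term_le[OF k r0, of "j + 2"], of "real (j + 2)"] by (simp add: h_def w_def mult.commute)
    have nn: "0 \<le> ?f j" for j using r0 by (simp add: h_def)
    have s2: "summable (\<lambda>j. ?f (j + 2))"
      by (rule summable_comparison_test'[OF tail_bounds(3)[OF w0], of 0]) (use le nn in \<open>simp only: real_norm_def abs_of_nonneg\<close>)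
    have "(\<Sum>j. ?f (j + 2)) \<le> 4 * w\<^sup>2" 
      using suminf_le[OF le s2 tail_bounds(3)[OF w0]] tail_bounds(4)[OF w0] by linarith
    moreover have "?f sums ((\<Sum>j. ?f (j + 2)) + (\<Sum>j<2. ?f j))"
      using sums_iff_shift[of ?f 2 "\<Sum>j. ?f (j + 2)"] summable_sums[OF s2] by simp
    moreover have "(\<Sum>j<2. ?f j) = 0" by (simp add: numeral_2_eq_2 h_def)
    ultimately show ?thesis by (intro exI[of _ "\<Sum>j. ?f (j + 2)"]) simp
  qed
  then obtain s where s: "(\<lambda>j. real (dk_pp k j) ^ 2 * r ^ j * h j) sums s" "s \<le> 4 * w\<^sup>2" by blast
  have hn: "0 \<le> h j" for j by (simp add: h_def)
  note EJ = expectation_J[OF k r0 ms(3) hn s(1), folded m_def]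
  have Eh0: "0 \<le> measure_pmf.expectation (Jpmf k r) h" by (rule Bochner_Integration.integral_nonneg) (rule hn)
  have "1 * measure_pmf.expectation (Jpmf k r) h \<le> m * measure_pmf.expectation (Jpmf k r) h" using m1 Eh0 by (rule mult_right_mono)
  then have Eh: "measure_pmf.expectation (Jpmf k r) h \<le> 4 * w\<^sup>2" using EJ(2) s(2) by simp
  have E2: "\<bar>?E H2\<bar> \<le> c * (2 * ln (real p)) * (4 * w\<^sup>2)"
  proof -
    have "\<bar>?E H2\<bar> \<le> ?E (\<lambda>ab. \<bar>H2 ab\<bar>)" by (rule integral_abs_bound)
    also have "\<dots> \<le> ?E (\<lambda>ab. c * (2 * ln (real p)) * h (n ab))"
    proof (rule pmf_expectation_mono)
      fix ab assume ab: "ab \<in> set_pmf (XX k r)"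
      show "\<bar>H2 ab\<bar> \<le> c * (2 * ln (real p)) * h (n ab)"
        using lip[OF u vC, of ab] len_Xp[OF k ab, of p] by (auto simp: H2_def H_def h_def n_def mult_ac)
    next
      show "integrable (measure_pmf (XX k r)) (\<lambda>ab. c * (2 * ln (real p)) * h (n ab))"
        using expectation_XX_J(2)[OF k, of r h] EJ(1) by (intro integrable_mult_right) (simp add: n_def)
    qed (use iH in auto)
    also have "\<dots> = c * (2 * ln (real p)) * measure_pmf.expectation (Jpmf k r) h"
      using expectation_XX_J(1)[OF k, of r h] by (simp add: n_def)
    also have "\<dots> \<le> c * (2 * ln (real p)) * (4 * w\<^sup>2)" using Eh c lp by (intro mult_left_mono) auto
    finally show ?thesis .
  qed
  have X: "measure_pmf.expectation (Xp k z p) (\<lambda>q. G (u + q)) - G u = ?E H"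
  proof -
    have "integrable (measure_pmf (XX k r)) (\<lambda>ab. G (u + vecp k p ab))"
      by (rule pmf_integrable_bounded[of _ _ 1]) (use G in \<open>simp add: abs_of_nonneg\<close>)
    then show ?thesis by (simp add: Xp_def H_def r_def)
  qed
  \<comment> \<open>Uses 1 - 1/m <= m - 1 <= w + 2 w^2 <= 2w, the last step because w <=
    1/4.\<close>
  have d: "\<bar>r / m * S - r * S\<bar> \<le> c * (2 * ln (real p)) * (2 * w\<^sup>2)"
  proof -
    have "r / m * S - r * S = - (r * S * (1 - 1 / m))" by (simp add: algebra_simps)
    then have "\<bar>r / m * S - r * S\<bar> = r * \<bar>S\<bar> * (1 - 1 / m)" using r0 m1 by (simp add: abs_mult)
    also have "\<dots> \<le> r * (real k ^ 2 * (c * (2 * ln (real p)))) * (2 * w)"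
    proof (intro mult_mono S)
      have "1 - 1 / m \<le> m - 1" using m1 sum_squares_ge_zero[of "m - 1" 0] by (simp add: field_simps)
      also have "\<dots> \<le> w + 2 * w\<^sup>2" using ms by simp
      also have "\<dots> \<le> 2 * w" using w0 mult_right_mono[of w "1/4" w] by (simp add: power2_eq_square)
      finally show "1 - 1 / m \<le> 2 * w" .
    qed (use r0 m1 c lp w0 in auto)
    also have "\<dots> = c * (2 * ln (real p)) * (2 * w\<^sup>2)" by (simp add: w_def power2_eq_square)
    finally show ?thesis .
  qed
  have "\<bar>?E H - r * S\<bar> \<le> c * (2 * ln (real p)) * (2 * w\<^sup>2) + c * (2 * ln (real p)) * (4 * w\<^sup>2)"
    unfolding EH E1 by (rule abs_combine2[OF d E2])
  also have "\<dots> = c * (2 * ln (real p)) * (6 * w\<^sup>2)" by (simp add: algebra_simps)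
  finally show ?thesis unfolding X S_def r_def[symmetric] w_def[symmetric] .
qed

text \<open>Each position has rate z lambda_p; the first-order term agrees with that of
  \<open>Xp\<close> up to lambda_p - 1/p.\<close>

definition Yl :: "nat \<Rightarrow> real \<Rightarrow> nat \<Rightarrow> vec pmf" where
  "Yl k z p = csum (\<lambda>ij. map_pmf (\<lambda>n. sc (real n) (ee p ij)) (poisson_pmf (z * lam p))) (idx k)"

lemma set_Yl: "2 \<le> p \<Longrightarrow> set_pmf (Yl k z p) \<subseteq> nonneg_vecs"
  unfolding Yl_def by (rule set_csum_subset[OF _ nonneg_vecs_0 nonneg_vecs_add]) (auto intro!: sc_nonneg_vecs ee_nonneg_vecs)

lemma set_Xp: "2 \<le> p \<Longrightarrow> set_pmf (Xp k z p) \<subseteq> nonneg_vecs"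
  unfolding Xp_def by (auto intro!: vecp_nonneg_vecs)

text \<open>Pulls the damping at the already accumulated u out of the Lipschitz constant, so that v
  -> W(u + v) fits the expansions above.\<close>

lemma window_shift_lipschitz:
  assumes L: "0 < L" and u: "u \<in> nonneg_vecs" and v: "v \<in> nonneg_vecs" and h: "h \<in> nonneg_vecs"
  shows "\<bar>window k L (u + (v + h)) - window k L (u + v)\<bar> \<le> exp (2 * real k ^ 2) / L * damping k L u * len k h"
proof -
  have "\<bar>window k L (u + v + h) - window k L (u + v)\<bar> \<le> exp (2 * real k ^ 2) / L * len k h * damping k L (u + v)"
    by (rule window_lipschitz[OF L nonneg_vecs_add[OF u v] h])
  also have "\<dots> \<le> exp (2 * real k ^ 2) / L * len k h * (damping k L u * 1)"
    unfolding damping_add using damping_bounds[OF L u] damping_bounds[OF L v] len_nonneg[OF h] L by (intro mult_left_mono) auto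
  finally show ?thesis by (simp add: mult_ac add.assoc)
qed

lemma abs_combine:
  "\<bar>X - g - s\<bar> \<le> a \<Longrightarrow> \<bar>Y - g - t\<bar> \<le> b \<Longrightarrow> b \<le> b' \<Longrightarrow> \<bar>t - s\<bar> \<le> d \<Longrightarrow> \<bar>X - Y\<bar> \<le> a + b' + (d :: real)"
  by linarith

text \<open>Both laws are expanded to first order and the common terms cancel. In units of 2 c ln p,
  with w = k^2 z/p <= 2k^2/p, the errors are 6 w^2 from \<open>Xp\<close>, 2 (2w)^2 from the Poisson
  side as z lambda_p k^2 <= 2w, and 2w/p from lambda_p against 1/p; together at most (14 * 4 + 4)
  k^4/p^2.\<close>

lemma compare_large:
  assumes k: "1 \<le> k" and L: "0 < L" and z: "0 < z" "z \<le> 2" and p: "8 * k ^ 2 \<le> p" "2 \<le> p" and u: "u \<in> nonneg_vecs"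
  shows "\<bar>measure_pmf.expectation (Xp k z p) (\<lambda>x. window k L (u + x)) - measure_pmf.expectation (Yl k z p) (\<lambda>x. window k L (u + x))\<bar>
    \<le> exp (2 * real k ^ 2) / L * (120 * real k ^ 4 * (ln (real p) / real p ^ 2)) * damping k L u"
proof -
  define c where "c = exp (2 * real k ^ 2) / L * damping k L u"
  define G where "G = (\<lambda>v. window k L (u + v))"
  define w where "w = real k ^ 2 * (z / real p)"
  define S where "S = (\<Sum>ij\<in>idx k. G (0 + ee p ij) - G 0)"
  have c0: "0 \<le> c" using L damping_bounds[OF L u] by (simp add: c_def)
  have lp: "0 \<le> ln (real p)" using p by simp
  have G: "0 \<le> G v \<and> G v \<le> 1" for v unfolding G_def by (rule window_bounds[OF L])
  have lip: "\<bar>G (v + h) - G v\<bar> \<le> c * len k h" if "v \<in> nonneg_vecs" "h \<in> nonneg_vecs" for v h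
    unfolding G_def c_def by (rule window_shift_lipschitz[OF L u that])
  have p0: "0 < real p" using p by simp
  have kp: "8 * real k ^ 2 \<le> real p" using p(1) by (metis of_nat_le_iff of_nat_mult of_nat_numeral of_nat_power)
  have w2: "w \<le> 2 * real k ^ 2 / real p"
  proof -
    have "w = real k ^ 2 * z / real p" by (simp add: w_def)
    also have "\<dots> \<le> real k ^ 2 * 2 / real p" using z p0 by (intro divide_right_mono mult_left_mono) auto
    finally show ?thesis by (simp add: mult.commute)
  qed
  also have "2 * real k ^ 2 / real p \<le> 1/4" using kp p0 by (simp add: field_simps)
  finally have w14: "w \<le> 1/4" .
  have w0: "0 \<le> w" using z by (simp add: w_def)
  have X: "\<bar>measure_pmf.expectation (Xp k z p) (\<lambda>q. G (0 + q)) - G 0 - z / real p * S\<bar> \<le> c * (2 * ln (real p)) * (6 * w\<^sup>2)"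
    unfolding S_def w_def by (rule X_first_order[OF k p(2) _ w14[unfolded w_def] c0 lip G nonneg_vecs_0]) (use z in auto)
  have lam0: "0 < z * lam p" using z lam_pos[OF p(2)] by simp
  have Y: "\<bar>measure_pmf.expectation (Yl k z p) (\<lambda>q. G (0 + q)) - G 0 - (z * lam p) * S\<bar> \<le> 2 * c * (2 * ln (real p)) * (z * lam p) ^ 2 * real (card (idx k)) ^ 2"
    unfolding S_def Yl_def
    by (rule csum_poisson_first_order[OF idx_finite lam0 c0 _ _ lip G nonneg_vecs_0]) (use p lp in \<open>auto simp: len_ee intro!: ee_nonneg_vecs\<close>)
  have S: "\<bar>S\<bar> \<le> real k ^ 2 * (c * (2 * ln (real p)))"
  proof -
    have "\<bar>S\<bar> \<le> (\<Sum>ij\<in>idx k. \<bar>G (0 + ee p ij) - G 0\<bar>)" unfolding S_def by (rule sum_abs)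
    also have "\<dots> \<le> (\<Sum>ij\<in>idx k. c * (2 * ln (real p)))"
    proof (rule sum_mono)
      fix ij assume ij: "ij \<in> idx k"
      show "\<bar>G (0 + ee p ij) - G 0\<bar> \<le> c * (2 * ln (real p))" using lip[OF nonneg_vecs_0 ee_nonneg_vecs, of p ij] p len_ee[OF ij] by simp
    qed
    also have "\<dots> = real k ^ 2 * (c * (2 * ln (real p)))" by (simp add: idx_card)
    finally show ?thesis .
  qed
  let ?b = "c * (2 * ln (real p))"
  have b0: "0 \<le> ?b" using c0 lp by simp
  have lw: "z * lam p * real k ^ 2 \<le> 2 * w"
  proof -
    have "z * lam p * real k ^ 2 \<le> z * (2 / real p) * real k ^ 2" using z lam_le'[OF p(2)] by (intro mult_right_mono mult_left_mono) auto
    then show ?thesis by (simp add: w_def mult_ac)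
  qed
  have Y': "2 * c * (2 * ln (real p)) * (z * lam p) ^ 2 * real (card (idx k)) ^ 2 \<le> ?b * (8 * w\<^sup>2)"
  proof -
    have "2 * c * (2 * ln (real p)) * (z * lam p) ^ 2 * real (card (idx k)) ^ 2 = ?b * (2 * (z * lam p * real k ^ 2) ^ 2)"
      by (simp add: idx_card power_mult_distrib)
    also have "\<dots> \<le> ?b * (2 * (2 * w) ^ 2)" using lw lam0 b0 by (intro mult_left_mono power_mono) auto
    finally show ?thesis by (simp add: power_mult_distrib)
  qed
  have d: "\<bar>(z * lam p) * S - z / real p * S\<bar> \<le> ?b * (2 * w / real p)"
  proof -
    have "(z * lam p) * S - z / real p * S = z * (lam p - 1 / real p) * S" by (simp add: algebra_simps)
    then have "\<bar>(z * lam p) * S - z / real p * S\<bar> = z * (lam p - 1 / real p) * \<bar>S\<bar>" using z lam_ge[OF p(2)] by (simp add: abs_mult)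
    also have "\<dots> \<le> z * (2 / real p ^ 2) * (real k ^ 2 * ?b)"
      using z lam_le[OF p(2)] lam_ge[OF p(2)] S by (intro mult_mono mult_left_mono) auto
    also have "\<dots> = ?b * (2 * w / real p)" by (simp add: w_def power2_eq_square mult_ac)
    finally show ?thesis .
  qed
  have "\<bar>measure_pmf.expectation (Xp k z p) (\<lambda>q. G (0 + q)) - measure_pmf.expectation (Yl k z p) (\<lambda>q. G (0 + q))\<bar>
     \<le> ?b * (6 * w\<^sup>2) + ?b * (8 * w\<^sup>2) + ?b * (2 * w / real p)"
    by (rule abs_combine[OF X Y Y' d])
  also have "\<dots> = ?b * (14 * w\<^sup>2 + 2 * w / real p)" by (simp add: algebra_simps)
  also have "\<dots> \<le> ?b * (60 * real k ^ 4 / real p ^ 2)"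
  proof (intro mult_left_mono b0)
    have "w\<^sup>2 \<le> (2 * real k ^ 2 / real p)\<^sup>2" using w0 w2 by (intro power_mono) auto
    also have "\<dots> = 4 * real k ^ 4 / real p ^ 2" by (simp add: power_divide power_mult_distrib flip: power_mult)
    finally have 1: "w\<^sup>2 \<le> 4 * real k ^ 4 / real p ^ 2" .
    have "2 * w / real p \<le> 2 * (2 * real k ^ 2 / real p) / real p" using w2 p0 by (intro divide_right_mono mult_left_mono) auto
    also have "\<dots> = 4 * real k ^ 2 / real p ^ 2" by (simp add: power2_eq_square)
    also have "\<dots> \<le> 4 * real k ^ 4 / real p ^ 2"
      using k by (intro divide_right_mono mult_left_mono power_increasing) auto
    finally have 2: "2 * w / real p \<le> 4 * real k ^ 4 / real p ^ 2" .
    have "14 * w\<^sup>2 + 2 * w / real p \<le> 14 * (4 * real k ^ 4 / real p ^ 2) + 4 * real k ^ 4 / real p ^ 2" using 1 2 by linarith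
    then show "14 * w\<^sup>2 + 2 * w / real p \<le> 60 * real k ^ 4 / real p ^ 2" by simp
  qed
  also have "\<dots> = exp (2 * real k ^ 2) / L * (120 * real k ^ 4 * (ln (real p) / real p ^ 2)) * damping k L u"
    by (simp add: c_def)
  finally show ?thesis by (simp add: G_def)
qed

text \<open>Bounds the unnormalised mean of j, uniformly for r <= theta^2. The midpoint x of theta
  and 1 leaves room on both sides: the series at x^2 converges, and j (theta/x)^(2j) stays
  bounded.\<close>

definition meanb :: "real \<Rightarrow> nat \<Rightarrow> real" where
  "meanb \<theta> k = (1 - (1 + \<theta>) / 2) powr (- (2 * real k)) / (1 - (\<theta> / ((1 + \<theta>) / 2))\<^sup>2)"

lemma mean_bound:
  assumes th: "0 < \<theta>" "\<theta> < 1" and r: "0 \<le> r" "r \<le> \<theta>\<^sup>2"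
  shows "\<exists>s. (\<lambda>j. real (dk_pp k j) ^ 2 * r ^ j * real j) sums s \<and> s \<le> meanb \<theta> k"
proof -
  define x where "x = (1 + \<theta>) / 2"
  define q where "q = (\<theta> / x)\<^sup>2"
  have x: "0 < x" "x < 1" "\<theta> < x" using th by (auto simp: x_def)
  have tx: "0 < \<theta> / x" "\<theta> / x < 1" using th x by auto
  have q: "0 < q" "q < 1" unfolding q_def using tx by (auto simp: power_less_one_iff abs_square_less_1)
  have jq: "real j * q ^ j \<le> 1 / (1 - q)" for j
  proof -
    have "real j * q ^ j = (\<Sum>i<j. q ^ j)" by simp
    also have "\<dots> \<le> (\<Sum>i<j. q ^ i)" using q by (intro sum_mono power_decreasing) auto
    also have "\<dots> \<le> (\<Sum>i. q ^ i)" using q by (intro sum_le_suminf summable_geometric) auto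
    also have "\<dots> = 1 / (1 - q)" using q by (intro suminf_geometric) auto
    finally show ?thesis .
  qed
  have tm: "real (dk_pp k j) ^ 2 * r ^ j * real j \<le> (real (dk_pp k j) ^ 2 * (x\<^sup>2) ^ j) * (1 / (1 - q))" for j
  proof -
    have "r ^ j \<le> (\<theta>\<^sup>2) ^ j" using r by (intro power_mono)
    also have "(\<theta>\<^sup>2) ^ j = (x\<^sup>2) ^ j * q ^ j"
    proof -
      have "x\<^sup>2 * q = \<theta>\<^sup>2" using x by (simp add: q_def power_divide)
      then show ?thesis by (simp only: power_mult_distrib[symmetric])
    qed
    finally have "r ^ j * real j \<le> (x\<^sup>2) ^ j * q ^ j * real j" by (intro mult_right_mono) auto
    also have "\<dots> = (x\<^sup>2) ^ j * (real j * q ^ j)" by simp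
    also have "\<dots> \<le> (x\<^sup>2) ^ j * (1 / (1 - q))" using jq by (intro mult_left_mono) auto
    finally have "real (dk_pp k j) ^ 2 * (r ^ j * real j) \<le> real (dk_pp k j) ^ 2 * ((x\<^sup>2) ^ j * (1 / (1 - q)))" by (intro mult_left_mono) auto
    then show ?thesis by (simp only: mult.assoc)
  qed
  have x2: "0 \<le> x\<^sup>2" "x\<^sup>2 < 1" using x by (auto simp: abs_square_less_1)
  have sm: "summable (\<lambda>j. (real (dk_pp k j) ^ 2 * (x\<^sup>2) ^ j) * (1 / (1 - q)))" by (intro summable_mult2 mass_summable x2)
  have s: "summable (\<lambda>j. real (dk_pp k j) ^ 2 * r ^ j * real j)"
    by (rule summable_comparison_test'[OF sm, of 0]) (use tm r in auto)
  have "(\<Sum>j. real (dk_pp k j) ^ 2 * r ^ j * real j) \<le> (\<Sum>j. (real (dk_pp k j) ^ 2 * (x\<^sup>2) ^ j) * (1 / (1 - q)))"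
    by (rule suminf_le[OF tm s sm])
  also have "\<dots> = mass k (x\<^sup>2) * (1 / (1 - q))" unfolding mass_def by (intro suminf_mult2[symmetric] mass_summable x2)
  also have "\<dots> \<le> (1 - x) powr (- (2 * real k)) * (1 / (1 - q))" using x q by (intro mult_right_mono mass_le) auto
  also have "\<dots> = meanb \<theta> k" by (simp add: meanb_def x_def q_def)
  finally show ?thesis using summable_sums[OF s] by blast
qed

text \<open>No expansion is possible at small primes, so the increment is dropped. The cost is the
  mean length of the increment; the mass is kept on the left because \<open>meanb\<close> bounds the
  unnormalised mean.\<close>

lemma compare_small:
  assumes k: "1 \<le> k" and L: "0 < L" and p: "2 \<le> p" and th: "0 < \<theta>" "\<theta> < 1" and r: "0 \<le> z / real p" "z / real p \<le> \<theta>\<^sup>2" and u: "u \<in> nonneg_vecs"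
  shows "mass k (z / real p) * \<bar>measure_pmf.expectation (Xp k z p) (\<lambda>x. window k L (u + x)) - measure_pmf.expectation (return_pmf 0) (\<lambda>x. window k L (u + x))\<bar>
    \<le> exp (2 * real k ^ 2) / L * (2 * ln (real p) * meanb \<theta> k) * damping k L u"
proof -
  define c where "c = exp (2 * real k ^ 2) / L * damping k L u"
  let ?r = "z / real p"
  let ?E = "measure_pmf.expectation (XX k ?r)"
  have c0: "0 \<le> c" using L damping_bounds[OF L u] by (simp add: c_def)
  have "\<theta>\<^sup>2 < 1" using th by (simp add: abs_square_less_1)
  then have r1: "?r < 1" using r by linarith
  obtain s where s: "(\<lambda>j. real (dk_pp k j) ^ 2 * ?r ^ j * real j) sums s" "s \<le> meanb \<theta> k" using mean_bound[OF th r] by blast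
  note EJ = expectation_J[OF k r(1) r1 _ s(1)]
  have m1: "1 \<le> mass k ?r" by (rule mass_ge_1[OF r(1) r1 k])
  have iW: "integrable (measure_pmf (XX k ?r)) (\<lambda>ab. window k L (u + vecp k p ab))"
    by (rule pmf_integrable_bounded[of _ _ 1]) (use window_bounds[OF L] in \<open>simp add: abs_of_nonneg\<close>)
  have "\<bar>measure_pmf.expectation (Xp k z p) (\<lambda>x. window k L (u + x)) - measure_pmf.expectation (return_pmf 0) (\<lambda>x. window k L (u + x))\<bar>
     = \<bar>?E (\<lambda>ab. window k L (u + vecp k p ab) - window k L u)\<bar>"
    using iW by (simp add: Xp_def)
  also have "\<dots> \<le> ?E (\<lambda>ab. \<bar>window k L (u + vecp k p ab) - window k L u\<bar>)" by (rule integral_abs_bound)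
  also have "\<dots> \<le> ?E (\<lambda>ab. c * (2 * ln (real p)) * real (\<Sum>i=1..k. fst ab i))"
  proof (rule pmf_expectation_mono)
    fix ab assume ab: "ab \<in> set_pmf (XX k ?r)"
    have "\<bar>window k L (u + vecp k p ab) - window k L u\<bar> \<le> exp (2 * real k ^ 2) / L * len k (vecp k p ab) * damping k L u"
      by (rule window_lipschitz[OF L u vecp_nonneg_vecs]) (use p in simp)
    then show "\<bar>window k L (u + vecp k p ab) - window k L u\<bar> \<le> c * (2 * ln (real p)) * real (\<Sum>i=1..k. fst ab i)"
      unfolding len_Xp[OF k ab] by (simp only: c_def mult_ac times_divide_eq_left times_divide_eq_right)
  next
    show "integrable (measure_pmf (XX k ?r)) (\<lambda>ab. c * (2 * ln (real p)) * real (\<Sum>i=1..k. fst ab i))"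
      by (intro integrable_mult_right expectation_XX_J(2)[OF k, of ?r real, THEN iffD2] EJ(1)) simp
  qed (use iW in auto)
  also have "\<dots> = c * (2 * ln (real p)) * measure_pmf.expectation (Jpmf k ?r) real"
    by (simp only: integral_mult_right_zero expectation_XX_J(1)[OF k, of ?r real])
  finally have "mass k ?r * \<bar>measure_pmf.expectation (Xp k z p) (\<lambda>x. window k L (u + x)) - measure_pmf.expectation (return_pmf 0) (\<lambda>x. window k L (u + x))\<bar>
     \<le> mass k ?r * (c * (2 * ln (real p)) * measure_pmf.expectation (Jpmf k ?r) real)" using m1 by (intro mult_left_mono) auto
  also have "\<dots> = c * (2 * ln (real p)) * s" using EJ(2) by (simp add: mult_ac)
  also have "\<dots> \<le> c * (2 * ln (real p)) * meanb \<theta> k" using s(2) c0 p by (intro mult_left_mono) auto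
  finally show ?thesis by (simp add: c_def mult_ac)
qed

lemma Yl_laplace:
  assumes L: "0 < L" and p: "2 \<le> p" and z: "0 < z"
  shows "measure_pmf.expectation (Yl k z p) (damping k L) = exp (real k ^ 2 * (z * lam p * (real p powr (- (2 * real k / L)) - 1)))"
proof -
  let ?w = "real p powr (- (2 * real k / L))"
  have lam0: "0 < z * lam p" using z lam_pos[OF p] by simp
  have w: "0 \<le> ?w" "?w \<le> 1" using p L powr_mono[of "- (2 * real k / L)" 0 "real p"] by auto
  have "measure_pmf.expectation (map_pmf (\<lambda>n. sc (real n) (ee p ij)) (poisson_pmf (z * lam p))) (damping k L) = exp (z * lam p * (?w - 1))"
    if ij: "ij \<in> idx k" for ij
  proof -
    have e: "damping k L (sc (real n) (ee p ij)) = ?w ^ n" for n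
    proof -
      have "damping k L (sc (real n) (ee p ij)) = exp (- (2 * real k / L) * ln (real p)) ^ n"
        unfolding damping_def len_sc len_ee[OF ij] by (subst exp_of_nat_mult[symmetric]) (simp add: mult_ac)
      then show ?thesis using p by (simp add: powr_def)
    qed
    have "ennreal (measure_pmf.expectation (poisson_pmf (z * lam p)) (\<lambda>n. ?w ^ n)) = ennreal (exp (z * lam p * (?w - 1)))"
      using poisson_laplace[OF lam0 w(1)] w
      by (subst nn_integral_pmf_eq_expectation[symmetric, where c = 1]) (auto simp: power_le_one)
    moreover have "0 \<le> measure_pmf.expectation (poisson_pmf (z * lam p)) (\<lambda>n. ?w ^ n)" using w by (intro Bochner_Integration.integral_nonneg) auto
    ultimately show ?thesis by (simp add: e)
  qed
  then have "(\<Prod>ij\<in>idx k. measure_pmf.expectation (map_pmf (\<lambda>n. sc (real n) (ee p ij)) (poisson_pmf (z * lam p))) (damping k L)) 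
     = (\<Prod>ij\<in>idx k. exp (z * lam p * (?w - 1)))" by (intro prod.cong) auto
  also have "\<dots> = exp (real k ^ 2 * (z * lam p * (?w - 1)))" by (simp add: idx_card exp_of_nat_mult[symmetric])
  also have "(\<Prod>ij\<in>idx k. measure_pmf.expectation (map_pmf (\<lambda>n. sc (real n) (ee p ij)) (poisson_pmf (z * lam p))) (damping k L)) = measure_pmf.expectation (Yl k z p) (damping k L)"
    unfolding Yl_def
    by (rule expectation_csum_mult[symmetric, where C = nonneg_vecs])
      (use damping_bounds[OF L] p in \<open>auto simp: nonneg_vecs_0 nonneg_vecs_add damping_add damping_0 intro!: sc_nonneg_vecs ee_nonneg_vecs\<close>)
  finally show ?thesis .
qed

text \<open>One majorant for the damped masses of both local laws. The exponent contains lambda_p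
  p^(-2k/L), the term that will be summed over primes; 8 k^4/p^2 dominates all quadratic
  corrections. The logarithmic estimate at the end controls the Euler factors of
  \<open>a_const\<close>.\<close>

lemma large_R:
  assumes k: "1 \<le> k" and L: "0 < L" and z: "0 < z" "z \<le> 2" and p: "8 * k ^ 2 \<le> p" "2 \<le> p"
  defines "R \<equiv> exp (real k ^ 2 * (z * (lam p * real p powr (- (2 * real k / L)))) + 8 * real k ^ 4 / real p ^ 2)"
  shows "mass k (z / real p) * measure_pmf.expectation (Xp k z p) (damping k L) \<le> R"
    and "mass k (z / real p) * measure_pmf.expectation (Yl k z p) (damping k L) \<le> R"
    and "1 \<le> R" and "mass k (z / real p) \<le> 2" and "1 \<le> mass k (z / real p)"
    and "\<bar>ln (mass k (z / real p)) - real k ^ 2 * z * lam p\<bar> \<le> 8 * real k ^ 4 / real p ^ 2"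
proof -
  let ?w = "real p powr (- (2 * real k / L))"
  define r where "r = z / real p"
  define w where "w = real k ^ 2 * r"
  have p0: "0 < real p" using p by simp
  have kp: "8 * real k ^ 2 \<le> real p" using p(1) by (metis of_nat_le_iff of_nat_mult of_nat_numeral of_nat_power)
  have W: "0 \<le> ?w" "?w \<le> 1" using p L powr_mono[of "- (2 * real k / L)" 0 "real p"] by auto
  have w2: "w \<le> 2 * real k ^ 2 / real p"
  proof -
    have "w = real k ^ 2 * z / real p" by (simp add: w_def r_def)
    also have "\<dots> \<le> real k ^ 2 * 2 / real p" using z p0 by (intro divide_right_mono mult_left_mono) auto
    finally show ?thesis by (simp add: mult.commute)
  qed
  also have "2 * real k ^ 2 / real p \<le> 1/4" using kp p0 by (simp add: field_simps)
  finally have w14: "w \<le> 1/4" .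
  have r0: "0 \<le> r" using z by (simp add: r_def)
  have w0: "0 \<le> w" using r0 by (simp add: w_def)
  have wsq: "w\<^sup>2 \<le> 4 * real k ^ 4 / real p ^ 2"
  proof -
    have "w\<^sup>2 \<le> (2 * real k ^ 2 / real p)\<^sup>2" using w0 w2 by (intro power_mono) auto
    also have "\<dots> = 4 * real k ^ 4 / real p ^ 2" by (simp add: power_divide power_mult_distrib flip: power_mult)
    finally show ?thesis .
  qed
  have wl: "w \<le> real k ^ 2 * (z * lam p)"
  proof -
    have "w = real k ^ 2 * (z * (1 / real p))" by (simp add: w_def r_def)
    also have "\<dots> \<le> real k ^ 2 * (z * lam p)" using z lam_ge[OF p(2)] by (intro mult_left_mono) auto
    finally show ?thesis .
  qed
  note ms = mass_small[OF k r0, folded w_def, OF w14]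
  show m1: "1 \<le> mass k (z / real p)" using ms w0 by (simp add: r_def)
  show "mass k (z / real p) \<le> 2" using ms(1) w14 w0 power_mono[of w "1/4" 2] by (simp add: r_def power2_eq_square)
  show "1 \<le> R" unfolding R_def using z lam_pos[OF p(2)] W by (auto intro!: add_nonneg_nonneg mult_nonneg_nonneg)
  have ml: "mass k r \<le> exp (w + 2 * w\<^sup>2)" using ms(1) exp_ge_add_one_self[of "w + 2 * w\<^sup>2"] by linarith
  have rw: "0 \<le> r * ?w" "real k ^ 2 * (r * ?w) \<le> w"
    using r0 W mult_left_le[of ?w "w"] w0 by (auto simp: w_def mult.assoc)
  have "mass k (r * ?w) \<le> 1 + real k ^ 2 * (r * ?w) + 2 * (real k ^ 2 * (r * ?w))\<^sup>2"
    by (rule mass_small(1)[OF k rw(1)]) (use rw(2) w14 in linarith)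
  also have "\<dots> \<le> 1 + w * ?w + 2 * w\<^sup>2"
    using rw r0 by (intro add_mono mult_left_mono power_mono) (auto simp: w_def mult.assoc)
  also have "\<dots> \<le> exp (w * ?w + 2 * w\<^sup>2)" using exp_ge_add_one_self[of "w * ?w + 2 * w\<^sup>2"] by linarith
  also have "\<dots> \<le> R"
  proof -
    have "w * ?w \<le> real k ^ 2 * (z * lam p) * ?w" using wl W by (intro mult_right_mono) auto
    then show ?thesis unfolding R_def using wsq by (simp add: mult.assoc)
  qed
  finally have a: "mass k (r * ?w) \<le> R" .
  have r1: "z / real p < 1" using ms(3) by (simp add: r_def)
  show "mass k (z / real p) * measure_pmf.expectation (Xp k z p) (damping k L) \<le> R"
    using mass_Xp_laplace[OF k L p(2) _ r1] r0 a by (simp add: r_def)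
  have "mass k r * measure_pmf.expectation (Yl k z p) (damping k L) \<le> exp (w + 2 * w\<^sup>2) * exp (real k ^ 2 * (z * lam p * (?w - 1)))"
    unfolding Yl_laplace[OF L p(2) z(1)] using ml by (intro mult_right_mono) auto
  also have "\<dots> = exp (w + 2 * w\<^sup>2 + real k ^ 2 * (z * lam p * (?w - 1)))" by (simp add: exp_add)
  also have "\<dots> \<le> R"
  proof -
    have "real k ^ 2 * (z * lam p * (?w - 1)) = real k ^ 2 * (z * (lam p * ?w)) - real k ^ 2 * (z * lam p)" by (simp add: algebra_simps)
    then show ?thesis unfolding R_def using wsq wl by simp
  qed
  finally show "mass k (z / real p) * measure_pmf.expectation (Yl k z p) (damping k L) \<le> R" by (simp add: r_def)
  show "\<bar>ln (mass k (z / real p)) - real k ^ 2 * z * lam p\<bar> \<le> 8 * real k ^ 4 / real p ^ 2"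
  proof -
    have mp: "0 < mass k r" using m1 by (simp add: r_def)
    have "ln (mass k r) \<le> ln (exp (w + 2 * w\<^sup>2))" using ml mp by (intro ln_mono) auto
    then have up: "ln (mass k r) \<le> w + 2 * w\<^sup>2" by simp
    have "w - w\<^sup>2 \<le> ln (1 + w)" using ln_one_plus_pos_lower_bound[of w] w0 w14 by simp
    also have "\<dots> \<le> ln (mass k r)" using ms(2) w0 by (intro ln_mono) auto
    finally have lo: "w - w\<^sup>2 \<le> ln (mass k r)" .
    have "real k ^ 2 * z * lam p \<le> real k ^ 2 * z * (1 / real p + 2 / real p ^ 2)" using z lam_le[OF p(2)] by (intro mult_left_mono) auto
    also have "\<dots> = w + real k ^ 2 * z * 2 / real p ^ 2" by (simp add: w_def r_def algebra_simps)
    also have "\<dots> \<le> w + real k ^ 4 * 2 * 2 / real p ^ 2"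
      using z k by (intro add_left_mono divide_right_mono mult_right_mono mult_mono power_increasing) auto
    finally have "real k ^ 2 * z * lam p \<le> w + 4 * real k ^ 4 / real p ^ 2" by (simp add: mult_ac)
    then show ?thesis using up lo wsq wl by (simp add: r_def[symmetric] abs_le_iff mult.assoc)
  qed
qed

section \<open>The first replacement, over all primes up to N\<close>

definition YY :: "nat \<Rightarrow> real \<Rightarrow> nat \<Rightarrow> nat \<Rightarrow> vec pmf" where
  "YY k z y p = (if p \<le> y then return_pmf 0 else Yl k z p)"

text \<open>The sum of the local costs converges: ln p/p^2 over the large primes gives
  \<open>sq_sum\<close>, and for p <= y the crude bound y^2 for the sum of ln p suffices, being a
  power of k. The 240 is twice 120 because a large prime has mass at most 2.\<close>

lemma lindeberg_primes:
  assumes k: "1 \<le> k" and N: "2 \<le> N" and th: "0 < \<theta>" "\<theta> < 1" and z: "0 < z" "z \<le> 2 * \<theta>\<^sup>2"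
    and yN: "8 * k ^ 2 \<le> N"
  defines "L \<equiv> ln (real N)" and "y \<equiv> 8 * k ^ 2"
  shows "(\<Prod>p\<in>pr N. mass k (z / real p)) * 
      \<bar>measure_pmf.expectation (csum (Xp k z) (pr N)) (window k L) - measure_pmf.expectation (csum (YY k z y) (pr N)) (window k L)\<bar>
    \<le> exp (2 * real k ^ 2) / L * (2 * real y ^ 2 * meanb \<theta> k + 240 * real k ^ 4 * sq_sum) *
      ((\<Prod>p\<in>pr y. mass k (z / real p)) * exp (real k ^ 2 * (z * (\<Sum>p\<in>PA y N. lam p * real p powr (- (2 * real k / L)))) + 4 * real k ^ 4 * (\<Sum>p\<in>PA y N. 2 / real p ^ 2)))"
proof -
  let ?m = "\<lambda>p. mass k (z / real p)"
  let ?e = "exp (2 * real k ^ 2) / L"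
  have L: "0 < L" using N by (simp add: L_def)
  have th2: "\<theta>\<^sup>2 < 1" using th by (simp add: abs_square_less_1)
  have z2: "z \<le> 2" using z th2 by linarith
  have r: "0 \<le> z / real p" "z / real p \<le> \<theta>\<^sup>2" "z / real p < 1" if "2 \<le> p" for p
  proof -
    show "0 \<le> z / real p" using z by simp
    have "z / real p \<le> z / 2" using z that by (intro divide_left_mono) auto
    then show "z / real p \<le> \<theta>\<^sup>2" using z by linarith
    then show "z / real p < 1" using th2 by linarith
  qed
  have m1: "1 \<le> ?m p" if "2 \<le> p" for p by (rule mass_ge_1[OF r(1,3)[OF that] k])
  have meanb0: "0 \<le> meanb \<theta> k"
  proof -
    obtain s where s: "(\<lambda>j. real (dk_pp k j) ^ 2 * 0 ^ j * real j) sums s" "s \<le> meanb \<theta> k" using mean_bound[OF th, of 0 k] by auto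
    have "0 \<le> s" by (rule sums_le[OF _ sums_zero s(1)]) simp
    then show ?thesis using s(2) by simp
  qed
  define Rl where "Rl = (\<lambda>p. exp (real k ^ 2 * (z * (lam p * real p powr (- (2 * real k / L)))) + 8 * real k ^ 4 / real p ^ 2))"
  \<comment> \<open>For p <= y damping is not exploited: it is at most 1, so the mass itself serves
    as the bound.\<close>
  define R where "R = (\<lambda>p. if p \<le> y then ?m p else Rl p)"
  \<comment> \<open>\<open>compare_small\<close> bounds the mass times the difference, hence the
    division by the mass, which cancels again in the total cost.\<close>
  define eps where "eps = (\<lambda>p. if p \<le> y then ?e * (2 * ln (real p) * meanb \<theta> k) / ?m p else ?e * (120 * real k ^ 4 * (ln (real p) / real p ^ 2)))"
  have lg: "8 * k ^ 2 \<le> p" if "\<not> p \<le> y" for p using that by (simp add: y_def)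
  interpret lindeberg "pr N" nonneg_vecs "window k L" "damping k L" ?m R
  proof
    show "0 \<in> nonneg_vecs" by (rule nonneg_vecs_0)
    show "u + v \<in> nonneg_vecs" if "u \<in> nonneg_vecs" "v \<in> nonneg_vecs" for u v using that by (rule nonneg_vecs_add)
    show "0 \<le> window k L u \<and> window k L u \<le> 1" for u by (rule window_bounds[OF L])
    show "0 \<le> damping k L u \<and> damping k L u \<le> 1" if "u \<in> nonneg_vecs" for u by (rule damping_bounds[OF L that])
    show "damping k L (u + v) = damping k L u * damping k L v" for u v by (rule damping_add)
    show "damping k L 0 = 1" by (rule damping_0)
    show "0 \<le> ?m p" if "p \<in> pr N" for p using m1[OF prD(3)[OF that]] by simp
    show "1 \<le> R p" if "p \<in> pr N" for p
      using m1[OF prD(3)[OF that]] large_R(3)[OF k L z(1) z2 lg prD(3)[OF that]] by (auto simp: R_def Rl_def)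
  qed
  have E_le_1: "measure_pmf.expectation A (damping k L) \<le> 1" if "set_pmf A \<subseteq> nonneg_vecs" for A
    using pmf_expectation_bounds[of A "damping k L" 1] damping_bounds[OF L] that by blast
  have main: "(\<Prod>p\<in>pr N. ?m p) * \<bar>measure_pmf.expectation (csum (Xp k z) (pr N)) (\<lambda>x. window k L (0 + x)) - measure_pmf.expectation (csum (YY k z y) (pr N)) (\<lambda>x. window k L (0 + x))\<bar>
     \<le> (\<Sum>p\<in>pr N. ?m p * eps p) * (\<Prod>p\<in>pr N. R p) * damping k L 0"
  proof (rule lindeberg_swap)
    show "finite (pr N)" "pr N \<subseteq> pr N" by auto
    fix p assume pN: "p \<in> pr N"
    then have p2: "2 \<le> p" by (rule prD)
    show "set_pmf (Xp k z p) \<subseteq> nonneg_vecs" by (rule set_Xp[OF p2])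
    show "set_pmf (YY k z y p) \<subseteq> nonneg_vecs" using set_Yl[OF p2] nonneg_vecs_0 by (auto simp: YY_def)
    show "?m p * measure_pmf.expectation (Xp k z p) (damping k L) \<le> R p"
    proof (cases "p \<le> y")
      case True
      have "?m p * measure_pmf.expectation (Xp k z p) (damping k L) \<le> ?m p * 1"
        using m1[OF p2] by (intro mult_left_mono E_le_1 set_Xp p2) auto
      then show ?thesis using True by (simp add: R_def)
    next
      case False
      then show ?thesis using large_R(1)[OF k L z(1) z2 lg[OF False] p2] by (simp add: R_def Rl_def)
    qed
    show "?m p * measure_pmf.expectation (YY k z y p) (damping k L) \<le> R p"
    proof (cases "p \<le> y")
      case True
      then show ?thesis by (simp add: R_def YY_def damping_0)
    next
      case False
      then show ?thesis using large_R(2)[OF k L z(1) z2 lg[OF False] p2] by (simp add: R_def Rl_def YY_def)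
    qed
    show "0 \<le> eps p" using m1[OF p2] meanb0 p2 L by (auto simp: eps_def)
    fix u assume u: "u \<in> nonneg_vecs"
    show "\<bar>measure_pmf.expectation (Xp k z p) (\<lambda>x. window k L (u + x)) - measure_pmf.expectation (YY k z y p) (\<lambda>x. window k L (u + x))\<bar> \<le> eps p * damping k L u"
    proof (cases "p \<le> y")
      case True
      have "?m p * \<bar>measure_pmf.expectation (Xp k z p) (\<lambda>x. window k L (u + x)) - measure_pmf.expectation (return_pmf 0) (\<lambda>x. window k L (u + x))\<bar>
        \<le> ?e * (2 * ln (real p) * meanb \<theta> k) * damping k L u" by (rule compare_small[OF k L p2 th r(1,2)[OF p2] u])
      moreover have "X \<le> B / m * D" if "m * X \<le> B * D" "1 \<le> m" for X B D m :: real
      proof -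
        have "X \<le> (B * D) / m" using that by (subst pos_le_divide_eq) (auto simp: mult.commute)
        then show ?thesis by simp
      qed
      ultimately have "\<bar>measure_pmf.expectation (Xp k z p) (\<lambda>x. window k L (u + x)) - measure_pmf.expectation (return_pmf 0) (\<lambda>x. window k L (u + x))\<bar>
        \<le> ?e * (2 * ln (real p) * meanb \<theta> k) / ?m p * damping k L u" using m1[OF p2] by blast
      then show ?thesis unfolding eps_def YY_def using True by (simp only: if_True)
    next
      case False
      then show ?thesis using compare_large[OF k L z(1) z2 lg[OF False] p2 u] by (simp add: eps_def YY_def)
    qed
  qed (rule nonneg_vecs_0)
  have sum_eps: "(\<Sum>p\<in>pr N. ?m p * eps p) \<le> ?e * (2 * real y ^ 2 * meanb \<theta> k + 240 * real k ^ 4 * sq_sum)"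
  proof -
    have "(\<Sum>p\<in>pr N. ?m p * eps p) \<le> (\<Sum>p\<in>pr N. ?e * (2 * meanb \<theta> k) * (if p \<le> y then ln (real p) else 0) + ?e * (240 * real k ^ 4) * (ln (real p) / real p ^ 2))"
    proof (rule sum_mono)
      fix p assume "p \<in> pr N"
      then have p2: "2 \<le> p" by (rule prD)
      have nn: "0 \<le> ?e * (240 * real k ^ 4) * (ln (real p) / real p ^ 2)" using L p2 by auto
      show "?m p * eps p \<le> ?e * (2 * meanb \<theta> k) * (if p \<le> y then ln (real p) else 0) + ?e * (240 * real k ^ 4) * (ln (real p) / real p ^ 2)"
      proof (cases "p \<le> y")
        case True
        have "?m p * eps p = ?e * (2 * ln (real p) * meanb \<theta> k)" using True m1[OF p2] by (simp add: eps_def)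
        then show ?thesis using nn True by (simp add: mult_ac)
      next
        case False
        have "?m p * eps p \<le> 2 * eps p"
          using large_R(4)[OF k L z(1) z2 lg[OF False] p2] False L p2 by (intro mult_right_mono) (auto simp: eps_def)
        also have "2 * eps p = ?e * (240 * real k ^ 4) * (ln (real p) / real p ^ 2)" using False by (simp add: eps_def)
        finally show ?thesis using False by simp
      qed
    qed
    also have "\<dots> = ?e * (2 * meanb \<theta> k) * (\<Sum>p\<in>pr N. if p \<le> y then ln (real p) else 0) + ?e * (240 * real k ^ 4) * (\<Sum>p\<in>pr N. ln (real p) / real p ^ 2)"
      by (simp only: sum.distrib sum_distrib_left)
    also have "\<dots> \<le> ?e * (2 * meanb \<theta> k) * real y ^ 2 + ?e * (240 * real k ^ 4) * sq_sum"
    proof (intro add_mono mult_left_mono sum_ln_div_square)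
      have "(\<Sum>p\<in>pr N. if p \<le> y then ln (real p) else 0) = (\<Sum>p\<in>{p\<in>pr N. p \<le> y}. ln (real p))"
        by (rule sum.inter_filter[symmetric]) simp
      also have "\<dots> \<le> (\<Sum>p\<in>{1..y}. real y)"
      proof (rule sum_mono2[THEN order_trans[rotated]])
        show "(\<Sum>p\<in>{p\<in>pr N. p \<le> y}. ln (real p)) \<le> (\<Sum>p\<in>{p\<in>pr N. p \<le> y}. real y)"
        proof (rule sum_mono)
          fix p assume "p \<in> {p\<in>pr N. p \<le> y}"
          then have "p \<le> y" "2 \<le> p" using prD(3) by auto
          then have "ln (real p) \<le> real p" using ln_le_minus_one[of "real p"] by simp
          then show "ln (real p) \<le> real y" using \<open>p \<le> y\<close> by linarith
        qed
      qed (auto dest!: prD(3))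
      also have "\<dots> = real y ^ 2" by (simp add: power2_eq_square)
      finally show "(\<Sum>p\<in>pr N. if p \<le> y then ln (real p) else 0) \<le> real y ^ 2" .
    qed (use L meanb0 in auto)
    finally show ?thesis by (simp add: algebra_simps)
  qed
  have pry: "pr y \<subseteq> pr N" using yN by (auto simp: pr_def y_def)
  have prod_R: "(\<Prod>p\<in>pr N. R p) = (\<Prod>p\<in>pr y. ?m p) * exp (real k ^ 2 * (z * (\<Sum>p\<in>PA y N. lam p * real p powr (- (2 * real k / L)))) + 4 * real k ^ 4 * (\<Sum>p\<in>PA y N. 2 / real p ^ 2))"
  proof -
    have "(\<Prod>p\<in>pr N. R p) = (\<Prod>p\<in>pr N - pr y. R p) * (\<Prod>p\<in>pr y. R p)" by (rule prod.subset_diff[OF pry]) simp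
    also have "(\<Prod>p\<in>pr y. R p) = (\<Prod>p\<in>pr y. ?m p)" by (intro prod.cong) (auto simp: R_def dest: prD)
    also have "(\<Prod>p\<in>pr N - pr y. R p) = (\<Prod>p\<in>PA y N. exp (real k ^ 2 * (z * (lam p * real p powr (- (2 * real k / L)))) + 8 * real k ^ 4 / real p ^ 2))"
      unfolding PA_def by (intro prod.cong) (auto simp: R_def Rl_def pr_def)
    also have "\<dots> = exp (\<Sum>p\<in>PA y N. real k ^ 2 * (z * (lam p * real p powr (- (2 * real k / L)))) + 8 * real k ^ 4 / real p ^ 2)"
      by (rule exp_sum[symmetric]) simp
    also have "(\<Sum>p\<in>PA y N. real k ^ 2 * (z * (lam p * real p powr (- (2 * real k / L)))) + 8 * real k ^ 4 / real p ^ 2)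
       = real k ^ 2 * (z * (\<Sum>p\<in>PA y N. lam p * real p powr (- (2 * real k / L)))) + 4 * real k ^ 4 * (\<Sum>p\<in>PA y N. 2 / real p ^ 2)"
      by (simp add: sum.distrib sum_distrib_left)
    finally show ?thesis by (simp only: mult.commute)
  qed
  have R0: "0 \<le> (\<Prod>p\<in>pr N. R p)" using R by (intro prod_nonneg) (auto intro: order_trans[OF zero_le_one])
  have "(\<Sum>p\<in>pr N. ?m p * eps p) * (\<Prod>p\<in>pr N. R p) \<le> ?e * (2 * real y ^ 2 * meanb \<theta> k + 240 * real k ^ 4 * sq_sum) * (\<Prod>p\<in>pr N. R p)"
    by (rule mult_right_mono[OF sum_eps R0])
  then show ?thesis using main unfolding prod_R damping_0 by simp
qed

text \<open>The double sum over primes and positions is exchanged: collected by position, the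
  Poisson variables of all primes form an independent copy of T at each (i, j).\<close>

lemma csum_YY:
  assumes z: "0 < z" "z \<le> 2" and y: "1 \<le> y"
  shows "csum (YY k z y) (pr N) = csum (\<lambda>ij. map_pmf (\<lambda>t. sc t (uv ij)) (rough.TT z y N)) (idx k)"
proof -
  interpret rough z y using z y by unfold_locales
  have "csum (YY k z y) (pr N) = csum (YY k z y) (PA y N)"
    by (rule csum_mono_neutral) (auto simp: PA_def YY_def pr_def)
  also have "\<dots> = csum (\<lambda>p. csum (\<lambda>ij. map_pmf (\<lambda>n. sc (real n) (ee p ij)) (poisson_pmf (z * lam p))) (idx k)) (PA y N)"
    by (rule csum_cong) (auto simp: YY_def Yl_def PA_def pr_def)
  also have "\<dots> = csum (\<lambda>ij. csum (\<lambda>p. map_pmf (\<lambda>n. sc (real n) (ee p ij)) (poisson_pmf (z * lam p))) (PA y N)) (idx k)"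
    by (rule csum_swap)
  also have "\<dots> = csum (\<lambda>ij. map_pmf (\<lambda>t. sc t (uv ij)) (TT N)) (idx k)"
  proof (rule csum_cong)
    fix ij
    have "map_pmf (\<lambda>t. sc t (uv ij)) (TT N) = csum (\<lambda>p. map_pmf (\<lambda>t. sc t (uv ij)) (map_pmf (\<lambda>n. real n * ln (real p)) (poisson_pmf (z * lam p)))) (PA y N)"
      unfolding TT_def cpoisson_def by (rule map_pmf_csum) (auto simp: sc_def fun_eq_iff distrib_right)
    also have "\<dots> = csum (\<lambda>p. map_pmf (\<lambda>n. sc (real n) (ee p ij)) (poisson_pmf (z * lam p))) (PA y N)"
      by (simp add: map_pmf_comp sc_def ee_def mult.assoc)
    finally show "csum (\<lambda>p. map_pmf (\<lambda>n. sc (real n) (ee p ij)) (poisson_pmf (z * lam p))) (PA y N) = map_pmf (\<lambda>t. sc t (uv ij)) (TT N)" by simp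
  qed simp
  finally show ?thesis .
qed

section \<open>Comparison with a continuous density\<close>

definition lin :: "(nat \<times> nat) set \<Rightarrow> (nat \<times> nat \<Rightarrow> real) \<Rightarrow> vec" where
  "lin J t = (\<lambda>c. \<Sum>j\<in>J. t j * uv j c)"

lemma lin_insert: "finite J \<Longrightarrow> a \<notin> J \<Longrightarrow> lin (insert a J) t = sc (t a) (uv a) + lin J t"
  by (simp add: lin_def sc_def fun_eq_iff)

lemma lin_cong: "(\<And>j. j \<in> J \<Longrightarrow> s j = t j) \<Longrightarrow> lin J s = lin J t"
  by (auto simp: lin_def intro!: sum.cong)

lemma window_measurable:
  assumes "\<And>c. (\<lambda>x. f x c) \<in> borel_measurable M"
  shows "(\<lambda>x. window k L (f x)) \<in> borel_measurable M"
  unfolding window_def using assms by measurable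

text \<open>One form for two situations: the law of T as a Borel measure with g = 1, and Lebesgue
  measure with density g and substitution h. Identities between them go by induction on J,
  integrating out one position at a time.\<close>

definition window_integral :: "'m measure \<Rightarrow> ('m \<Rightarrow> real) \<Rightarrow> ('m \<Rightarrow> real) \<Rightarrow> nat \<Rightarrow> real \<Rightarrow> (nat \<times> nat) set \<Rightarrow> vec \<Rightarrow> ennreal" where
  "window_integral M g h k L J u = (\<integral>\<^sup>+x. ennreal (\<Prod>j\<in>J. g (x j)) * ennreal (window k L (u + lin J (\<lambda>j. h (x j)))) \<partial>PiM J (\<lambda>_. M))"

lemma window_integral_insert:
  assumes M: "sigma_finite_measure M" and [measurable]: "g \<in> borel_measurable M" "h \<in> borel_measurable M" and g: "\<And>x. 0 \<le> g x"
    and J: "finite J" "a \<notin> J"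
  shows "window_integral M g h k L (insert a J) u = (\<integral>\<^sup>+y. ennreal (g y) * window_integral M g h k L J (u + sc (h y) (uv a)) \<partial>M)"
proof -
  interpret sigma_finite_measure M by fact
  interpret product_sigma_finite "\<lambda>_. M" by unfold_locales
  have 1: "(\<lambda>x. window k L (u + lin (insert a J) (\<lambda>j. h (x j)))) \<in> borel_measurable (PiM (insert a J) (\<lambda>_. M))"
    by (rule window_measurable) (simp add: lin_def, measurable)
  have 2: "(\<lambda>x. \<Prod>j\<in>insert a J. g (x j)) \<in> borel_measurable (PiM (insert a J) (\<lambda>_. M))" by measurable
  have 3: "(\<lambda>x. window k L (v + lin J (\<lambda>j. h (x j)))) \<in> borel_measurable (PiM J (\<lambda>_. M))" for v
    by (rule window_measurable) (simp add: lin_def, measurable)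
  have 4: "(\<lambda>x. \<Prod>j\<in>J. g (x j)) \<in> borel_measurable (PiM J (\<lambda>_. M))" by measurable
  have "window_integral M g h k L (insert a J) u = (\<integral>\<^sup>+y. (\<integral>\<^sup>+x. ennreal (\<Prod>j\<in>insert a J. g ((x(a := y)) j)) * ennreal (window k L (u + lin (insert a J) (\<lambda>j. h ((x(a := y)) j)))) \<partial>PiM J (\<lambda>_. M)) \<partial>M)"
    unfolding window_integral_def by (rule product_nn_integral_insert_rev[OF J]) (use 1 2 in measurable)
  also have "\<dots> = (\<integral>\<^sup>+y. (\<integral>\<^sup>+x. ennreal (g y) * (ennreal (\<Prod>j\<in>J. g (x j)) * ennreal (window k L (u + sc (h y) (uv a) + lin J (\<lambda>j. h (x j))))) \<partial>PiM J (\<lambda>_. M)) \<partial>M)"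
  proof (intro nn_integral_cong)
    fix y x
    have "(\<Prod>j\<in>insert a J. g ((x(a := y)) j)) = g y * (\<Prod>j\<in>J. g (x j))"
      using J by (simp add: prod.insert) (intro prod.cong disjI2, auto)
    moreover have "lin (insert a J) (\<lambda>j. h ((x(a := y)) j)) = sc (h y) (uv a) + lin J (\<lambda>j. h (x j))"
      unfolding lin_insert[OF J] using J by (intro arg_cong2[where f="(+)"] lin_cong) auto
    ultimately show "ennreal (\<Prod>j\<in>insert a J. g ((x(a := y)) j)) * ennreal (window k L (u + lin (insert a J) (\<lambda>j. h ((x(a := y)) j))))
      = ennreal (g y) * (ennreal (\<Prod>j\<in>J. g (x j)) * ennreal (window k L (u + sc (h y) (uv a) + lin J (\<lambda>j. h (x j)))))"
      by (simp only: ennreal_mult[OF g prod_nonneg[OF g]] mult.assoc add.assoc)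
  qed
  also have "\<dots> = (\<integral>\<^sup>+y. ennreal (g y) * window_integral M g h k L J (u + sc (h y) (uv a)) \<partial>M)"
    unfolding window_integral_def by (intro nn_integral_cong nn_integral_cmult) (use 3 4 in measurable)
  finally show ?thesis .
qed

lemma window_integral_empty: "0 < L \<Longrightarrow> window_integral M g h k L {} u = ennreal (window k L u)"
proof -
  have "lin {} t = 0" for t by (simp add: lin_def fun_eq_iff)
  then show ?thesis by (simp add: window_integral_def PiM_empty nn_integral_count_space_finite)
qed

lemma window_integral_borel:
  assumes M: "sigma_finite_measure M" and [measurable]: "g \<in> borel_measurable M" "h \<in> borel_measurable M" and J: "finite J"
  shows "(\<lambda>t. window_integral M g h k L J (u + sc t v)) \<in> borel_measurable borel"
proof -
  interpret sigma_finite_measure M by fact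
  interpret product_sigma_finite "\<lambda>_. M" by unfold_locales
  interpret P: finite_product_sigma_finite "\<lambda>_. M" J by unfold_locales (rule J)
  have [measurable]: "(\<lambda>x. window k L (u + sc (fst x) v + lin J (\<lambda>j. h (snd x j)))) \<in> borel_measurable (borel \<Otimes>\<^sub>M PiM J (\<lambda>_. M))"
    by (rule window_measurable) (simp add: lin_def sc_def, measurable)
  show ?thesis unfolding window_integral_def
    by (rule P.borel_measurable_nn_integral) (simp add: case_prod_beta, measurable)
qed

text \<open>Both sides peel off one position in the same way. The discrete law is pushed forward to
  the Borel sets, where the product measures are to be compared.\<close>

lemma window_integral_pmf:
  assumes L: "0 < L" and J: "finite J" and h0 [measurable]: "h0 \<in> borel_measurable borel"
  shows "(\<integral>\<^sup>+q. ennreal (window k L (u + q)) \<partial>measure_pmf (csum (\<lambda>ij. map_pmf (\<lambda>t. sc (h0 t) (uv ij)) T) J)) = window_integral (distr (measure_pmf T) borel id) (\<lambda>_. 1) h0 k L J u"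
  using J
proof (induction J arbitrary: u)
  case empty
  then show ?case by (simp add: window_integral_empty[OF L])
next
  case (insert a J)
  let ?D = "distr (measure_pmf T) borel id"
  interpret D: prob_space ?D by (rule measure_pmf.prob_space_distr) simp
  have sf: "sigma_finite_measure ?D" by unfold_locales
  have "(\<integral>\<^sup>+q. ennreal (window k L (u + q)) \<partial>measure_pmf (csum (\<lambda>ij. map_pmf (\<lambda>t. sc (h0 t) (uv ij)) T) (insert a J)))
    = (\<integral>\<^sup>+t. \<integral>\<^sup>+q. ennreal (window k L (u + sc (h0 t) (uv a) + q)) \<partial>measure_pmf (csum (\<lambda>ij. map_pmf (\<lambda>t. sc (h0 t) (uv ij)) T) J) \<partial>measure_pmf T)"
    using insert(1,2) by (simp add: csum_insert cpmf_def add.assoc)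
  also have "\<dots> = (\<integral>\<^sup>+t. window_integral ?D (\<lambda>_. 1) h0 k L J (u + sc (h0 t) (uv a)) \<partial>measure_pmf T)"
    by (simp only: insert.IH)
  also have "\<dots> = (\<integral>\<^sup>+t. window_integral ?D (\<lambda>_. 1) h0 k L J (u + sc (h0 t) (uv a)) \<partial>?D)"
    by (subst nn_integral_distr) (auto intro!: measurable_compose[OF h0 window_integral_borel] sf insert)
  also have "\<dots> = window_integral ?D (\<lambda>_. 1) h0 k L (insert a J) u"
    by (subst window_integral_insert) (auto intro!: sf insert)
  finally show ?case .
qed

text \<open>Moves density and substitution from the measure into the integrand, one coordinate per
  induction step, which turns the model measure into plain Lebesgue measure.\<close>

lemma window_integral_distr_density:
  assumes L: "0 < L" and J: "finite J" and M: "sigma_finite_measure M" and sf: "sigma_finite_measure (distr (density M (\<lambda>x. ennreal (g x))) borel h)"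
    and [measurable]: "g \<in> borel_measurable M" "h \<in> borel_measurable M" and g: "\<And>x. 0 \<le> g x" and h0 [measurable]: "h0 \<in> borel_measurable borel"
  shows "window_integral (distr (density M (\<lambda>x. ennreal (g x))) borel h) (\<lambda>_. 1) h0 k L J u = window_integral M g (\<lambda>x. h0 (h x)) k L J u"
  using J
proof (induction J arbitrary: u)
  case empty
  then show ?case by (simp add: window_integral_empty[OF L])
next
  case (insert a J)
  let ?D = "distr (density M (\<lambda>x. ennreal (g x))) borel h"
  have m: "(\<lambda>t. window_integral ?D (\<lambda>_. 1) h0 k L J (u + sc (h0 t) (uv a))) \<in> borel_measurable borel" by (rule measurable_compose[OF h0 window_integral_borel[OF sf _ _ insert(1)]]) auto
  have m': "(\<lambda>x. window_integral ?D (\<lambda>_. 1) h0 k L J (u + sc (h0 (h x)) (uv a))) \<in> borel_measurable M"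
    by (rule measurable_compose[OF _ m]) measurable
  have "window_integral ?D (\<lambda>_. 1) h0 k L (insert a J) u = (\<integral>\<^sup>+t. window_integral ?D (\<lambda>_. 1) h0 k L J (u + sc (h0 t) (uv a)) \<partial>?D)"
    by (subst window_integral_insert) (auto intro!: sf insert)
  also have "\<dots> = (\<integral>\<^sup>+x. window_integral ?D (\<lambda>_. 1) h0 k L J (u + sc (h0 (h x)) (uv a)) \<partial>density M (\<lambda>x. ennreal (g x)))"
    by (rule nn_integral_distr) (use m in auto)
  also have "\<dots> = (\<integral>\<^sup>+x. ennreal (g x) * window_integral ?D (\<lambda>_. 1) h0 k L J (u + sc (h0 (h x)) (uv a)) \<partial>M)"
    by (rule nn_integral_density) (use m' in auto)
  also have "\<dots> = (\<integral>\<^sup>+x. ennreal (g x) * window_integral M g (\<lambda>x. h0 (h x)) k L J (u + sc (h0 (h x)) (uv a)) \<partial>M)"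
    by (simp only: insert.IH)
  also have "\<dots> = window_integral M g (\<lambda>x. h0 (h x)) k L (insert a J) u"
    by (subst window_integral_insert[OF M]) (auto intro!: insert g)
  finally show ?case .
qed

section \<open>Replacement on product measures and an integral formula\<close>

lemma finite_measure_integrable:
  fixes f :: "'q \<Rightarrow> real"
  assumes "finite_measure M" "f \<in> borel_measurable M" "\<And>x. \<bar>f x\<bar> \<le> B"
  shows "integrable M f"
  by (rule finite_measure.integrable_const_bound[OF assms(1), of _ B]) (use assms in auto)

text \<open>\<open>H A\<close> uses P2 in the coordinates of A and P1 elsewhere. Changing one
  coordinate costs epsilon times the product of d over the others, and d integrates to at most R
  under either measure; hence R^(card J - 1) for each of the \<open>card J\<close> changes.\<close>

lemma PiM_swap:
  fixes F :: "('j \<Rightarrow> real) \<Rightarrow> real" and d :: "real \<Rightarrow> real"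
  assumes J: "finite J"
    and P: "finite_measure P1" "finite_measure P2" "sets P1 = sets borel" "sets P2 = sets borel"
    and F: "F \<in> borel_measurable (PiM J (\<lambda>_. borel))" "\<And>x. 0 \<le> F x \<and> F x \<le> 1"
    and d: "d \<in> borel_measurable borel" "\<And>x. 0 \<le> d x \<and> d x \<le> 1"
    and R: "integral\<^sup>L P1 d \<le> R" "integral\<^sup>L P2 d \<le> R"
    and \<epsilon>: "0 \<le> \<epsilon>"
    and step: "\<And>a x. a \<in> J \<Longrightarrow> \<bar>(\<integral>y. F (x(a := y)) \<partial>P1) - (\<integral>y. F (x(a := y)) \<partial>P2)\<bar> \<le> \<epsilon> * (\<Prod>j\<in>J - {a}. d (x j))"
  shows "\<bar>(\<integral>x. F x \<partial>PiM J (\<lambda>_. P1)) - (\<integral>x. F x \<partial>PiM J (\<lambda>_. P2))\<bar> \<le> real (card J) * (\<epsilon> * R ^ (card J - 1))"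
proof -
  interpret P1: finite_measure P1 by fact
  interpret P2: finite_measure P2 by fact
  define \<Phi> :: "'j set \<Rightarrow> 'j \<Rightarrow> real measure" where "\<Phi> = (\<lambda>A j. if j \<in> A then P2 else P1)"
  have sf: "product_sigma_finite (\<Phi> A)" for A
    by (rule product_sigma_finite.intro) (simp add: \<Phi>_def P1.sigma_finite_measure_axioms P2.sigma_finite_measure_axioms)
  have fin: "finite_measure (\<Phi> A j)" for A j using P by (simp add: \<Phi>_def)
  have setsPhi: "sets (\<Phi> A j) = sets borel" for A j using P by (simp add: \<Phi>_def)
  have setsPi: "sets (PiM I (\<Phi> A)) = sets (PiM I (\<lambda>_. borel))" for I A by (rule sets_PiM_cong) (auto simp: setsPhi)
  have finPi: "finite_measure (PiM I (\<Phi> A))" if "finite I" for I A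
  proof (rule finite_measureI)
    interpret product_sigma_finite "\<Phi> A" by (rule sf)
    have "emeasure (PiM I (\<Phi> A)) (space (PiM I (\<Phi> A))) = (\<Prod>i\<in>I. emeasure (\<Phi> A i) (space (\<Phi> A i)))"
      unfolding space_PiM by (rule emeasure_PiM[OF that]) auto
    also have "\<dots> \<noteq> \<infinity>" using finite_measure.emeasure_finite[OF fin] by (simp add: ennreal_prod_eq_top)
    finally show "emeasure (PiM I (\<Phi> A)) (space (PiM I (\<Phi> A))) \<noteq> \<infinity>" .
  qed
  define H where "H = (\<lambda>A. \<integral>x. F x \<partial>PiM J (\<Phi> A))"
  have swap1: "\<bar>H (insert a A) - H A\<bar> \<le> \<epsilon> * R ^ (card J - 1)" if a: "a \<in> J" "a \<notin> A" for a A
  proof -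
    let ?J = "J - {a}"
    have Jeq: "insert a ?J = J" using a by blast
    have fJ: "finite ?J" "a \<notin> ?J" using J by auto
    have same: "PiM ?J (\<Phi> (insert a A)) = PiM ?J (\<Phi> A)" by (rule PiM_cong) (auto simp: \<Phi>_def)
    have iF: "integrable (PiM (insert a ?J) (\<Phi> B)) F" for B
    proof (rule finite_measure_integrable[OF finPi])
      show "F \<in> borel_measurable (PiM (insert a ?J) (\<Phi> B))"
        using F(1) unfolding Jeq measurable_cong_sets[OF setsPi refl] .
      show "\<bar>F x\<bar> \<le> 1" for x using F(2)[of x] by simp
    qed (use fJ in auto)
    have H1: "H (insert a A) = (\<integral>x. (\<integral>y. F (x(a := y)) \<partial>P2) \<partial>PiM ?J (\<Phi> A))"
    proof -
      interpret product_sigma_finite "\<Phi> (insert a A)" by (rule sf)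
      show ?thesis using product_integral_insert[OF fJ iF[of "insert a A"]] unfolding Jeq same H_def by (simp add: \<Phi>_def)
    qed
    have H2: "H A = (\<integral>x. (\<integral>y. F (x(a := y)) \<partial>P1) \<partial>PiM ?J (\<Phi> A))"
    proof -
      interpret product_sigma_finite "\<Phi> A" by (rule sf)
      show ?thesis using product_integral_insert[OF fJ iF[of A]] a unfolding Jeq H_def by (simp add: \<Phi>_def)
    qed
    have Fm: "(\<lambda>(x, y). F (x(a := y))) \<in> borel_measurable (PiM ?J (\<Phi> A) \<Otimes>\<^sub>M Q)" if "sets Q = sets borel" for Q
    proof -
      have "(\<lambda>(x, y). x(a := y)) \<in> measurable (PiM ?J (\<Phi> A) \<Otimes>\<^sub>M Q) (PiM (insert a ?J) (\<lambda>_. borel))"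
      proof -
        have "(\<lambda>(x, y). x(a := y)) \<in> measurable (PiM ?J (\<lambda>_. borel) \<Otimes>\<^sub>M borel) (PiM (insert a ?J) (\<lambda>_. borel :: real measure))"
          by (rule measurable_add_dim)
        then show ?thesis
          by (subst measurable_cong_sets[OF sets_pair_measure_cong[OF setsPi that] refl])
      qed
      then have "(\<lambda>(x, y). x(a := y)) \<in> measurable (PiM ?J (\<Phi> A) \<Otimes>\<^sub>M Q) (PiM J (\<lambda>_. borel))" unfolding Jeq .
      from measurable_compose[OF this F(1)] show ?thesis by (simp add: case_prod_beta)
    qed
    have im: "integrable (PiM ?J (\<Phi> A)) (\<lambda>x. \<integral>y. F (x(a := y)) \<partial>Q)" if Q: "finite_measure Q" "sets Q = sets borel" for Q
    proof -
      interpret Q: finite_measure Q by fact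
      show ?thesis
      proof (rule finite_measure_integrable[OF finPi[OF fJ(1)], where B = "measure Q (space Q)"])
        show "(\<lambda>x. \<integral>y. F (x(a := y)) \<partial>Q) \<in> borel_measurable (PiM ?J (\<Phi> A))"
          by (rule Q.borel_measurable_lebesgue_integral[OF Fm[OF Q(2)]])
        fix x
        have "\<bar>\<integral>y. F (x(a := y)) \<partial>Q\<bar> \<le> (\<integral>y. \<bar>F (x(a := y))\<bar> \<partial>Q)" by (rule integral_abs_bound)
        also have "\<dots> \<le> (\<integral>y. 1 \<partial>Q)"
        proof (cases "integrable Q (\<lambda>y. \<bar>F (x(a := y))\<bar>)")
          case True
          then show ?thesis by (rule integral_mono) (use F(2) in \<open>auto simp: abs_le_iff intro: order_trans[of _ 0]\<close>)
        qed (simp add: not_integrable_integral_eq)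
        finally show "\<bar>\<integral>y. F (x(a := y)) \<partial>Q\<bar> \<le> measure Q (space Q)" by simp
      qed
    qed
    let ?i = "\<lambda>x. (\<integral>y. F (x(a := y)) \<partial>P2) - (\<integral>y. F (x(a := y)) \<partial>P1)"
    have dm: "(\<lambda>x. \<Prod>j\<in>?J. d (x j)) \<in> borel_measurable (PiM ?J (\<Phi> A))"
    proof (rule borel_measurable_prod)
      fix j assume "j \<in> ?J"
      then have "(\<lambda>x. x j) \<in> measurable (PiM ?J (\<Phi> A)) (\<Phi> A j)" by (rule measurable_component_singleton)
      then have "(\<lambda>x. x j) \<in> measurable (PiM ?J (\<Phi> A)) borel" by (subst (asm) measurable_cong_sets[OF refl setsPhi])
      then show "(\<lambda>x. d (x j)) \<in> borel_measurable (PiM ?J (\<Phi> A))" by (rule measurable_compose[OF _ d(1)])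
    qed
    have di: "integrable (PiM ?J (\<Phi> A)) (\<lambda>x. \<epsilon> * (\<Prod>j\<in>?J. d (x j)))"
      by (intro integrable_mult_right finite_measure_integrable[OF finPi[OF fJ(1)] dm, of 1]) (use d(2) in \<open>auto simp: abs_prod intro!: prod_le_1\<close>)
    have dPhi: "d \<in> borel_measurable (\<Phi> A j)" for j using d(1) by (subst measurable_cong_sets[OF setsPhi refl])
    have "H (insert a A) - H A = (\<integral>x. ?i x \<partial>PiM ?J (\<Phi> A))"
      unfolding H1 H2 by (rule Bochner_Integration.integral_diff[symmetric]) (intro im P)+
    then have "\<bar>H (insert a A) - H A\<bar> = \<bar>\<integral>x. ?i x \<partial>PiM ?J (\<Phi> A)\<bar>" by (rule arg_cong)
    also have "\<dots> \<le> (\<integral>x. \<bar>?i x\<bar> \<partial>PiM ?J (\<Phi> A))" by (rule integral_abs_bound)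
    also have "\<dots> \<le> (\<integral>x. \<epsilon> * (\<Prod>j\<in>?J. d (x j)) \<partial>PiM ?J (\<Phi> A))"
    proof (rule integral_mono[OF _ di])
      show "integrable (PiM ?J (\<Phi> A)) (\<lambda>x. \<bar>?i x\<bar>)" by (intro integrable_abs Bochner_Integration.integrable_diff im P)
      show "\<bar>?i x\<bar> \<le> \<epsilon> * (\<Prod>j\<in>?J. d (x j))" for x using step[OF a(1), of x] by (simp only: abs_minus_commute)
    qed
    also have "\<dots> = \<epsilon> * (\<integral>x. (\<Prod>j\<in>?J. d (x j)) \<partial>PiM ?J (\<Phi> A))" by simp
    also have "(\<integral>x. (\<Prod>j\<in>?J. d (x j)) \<partial>PiM ?J (\<Phi> A)) = (\<Prod>j\<in>?J. integral\<^sup>L (\<Phi> A j) d)"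
    proof -
      interpret product_sigma_finite "\<Phi> A" by (rule sf)
      show ?thesis by (rule product_integral_prod[OF fJ(1)]) (rule finite_measure_integrable[OF fin dPhi, of 1], use d(2) in \<open>simp add: abs_of_nonneg\<close>)
    qed
    also have "\<dots> \<le> (\<Prod>j\<in>?J. R)" using R d(2) by (intro prod_mono) (auto simp: \<Phi>_def intro!: Bochner_Integration.integral_nonneg)
    also have "\<dots> = R ^ (card J - 1)" using J a by simp
    finally show ?thesis using \<epsilon> by (simp add: mult_left_mono)
  qed
  have "\<bar>H A - H {}\<bar> \<le> real (card A) * (\<epsilon> * R ^ (card J - 1))" if "finite A" "A \<subseteq> J" for A
    using that
  proof (induction A)
    case (insert a A)
    have "\<bar>H (insert a A) - H {}\<bar> \<le> \<bar>H (insert a A) - H A\<bar> + \<bar>H A - H {}\<bar>" by linarith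
    also have "\<dots> \<le> \<epsilon> * R ^ (card J - 1) + real (card A) * (\<epsilon> * R ^ (card J - 1))"
      by (rule add_mono) (use insert swap1 in auto)
    finally show ?case using insert(1,2) by (simp add: algebra_simps)
  qed simp
  from this[OF J subset_refl] have "\<bar>H J - H {}\<bar> \<le> real (card J) * (\<epsilon> * R ^ (card J - 1))" .
  moreover have "H {} = (\<integral>x. F x \<partial>PiM J (\<lambda>_. P1))" by (simp add: H_def \<Phi>_def)
  moreover have "H J = (\<integral>x. F x \<partial>PiM J (\<lambda>_. P2))" unfolding H_def by (rule arg_cong[where f = "\<lambda>M. integral\<^sup>L M F"], rule PiM_cong) (auto simp: \<Phi>_def)
  ultimately show ?thesis by (simp add: abs_minus_commute)
qed

text \<open>Derivatives are required in the open interval only, as the antiderivatives used below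
  contain real powers of v.\<close>

lemma lborel_integral_from_FTC:
  fixes f F :: "real \<Rightarrow> real"
  assumes b: "0 \<le> b" and F: "continuous_on {0..b} F" and D: "\<And>v. 0 < v \<Longrightarrow> v < b \<Longrightarrow> (F has_real_derivative f v) (at v)"
    and f: "f \<in> borel_measurable borel" "\<And>v. 0 \<le> v \<Longrightarrow> v \<le> b \<Longrightarrow> 0 \<le> f v"
  shows "(LINT v|lborel. indicator {0..b} v * f v) = F b - F 0" "integrable lborel (\<lambda>v. indicator {0..b} v * f v)"
proof -
  have "(f has_integral (F b - F 0)) {0..b}"
    by (rule fundamental_theorem_of_calculus_interior[OF b F]) (use D in \<open>auto simp: has_real_derivative_iff_has_vector_derivative[symmetric]\<close>)
  then have "((\<lambda>v. if v \<in> {0..b} then f v else 0) has_integral (F b - F 0)) UNIV" by (simp only: has_integral_restrict_UNIV)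
  moreover have "(\<lambda>v. if v \<in> {0..b} then f v else 0) = (\<lambda>v. indicator {0..b} v * f v)" by (auto simp: indicator_def)
  ultimately have h: "((\<lambda>v. indicator {0..b} v * f v) has_integral (F b - F 0)) UNIV" by simp
  have nn: "0 \<le> indicator {0..b} v * f v" for v using f(2)[of v] by (simp add: indicator_def)
  have m: "(\<lambda>v. indicator {0..b} v * f v) \<in> borel_measurable borel" using f(1) by measurable
  have n: "(\<integral>\<^sup>+v. ennreal (indicator {0..b} v * f v) \<partial>lborel) = ennreal (F b - F 0)"
    by (rule nn_integral_has_integral_lborel[OF m nn h])
  have p: "0 \<le> F b - F 0" by (rule has_integral_nonneg[OF h]) (rule nn)
  show "integrable lborel (\<lambda>v. indicator {0..b} v * f v)"
    by (rule integrableI_nn_integral_finite[OF _ _ n]) (use m nn p in auto)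
  show "(LINT v|lborel. indicator {0..b} v * f v) = F b - F 0"
    by (subst integral_eq_nn_integral) (use m nn n p in auto)
qed

section \<open>The continuous model for T\<close>

locale rough_window = rough +
  fixes N :: nat and L :: real
  assumes N: "2 \<le> N" and Ldef: "L = ln (real N)"
begin

lemma L_pos: "0 < L" using N Ldef by simp

text \<open>With t = L v^(1/z), the image of \<open>KP\<close> dv on [0, 1] gives [0, t] the mass
  \<open>cy\<close> t^z/Gamma(1+z). Integrating this once or twice in t produces the main terms
  found for \<open>Am\<close>, so \<open>P2\<close> is the natural model of the law of T.\<close>

definition KP :: real where "KP = cy * L powr z / Gamma (1 + z)"
definition gP :: "real \<Rightarrow> real" where "gP v = KP / wt N * indicator {0..1} v"
definition hP :: "real \<Rightarrow> real" where "hP v = L * v powr (1 / z)"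
definition P2 :: "real measure" where "P2 = distr (density lborel (\<lambda>v. ennreal (gP v))) borel hP"
text \<open>The law of T on the Borel sets, so that it shares a measurable space with
  \<open>P2\<close>.\<close>

definition P1 :: "real measure" where "P1 = distr (measure_pmf (TT N)) borel id"

lemma Gamma1_pos: "0 < Gamma (1 + z)" using z0 by (intro Gamma_real_pos) auto

lemma KP_pos: "0 < KP" using cy_bounds L_pos Gamma1_pos by (simp add: KP_def)

lemma gP_nonneg: "0 \<le> gP v" using KP_pos wt_pos[of N] by (simp add: gP_def)

lemma gP_borel [measurable]: "gP \<in> borel_measurable borel" and hP_borel [measurable]: "hP \<in> borel_measurable borel"
  unfolding gP_def[abs_def] hP_def[abs_def] by measurable

lemma hP_nonneg: "0 \<le> hP v" using L_pos by (simp add: hP_def)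

lemma P2_finite: "finite_measure P2"
proof -
  have "emeasure (density lborel (\<lambda>v. ennreal (gP v))) UNIV = (\<integral>\<^sup>+v. ennreal (gP v) \<partial>lborel)"
    by (subst emeasure_density) auto
  also have "\<dots> = (\<integral>\<^sup>+v. ennreal (KP / wt N) * indicator {0..1::real} v \<partial>lborel)"
    by (rule nn_integral_cong) (simp add: gP_def indicator_def)
  also have "\<dots> = ennreal (KP / wt N)" by (subst nn_integral_cmult) auto
  finally have "finite_measure (density lborel (\<lambda>v. ennreal (gP v)))" by (intro finite_measureI) simp
  then show ?thesis unfolding P2_def by (rule finite_measure.finite_measure_distr) simp
qed

lemma integral_P2:
  assumes [measurable]: "f \<in> borel_measurable borel"
  shows "integral\<^sup>L P2 f = KP / wt N * (LINT v|lborel. indicator {0..1} v * f (hP v) :: real)"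
proof -
  have "integral\<^sup>L P2 f = (\<integral>v. f (hP v) \<partial>density lborel (\<lambda>v. ennreal (gP v)))"
    unfolding P2_def by (rule integral_distr) auto
  also have "\<dots> = (LINT v|lborel. gP v *\<^sub>R f (hP v))"
    by (rule integral_density) (auto simp: gP_nonneg)
  also have "\<dots> = (LINT v|lborel. KP / wt N * (indicator {0..1} v * f (hP v)))"
    by (intro Bochner_Integration.integral_cong refl) (simp add: gP_def)
  finally show ?thesis by (simp only: integral_mult_right_zero)
qed

lemma integral_P1: "f \<in> borel_measurable borel \<Longrightarrow> integral\<^sup>L P1 f = measure_pmf.expectation (TT N) (f :: real \<Rightarrow> real)"
  unfolding P1_def by (rule trans[OF integral_distr]) auto

lemma P1_finite: "finite_measure P1"
  unfolding P1_def by (rule finite_measure.finite_measure_distr) (auto intro: measure_pmf.finite_measure_axioms)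

lemma hP_le_iff:
  assumes x: "0 \<le> x" and v: "0 \<le> v"
  shows "hP v \<le> x \<longleftrightarrow> v \<le> (x / L) powr z"
proof -
  have "hP v \<le> x \<longleftrightarrow> v powr (1 / z) \<le> x / L" using L_pos by (simp add: hP_def pos_le_divide_eq mult.commute)
  also have "\<dots> \<longleftrightarrow> (v powr (1 / z)) powr z \<le> (x / L) powr z"
    using z0 x L_pos by (auto intro: powr_mono2 simp: powr_le_cancel_iff) (metis divide_nonneg_pos linorder_not_le powr_ge_zero powr_less_mono2)
  also have "(v powr (1 / z)) powr z = v" using z0 v by (simp add: powr_powr)
  finally show ?thesis .
qed

text \<open>The model reproduces the main terms of \<open>Am_asymp\<close> without error. Below x
  the variable v runs up to b = (x/L)^z; the integral is elementary, and Gamma(s+1) = s Gamma(s)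
  accounts for the quotient of Gamma values.\<close>

lemma P2_moment:
  assumes x: "0 < x" "x \<le> L" and m: "m = 1 \<or> m = 2"
  shows "wt N * integral\<^sup>L P2 (\<lambda>t. (max 0 (x - t)) ^ m / fact m) = cy * x powr (real m + z) / Gamma (real m + 1 + z)"
proof -
  define b where "b = (x / L) powr z"
  have xL: "0 < x / L" "x / L \<le> 1" using x L_pos by auto
  have b: "0 < b" "b \<le> 1" using xL z0 by (auto simp: b_def powr_le1)
  have hb: "L * b powr (1 / z) = x" using xL z0 L_pos x by (simp add: b_def powr_powr)
  define f where "f = (\<lambda>v. (x - L * v powr (1/z)) ^ m / fact m)"
  have e: "indicator {0..1} v * ((max 0 (x - hP v)) ^ m / fact m) = indicator {0..b} v * f v" for v :: real
  proof (cases "0 \<le> v")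
    case True
    show ?thesis
    proof (cases "v \<le> b")
      case True': True
      then have "hP v \<le> x" using hP_le_iff[of x v] x True by (simp add: b_def)
      then show ?thesis using True True' b by (simp add: f_def hP_def)
    next
      case False
      then have "\<not> hP v \<le> x" using hP_le_iff[of x v] x True by (simp add: b_def)
      then show ?thesis using False m by (auto simp: max_def)
    qed
  qed auto
  define F where "F = (\<lambda>v::real. if m = 1 then x * v - L * v powr (1/z + 1) / (1/z + 1)
      else (x\<^sup>2 * v - 2 * x * L * v powr (1/z + 1) / (1/z + 1) + L\<^sup>2 * v powr (2/z + 1) / (2/z + 1)) / 2)"
  have e1: "1/z + 1 \<noteq> 0" "2/z + 1 \<noteq> 0" "0 < 1/z + 1" "0 < 2/z + 1" using z0 by (auto simp: add_pos_pos intro!: less_imp_neq[symmetric])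
  have D: "(F has_real_derivative f v) (at v)" if v: "0 < v" "v < b" for v
  proof -
    have d: "((\<lambda>v. v powr (a + 1) / (a + 1)) has_real_derivative v powr a) (at v)" if "a + 1 \<noteq> 0" for a
      using v that by (auto intro!: derivative_eq_intros)
    have v2: "v powr (2/z) = (v powr (1/z))\<^sup>2" using v by (simp add: powr_power)
    show ?thesis
    proof (cases "m = 1")
      case True
      have "((\<lambda>v. x * v - L * (v powr (1/z + 1) / (1/z + 1))) has_real_derivative x * 1 - L * v powr (1/z)) (at v)"
        by (intro DERIV_diff DERIV_cmult DERIV_ident d e1)
      then show ?thesis using True by (simp add: F_def f_def)
    next
      case False
      then have m2: "m = 2" using m by simp
      have "((\<lambda>v. (x\<^sup>2 * v - 2 * x * L * (v powr (1/z + 1) / (1/z + 1)) + L\<^sup>2 * (v powr (2/z + 1) / (2/z + 1))) / 2) has_real_derivative 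
         (x\<^sup>2 * 1 - 2 * x * L * v powr (1/z) + L\<^sup>2 * v powr (2/z)) / 2) (at v)"
        by (intro DERIV_cdivide DERIV_add DERIV_diff DERIV_cmult DERIV_ident d e1)
      moreover have "(x\<^sup>2 * 1 - 2 * x * L * v powr (1/z) + L\<^sup>2 * v powr (2/z)) / 2 = f v"
        unfolding v2 f_def m2 by (simp add: power2_eq_square algebra_simps fact_2)
      ultimately show ?thesis using m2 by (simp add: F_def)
    qed
  qed
  have cF: "continuous_on {0..b} F"
  proof -
    have "continuous_on {0..b} (\<lambda>v. v powr a)" if "0 < a" for a :: real
      using that by (intro continuous_on_powr' continuous_intros) auto
    from this[of "1/z+1"] this[of "2/z+1"] e1 have c: "continuous_on {0..b} (\<lambda>v. v powr (1/z+1))" "continuous_on {0..b} (\<lambda>v. v powr (2/z+1))" by auto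
    show ?thesis
    proof (cases "m = 1")
      case True
      have "continuous_on {0..b} (\<lambda>v. x * v - L * v powr (1/z + 1) / (1/z + 1))" by (intro continuous_on_diff continuous_on_add continuous_on_mult continuous_on_divide continuous_on_const continuous_on_id c ballI e1) (use z0 in simp_all)
      then show ?thesis by (simp only: F_def True refl if_True)
    next
      case False
      have "continuous_on {0..b} (\<lambda>v. (x\<^sup>2 * v - 2 * x * L * v powr (1/z + 1) / (1/z + 1) + L\<^sup>2 * v powr (2/z + 1) / (2/z + 1)) / 2)"
        by (intro continuous_on_diff continuous_on_add continuous_on_mult continuous_on_divide continuous_on_const continuous_on_id c ballI e1) (use z0 in simp_all)
      then show ?thesis by (simp only: F_def False if_False)
    qed
  qed
  have "(LINT v|lborel. indicator {0..b} v * f v) = F b - F 0"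
  proof (rule lborel_integral_from_FTC(1)[OF _ cF D])
    show "f \<in> borel_measurable borel" unfolding f_def by measurable
    fix v assume v: "0 \<le> v" "v \<le> b"
    then have "hP v \<le> x" using hP_le_iff[of x v] x by (simp add: b_def)
    then show "0 \<le> f v" by (simp add: f_def hP_def)
  qed (use b in auto)
  also have "F b - F 0 = x ^ m * b * (Gamma (1 + z) / Gamma (real m + 1 + z))"
  proof -
    have G2: "Gamma (2 + z) = (1 + z) * Gamma (1 + z)" using Gamma_plus1[of "1 + z"] z0 by (force simp: add.commute add.left_commute dest: nonpos_Ints_nonpos)
    have G3: "Gamma (3 + z) = (2 + z) * Gamma (2 + z)" using Gamma_plus1[of "2 + z"] z0 by (force simp: add.commute dest: nonpos_Ints_nonpos)
    have Gn: "Gamma (1 + z) \<noteq> 0" using Gamma1_pos by linarith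
    have p1: "L * b powr (1/z + 1) = x * b" using b hb by (simp add: powr_add)
    have p2: "L\<^sup>2 * b powr (2/z + 1) = x\<^sup>2 * b"
    proof -
      have "L\<^sup>2 * b powr (2/z + 1) = (L * b powr (1/z))\<^sup>2 * b" using b by (simp add: powr_add powr_power power_mult_distrib)
      then show ?thesis unfolding hb .
    qed
    have F0: "F 0 = 0" by (simp add: F_def)
    show ?thesis
    proof (cases "m = 1")
      case True
      have "F b = x * b - x * b / (1/z + 1)" using True p1 by (simp add: F_def)
      also have "\<dots> = x * b * (1 / (1 + z))" using z0 by (simp add: field_simps)
      also have "1 / (1 + z) = Gamma (1 + z) / Gamma (2 + z)" using z0 by (simp add: G2 Gn)
      finally show ?thesis using True F0 by simp
    next
      case False
      then have m2: "m = 2" using m by simp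
      have "F b = (x\<^sup>2 * b - 2 * x * (L * b powr (1/z + 1)) / (1/z + 1) + (L\<^sup>2 * b powr (2/z + 1)) / (2/z + 1)) / 2"
        using m2 by (simp add: F_def mult.assoc)
      also have "\<dots> = (x\<^sup>2 * b - 2 * x * (x * b) / (1/z + 1) + (x\<^sup>2 * b) / (2/z + 1)) / 2" unfolding p1 p2 ..
      also have "\<dots> = x\<^sup>2 * b * ((1 - 2 / (1/z + 1) + 1 / (2/z + 1)) / 2)" by (simp add: power2_eq_square algebra_simps)
      also have "(1 - 2 / (1/z + 1) + 1 / (2/z + 1)) / 2 = 1 / ((2 + z) * (1 + z))"
      proof -
        have a: "2 / (1/z + 1) = 2 * z / (1 + z)" "1 / (2/z + 1) = z / (2 + z)" using z0 by (simp_all add: field_simps)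
        have n: "1 + z \<noteq> 0" "2 + z \<noteq> 0" using z0 by auto
        have "(1 - 2 * z / (1 + z) + z / (2 + z)) * ((2 + z) * (1 + z)) = 2"
        proof -
          have "2 * z / (1 + z) * ((2 + z) * (1 + z)) = 2 * z * (2 + z)" "z / (2 + z) * ((2 + z) * (1 + z)) = z * (1 + z)" using n by simp_all
          then have "(1 - 2 * z / (1 + z) + z / (2 + z)) * ((2 + z) * (1 + z)) = (2 + z) * (1 + z) - 2 * z * (2 + z) + z * (1 + z)"
            by (simp only: left_diff_distrib distrib_right mult_1)
          then show ?thesis by (simp add: algebra_simps)
        qed
        then show ?thesis unfolding a using n by (simp add: eq_divide_eq)
      qed
      also have "1 / ((2 + z) * (1 + z)) = Gamma (1 + z) / Gamma (3 + z)" using z0 by (simp add: G2 G3 Gn)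
      finally show ?thesis using m2 F0 by simp
    qed
  qed
  finally have I: "(LINT v|lborel. indicator {0..b} v * f v) = x ^ m * b * (Gamma (1 + z) / Gamma (real m + 1 + z))" .
  have "wt N * integral\<^sup>L P2 (\<lambda>t. (max 0 (x - t)) ^ m / fact m) = KP * (LINT v|lborel. indicator {0..1} v * ((max 0 (x - hP v)) ^ m / fact m))"
    using wt_pos[of N] by (subst integral_P2) auto
  also have "\<dots> = KP * (x ^ m * b * (Gamma (1 + z) / Gamma (real m + 1 + z)))" unfolding e I ..
  also have "\<dots> = cy * (x ^ m * (L powr z * b)) / Gamma (real m + 1 + z)" using Gamma1_pos by (simp add: KP_def)
  also have "L powr z * b = x powr z" using x L_pos by (simp add: b_def powr_mult[symmetric])
  also have "x ^ m * x powr z = x powr (real m + z)" using x by (simp add: powr_add powr_realpow)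
  finally show ?thesis .
qed

text \<open>The model analogue of the damped prime sum. The rational majorant 96 a^2/(v+a)^2 has an
  explicit antiderivative and an integral of at most 96 a, uniformly in z.\<close>

lemma P2_laplace:
  assumes k: "1 \<le> k"
  shows "wt N * integral\<^sup>L P2 (\<lambda>t. exp (- (2 * real k / L * max 0 t))) \<le> KP * (96 * (2 * real k) powr (- z))"
proof -
  \<comment> \<open>The scale of decay in v: the exponent 2k v^(1/z) equals (v/a)^(1/z).\<close>
  define a where "a = (2 * real k) powr (- z)"
  have a: "0 < a" using k by (simp add: a_def)
  have bound: "exp (- (2 * real k / L * max 0 (hP v))) \<le> 96 * a\<^sup>2 / (v + a)\<^sup>2" if v: "0 \<le> v" for v
  proof -
    define s where "s = v / a"
    have s: "0 \<le> s" using v a by (simp add: s_def)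
    have "2 * real k / L * max 0 (hP v) = 2 * real k * v powr (1/z)" using L_pos by (simp add: hP_def)
    moreover have "2 * real k = (1 / a) powr (1 / z)" using k z0 by (simp add: a_def powr_minus_divide powr_powr)
    moreover have "(1 / a) powr (1 / z) * v powr (1 / z) = s powr (1 / z)" using v a by (subst powr_mult[symmetric]) (auto simp: s_def)
    ultimately have ex: "2 * real k / L * max 0 (hP v) = s powr (1 / z)" by metis
    have "exp (- (s powr (1 / z))) \<le> 96 / (s + 1)\<^sup>2"
    proof (cases "s \<le> 1")
      case True
      have "(s + 1)\<^sup>2 \<le> 2\<^sup>2" using s True by (intro power_mono) auto
      then have "1 \<le> 96 / (s + 1)\<^sup>2" using s by (simp add: pos_le_divide_eq)
      moreover have "exp (- (s powr (1 / z))) \<le> 1" by simp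
      ultimately show ?thesis by linarith
    next
      case False
      then have s1: "1 < s" by simp
      \<comment> \<open>As z <= 2 and s > 1, s^(1/z) >= sqrt s = q. The term q^4/4! of the
        exponential series gives s^2 <= 24 exp q, and (s+1)^2 <= 4 s^2 makes 96.\<close>
      define q where "q = sqrt s"
      have q: "1 < q" "q\<^sup>2 = s" using s1 by (auto simp: q_def)
      have "q = s powr (1/2)" using s by (simp add: q_def powr_half_sqrt)
      also have "\<dots> \<le> s powr (1 / z)" using s1 z0 z2 by (intro powr_mono) (auto simp: field_simps)
      finally have qs: "q \<le> s powr (1 / z)" .
      have "q ^ 4 / fact 4 \<le> exp q"
      proof -
        have "(\<Sum>i\<in>{4}. q ^ i /\<^sub>R fact i) \<le> (\<Sum>i. q ^ i /\<^sub>R fact i)"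
          by (rule sum_le_suminf[OF summable_exp_generic]) (use q in auto)
        then show ?thesis by (simp add: exp_def divide_inverse mult.commute)
      qed
      moreover have "q ^ 4 = s\<^sup>2" using q by (metis numeral_Bit0 power_add power2_eq_square)
      moreover have "(fact 4 :: real) = 24" by (simp add: fact_numeral)
      ultimately have "s\<^sup>2 \<le> 24 * exp q" by simp
      have "(s + 1)\<^sup>2 \<le> (2 * s)\<^sup>2" using s1 by (intro power_mono) auto
      also have "\<dots> \<le> 96 * exp q" using \<open>s\<^sup>2 \<le> 24 * exp q\<close> by (simp add: power_mult_distrib)
      also have "\<dots> \<le> 96 * exp (s powr (1 / z))" using qs by simp
      finally show ?thesis using s by (simp add: pos_le_divide_eq exp_minus field_simps)
    qed
    also have "96 / (s + 1)\<^sup>2 = 96 * a\<^sup>2 / (v + a)\<^sup>2"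
    proof -
      have "s + 1 = (v + a) / a" using a by (simp add: s_def field_simps)
      then show ?thesis by (simp add: power_divide)
    qed
    finally show ?thesis unfolding ex .
  qed
  have cF: "continuous_on {0..1} (\<lambda>v. - (96 * a\<^sup>2) / (v + a))" using a by (intro continuous_intros) auto
  have DF: "((\<lambda>v. - (96 * a\<^sup>2) / (v + a)) has_real_derivative 96 * a\<^sup>2 / (v + a)\<^sup>2) (at v)" if "0 < v" "v < 1" for v
    using that a by (auto intro!: derivative_eq_intros simp: power2_eq_square)
  have mm: "(\<lambda>v. 96 * a\<^sup>2 / (v + a)\<^sup>2) \<in> borel_measurable borel" by measurable
  have nn: "0 \<le> 96 * a\<^sup>2 / (v + a)\<^sup>2" for v by simp
  note maj1 = lborel_integral_from_FTC(1)[OF zero_le_one cF DF mm nn] and maj2 = lborel_integral_from_FTC(2)[OF zero_le_one cF DF mm nn]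
  have "(LINT v|lborel. indicator {0..1} v * exp (- (2 * real k / L * max 0 (hP v)))) \<le> (LINT v|lborel. indicator {0..1} v * (96 * a\<^sup>2 / (v + a)\<^sup>2))"
  proof (rule integral_mono)
    show "integrable lborel (\<lambda>v. indicator {0..1} v * (96 * a\<^sup>2 / (v + a)\<^sup>2))" by (rule maj2)
    show "integrable lborel (\<lambda>v. indicator {0..1} v * exp (- (2 * real k / L * max 0 (hP v))))"
    proof (rule Bochner_Integration.integrable_bound[OF \<open>integrable lborel (\<lambda>v. indicator {0..1} v * (96 * a\<^sup>2 / (v + a)\<^sup>2))\<close>])
      show "AE v in lborel. norm (indicator {0..1} v * exp (- (2 * real k / L * max 0 (hP v)))) \<le> norm (indicator {0..1} v * (96 * a\<^sup>2 / (v + a)\<^sup>2))"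
        using bound by (intro always_eventually) (auto simp: indicator_def)
    qed measurable
    show "indicator {0..1} v * exp (- (2 * real k / L * max 0 (hP v))) \<le> indicator {0..1} v * (96 * a\<^sup>2 / (v + a)\<^sup>2)" for v :: real
      using bound[of v] by (auto simp: indicator_def)
  qed
  also have "\<dots> = - (96 * a\<^sup>2) / (1 + a) - - (96 * a\<^sup>2) / (0 + a)" by (rule maj1)
  also have "\<dots> \<le> 96 * a" using a by (simp add: power2_eq_square)
  finally have "KP * (LINT v|lborel. indicator {0..1} v * exp (- (2 * real k / L * max 0 (hP v)))) \<le> KP * (96 * a)" using KP_pos by (intro mult_left_mono) auto
  then show ?thesis using wt_pos[of N] by (subst integral_P2) (auto simp: a_def)
qed

lemma P1_laplace:
  assumes k: "1 \<le> k"
  shows "wt N * integral\<^sup>L P1 (\<lambda>t. exp (- (2 * real k / L * max 0 t))) = exp (z * (\<Sum>p\<in>PA y N. lam p * real p powr (- (2 * real k / L))))"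
proof -
  have "integral\<^sup>L P1 (\<lambda>t. exp (- (2 * real k / L * max 0 t))) = measure_pmf.expectation (TT N) (\<lambda>t. exp (- (2 * real k / L * max 0 t)))"
    by (rule integral_P1) measurable
  also have "\<dots> = measure_pmf.expectation (TT N) (\<lambda>t. exp (- (2 * real k / L * t)))"
    by (rule pmf_expectation_cong) (simp add: TT_nonneg max_def)
  finally show ?thesis using wt_laplace[of "2 * real k / L" N] L_pos by simp
qed

text \<open>For alpha <= beta the product of the truncations is (alpha - t)_+^2 + (beta -
  alpha)(alpha - t)_+, a combination of the truncated moments of orders 2 and 1. The 3 counts two
  errors of order 2 and one of order 1.\<close>

lemma kernel_diff:
  assumes ab: "\<alpha> \<le> \<beta>" "\<beta> \<le> L" and \<alpha>: "0 < \<alpha>"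
  shows "wt N * \<bar>integral\<^sup>L P1 (\<lambda>t. max 0 (\<alpha> - max 0 t) * max 0 (\<beta> - max 0 t)) - integral\<^sup>L P2 (\<lambda>t. max 0 (\<alpha> - max 0 t) * max 0 (\<beta> - max 0 t))\<bar>
     \<le> 3 * B1 * theta_err y * (1 + L) powr (1 + z)"
proof -
  let ?\<psi> = "\<lambda>t. max 0 (\<alpha> - max 0 t) * max 0 (\<beta> - max 0 t)"
  let ?m = "\<lambda>m t. (max 0 (\<alpha> - t)) ^ m / fact m :: real"
  have aL: "\<alpha> \<le> L" using ab by simp
  have psi: "?\<psi> t = 2 * ?m 2 t + (\<beta> - \<alpha>) * ?m 1 t" if "0 \<le> t" for t
    using that ab by (auto simp: max_def power2_eq_square algebra_simps fact_2)
  have [measurable]: "?\<psi> \<in> borel_measurable borel" by measurable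
  have 1: "wt N * integral\<^sup>L P1 ?\<psi> = 2 * Am 2 N \<alpha> + (\<beta> - \<alpha>) * Am 1 N \<alpha>"
  proof -
    have "integral\<^sup>L P1 ?\<psi> = measure_pmf.expectation (TT N) ?\<psi>" by (rule integral_P1) measurable
    also have "\<dots> = measure_pmf.expectation (TT N) (\<lambda>t. 2 * ?m 2 t + (\<beta> - \<alpha>) * ?m 1 t)"
      by (rule pmf_expectation_cong) (rule psi, rule TT_nonneg)
    also have "\<dots> = 2 * measure_pmf.expectation (TT N) (?m 2) + (\<beta> - \<alpha>) * measure_pmf.expectation (TT N) (?m 1)"
    proof -
      have "integrable (measure_pmf (TT N)) (?m 1)" "integrable (measure_pmf (TT N)) (?m 2)"
        using Am1_integrable[of N \<alpha>] Am2_integrable[of N \<alpha>] by (simp_all add: fact_2)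
      then show ?thesis by (simp only: Bochner_Integration.integral_add[OF integrable_mult_right integrable_mult_right] integral_mult_right_zero)
    qed
    finally have "wt N * integral\<^sup>L P1 ?\<psi> = 2 * (wt N * measure_pmf.expectation (TT N) (?m 2)) + (\<beta> - \<alpha>) * (wt N * measure_pmf.expectation (TT N) (?m 1))"
      by (simp only: distrib_left mult.left_commute)
    then show ?thesis by (simp only: Am_def)
  qed
  define A' where "A' = (\<lambda>m. cy * \<alpha> powr (real m + z) / Gamma (real m + 1 + z))"
  have 2: "wt N * integral\<^sup>L P2 ?\<psi> = 2 * A' 2 + (\<beta> - \<alpha>) * A' 1"
  proof -
    \<comment> \<open>A function that is not integrable has Bochner integral 0, while
      \<open>P2_moment\<close> gives a positive value; integrability follows without a separate
      estimate.\<close>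
    have i: "integrable P2 (?m m)" if m: "m = 1 \<or> m = 2" for m
    proof (rule ccontr)
      assume "\<not> integrable P2 (?m m)"
      then have "integral\<^sup>L P2 (?m m) = 0" by (rule not_integrable_integral_eq)
      then have "cy * \<alpha> powr (real m + z) / Gamma (real m + 1 + z) = 0" using P2_moment[OF \<alpha> aL m] by (simp only: mult_zero_right)
      moreover have "0 < cy * \<alpha> powr (real m + z) / Gamma (real m + 1 + z)"
        using cy_bounds \<alpha> z0 by (intro divide_pos_pos mult_pos_pos Gamma_real_pos) auto
      ultimately show False by linarith
    qed
    have "AE t in P2. 0 \<le> t"
    proof -
      have "AE v in density lborel (\<lambda>v. ennreal (gP v)). 0 \<le> hP v" by (simp add: hP_nonneg)
      then show ?thesis unfolding P2_def by (subst AE_distr_iff) auto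
    qed
    then have "integral\<^sup>L P2 ?\<psi> = integral\<^sup>L P2 (\<lambda>t. 2 * ?m 2 t + (\<beta> - \<alpha>) * ?m 1 t)"
    proof (intro integral_cong_AE)
      assume "AE t in P2. 0 \<le> t"
      then show "AE t in P2. ?\<psi> t = 2 * ?m 2 t + (\<beta> - \<alpha>) * ?m 1 t" by eventually_elim (rule psi)
    qed (simp_all add: P2_def)
    also have "\<dots> = 2 * integral\<^sup>L P2 (?m 2) + (\<beta> - \<alpha>) * integral\<^sup>L P2 (?m 1)"
      using i[of 1] i[of 2] by (simp only: Bochner_Integration.integral_add[OF integrable_mult_right integrable_mult_right] integral_mult_right_zero simp_thms)
    finally have "wt N * integral\<^sup>L P2 ?\<psi> = 2 * (wt N * integral\<^sup>L P2 (?m 2)) + (\<beta> - \<alpha>) * (wt N * integral\<^sup>L P2 (?m 1))" 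
      by (simp only: distrib_left mult.left_commute)
    then show ?thesis using P2_moment[OF \<alpha> aL, of 1] P2_moment[OF \<alpha> aL, of 2] unfolding A'_def by simp
  qed
  have N1: "1 \<le> N" using N by simp
  have aN: "\<alpha> \<le> ln (real N)" using aL Ldef by simp
  define Ky where "Ky = B1 * theta_err y"
  have Ky: "0 \<le> Ky" using Bc_ge1 gam_inf(1) theta_err_ge1[OF y1] by (auto simp: Ky_def B1_def intro!: mult_nonneg_nonneg add_nonneg_nonneg)
  have d1: "\<bar>Am 1 N \<alpha> - A' 1\<bar> \<le> Ky * (1 + L) powr z"
  proof -
    have "\<bar>Am 1 N \<alpha> - A' 1\<bar> \<le> Ky * (1 + \<alpha>) powr (real 1 - 1 + z)"
      unfolding A'_def Ky_def by (rule Am_asymp[OF _ aN N1]) (use \<alpha> in auto)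
    also have "\<dots> \<le> Ky * (1 + L) powr z" using aL \<alpha> z0 Ky by (intro mult_left_mono) (auto intro!: powr_mono2)
    finally show ?thesis .
  qed
  have d2: "\<bar>Am 2 N \<alpha> - A' 2\<bar> \<le> Ky * (1 + L) powr (1 + z)"
  proof -
    have "\<bar>Am 2 N \<alpha> - A' 2\<bar> \<le> Ky * (1 + \<alpha>) powr (real 2 - 1 + z)"
      unfolding A'_def Ky_def by (rule Am_asymp[OF _ aN N1]) (use \<alpha> in auto)
    also have "\<dots> \<le> Ky * (1 + L) powr (1 + z)" using aL \<alpha> z0 Ky by (intro mult_left_mono) (auto intro!: powr_mono2)
    finally show ?thesis .
  qed
  have "wt N * \<bar>integral\<^sup>L P1 ?\<psi> - integral\<^sup>L P2 ?\<psi>\<bar> = \<bar>wt N * integral\<^sup>L P1 ?\<psi> - wt N * integral\<^sup>L P2 ?\<psi>\<bar>"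
    using wt_pos[of N] by (simp add: abs_mult flip: right_diff_distrib)
  also have "\<dots> = \<bar>2 * (Am 2 N \<alpha> - A' 2) + (\<beta> - \<alpha>) * (Am 1 N \<alpha> - A' 1)\<bar>" unfolding 1 2 by (simp add: algebra_simps)
  also have "\<dots> \<le> 2 * \<bar>Am 2 N \<alpha> - A' 2\<bar> + (\<beta> - \<alpha>) * \<bar>Am 1 N \<alpha> - A' 1\<bar>"
    using abs_triangle_ineq[of "2 * (Am 2 N \<alpha> - A' 2)" "(\<beta> - \<alpha>) * (Am 1 N \<alpha> - A' 1)"] ab
    by (simp only: abs_mult abs_numeral abs_of_nonneg[of "\<beta> - \<alpha>"] diff_ge_0_iff_ge)
  also have "\<dots> \<le> 2 * (Ky * (1 + L) powr (1 + z)) + (1 + L) * (Ky * (1 + L) powr z)"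
    using d1 d2 ab \<alpha> by (intro add_mono mult_mono) auto
  also have "(1 + L) * (Ky * (1 + L) powr z) = Ky * (1 + L) powr (1 + z)" using L_pos by (simp add: powr_add)
  finally show ?thesis by (simp add: Ky_def)
qed

end

lemma damping_lin:
  assumes "finite J" "J \<subseteq> idx k"
  shows "damping k L (lin J t) = (\<Prod>j\<in>J. exp (- (2 * real k / L * t j)))"
  using assms
proof (induction J)
  case empty
  have "lin {} t = 0" by (simp add: lin_def fun_eq_iff)
  then show ?case by (simp only: damping_0 prod.empty)
next
  case (insert a J)
  have "len k (uv a) = 2" using insert(4) by (intro len_uv) auto
  then have "damping k L (sc (t a) (uv a)) = exp (- (2 * real k / L * t a))" by (simp add: damping_def len_sc mult_ac)
  moreover have "damping k L (lin J t) = (\<Prod>j\<in>J. exp (- (2 * real k / L * t j)))" using insert by blast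
  ultimately show ?case by (simp only: lin_insert[OF insert(1,2)] damping_add prod.insert[OF insert(1,2)])
qed

lemma lin_nonneg_vecs: "(\<And>j. j \<in> J \<Longrightarrow> 0 \<le> t j) \<Longrightarrow> lin J t \<in> nonneg_vecs"
  using nonneg_vecs_nonneg[OF uv_nonneg_vecs] by (auto simp: nonneg_vecs_def lin_def intro!: sum_nonneg mult_nonneg_nonneg)

lemma max_shift_scale: "0 < L \<Longrightarrow> 0 \<le> u \<Longrightarrow> max 0 (1 - max 0 (u + max 0 t) / L) = max 0 (L - u - max 0 t) / (L::real)"
  by (auto simp: max_def field_simps)

text \<open>A change at position (i, j) reaches the coordinates (False, i) and (True, j) alone; the
  remaining factors form the constant K.\<close>

lemma window_step:
  assumes L: "0 < L" and u: "u \<in> nonneg_vecs" and a: "a \<in> idx k"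
  defines "K \<equiv> \<Prod>c\<in>coords k - {(False, fst a), (True, snd a)}. max 0 (1 - max 0 (u c) / L)"
  shows "window k L (u + sc (max 0 t) (uv a)) = K / L\<^sup>2 * (max 0 (L - u (False, fst a) - max 0 t) * max 0 (L - u (True, snd a) - max 0 t))"
    and "0 \<le> K" "K \<le> 1"
proof -
  let ?c1 = "(False, fst a)" and ?c2 = "(True, snd a)"
  let ?f = "\<lambda>c. max 0 (1 - max 0 ((u + sc (max 0 t) (uv a)) c) / L)"
  have c: "{?c1, ?c2} \<subseteq> coords k" using a by (auto simp: coords_def idx_def)
  have "window k L (u + sc (max 0 t) (uv a)) = prod ?f (coords k - {?c1, ?c2}) * prod ?f {?c1, ?c2}"
    unfolding window_def by (rule prod.subset_diff[OF c]) simp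
  also have "prod ?f (coords k - {?c1, ?c2}) = K"
    unfolding K_def by (intro prod.cong refl) (simp add: uv_def sc_def)
  also have "prod ?f {?c1, ?c2} = ?f ?c1 * ?f ?c2" by simp
  also have "?f ?c1 = max 0 (L - u ?c1 - max 0 t) / L"
    using max_shift_scale[OF L nonneg_vecs_nonneg[OF u], of ?c1 t] by (simp add: uv_def sc_def)
  also have "?f ?c2 = max 0 (L - u ?c2 - max 0 t) / L"
    using max_shift_scale[OF L nonneg_vecs_nonneg[OF u], of ?c2 t] by (simp add: uv_def sc_def)
  also have "K * (max 0 (L - u ?c1 - max 0 t) / L * (max 0 (L - u ?c2 - max 0 t) / L)) = K / L\<^sup>2 * (max 0 (L - u ?c1 - max 0 t) * max 0 (L - u ?c2 - max 0 t))"
    by (simp add: power2_eq_square)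
  finally show "window k L (u + sc (max 0 t) (uv a)) = K / L\<^sup>2 * (max 0 (L - u ?c1 - max 0 t) * max 0 (L - u ?c2 - max 0 t))" .
  show "0 \<le> K" "K \<le> 1" unfolding K_def using window_factor_bounds[OF L] by (auto intro!: prod_nonneg prod_le_1)
qed

section \<open>The second replacement, over the positions, and its main term\<close>

context rough_window begin

lemma B1_pos: "0 < B1" using Bc_ge1 gam_inf(1) by (simp add: B1_def add_pos_pos)

definition EE :: real where "EE = 3 * B1 * theta_err y * (1 + L) powr (1 + z)"

lemma EE_nonneg: "0 \<le> EE" using B1_pos theta_err_ge1[OF y1] by (simp add: EE_def)

lemma kernel_diff_sym:
  assumes "0 < \<alpha>" "0 < \<beta>" "\<alpha> \<le> L" "\<beta> \<le> L"
  shows "wt N * \<bar>integral\<^sup>L P1 (\<lambda>t. max 0 (\<alpha> - max 0 t) * max 0 (\<beta> - max 0 t)) - integral\<^sup>L P2 (\<lambda>t. max 0 (\<alpha> - max 0 t) * max 0 (\<beta> - max 0 t))\<bar> \<le> EE"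
proof (cases "\<alpha> \<le> \<beta>")
  case True
  then show ?thesis unfolding EE_def by (rule kernel_diff) (use assms in auto)
next
  case False
  have "(\<lambda>t. max 0 (\<alpha> - max 0 t) * max 0 (\<beta> - max 0 t)) = (\<lambda>t. max 0 (\<beta> - max 0 t) * max 0 (\<alpha> - max 0 t))" by (simp only: mult.commute)
  then show ?thesis unfolding EE_def using kernel_diff[of \<beta> \<alpha>] assms False by simp
qed

text \<open>The kernel estimate divided by L^2. When all coordinates of u are below L a factor
  exp(2k^2) times the damping, which is at least 1, is inserted; otherwise both integrals
  vanish.\<close>

lemma step_bound:
  assumes u: "u \<in> nonneg_vecs" and a: "a \<in> idx k"
  shows "\<bar>integral\<^sup>L P1 (\<lambda>t. window k L (u + sc (max 0 t) (uv a))) - integral\<^sup>L P2 (\<lambda>t. window k L (u + sc (max 0 t) (uv a)))\<bar>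
    \<le> exp (2 * real k ^ 2) * (EE / L\<^sup>2) / wt N * damping k L u"
proof (cases "\<exists>c\<in>coords k. L \<le> u c")
  case True
  then obtain c where c: "c \<in> coords k" "L \<le> u c" by blast
  have "window k L (u + sc (max 0 t) (uv a)) = 0" for t
  proof (rule window_eq_0[OF L_pos c(1)])
    have "0 \<le> sc (max 0 t) (uv a) c" by (rule nonneg_vecs_nonneg[OF sc_nonneg_vecs[OF _ uv_nonneg_vecs]]) simp
    then show "L \<le> (u + sc (max 0 t) (uv a)) c" using c by simp
  qed
  moreover have "0 \<le> exp (2 * real k ^ 2) * (EE / L\<^sup>2) / wt N * damping k L u"
    using EE_nonneg wt_pos[of N] by (simp add: damping_def)
  ultimately show ?thesis by simp
next
  case False
  let ?c1 = "(False, fst a)" and ?c2 = "(True, snd a)"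
  let ?\<psi> = "\<lambda>t. max 0 (L - u ?c1 - max 0 t) * max 0 (L - u ?c2 - max 0 t)"
  define K where "K = (\<Prod>c\<in>coords k - {?c1, ?c2}. max 0 (1 - max 0 (u c) / L))"
  note W = window_step[OF L_pos u a, folded K_def]
  have c: "?c1 \<in> coords k" "?c2 \<in> coords k" using a by (auto simp: coords_def idx_def)
  have lt: "u c < L" if "c \<in> coords k" for c using False that by (meson not_le)
  have "wt N * \<bar>integral\<^sup>L P1 ?\<psi> - integral\<^sup>L P2 ?\<psi>\<bar> \<le> EE"
    by (rule kernel_diff_sym) (use lt c nonneg_vecs_nonneg[OF u] in auto)
  then have d: "\<bar>integral\<^sup>L P1 ?\<psi> - integral\<^sup>L P2 ?\<psi>\<bar> \<le> EE / wt N" using wt_pos[of N] by (simp add: pos_le_divide_eq mult.commute)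
  have "\<bar>integral\<^sup>L P1 (\<lambda>t. window k L (u + sc (max 0 t) (uv a))) - integral\<^sup>L P2 (\<lambda>t. window k L (u + sc (max 0 t) (uv a)))\<bar>
      = K / L\<^sup>2 * \<bar>integral\<^sup>L P1 ?\<psi> - integral\<^sup>L P2 ?\<psi>\<bar>"
    unfolding W(1) integral_mult_right_zero right_diff_distrib[symmetric] using W(2) by (simp only: abs_mult) simp
  also have "\<dots> \<le> 1 / L\<^sup>2 * (EE / wt N)"
    using d W by (intro mult_mono divide_right_mono) auto
  also have "\<dots> = EE / L\<^sup>2 / wt N * 1" by simp
  also have "\<dots> \<le> EE / L\<^sup>2 / wt N * (exp (2 * real k ^ 2) * damping k L u)"
    using EE_nonneg wt_pos[of N] by (intro mult_left_mono exp_damping_ge_1[OF L_pos]) (auto intro: less_imp_le lt)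
  finally show ?thesis by (simp add: mult_ac)
qed

definition FF :: "nat \<Rightarrow> (nat \<times> nat \<Rightarrow> real) \<Rightarrow> real" where
  "FF k x = window k L (lin (idx k) (\<lambda>j. max 0 (x j)))"

lemma FF_measurable: "FF k \<in> borel_measurable (PiM (idx k) (\<lambda>_. borel))"
  unfolding FF_def by (rule window_measurable) (simp add: lin_def, measurable)

lemma sets_P12: "sets P1 = sets borel" "sets P2 = sets borel" by (simp_all add: P1_def P2_def)

text \<open>\<open>PiM_swap\<close> with the weight exp(-2kt/L) at each position. Multiplying by
  \<open>wt N\<close> to the power k^2 cancels all normalisations: the exchanged position carries
  \<open>EE\<close>/L^2, each of the other k^2 - 1 at most R.\<close>

lemma FF_swap:
  assumes k: "1 \<le> k" and R: "exp (z * (\<Sum>p\<in>PA y N. lam p * real p powr (- (2 * real k / L)))) \<le> R" "KP * (96 * (2 * real k) powr (- z)) \<le> R"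
  shows "wt N ^ (k\<^sup>2) * \<bar>(\<integral>x. FF k x \<partial>PiM (idx k) (\<lambda>_. P1)) - (\<integral>x. FF k x \<partial>PiM (idx k) (\<lambda>_. P2))\<bar>
    \<le> real k ^ 2 * (exp (2 * real k ^ 2) * (EE / L\<^sup>2) * R ^ (k\<^sup>2 - 1))"
proof -
  have w: "0 < wt N" by (rule wt_pos)
  have "\<bar>(\<integral>x. FF k x \<partial>PiM (idx k) (\<lambda>_. P1)) - (\<integral>x. FF k x \<partial>PiM (idx k) (\<lambda>_. P2))\<bar>
     \<le> real (card (idx k)) * ((exp (2 * real k ^ 2) * (EE / L\<^sup>2) / wt N) * (R / wt N) ^ (card (idx k) - 1))"
  proof (rule PiM_swap[where d = "\<lambda>t. exp (- (2 * real k / L * max 0 t))"])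
    show "integral\<^sup>L P1 (\<lambda>t. exp (- (2 * real k / L * max 0 t))) \<le> R / wt N" 
      using P1_laplace[OF k] R(1) w by (simp add: pos_le_divide_eq mult.commute)
    show "integral\<^sup>L P2 (\<lambda>t. exp (- (2 * real k / L * max 0 t))) \<le> R / wt N" 
      using order_trans[OF P2_laplace[OF k] R(2)] w by (simp add: pos_le_divide_eq mult.commute)
    show "0 \<le> exp (2 * real k ^ 2) * (EE / L\<^sup>2) / wt N" using EE_nonneg w by simp
    show "0 \<le> FF k x \<and> FF k x \<le> 1" for x unfolding FF_def by (rule window_bounds[OF L_pos])
    show "0 \<le> exp (- (2 * real k / L * max 0 t)) \<and> exp (- (2 * real k / L * max 0 t)) \<le> 1" for t using L_pos by simp
    fix a x assume a: "a \<in> idx k"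
    define J where "J = idx k - {a}"
    have J: "finite J" "a \<notin> J" "J \<subseteq> idx k" "idx k = insert a J" using a by (auto simp: J_def)
    define u where "u = lin J (\<lambda>j. max 0 (x j))"
    have F: "FF k (x(a := t)) = window k L (u + sc (max 0 t) (uv a))" for t
    proof -
      have "lin J (\<lambda>j. max 0 ((x(a := t)) j)) = u" unfolding u_def using J by (intro lin_cong) auto
      then show ?thesis unfolding FF_def J(4) by (subst lin_insert[OF J(1,2)]) (simp add: add.commute)
    qed
    have "damping k L u = (\<Prod>j\<in>J. exp (- (2 * real k / L * max 0 (x j))))" unfolding u_def by (rule damping_lin[OF J(1,3)])
    moreover have "u \<in> nonneg_vecs" unfolding u_def by (rule lin_nonneg_vecs) simp
    ultimately show "\<bar>(\<integral>y. FF k (x(a := y)) \<partial>P1) - (\<integral>y. FF k (x(a := y)) \<partial>P2)\<bar>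
      \<le> exp (2 * real k ^ 2) * (EE / L\<^sup>2) / wt N * (\<Prod>j\<in>idx k - {a}. exp (- (2 * real k / L * max 0 (x j))))"
      unfolding F using step_bound[of u a k] a by (simp only: J_def)
  qed (auto simp: P1_finite P2_finite sets_P12 FF_measurable)
  then have "wt N ^ (k\<^sup>2) * \<bar>(\<integral>x. FF k x \<partial>PiM (idx k) (\<lambda>_. P1)) - (\<integral>x. FF k x \<partial>PiM (idx k) (\<lambda>_. P2))\<bar>
    \<le> wt N ^ (k\<^sup>2) * (real (k\<^sup>2) * ((exp (2 * real k ^ 2) * (EE / L\<^sup>2) / wt N) * (R / wt N) ^ (k\<^sup>2 - 1)))"
    unfolding idx_card using w by (intro mult_left_mono) auto
  also have "wt N ^ (k\<^sup>2) * (real (k\<^sup>2) * ((exp (2 * real k ^ 2) * (EE / L\<^sup>2) / wt N) * (R / wt N) ^ (k\<^sup>2 - 1)))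
    = real k ^ 2 * (exp (2 * real k ^ 2) * (EE / L\<^sup>2) * R ^ (k\<^sup>2 - 1))"
  proof -
    have "wt N ^ (k\<^sup>2) = wt N * wt N ^ (k\<^sup>2 - 1)" using k by (subst power_Suc[symmetric]) simp
    then show ?thesis using w by (simp add: power_divide)
  qed
  finally show ?thesis .
qed

lemma integral_FF_window_integral:
  assumes "sets P = sets borel"
  shows "(\<integral>x. FF k x \<partial>PiM (idx k) (\<lambda>_. P)) = enn2real (window_integral P (\<lambda>_. 1) (max 0) k L (idx k) 0)"
proof -
  have "sets (PiM (idx k) (\<lambda>_. P)) = sets (PiM (idx k) (\<lambda>_. borel))" by (rule sets_PiM_cong) (auto simp: assms)
  from measurable_cong_sets[OF this refl] have m: "FF k \<in> borel_measurable (PiM (idx k) (\<lambda>_. P))" using FF_measurable[of k] by blast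
  have "(\<integral>x. FF k x \<partial>PiM (idx k) (\<lambda>_. P)) = enn2real (\<integral>\<^sup>+x. ennreal (FF k x) \<partial>PiM (idx k) (\<lambda>_. P))"
    by (rule integral_eq_nn_integral[OF m]) (simp add: FF_def window_bounds[OF L_pos])
  then show ?thesis by (simp only: window_integral_def FF_def add_0 prod.neutral_const ennreal_1 mult_1)
qed

text \<open>T is nonnegative on its support, so the truncation in \<open>FF\<close>, which serves
  arbitrary real arguments, does not change it.\<close>

lemma expectation_YY:
  "measure_pmf.expectation (csum (\<lambda>ij. map_pmf (\<lambda>t. sc t (uv ij)) (TT N)) (idx k)) (window k L) = (\<integral>x. FF k x \<partial>PiM (idx k) (\<lambda>_. P1))"
proof -
  have "(\<lambda>ij. map_pmf (\<lambda>t. sc t (uv ij)) (TT N)) = (\<lambda>ij. map_pmf (\<lambda>t. sc (max 0 t) (uv ij)) (TT N))"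
    by (intro ext map_pmf_cong refl) (simp add: TT_nonneg max_def)
  moreover have "measure_pmf.expectation q (window k L) = enn2real (\<integral>\<^sup>+v. ennreal (window k L v) \<partial>measure_pmf q)" for q
    by (rule integral_eq_nn_integral) (auto simp: window_bounds[OF L_pos])
  moreover have "(\<integral>\<^sup>+q. ennreal (window k L (0 + q)) \<partial>measure_pmf (csum (\<lambda>ij. map_pmf (\<lambda>t. sc (max 0 t) (uv ij)) (TT N)) (idx k))) = window_integral P1 (\<lambda>_. 1) (max 0) k L (idx k) 0"
    unfolding P1_def by (rule window_integral_pmf[OF L_pos]) auto
  ultimately show ?thesis by (simp only: integral_FF_window_integral[OF sets_P12(1)] add_0)
qed

lemma lin_entries:
  assumes "c \<in> coords k"
  shows "lin (idx k) t c = (if fst c then (\<Sum>i=1..k. t (i, snd c)) else (\<Sum>j=1..k. t (snd c, j)))"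
proof -
  obtain b m where c: "c = (b, m)" "m \<in> {1..k}" using assms by (auto simp: coords_def)
  have "lin (idx k) t c = (\<Sum>i\<in>{1..k}. \<Sum>j\<in>{1..k}. t (i, j) * uv (i, j) c)"
    unfolding lin_def idx_def by (simp add: sum.cartesian_product)
  also have "\<dots> = (if b then (\<Sum>i\<in>{1..k}. t (i, m)) else (\<Sum>j\<in>{1..k}. t (m, j)))"
  proof (cases b)
    case True
    have "(\<Sum>i\<in>{1..k}. \<Sum>j\<in>{1..k}. t (i, j) * uv (i, j) c) = (\<Sum>i\<in>{1..k}. \<Sum>j\<in>{1..k}. if j = m then t (i, j) else 0)"
      by (intro sum.cong refl) (use c True in \<open>auto simp: uv_def\<close>)
    also have "\<dots> = (\<Sum>i\<in>{1..k}. t (i, m))" using c(2) by (intro sum.cong refl) (simp only: sum.delta finite_atLeastAtMost if_True)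
    finally show ?thesis using True by (simp only: if_True)
  next
    case False
    have "(\<Sum>i\<in>{1..k}. \<Sum>j\<in>{1..k}. t (i, j) * uv (i, j) c) = (\<Sum>j\<in>{1..k}. \<Sum>i\<in>{1..k}. t (i, j) * uv (i, j) c)" by (rule sum.swap)
    also have "\<dots> = (\<Sum>j\<in>{1..k}. \<Sum>i\<in>{1..k}. if i = m then t (i, j) else 0)"
      by (intro sum.cong refl) (use c False in \<open>auto simp: uv_def\<close>)
    also have "\<dots> = (\<Sum>j\<in>{1..k}. t (m, j))" using c(2) by (intro sum.cong refl) (simp only: sum.delta finite_atLeastAtMost if_True)
    finally show ?thesis using False by (simp only: if_False)
  qed
  finally show ?thesis using c by (simp only: fst_conv snd_conv)
qed

text \<open>Under t = L v^(1/z) the coordinates become L times the row and column sums of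
  x_ij^(1/z), so the factors of the window are those in \<open>gamma_const\<close>. Its truncation
  at 0 is the indicator of \<open>P_set\<close>: a sum above 1 makes a factor vanish.\<close>

lemma main_pointwise:
  assumes \<rho>: "z = \<rho>\<^sup>2" and x: "x \<in> idx k \<rightarrow>\<^sub>E UNIV"
  shows "(\<Prod>j\<in>idx k. gP (x j)) * window k L (lin (idx k) (\<lambda>j. max 0 (hP (x j)))) = (KP / wt N) ^ (k\<^sup>2) * (indicator (P_set k \<rho>) x *
            (\<Prod>i=1..k. 1 - (\<Sum>j=1..k. x (i, j) powr (1 / \<rho> ^ 2))) *
            (\<Prod>j=1..k. 1 - (\<Sum>i=1..k. x (i, j) powr (1 / \<rho> ^ 2))))"
proof -
  define r where "r = (\<lambda>i. \<Sum>j=1..k. x (i, j) powr (1 / z))"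
  define s where "s = (\<lambda>j. \<Sum>i=1..k. x (i, j) powr (1 / z))"
  have P: "x \<in> P_set k \<rho> \<longleftrightarrow> (\<forall>ij\<in>idx k. 0 \<le> x ij) \<and> (\<forall>j\<in>{1..k}. s j \<le> 1) \<and> (\<forall>i\<in>{1..k}. r i \<le> 1)"
    using x by (simp add: P_set_def r_def s_def \<rho>)
  show ?thesis
  proof (cases "\<forall>ij\<in>idx k. 0 \<le> x ij \<and> x ij \<le> 1")
    case True
    have "(\<Prod>j\<in>idx k. gP (x j)) = (\<Prod>j\<in>idx k. KP / wt N)" using True by (intro prod.cong refl) (simp add: gP_def)
    also have "\<dots> = (KP / wt N) ^ (k\<^sup>2)" by (simp add: idx_card)
    finally have 1: "(\<Prod>j\<in>idx k. gP (x j)) = (KP / wt N) ^ (k\<^sup>2)" .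
    have f: "1 - max 0 (lin (idx k) (\<lambda>j. max 0 (hP (x j))) c) / L = (if fst c then 1 - s (snd c) else 1 - r (snd c))" if c: "c \<in> coords k" for c
    proof -
      have "lin (idx k) (\<lambda>j. max 0 (hP (x j))) c = L * (if fst c then s (snd c) else r (snd c))"
        unfolding lin_entries[OF c] s_def r_def using hP_nonneg by (simp add: max_def hP_def sum_distrib_left)
      moreover have "0 \<le> s (snd c)" "0 \<le> r (snd c)" by (auto simp: s_def r_def intro!: sum_nonneg)
      ultimately show ?thesis using L_pos by (simp add: max_def)
    qed
    have "window k L (lin (idx k) (\<lambda>j. max 0 (hP (x j)))) = (\<Prod>c\<in>coords k. max 0 (if fst c then 1 - s (snd c) else 1 - r (snd c)))"
      unfolding window_def by (intro prod.cong refl) (simp only: f)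
    also have "\<dots> = (\<Prod>b\<in>UNIV. \<Prod>m\<in>{1..k}. max 0 (if b then 1 - s m else 1 - r m))"
      unfolding coords_def by (simp add: prod.cartesian_product case_prod_unfold)
    also have "\<dots> = (\<Prod>i\<in>{1..k}. max 0 (1 - r i)) * (\<Prod>j\<in>{1..k}. max 0 (1 - s j))" by (simp add: UNIV_bool mult.commute)
    also have "\<dots> = indicator (P_set k \<rho>) x * (\<Prod>i\<in>{1..k}. 1 - r i) * (\<Prod>j\<in>{1..k}. 1 - s j)"
    proof (cases "x \<in> P_set k \<rho>")
      case True
      then have "(\<Prod>i\<in>{1..k}. max 0 (1 - r i)) = (\<Prod>i\<in>{1..k}. 1 - r i)" "(\<Prod>j\<in>{1..k}. max 0 (1 - s j)) = (\<Prod>j\<in>{1..k}. 1 - s j)"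
        unfolding P by (auto intro!: prod.cong)
      then show ?thesis using True by (simp only: indicator_simps mult_1)
    next
      case False
      then have "(\<exists>j\<in>{1..k}. 1 < s j) \<or> (\<exists>i\<in>{1..k}. 1 < r i)" using True unfolding P by (meson not_le)
      then have "(\<Prod>i\<in>{1..k}. max 0 (1 - r i)) = 0 \<or> (\<Prod>j\<in>{1..k}. max 0 (1 - s j)) = 0"
      proof (elim disjE bexE)
        fix j assume j: "j \<in> {1..k}" "1 < s j"
        then have "max 0 (1 - s j) = 0" by simp
        then show ?thesis using j(1) by (intro disjI2 prod_zero) blast+
      next
        fix i assume i: "i \<in> {1..k}" "1 < r i"
        then have "max 0 (1 - r i) = 0" by simp
        then show ?thesis using i(1) by (intro disjI1 prod_zero) blast+
      qed
      moreover have "indicator (P_set k \<rho>) x = (0::real)" using False by (rule indicator_simps)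
      ultimately show ?thesis by (auto simp only: mult_zero_left mult_zero_right)
    qed
    finally show ?thesis unfolding 1 r_def s_def \<rho>[symmetric] by (simp only: mult.assoc)
  next
    case False
    then obtain ij where ij: "ij \<in> idx k" "\<not> (0 \<le> x ij \<and> x ij \<le> 1)" by blast
    have "gP (x ij) = 0" using ij(2) by (simp add: gP_def)
    then have 1: "(\<Prod>j\<in>idx k. gP (x j)) = 0" using ij(1) by (intro prod_zero) auto
    \<comment> \<open>Membership excludes negative entries, and an entry above 1 already exceeds the
      bound for its row sum.\<close>
    have "x \<notin> P_set k \<rho>"
    proof
      assume p: "x \<in> P_set k \<rho>"
      then have "1 < x ij" using ij unfolding P by fastforce
      then have "1 < x ij powr (1 / z)" using z0 by simp
      also have "\<dots> \<le> r (fst ij)" unfolding r_def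
        using member_le_sum[of "snd ij" "{1..k}" "\<lambda>j. x (fst ij, j) powr (1 / z)"] ij(1) by (auto simp: idx_def)
      also have "\<dots> \<le> 1" using p ij(1) unfolding P by (auto simp: idx_def)
      finally show False by simp
    qed
    then have "indicator (P_set k \<rho>) x = (0::real)" by simp
    then show ?thesis unfolding 1 by (simp only: mult_zero_left mult_zero_right)
  qed
qed

text \<open>No error occurs here: k^2 factors \<open>KP\<close> supply L^(k^2 z), the Gamma power of
  \<open>gamma_const\<close> and the power of \<open>cy\<close> that belongs to the primes up to
  y.\<close>

lemma main_value:
  assumes \<rho>: "z = \<rho>\<^sup>2"
  shows "wt N ^ (k\<^sup>2) * (\<integral>x. FF k x \<partial>PiM (idx k) (\<lambda>_. P2)) = cy ^ (k\<^sup>2) * L powr (real k ^ 2 * z) * gamma_const k \<rho>"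
proof -
  define I where "I = (\<lambda>x. (\<Prod>j\<in>idx k. gP (x j)) * window k L (0 + lin (idx k) (\<lambda>j. max 0 (hP (x j)))))"
  define G where "G = (\<lambda>x. indicator (P_set k \<rho>) x *
            (\<Prod>i=1..k. 1 - (\<Sum>j=1..k. x (i, j) powr (1 / \<rho> ^ 2))) *
            (\<Prod>j=1..k. 1 - (\<Sum>i=1..k. x (i, j) powr (1 / \<rho> ^ 2))))"
  have "(\<integral>x. FF k x \<partial>PiM (idx k) (\<lambda>_. P2)) = enn2real (window_integral P2 (\<lambda>_. 1) (max 0) k L (idx k) 0)" by (rule integral_FF_window_integral[OF sets_P12(2)])
  also have "window_integral P2 (\<lambda>_. 1) (max 0) k L (idx k) 0 = window_integral lborel gP (\<lambda>x. max 0 (hP x)) k L (idx k) 0"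
    unfolding P2_def
    by (rule window_integral_distr_density[OF L_pos]) (auto simp: gP_nonneg lborel.sigma_finite_measure_axioms intro: finite_measure.axioms(1)[OF P2_finite, unfolded P2_def])
  also have "\<dots> = (\<integral>\<^sup>+x. ennreal (I x) \<partial>PiM (idx k) (\<lambda>_. lborel))"
    unfolding window_integral_def I_def by (intro nn_integral_cong ennreal_mult[symmetric] prod_nonneg) (auto simp: gP_nonneg window_bounds[OF L_pos])
  also have "enn2real \<dots> = (\<integral>x. I x \<partial>PiM (idx k) (\<lambda>_. lborel))"
  proof (rule integral_eq_nn_integral[symmetric])
    have "(\<lambda>x. window k L (0 + lin (idx k) (\<lambda>j. max 0 (hP (x j))))) \<in> borel_measurable (PiM (idx k) (\<lambda>_. lborel))"
      by (rule window_measurable) (simp add: lin_def, measurable)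
    then show "I \<in> borel_measurable (PiM (idx k) (\<lambda>_. lborel))" unfolding I_def by measurable
    show "AE x in PiM (idx k) (\<lambda>_. lborel). 0 \<le> I x" 
      unfolding I_def by (intro always_eventually allI mult_nonneg_nonneg prod_nonneg) (auto simp: gP_nonneg window_bounds[OF L_pos])
  qed
  also have "\<dots> = (\<integral>x. (KP / wt N) ^ (k\<^sup>2) * G x \<partial>PiM (idx k) (\<lambda>_. lborel))"
    by (intro Bochner_Integration.integral_cong refl) (unfold I_def G_def add_0, rule main_pointwise[OF \<rho>], simp add: space_PiM)
  also have "\<dots> = (KP / wt N) ^ (k\<^sup>2) * (\<integral>x. G x \<partial>PiM (idx k) (\<lambda>_. lborel))" by (rule integral_mult_right_zero)
  finally have "wt N ^ (k\<^sup>2) * (\<integral>x. FF k x \<partial>PiM (idx k) (\<lambda>_. P2)) = KP ^ (k\<^sup>2) * (\<integral>x. G x \<partial>PiM (idx k) (\<lambda>_. lborel))"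
    using wt_pos[of N] by (simp add: power_divide)
  also have "KP ^ (k\<^sup>2) = cy ^ (k\<^sup>2) * L powr (real k ^ 2 * z) * (1 / Gamma (1 + z) ^ (k\<^sup>2))"
  proof -
    have "(L powr z) ^ (k\<^sup>2) = L powr (real (k\<^sup>2) * z)" using L_pos by (simp add: powr_power)
    then show ?thesis by (simp add: KP_def power_divide power_mult_distrib)
  qed
  also have "\<dots> * (\<integral>x. G x \<partial>PiM (idx k) (\<lambda>_. lborel)) = cy ^ (k\<^sup>2) * L powr (real k ^ 2 * z) * gamma_const k \<rho>"
    using z0 \<rho> by (simp add: gamma_const_def G_def)
  finally show ?thesis .
qed

end

section \<open>The Euler product and the error term\<close>

lemma sum_inv_sq_tail:
  assumes y: "1 \<le> y"
  shows "(\<Sum>p\<in>PA y N. 1 / real p ^ 2) \<le> 1 / real y"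
proof (cases "y \<le> N")
  case True
  then have "(\<Sum>n\<in>{y<..N}. 1 / real n ^ 2) \<le> 1 / real y - 1 / real N"
  proof (induction N rule: dec_induct)
    case (step n)
    have n: "0 < real n" using step(1) y by linarith
    have eq: "{y<..Suc n} = insert (Suc n) {y<..n}" using step(1) by auto
    have "1 / real (Suc n) ^ 2 \<le> 1 / (real n * (real n + 1))"
    proof (rule frac_le)
      show "0 < real n * (real n + 1)" using n by (intro mult_pos_pos) auto
      show "real n * (real n + 1) \<le> real (Suc n) ^ 2" by (simp add: power2_eq_square algebra_simps)
    qed auto
    also have "\<dots> = 1 / real n - 1 / real (Suc n)" using n by (simp add: field_simps)
    finally have "1 / real (Suc n) ^ 2 \<le> 1 / real n - 1 / real (Suc n)" .
    then show ?case using step(3) unfolding eq by (subst sum.insert) auto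
  qed simp
  moreover have "(\<Sum>p\<in>PA y N. 1 / real p ^ 2) \<le> (\<Sum>n\<in>{y<..N}. 1 / real n ^ 2)"
    by (rule sum_mono2) (auto simp: PA_def pr_def)
  moreover have "0 \<le> 1 / real N" by simp
  ultimately show ?thesis by linarith
next
  case False
  then have "PA y N = {}" by (auto simp: PA_def pr_def)
  then show ?thesis by simp
qed

text \<open>Telescoping from 1/sqrt m <= 2 sqrt m - 2 sqrt(m-1).\<close>

lemma sum_inv_sqrt_le: "(\<Sum>n=1..m. 1 / sqrt (real n)) \<le> 2 * sqrt (real m)"
proof (induction m)
  case (Suc m)
  define a where "a = sqrt (real m)" define b where "b = sqrt (real (Suc m))"
  have ab: "0 \<le> a" "0 < b" "a \<le> b" "b\<^sup>2 - a\<^sup>2 = 1" by (auto simp: a_def b_def)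
  have "(b - a) * (b + a) = 1" using ab(4) by (simp add: power2_eq_square algebra_simps)
  moreover have "(b - a) * (b + a) \<le> (b - a) * (2 * b)" using ab by (intro mult_left_mono) auto
  ultimately have "1 \<le> (2 * b - 2 * a) * b" by (simp add: algebra_simps)
  then have "1 / b \<le> 2 * b - 2 * a" by (simp only: pos_divide_le_eq[OF ab(2)])
  then show ?case using Suc unfolding a_def b_def by (subst sum.nat_ivl_Suc') auto
qed simp

text \<open>By \<open>mass_le\<close> a mass is at most (1 - x)^(-2k) with x = sqrt(z/p) <= theta,
  and -ln(1 - x) <= x/(1 - theta). The sum of 1/sqrt p up to 8k^2 is O(k), hence the exponent
  O(k^2). Here theta < 1, which comes from delta, is essential.\<close>

lemma prod_mass_small:
  assumes k: "1 \<le> k" and th: "0 < \<theta>" "\<theta> < 1" and z: "0 \<le> z" "z \<le> 2 * \<theta>\<^sup>2"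
  shows "(\<Prod>p\<in>pr (8 * k ^ 2). mass k (z / real p)) \<le> exp (16 * real k ^ 2 / (1 - \<theta>))"
proof -
  have th2: "\<theta>\<^sup>2 < 1" using th by (simp add: abs_square_less_1)
  have bound: "mass k (z / real p) \<le> exp (2 * real k * sqrt 2 / (1 - \<theta>) * (1 / sqrt (real p)))" and nn: "0 \<le> mass k (z / real p)" if p: "2 \<le> p" for p
  proof -
    define x where "x = sqrt (z / real p)"
    have "z / real p \<le> z / 2" using p z by (intro divide_left_mono) auto
    then have zp: "z / real p \<le> \<theta>\<^sup>2" using z by linarith
    have x: "0 \<le> x" "x \<le> \<theta>" using z zp th by (auto simp: x_def intro: real_le_lsqrt)
    have x2: "x\<^sup>2 = z / real p" using z by (simp add: x_def)
    have xs: "x \<le> sqrt 2 * (1 / sqrt (real p))"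
    proof -
      have "x \<le> sqrt (2 / real p)" unfolding x_def using z th2 p by (intro real_sqrt_le_mono divide_right_mono) auto
      then show ?thesis by (simp add: real_sqrt_divide)
    qed
    have "- ln (1 - x) \<le> x / (1 - \<theta>)"
    proof -
      have "- ln (1 - x) = ln (1 / (1 - x))" using x th by (simp add: ln_div)
      also have "\<dots> \<le> 1 / (1 - x) - 1" using x th by (intro ln_le_minus_one) auto
      also have "\<dots> = x / (1 - x)" using x th by (simp add: field_simps)
      also have "\<dots> \<le> x / (1 - \<theta>)" using x th by (intro divide_left_mono mult_pos_pos) auto
      finally show ?thesis .
    qed
    also have "\<dots> \<le> (sqrt 2 * (1 / sqrt (real p))) / (1 - \<theta>)" using xs th by (intro divide_right_mono) auto
    finally have l: "- ln (1 - x) \<le> (sqrt 2 * (1 / sqrt (real p))) / (1 - \<theta>)" .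
    have "mass k (z / real p) \<le> (1 - x) powr (- (2 * real k))" using mass_le[of x k] x th by (simp add: x2)
    also have "\<dots> = exp (2 * real k * (- ln (1 - x)))" using x th by (simp add: powr_def)
    also have "\<dots> \<le> exp (2 * real k * ((sqrt 2 * (1 / sqrt (real p))) / (1 - \<theta>)))" using l by (simp only: exp_le_cancel_iff) (intro mult_left_mono, auto)
    finally show "mass k (z / real p) \<le> exp (2 * real k * sqrt 2 / (1 - \<theta>) * (1 / sqrt (real p)))" by (simp add: mult_ac)
    have "z / real p < 1" using zp th2 by linarith
    then show "0 \<le> mass k (z / real p)" using mass_ge_1[of "z / real p" k] z k by (simp add: order_trans[of 0 1])
  qed
  let ?c = "2 * real k * sqrt 2 / (1 - \<theta>)"
  have c: "0 \<le> ?c" using th by simp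
  have "(\<Prod>p\<in>pr (8 * k ^ 2). mass k (z / real p)) \<le> (\<Prod>p\<in>pr (8 * k ^ 2). exp (?c * (1 / sqrt (real p))))"
    using bound nn by (intro prod_mono) (auto dest: prD)
  also have "\<dots> = exp (?c * (\<Sum>p\<in>pr (8 * k ^ 2). 1 / sqrt (real p)))" by (simp add: exp_sum sum_distrib_left)
  also have "\<dots> \<le> exp (?c * (2 * sqrt (real (8 * k ^ 2))))"
  proof -
    have "(\<Sum>p\<in>pr (8 * k ^ 2). 1 / sqrt (real p)) \<le> (\<Sum>n=1..8 * k ^ 2. 1 / sqrt (real n))"
      by (rule sum_mono2) (auto simp: pr_def dest: prime_gt_0_nat)
    then have "(\<Sum>p\<in>pr (8 * k ^ 2). 1 / sqrt (real p)) \<le> 2 * sqrt (real (8 * k ^ 2))" using sum_inv_sqrt_le order_trans by blast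
    then show ?thesis using c by (simp only: exp_le_cancel_iff mult_left_mono)
  qed
  also have "?c * (2 * sqrt (real (8 * k ^ 2))) = 16 * real k ^ 2 / (1 - \<theta>)"
  proof -
    have "sqrt (real (8 * k ^ 2)) = 2 * sqrt 2 * real k"
    proof (rule real_sqrt_unique)
      show "(2 * sqrt 2 * real k)\<^sup>2 = real (8 * k ^ 2)" by (simp add: power_mult_distrib)
    qed simp
    then have "?c * (2 * sqrt (real (8 * k ^ 2))) = 8 * real k ^ 2 * (sqrt 2 * sqrt 2) / (1 - \<theta>)" by (simp only: power2_eq_square) simp
    also have "sqrt 2 * sqrt 2 = (2::real)" by simp
    finally show ?thesis by simp
  qed
  finally show ?thesis .
qed

text \<open>The Euler factor of \<open>a_const\<close> at p, written with z = rho^2.\<close>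

definition ap :: "nat \<Rightarrow> real \<Rightarrow> nat \<Rightarrow> real" where
  "ap k z p = mass k (z / real p) * exp (- (real k ^ 2 * z * lam p))"

lemma ap_bounds:
  assumes k: "1 \<le> k" and z: "0 < z" "z \<le> 2" and p: "8 * k ^ 2 \<le> p" "2 \<le> p"
  shows "0 < ap k z p" "\<bar>ln (ap k z p)\<bar> \<le> 8 * real k ^ 4 * (1 / real p ^ 2)"
proof -
  have m: "1 \<le> mass k (z / real p)" by (rule large_R(5)[OF k zero_less_one z p])
  then show "0 < ap k z p" by (simp add: ap_def)
  have e: "ln (ap k z p) = ln (mass k (z / real p)) - real k ^ 2 * z * lam p" using m by (simp add: ap_def ln_mult)
  have "\<bar>ln (mass k (z / real p)) - real k ^ 2 * z * lam p\<bar> \<le> 8 * real k ^ 4 / real p ^ 2"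
    by (rule large_R(6)[OF k zero_less_one z p])
  then show "\<bar>ln (ap k z p)\<bar> \<le> 8 * real k ^ 4 * (1 / real p ^ 2)" unfolding e times_divide_eq_right mult_1_right .
qed

lemma ap_sum_bound:
  assumes k: "1 \<le> k" and z: "0 < z" "z \<le> 2" and y: "8 * k ^ 2 \<le> y"
  shows "(\<Sum>p\<in>PA y N. \<bar>ln (ap k z p)\<bar>) \<le> 8 * real k ^ 4 / real y"
proof -
  have y1: "1 \<le> y" using y k one_le_power[OF k, of 2] by linarith
  have "(\<Sum>p\<in>PA y N. \<bar>ln (ap k z p)\<bar>) \<le> (\<Sum>p\<in>PA y N. 8 * real k ^ 4 * (1 / real p ^ 2))"
    by (intro sum_mono ap_bounds k z) (use y in \<open>auto simp: PA_def pr_def dest: prime_ge_2_nat\<close>)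
  also have "\<dots> = 8 * real k ^ 4 * (\<Sum>p\<in>PA y N. 1 / real p ^ 2)" by (simp only: sum_distrib_left)
  also have "\<dots> \<le> 8 * real k ^ 4 * (1 / real y)" by (intro mult_left_mono sum_inv_sq_tail y1) simp
  finally show ?thesis by simp
qed

lemma ap_prod_PA_le:
  assumes k: "1 \<le> k" and z: "0 < z" "z \<le> 2"
  shows "0 < (\<Prod>p\<in>PA (8 * k ^ 2) N. ap k z p)" "(\<Prod>p\<in>PA (8 * k ^ 2) N. ap k z p) \<le> exp (real k ^ 2)"
proof -
  have p: "8 * k ^ 2 \<le> p" "2 \<le> p" if "p \<in> PA (8 * k ^ 2) N" for p using that by (auto simp: PA_def pr_def dest: prime_ge_2_nat)
  have pos: "0 < ap k z p" if "p \<in> PA (8 * k ^ 2) N" for p by (rule ap_bounds(1)[OF k z p[OF that]])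
  then show "0 < (\<Prod>p\<in>PA (8 * k ^ 2) N. ap k z p)" by (intro prod_pos) auto
  have "(\<Prod>p\<in>PA (8 * k ^ 2) N. ap k z p) = exp (\<Sum>p\<in>PA (8 * k ^ 2) N. ln (ap k z p))"
    unfolding exp_sum[OF finite_PA] using pos by (intro prod.cong refl) simp
  also have "\<dots> \<le> exp (\<Sum>p\<in>PA (8 * k ^ 2) N. \<bar>ln (ap k z p)\<bar>)" by (simp only: exp_le_cancel_iff) (intro sum_mono, simp)
  also have "\<dots> \<le> exp (8 * real k ^ 4 / real (8 * k ^ 2))" by (simp only: exp_le_cancel_iff) (rule ap_sum_bound[OF k z order_refl])
  also have "8 * real k ^ 4 / real (8 * k ^ 2) = real k ^ 2" using k by (simp add: power2_eq_square power4_eq_xxxx)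
  finally show "(\<Prod>p\<in>PA (8 * k ^ 2) N. ap k z p) \<le> exp (real k ^ 2)" .
qed

lemma a_const_factor:
  assumes p: "prime p"
  shows "(1 - 1 / real p) powr (real k ^ 2 * \<rho> ^ 2) * (\<Sum>j. real (dk_pp k j) ^ 2 * \<rho> ^ (2 * j) / real p ^ j) = ap k (\<rho>\<^sup>2) p"
proof -
  have p1: "1 < real p" using p prime_gt_1_nat by fastforce
  have "(1 - 1 / real p) powr (real k ^ 2 * \<rho> ^ 2) = exp (- (real k ^ 2 * \<rho>\<^sup>2 * lam p))"
    using p1 by (simp add: powr_def lam_def)
  moreover have "(\<Sum>j. real (dk_pp k j) ^ 2 * \<rho> ^ (2 * j) / real p ^ j) = mass k (\<rho>\<^sup>2 / real p)"
    unfolding mass_def by (simp add: power_divide power_mult)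
  ultimately show ?thesis by (simp add: ap_def)
qed

text \<open>Logarithms are taken beyond N only, where \<open>ap_bounds\<close> applies and makes
  their series absolutely convergent; the finite product up to N stays as it is.\<close>

lemma a_const_tail:
  assumes k: "1 \<le> k" and z: "0 < \<rho>" "\<rho>\<^sup>2 \<le> 2" and N: "8 * k ^ 2 \<le> N" and pos: "\<And>p. p \<in> pr N \<Longrightarrow> 0 < ap k (\<rho>\<^sup>2) p"
  obtains \<tau> where "\<bar>\<tau>\<bar> \<le> 8 * real k ^ 4 / real N" "a_const k \<rho> = (\<Prod>p\<in>pr N. ap k (\<rho>\<^sup>2) p) * exp \<tau>"
proof -
  have z0: "0 < \<rho>\<^sup>2" using z by simp
  define f where "f = (\<lambda>p. if prime p \<and> N < p then ln (ap k (\<rho>\<^sup>2) p) else 0)"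
  have big: "8 * k ^ 2 \<le> p" "2 \<le> p" if "prime p" "N < p" for p using that N by (auto dest: prime_ge_2_nat)
  have fb: "\<bar>f p\<bar> \<le> 4 * real k ^ 4 * (2 * (1 / real p ^ 2))" for p
    using ap_bounds(2)[OF k z0 z(2) big, of p] by (auto simp: f_def)
  have sa: "summable (\<lambda>p. \<bar>f p\<bar>)"
    by (rule summable_comparison_test'[OF summable_mult[OF summable_inv_sq, of "4 * real k ^ 4"], of 0]) (use fb in auto)
  then have sf: "summable f" by (rule summable_rabs_cancel)
  define \<tau> where "\<tau> = suminf f"
  have "\<bar>\<tau>\<bar> \<le> (\<Sum>p. \<bar>f p\<bar>)" unfolding \<tau>_def by (rule summable_rabs[OF sa])
  also have "\<dots> \<le> 8 * real k ^ 4 / real N"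
  proof (rule suminf_le_const[OF sa])
    fix n
    have "(\<Sum>p<n. \<bar>f p\<bar>) = (\<Sum>p\<in>{p\<in>{..<n}. prime p \<and> N < p}. \<bar>ln (ap k (\<rho>\<^sup>2) p)\<bar>)"
      unfolding sum.inter_filter[OF finite_lessThan] by (intro sum.cong refl) (simp add: f_def)
    also have "\<dots> \<le> (\<Sum>p\<in>PA N n. \<bar>ln (ap k (\<rho>\<^sup>2) p)\<bar>)" by (rule sum_mono2) (auto simp: PA_def pr_def)
    also have "\<dots> \<le> 8 * real k ^ 4 / real N" by (rule ap_sum_bound[OF k z0 z(2) N])
    finally show "(\<Sum>p<n. \<bar>f p\<bar>) \<le> 8 * real k ^ 4 / real N" .
  qed
  finally have 1: "\<bar>\<tau>\<bar> \<le> 8 * real k ^ 4 / real N" .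
  define g where "g = (\<lambda>p. if prime p then ap k (\<rho>\<^sup>2) p else 1)"
  define A where "A = (\<Prod>p\<in>pr N. ap k (\<rho>\<^sup>2) p)"
  have A0: "0 < A" unfolding A_def by (intro prod_pos) (use pos in auto)
  have part: "(\<Prod>i\<le>n. g i) = A * exp (\<Sum>i<Suc n. f i)" if "N \<le> n" for n
    using that
  proof (induction n rule: dec_induct)
    case base
    have "(\<Prod>i\<le>N. g i) = (\<Prod>p\<in>{p\<in>{..N}. prime p}. ap k (\<rho>\<^sup>2) p)"
      unfolding prod.inter_filter[OF finite_atMost] g_def ..
    also have "{p\<in>{..N}. prime p} = pr N" by (auto simp: pr_def)
    finally have "(\<Prod>i\<le>N. g i) = A" by (simp add: A_def)
    moreover have "(\<Sum>i<Suc N. f i) = 0" by (intro sum.neutral) (auto simp: f_def)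
    ultimately show ?case by simp
  next
    case (step n)
    have "g (Suc n) = exp (f (Suc n))"
      using ap_bounds(1)[OF k z0 z(2) big, of "Suc n"] step(1) by (auto simp: g_def f_def)
    then show ?case using step(3) by (simp add: exp_add)
  qed
  have "(\<lambda>n. \<Sum>i<Suc n. f i) \<longlonglongrightarrow> \<tau>" unfolding \<tau>_def by (rule LIMSEQ_Suc[OF summable_LIMSEQ[OF sf]])
  then have "(\<lambda>n. A * exp (\<Sum>i<Suc n. f i)) \<longlonglongrightarrow> A * exp \<tau>" by (intro tendsto_intros)
  moreover have "\<forall>\<^sub>F n in sequentially. A * exp (\<Sum>i<Suc n. f i) = (\<Prod>i\<le>n. g i)"
    using eventually_ge_at_top[of N] by eventually_elim (simp only: part)
  ultimately have "(\<lambda>n. \<Prod>i\<le>n. g i) \<longlonglongrightarrow> A * exp \<tau>" by (rule Lim_transform_eventually)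
  \<comment> \<open>An infinite product in this sense must have a nonzero limit, which is where
    positivity of the factors up to N is used.\<close>
  then have "g has_prod (A * exp \<tau>)" unfolding has_prod_def raw_has_prod_def using A0 by simp
  then have "A * exp \<tau> = prodinf g" by (rule has_prod_unique)
  moreover have "a_const k \<rho> = prodinf g" unfolding a_const_def g_def
    by (intro arg_cong[where f = prodinf] ext) (simp add: a_const_factor)
  ultimately show ?thesis using that[OF 1] by (simp add: A_def)
qed

text \<open>For p <= N the factor p^(1/L) is at most e <= 3, so the undamped sum is within a factor
  3 of the damped one at sigma = 1/L. This crude bound is enough, as it controls the Euler tail of
  size 1/N.\<close>

lemma sum_lam_le:
  assumes L: "L = ln (real N)" "1 \<le> L"
  shows "(\<Sum>p\<in>pr N. lam p) \<le> 3 * (ln L + (1 + inv_sq_sum))"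
proof -
  have "(\<Sum>p\<in>pr N. lam p) \<le> (\<Sum>p\<in>pr N. 3 * (lam p * real p powr (- (1 / L))))"
  proof (rule sum_mono)
    fix p assume p: "p \<in> pr N"
    have "ln (real p) \<le> L" unfolding L using prD[OF p] by (intro ln_mono) auto
    then have "1 / L * ln (real p) \<le> 1" using L by (simp add: divide_le_eq)
    then have "exp (1 / L * ln (real p)) \<le> exp 1" by simp
    also have "\<dots> \<le> 3" by (rule exp_le)
    finally have e: "exp (1 / L * ln (real p)) \<le> 3" .
    have "1 = exp (1 / L * ln (real p)) * real p powr (- (1 / L))" using prD[OF p] by (simp add: powr_def exp_minus)
    also have "\<dots> \<le> 3 * real p powr (- (1 / L))" using e by (intro mult_right_mono) auto
    finally show "lam p \<le> 3 * (lam p * real p powr (- (1 / L)))"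
      using mult_left_mono[of 1 "3 * real p powr (- (1 / L))" "lam p"] lam_pos[of p] prD[OF p] by simp
  qed
  also have "\<dots> = 3 * (\<Sum>p\<in>pr N. lam p * real p powr (- (1 / L)))" by (simp only: sum_distrib_left)
  also have "\<dots> \<le> 3 * (ln (1 / (1 / L)) + (1 + inv_sq_sum))" by (intro mult_left_mono sum_lam_powr_le) (use L in auto)
  finally show ?thesis by simp
qed

section \<open>Assembling the error terms\<close>

lemma abs_exp_minus_1_le:
  fixes t :: real
  assumes "\<bar>t\<bar> \<le> 1/2"
  shows "\<bar>exp t - 1\<bar> \<le> 2 * \<bar>t\<bar>"
proof -
  have "exp t \<le> 1 + 2 * \<bar>t\<bar>" using exp_bound_lemma[of t] assms by simp
  moreover have "1 + t \<le> exp t" by (rule exp_ge_add_one_self)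
  ultimately show ?thesis by linarith
qed

text \<open>In its use, E1, E2 and E3 are the window averages for the arithmetic, the Poisson and
  the continuous model, tau is the logarithm of the Euler tail, W = wt^(k^2), and Q collects Euler
  factors of size exp(O(k^2)).\<close>

lemma telescoping_error:
  fixes Q W E1 E2 E3 M main \<tau> u t1 t2 :: real
  assumes M: "M = Q * W" and 1: "M * \<bar>E1 - E2\<bar> \<le> t1" and 2: "W * \<bar>E2 - E3\<bar> \<le> t2"
    and main: "main = M * E3 * exp \<tau>" and \<tau>: "2 * \<bar>\<tau>\<bar> \<le> u" "u \<le> 1" and u: "W * u \<le> v"
    and E: "E2 \<le> 1" "0 \<le> E3" and Q: "0 \<le> Q" and W: "0 \<le> W"
  shows "\<bar>M * E1 - main\<bar> \<le> t1 + Q * (v + 2 * t2)"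
proof -
  have M0: "0 \<le> M" using M Q W by simp
  have u0: "0 \<le> u" using \<tau> by linarith
  have t20: "0 \<le> t2" using 2 W by (meson abs_ge_zero mult_nonneg_nonneg order_trans)
  have a: "\<bar>M * E1 - M * E2\<bar> \<le> t1" using 1 M0 by (simp add: abs_mult flip: right_diff_distrib)
  have "\<bar>M * E2 - M * E3\<bar> = Q * (W * \<bar>E2 - E3\<bar>)" using Q W unfolding M by (simp add: abs_mult flip: right_diff_distrib)
  also have "\<dots> \<le> Q * t2" using 2 Q by (rule mult_left_mono)
  finally have b: "\<bar>M * E2 - M * E3\<bar> \<le> Q * t2" .
  \<comment> \<open>The continuous model is not a probability measure, so E3 is bounded through E2
    <= 1 and the second replacement.\<close>
  have "W * E3 \<le> W * E2 + W * \<bar>E2 - E3\<bar>" using W by (simp flip: distrib_left) (intro mult_left_mono, auto)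
  also have "\<dots> \<le> W * 1 + t2" using 2 E W by (intro add_mono mult_left_mono) auto
  finally have WE: "W * E3 \<le> W + t2" by simp
  have "M * E3 - main = M * E3 * (1 - exp \<tau>)" unfolding main by (simp add: right_diff_distrib)
  then have "\<bar>M * E3 - main\<bar> = M * E3 * \<bar>exp \<tau> - 1\<bar>" using M0 E by (simp add: abs_mult abs_minus_commute)
  also have "\<dots> \<le> M * E3 * u"
    using abs_exp_minus_1_le[of \<tau>] \<tau> M0 E by (intro mult_left_mono) auto
  also have "\<dots> = Q * (W * E3 * u)" unfolding M by simp
  also have "\<dots> \<le> Q * ((W + t2) * u)" using WE u0 Q by (intro mult_left_mono mult_right_mono)
  also have "\<dots> \<le> Q * (v + t2)"
  proof (rule mult_left_mono[OF _ Q])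
    have "t2 * u \<le> t2 * 1" using t20 \<tau> by (intro mult_left_mono) auto
    then show "(W + t2) * u \<le> v + t2" using u by (simp add: distrib_right)
  qed
  finally have c: "\<bar>M * E3 - main\<bar> \<le> Q * v + Q * t2" by (simp add: distrib_left)
  have "Q * (v + 2 * t2) = Q * v + Q * t2 + Q * t2" by (simp add: distrib_left)
  then show ?thesis using a b c by linarith
qed

context rough_window begin

text \<open>The first summand bounds the constant for the law of T, the second the one for the
  continuous model.\<close>

definition K0 :: real where "K0 = exp (2 * (2 + inv_sq_sum)) + 96 / gam_inf"

lemma K0_ge1: "1 \<le> K0"
proof -
  have "1 \<le> exp (2 * (2 + inv_sq_sum))" using inv_sq_sum_nonneg by simp
  then show ?thesis using gam_inf(1) by (simp add: K0_def add_increasing2)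
qed

text \<open>The damped mass of one position is at most a constant times (L/(k ln y))^z for both
  models, and ln y is at least ln k: this is the whole saving in k. The hypothesis \<open>h2\<close>
  keeps the Mertens error of the primes up to y bounded.\<close>

lemma R_bounds:
  assumes k: "1 \<le> k" and yk: "y = 8 * k ^ 2" and yN: "y \<le> N" and h2: "2 * real k * (ln (real y) + (2 + 4 * sq_sum)) \<le> L"
  defines "B \<equiv> L / (real k * ln (real y))"
  shows "exp (z * (\<Sum>p\<in>PA y N. lam p * real p powr (- (2 * real k / L)))) \<le> K0 * B powr z"
    and "KP * (96 * (2 * real k) powr (- z)) \<le> K0 * B powr z"
    and "1 \<le> B" and "1 \<le> ln (real y)" and "1 \<le> L"
proof -
  have "8 * 1 \<le> y" unfolding yk using one_le_power[OF k, of 2] by (intro mult_left_mono) auto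
  then have y8: "8 \<le> y" by simp
  have "ln (exp 1) \<le> ln (real y)" using exp_le y8 by (intro ln_mono) auto
  then show ly: "1 \<le> ln (real y)" by simp
  have k1: "1 \<le> real k" using k by simp
  have sq: "0 \<le> sq_sum" by (rule sq_sum_nonneg)
  have "2 * real k * 1 \<le> 2 * real k * (ln (real y) + (2 + 4 * sq_sum))" using ly sq k1 by (intro mult_left_mono) auto
  then have kL: "2 * real k \<le> L" using h2 by linarith
  then show L1: "1 \<le> L" using k1 by linarith
  have "real k * ln (real y) \<le> 2 * real k * (ln (real y) + (2 + 4 * sq_sum))"
    using ly sq k1 by (intro mult_mono) auto
  then have "real k * ln (real y) \<le> L" using h2 by (rule order_trans)
  moreover have "0 < real k * ln (real y)" using ly k1 by (intro mult_pos_pos) linarith+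
  ultimately show B1': "1 \<le> B" unfolding B_def by simp
  define \<sigma> where "\<sigma> = 2 * real k / L"
  have s: "0 < \<sigma>" "\<sigma> \<le> 1" using kL k1 L1 by (auto simp: \<sigma>_def)
  let ?f = "\<lambda>p. lam p * real p powr (- \<sigma>)"
  have sub: "pr y \<subseteq> pr N" using yN by (auto simp: pr_def)
  have "(\<Sum>p\<in>PA y N. ?f p) = (\<Sum>p\<in>pr N. ?f p) - (\<Sum>p\<in>pr y. ?f p)" unfolding PA_def by (rule sum_diff[OF finite_pr sub])
  moreover have "(\<Sum>p\<in>pr N. ?f p) \<le> ln (1 / \<sigma>) + (1 + inv_sq_sum)" by (rule sum_lam_powr_le[OF s])
  moreover have "ln (ln (real y)) - \<sigma> * (ln (real y) + (2 + 4 * sq_sum)) \<le> (\<Sum>p\<in>pr y. ?f p)" by (rule sum_lam_powr_ge) (use y8 s in auto)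
  moreover have "\<sigma> * (ln (real y) + (2 + 4 * sq_sum)) \<le> 1" using h2 L1 by (simp add: \<sigma>_def)
  moreover have "ln (1 / \<sigma>) \<le> ln L - ln (real k)"
  proof -
    have "1 / \<sigma> \<le> L / real k" unfolding \<sigma>_def using k1 L1 by (simp add: field_simps)
    then have "ln (1 / \<sigma>) \<le> ln (L / real k)" using s by (intro ln_mono) auto
    then show ?thesis using k1 L1 by (simp add: ln_div)
  qed
  moreover have lB: "ln B = ln L - ln (real k) - ln (ln (real y))" using k1 ly L1 by (simp add: B_def ln_div ln_mult)
  \<comment> \<open>ln(1/sigma) with sigma = 2k/L yields L/k, and subtracting the primes up to y
    yields ln y in the denominator of B.\<close>
  ultimately have S: "(\<Sum>p\<in>PA y N. ?f p) \<le> ln B + (2 + inv_sq_sum)" by linarith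
  have Bz: "B powr z = exp (z * ln B)" using B1' by (simp add: powr_def)
  have "z * (\<Sum>p\<in>PA y N. ?f p) \<le> z * ln B + z * (2 + inv_sq_sum)" using mult_left_mono[OF S, of z] z0 by (simp add: distrib_left)
  also have "z * (2 + inv_sq_sum) \<le> 2 * (2 + inv_sq_sum)" using z2 inv_sq_sum_nonneg by (intro mult_right_mono) auto
  finally have "exp (z * (\<Sum>p\<in>PA y N. ?f p)) \<le> exp (z * ln B + 2 * (2 + inv_sq_sum))" by simp
  also have "\<dots> = exp (2 * (2 + inv_sq_sum)) * B powr z" by (simp add: Bz exp_add)
  also have "\<dots> \<le> K0 * B powr z" using gam_inf(1) by (intro mult_right_mono) (auto simp: K0_def)
  finally show "exp (z * (\<Sum>p\<in>PA y N. lam p * real p powr (- (2 * real k / L)))) \<le> K0 * B powr z" by (simp only: \<sigma>_def)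
  \<comment> \<open>\<open>cy\<close> is at most (ln y)^(-z), which gives the continuous model the
    same factor as the prime sum.\<close>
  have c: "cy \<le> exp (- (z * ln (ln (real y))))"
    unfolding cy_def using sum_lam_ge[of y] y8 z0 by (simp add: mult_left_mono)
  have G: "gam_inf \<le> Gamma (1 + z)" by (rule gam_inf(2)) (use z0 z2 in auto)
  have "KP \<le> exp (- (z * ln (ln (real y)))) * L powr z / gam_inf" unfolding KP_def
    using c G gam_inf(1) cy_bounds by (intro frac_le mult_right_mono mult_nonneg_nonneg) auto
  moreover have "(2 * real k) powr (- z) \<le> real k powr (- z)" using k1 z0 by (intro powr_mono2') auto
  ultimately have "KP * (96 * (2 * real k) powr (- z)) \<le> (exp (- (z * ln (ln (real y)))) * L powr z / gam_inf) * (96 * real k powr (- z))"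
    using KP_pos by (intro mult_mono) auto
  also have "\<dots> = 96 / gam_inf * (exp (- (z * ln (ln (real y)))) * L powr z * real k powr (- z))" by simp
  also have "exp (- (z * ln (ln (real y)))) * L powr z * real k powr (- z) = B powr z"
  proof -
    have "exp (- (z * ln (ln (real y)))) * L powr z * real k powr (- z) = exp (- (z * ln (ln (real y))) + z * ln L + (- z) * ln (real k))"
      unfolding exp_add powr_def using k1 L1 by simp
    also have "- (z * ln (ln (real y))) + z * ln L + (- z) * ln (real k) = z * ln B" unfolding lB by (simp add: algebra_simps)
    finally show ?thesis unfolding Bz .
  qed
  also have "96 / gam_inf * B powr z \<le> K0 * B powr z" by (intro mult_right_mono) (auto simp: K0_def)
  finally show "KP * (96 * (2 * real k) powr (- z)) \<le> K0 * B powr z" .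
qed

text \<open>Collects both replacements and the Euler tail. Each contributes at most R^(k^2)/L times
  a factor that \<open>const_bound\<close> shows to be exp(O(k^2)).\<close>

lemma error_bound:
  assumes k: "1 \<le> k" and yk: "y = 8 * k ^ 2" and yN: "y \<le> N" and h2: "2 * real k * (ln (real y) + (2 + 4 * sq_sum)) \<le> L"
    and h3: "16 * real k ^ 4 \<le> real N" and h4: "wt N ^ (k\<^sup>2) * (16 * real k ^ 4) * L \<le> real N"
    and \<rho>: "z = \<rho>\<^sup>2" "0 < \<rho>" and th: "0 < \<theta>" "\<theta> < 1" "z \<le> 2 * \<theta>\<^sup>2"
  defines "R \<equiv> K0 * (L / (real k * ln (real y))) powr z"
  shows "\<bar>moment_S k \<rho> N - a_const k \<rho> * gamma_const k \<rho> * L powr (real k ^ 2 * \<rho> ^ 2)\<bar>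
    \<le> exp (16 * real k ^ 2 / (1 - \<theta>)) * exp (real k ^ 2) * (exp (2 * real k ^ 2) * (2 * real y ^ 2 * meanb \<theta> k + 240 * real k ^ 4 * sq_sum)
        + 1 + 2 * (real k ^ 2 * (exp (2 * real k ^ 2) * (24 * B1 * theta_err y * (64 * real k ^ 6))))) * (1 / L * R ^ (k\<^sup>2))"
proof -
  define B where "B = L / (real k * ln (real y))"
  note Rb = R_bounds[OF k yk yN h2, folded B_def, folded R_def[folded B_def]]
  have R1: "1 \<le> R" using K0_ge1 Rb(3) z0 mult_mono[of 1 K0 1 "B powr z"] by (simp add: R_def B_def[symmetric] ge_one_powr_ge_zero)
  have k1: "1 \<le> real k" using k by simp
  have L0: "0 < L" by (rule L_pos)
  have th2: "\<theta>\<^sup>2 < 1" using th by (simp add: abs_square_less_1)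
  have z2': "z < 2" using th th2 by linarith
  have PAy: "\<And>p. p \<in> PA y N \<Longrightarrow> 8 * k ^ 2 \<le> p \<and> 2 \<le> p" unfolding yk by (auto simp: PA_def pr_def dest: prime_ge_2_nat)
  let ?m = "\<lambda>p. mass k (z / real p)"
  have mpos: "0 < ?m p" if p: "p \<in> pr n" for p n
  proof -
    have "z / real p < 1" using prD(3)[OF p] z2' by (simp add: divide_less_eq)
    then show ?thesis using mass_ge_1[of "z / real p" k] z0 k by (simp add: less_le_trans[of 0 1])
  qed
  have sub: "pr y \<subseteq> pr N" using yN by (auto simp: pr_def)
  define M where "M = (\<Prod>p\<in>pr N. ?m p)"
  define My where "My = (\<Prod>p\<in>pr y. ?m p)"
  define A where "A = (\<Prod>p\<in>PA y N. ap k z p)"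
  define W where "W = wt N ^ (k\<^sup>2)"
  define Q where "Q = My * A"
  have My0: "0 < My" unfolding My_def by (intro prod_pos) (use mpos in auto)
  have My1: "My \<le> exp (16 * real k ^ 2 / (1 - \<theta>))" unfolding My_def yk by (rule prod_mass_small[OF k th(1,2) _ th(3)]) (use z0 in simp)
  have A0: "0 < A" "A \<le> exp (real k ^ 2)" unfolding A_def yk by (rule ap_prod_PA_le[OF k z0 z2])+
  have Q: "0 < Q" "Q \<le> exp (16 * real k ^ 2 / (1 - \<theta>)) * exp (real k ^ 2)"
    using My0 My1 A0 by (auto simp: Q_def intro!: mult_mono)
  have split: "(\<Prod>p\<in>pr N. f p) = (\<Prod>p\<in>pr y. f p) * (\<Prod>p\<in>PA y N. f p)" for f :: "nat \<Rightarrow> real"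
    unfolding PA_def using prod.subset_diff[OF sub finite_pr, of f] by (simp add: mult.commute)
  have ex: "(\<Prod>p\<in>P. exp (- (real k ^ 2 * z * lam p))) = exp (- (z * (\<Sum>p\<in>P. lam p))) ^ (k\<^sup>2)" if "finite P" for P
  proof -
    have "(\<Prod>p\<in>P. exp (- (real k ^ 2 * z * lam p))) = exp (\<Sum>p\<in>P. - (real k ^ 2 * z * lam p))" by (rule exp_sum[symmetric]) fact
    also have "(\<Sum>p\<in>P. - (real k ^ 2 * z * lam p)) = real (k\<^sup>2) * (- (z * (\<Sum>p\<in>P. lam p)))" by (simp add: sum_distrib_left sum_negf mult_ac)
    also have "exp \<dots> = exp (- (z * (\<Sum>p\<in>P. lam p))) ^ (k\<^sup>2)" by (rule exp_of_nat_mult)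
    finally show ?thesis .
  qed
  have W0: "0 < W" using wt_pos by (simp add: W_def)
  \<comment> \<open>The exponential factors inside \<open>ap\<close> over the primes above y
    multiply to the inverse of W, so the plain masses are left.\<close>
  have AW: "A * W = (\<Prod>p\<in>PA y N. ?m p)"
  proof -
    have "A = (\<Prod>p\<in>PA y N. ?m p) * exp (- (z * (\<Sum>p\<in>PA y N. lam p))) ^ (k\<^sup>2)"
      unfolding A_def ap_def prod.distrib ex[OF finite_PA] ..
    moreover have "exp (- (z * (\<Sum>p\<in>PA y N. lam p))) ^ (k\<^sup>2) * W = 1"
      unfolding W_def wt_def power_mult_distrib[symmetric] by (simp add: exp_minus)
    ultimately show ?thesis by (simp only: mult.assoc mult_1_right)
  qed
  have MQ: "M = Q * W" unfolding M_def split Q_def My_def[symmetric] AW[symmetric] by (simp only: mult.assoc)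
  \<comment> \<open>The small primes enter Q with their bare masses; the power of \<open>cy\<close>
    from \<open>main_value\<close> adds the missing convergence factors and completes the Euler
    product of \<open>a_const\<close> up to N.\<close>
  have AN: "Q * cy ^ (k\<^sup>2) = (\<Prod>p\<in>pr N. ap k z p)"
  proof -
    have "(\<Prod>p\<in>pr y. ap k z p) = My * cy ^ (k\<^sup>2)"
      unfolding ap_def prod.distrib ex[OF finite_pr] My_def cy_def ..
    then show ?thesis unfolding split Q_def A_def by simp
  qed
  obtain \<tau> where \<tau>: "\<bar>\<tau>\<bar> \<le> 8 * real k ^ 4 / real N" and a: "a_const k \<rho> = (\<Prod>p\<in>pr N. ap k (\<rho>\<^sup>2) p) * exp \<tau>"
  proof (rule a_const_tail[OF k \<rho>(2)])
    show "0 < ap k (\<rho>\<^sup>2) p" if "p \<in> pr N" for p using mpos[OF that] by (simp add: ap_def flip: \<rho>(1))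
  qed (use z2' \<rho> yN yk in auto)
  define E1 where "E1 = measure_pmf.expectation (csum (Xp k z) (pr N)) (window k L)"
  define E2 where "E2 = measure_pmf.expectation (csum (YY k z y) (pr N)) (window k L)"
  define E3 where "E3 = (\<integral>x. FF k x \<partial>PiM (idx k) (\<lambda>_. P2))"
  have S: "moment_S k \<rho> N = M * E1"
    using moment_S_expectation[OF N k \<rho>(2)] z2' unfolding M_def E1_def \<rho>(1) Ldef by simp
  have E2F: "E2 = (\<integral>x. FF k x \<partial>PiM (idx k) (\<lambda>_. P1))" unfolding E2_def csum_YY[OF z0 z2 y1] by (rule expectation_YY)
  have main: "a_const k \<rho> * gamma_const k \<rho> * L powr (real k ^ 2 * \<rho> ^ 2) = M * E3 * exp \<tau>"
  proof -
    have "M * E3 = Q * (cy ^ (k\<^sup>2) * L powr (real k ^ 2 * z) * gamma_const k \<rho>)"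
      unfolding MQ E3_def W_def mult.assoc main_value[OF \<rho>(1), unfolded mult.assoc] ..
    also have "\<dots> = (Q * cy ^ (k\<^sup>2)) * (L powr (real k ^ 2 * z) * gamma_const k \<rho>)" by (simp only: mult.assoc)
    finally have "M * E3 = (\<Prod>p\<in>pr N. ap k z p) * (L powr (real k ^ 2 * z) * gamma_const k \<rho>)" unfolding AN .
    then show ?thesis unfolding a \<rho>(1)[symmetric] by simp
  qed
  define t1 where "t1 = exp (2 * real k ^ 2) / L * (2 * real y ^ 2 * meanb \<theta> k + 240 * real k ^ 4 * sq_sum) *
      (exp (16 * real k ^ 2 / (1 - \<theta>)) * (R ^ (k\<^sup>2) * exp (real k ^ 2)))"
  have mb: "0 \<le> 2 * real y ^ 2 * meanb \<theta> k + 240 * real k ^ 4 * sq_sum"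
  proof -
    have "(\<theta> / ((1 + \<theta>) / 2))\<^sup>2 < 1" using th by (intro power_less_one_iff[THEN iffD2]) (auto simp: divide_less_eq abs_square_less_1)
    then show ?thesis using sq_sum_nonneg by (auto simp: meanb_def intro!: add_nonneg_nonneg mult_nonneg_nonneg divide_nonneg_nonneg)
  qed
  have 1: "M * \<bar>E1 - E2\<bar> \<le> t1"
  proof -
    have "M * \<bar>E1 - E2\<bar> \<le> exp (2 * real k ^ 2) / L * (2 * real y ^ 2 * meanb \<theta> k + 240 * real k ^ 4 * sq_sum) *
      (My * exp (real k ^ 2 * (z * (\<Sum>p\<in>PA y N. lam p * real p powr (- (2 * real k / L)))) + 4 * real k ^ 4 * (\<Sum>p\<in>PA y N. 2 / real p ^ 2)))"
      using lindeberg_primes[OF k N th(1,2) z0 th(3)] yN unfolding M_def My_def E1_def E2_def Ldef yk by blast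
    also have "\<dots> \<le> t1" unfolding t1_def
    proof (intro mult_left_mono mult_mono)
      have "(\<Sum>p\<in>PA y N. 2 / real p ^ 2) = 2 * (\<Sum>p\<in>PA y N. 1 / real p ^ 2)" by (simp add: sum_distrib_left)
      also have "\<dots> \<le> 2 * (1 / real y)" by (intro mult_left_mono sum_inv_sq_tail y1) simp
      finally have "4 * real k ^ 4 * (\<Sum>p\<in>PA y N. 2 / real p ^ 2) \<le> 4 * real k ^ 4 * (2 * (1 / real y))" by (intro mult_left_mono) auto
      also have "\<dots> = real k ^ 2" using k1 unfolding yk by (simp add: power2_eq_square power4_eq_xxxx)
      finally have t: "4 * real k ^ 4 * (\<Sum>p\<in>PA y N. 2 / real p ^ 2) \<le> real k ^ 2" .
      have "exp (real k ^ 2 * (z * (\<Sum>p\<in>PA y N. lam p * real p powr (- (2 * real k / L))))) = exp (z * (\<Sum>p\<in>PA y N. lam p * real p powr (- (2 * real k / L)))) ^ (k\<^sup>2)"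
        unfolding exp_of_nat_mult[symmetric] by simp
      also have "\<dots> \<le> R ^ (k\<^sup>2)" using Rb(1) by (intro power_mono) auto
      finally show "exp (real k ^ 2 * (z * (\<Sum>p\<in>PA y N. lam p * real p powr (- (2 * real k / L)))) + 4 * real k ^ 4 * (\<Sum>p\<in>PA y N. 2 / real p ^ 2)) \<le> R ^ (k\<^sup>2) * exp (real k ^ 2)"
        unfolding exp_add using t R1 by (intro mult_mono) auto
    qed (use My0 My1 L0 mb R1 in \<open>auto intro!: mult_nonneg_nonneg divide_nonneg_nonneg\<close>)
    finally show ?thesis .
  qed
  define t2 where "t2 = real k ^ 2 * (exp (2 * real k ^ 2) * (24 * B1 * theta_err y * (64 * real k ^ 6))) * (1 / L * R ^ (k\<^sup>2))"
  have te: "0 \<le> theta_err y" using theta_err_ge1[OF y1] by simp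
  have 2: "W * \<bar>E2 - E3\<bar> \<le> t2"
  proof -
    have "W * \<bar>E2 - E3\<bar> \<le> real k ^ 2 * (exp (2 * real k ^ 2) * (EE / L\<^sup>2) * R ^ (k\<^sup>2 - 1))"
      unfolding W_def E2F E3_def by (rule FF_swap[OF k Rb(1,2)])
    also have "\<dots> \<le> real k ^ 2 * (exp (2 * real k ^ 2) * (24 * B1 * theta_err y * (64 * real k ^ 6) * (R / L)) * R ^ (k\<^sup>2 - 1))"
    proof (intro mult_left_mono mult_right_mono)
      \<comment> \<open>The exchanged position is not damped and leaves L^z/L. Rewriting L as k
        ln(y) B gives R times (k ln y)^z <= (k y)^2 = 64 k^6, a loss polynomial in k.\<close>
      have "(1 + L) powr (1 + z) \<le> (2 * L) powr (1 + z)" using Rb(5) z0 by (intro powr_mono2) auto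
      also have "\<dots> = 2 powr (1 + z) * (L * L powr z)" using L0 by (simp add: powr_mult powr_add)
      also have "\<dots> \<le> 8 * (L * (64 * real k ^ 6 * R))"
      proof (intro mult_mono mult_left_mono)
        have "2 powr (1 + z) \<le> 2 powr (3::real)" using z2 by (intro powr_mono) auto
        then show "2 powr (1 + z) \<le> (8::real)" by simp
        have kl: "1 \<le> real k * ln (real y)" using mult_mono[of 1 "real k" 1 "ln (real y)"] k1 Rb(4) by simp
        have "L = (real k * ln (real y)) * B" using k1 Rb(4) by (simp add: B_def)
        then have "L powr z = (real k * ln (real y)) powr z * B powr z" using k1 Rb(3,4) by (simp add: powr_mult)
        also have "\<dots> \<le> 64 * real k ^ 6 * R"
        proof (intro mult_mono)
          have "(real k * ln (real y)) powr z \<le> (real k * ln (real y)) powr 2" using kl z2 by (intro powr_mono) auto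
          also have "\<dots> = (real k * ln (real y))\<^sup>2" using kl by simp
          also have "\<dots> \<le> (real k * real y)\<^sup>2" using k1 kl Rb(4) ln_bound[of "real y"] y1 by (intro power_mono mult_left_mono) auto
          also have "\<dots> = 64 * real k ^ 6" unfolding yk by (simp add: power_mult_distrib flip: power_mult power_add)
          finally show "(real k * ln (real y)) powr z \<le> 64 * real k ^ 6" .
          have "1 * B powr z \<le> K0 * B powr z" using K0_ge1 by (intro mult_right_mono) auto
          then show "B powr z \<le> R" by (simp add: R_def B_def)
        qed auto
        finally show "L powr z \<le> 64 * real k ^ 6 * R" .
      qed (use L0 in auto)
      finally have "EE \<le> 3 * B1 * theta_err y * (8 * (L * (64 * real k ^ 6 * R)))"
        unfolding EE_def using B1_pos te by (intro mult_left_mono) auto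
      then have "EE / L\<^sup>2 \<le> 3 * B1 * theta_err y * (8 * (L * (64 * real k ^ 6 * R))) / L\<^sup>2" by (intro divide_right_mono) auto
      also have "\<dots> = 24 * B1 * theta_err y * (64 * real k ^ 6) * (R / L)" using L0 by (simp add: power2_eq_square)
      finally show "EE / L\<^sup>2 \<le> 24 * B1 * theta_err y * (64 * real k ^ 6) * (R / L)" .
    qed (use R1 in auto)
    also have "\<dots> = t2"
    proof -
      have "R ^ (k\<^sup>2) = R * R ^ (k\<^sup>2 - 1)" using k by (subst power_Suc[symmetric]) simp
      then show ?thesis unfolding t2_def by simp
    qed
    finally show ?thesis .
  qed
  have NP: "0 < real N" using N by simp
  have "\<bar>M * E1 - a_const k \<rho> * gamma_const k \<rho> * L powr (real k ^ 2 * \<rho> ^ 2)\<bar> \<le> t1 + Q * (1 / L * R ^ (k\<^sup>2) + 2 * t2)"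
  proof (rule telescoping_error[OF MQ 1 2 main])
    show "2 * \<bar>\<tau>\<bar> \<le> 16 * real k ^ 4 / real N" using \<tau> by simp
    show "16 * real k ^ 4 / real N \<le> 1" using h3 NP by simp
    \<comment> \<open>Hypothesis \<open>h4\<close> says that the Euler tail, of size k^4/N, stays
      below 1/L even after multiplication by W.\<close>
    have "W * (16 * real k ^ 4 / real N) \<le> 1 / L"
      using h4 NP L0 by (simp add: W_def pos_le_divide_eq pos_divide_le_eq mult_ac)
    also have "\<dots> = 1 / L * 1" by simp
    also have "\<dots> \<le> 1 / L * R ^ (k\<^sup>2)" using L0 R1 by (intro mult_left_mono one_le_power) auto
    finally show "W * (16 * real k ^ 4 / real N) \<le> 1 / L * R ^ (k\<^sup>2)" .
    show "E2 \<le> 1" unfolding E2_def by (rule pmf_expectation_bounds[THEN conjunct2]) (use window_bounds[OF L_pos] in auto)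
    show "0 \<le> E3" unfolding E3_def by (rule Bochner_Integration.integral_nonneg) (simp add: FF_def window_bounds[OF L_pos])
  qed (use Q W0 in auto)
  also have "\<dots> \<le> t1 + exp (16 * real k ^ 2 / (1 - \<theta>)) * exp (real k ^ 2) * (1 / L * R ^ (k\<^sup>2) + 2 * t2)"
  proof (intro add_left_mono mult_right_mono Q)
    have "0 \<le> t2" using 2 W0 by (meson abs_ge_zero less_imp_le mult_nonneg_nonneg order_trans)
    then show "0 \<le> 1 / L * R ^ (k\<^sup>2) + 2 * t2" using L0 R1 by simp
  qed
  also have "\<dots> = exp (16 * real k ^ 2 / (1 - \<theta>)) * exp (real k ^ 2) * (exp (2 * real k ^ 2) * (2 * real y ^ 2 * meanb \<theta> k + 240 * real k ^ 4 * sq_sum)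
        + 1 + 2 * (real k ^ 2 * (exp (2 * real k ^ 2) * (24 * B1 * theta_err y * (64 * real k ^ 6))))) * (1 / L * R ^ (k\<^sup>2))"
  proof -
    have alg: "e2 / L * m * (g * (r * e)) + g * e * (1 / L * r + 2 * (s * (1 / L * r))) = g * e * (e2 * m + 1 + 2 * s) * (1 / L * r)" for e2 m g r e s :: real
      by (simp add: algebra_simps add_divide_distrib)
    show ?thesis unfolding t1_def t2_def by (rule alg)
  qed
  finally show ?thesis unfolding S .
qed

end

text \<open>With kappa = k^2 and E = exp kappa, every power of k and every logarithm of y is at most
  a power of E, \<open>meanb\<close> is at most D times a constant, and K^(k^2) is already of the
  required form. The numbers 5 and 7 count factors E.\<close>

lemma const_bound:
  assumes th: "0 < \<theta>" "\<theta> < 1" and b: "0 \<le> b" and K: "1 \<le> K"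
  obtains C where "0 < C" and "\<And>k y. 1 \<le> k \<Longrightarrow> y = 8 * k ^ 2 \<Longrightarrow>
    exp (16 * real k ^ 2 / (1 - \<theta>)) * exp (real k ^ 2) * (exp (2 * real k ^ 2) * (2 * real y ^ 2 * meanb \<theta> k + 240 * real k ^ 4 * sq_sum)
        + 1 + 2 * (real k ^ 2 * (exp (2 * real k ^ 2) * (24 * b * theta_err y * (64 * real k ^ 6))))) * K ^ (k\<^sup>2) \<le> exp (C * real k ^ 2)"
proof -
  define m1 where "m1 = - ln (1 - (1 + \<theta>) / 2)"
  define m2 where "m2 = 1 / (1 - (\<theta> / ((1 + \<theta>) / 2))\<^sup>2)"
  define c where "c = 2 * (2 + 4 * sq_sum) + 1"
  define h1 where "h1 = 128 * m2 + 240 * sq_sum"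
  define h3 where "h3 = 3072 * b * (c + 8)"
  define H where "H = h1 + 1 + h3"
  define C where "C = 16 / (1 - \<theta>) + 1 + (7 + 2 * m1 + H) + ln K"
  have sq: "0 \<le> sq_sum" by (rule sq_sum_nonneg)
  have m1: "0 \<le> m1" using th by (simp add: m1_def)
  have q: "(\<theta> / ((1 + \<theta>) / 2))\<^sup>2 < 1" using th by (intro power_less_one_iff[THEN iffD2]) (auto simp: divide_less_eq abs_square_less_1)
  then have m2: "0 < m2" by (simp add: m2_def)
  have h: "0 \<le> h1" "0 \<le> h3" using m2 sq b by (auto simp: h1_def h3_def c_def)
  have C: "0 < C" unfolding C_def H_def using th h m1 K by (intro add_pos_nonneg) auto
  show ?thesis
  proof (rule that[OF C])
    fix k y :: nat assume k: "1 \<le> k" and y: "y = 8 * k ^ 2"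
    define \<kappa> where "\<kappa> = real k ^ 2"
    define E where "E = exp \<kappa>"
    define D where "D = exp (2 * m1 * \<kappa>)"
    have k1: "1 \<le> real k" using k by simp
    have \<kappa>: "1 \<le> \<kappa>" unfolding \<kappa>_def using k1 by (rule one_le_power)
    have kk: "real k \<le> \<kappa>" unfolding \<kappa>_def power2_eq_square using mult_left_mono[OF k1, of "real k"] by simp
    have E: "1 \<le> E" "\<kappa> \<le> E" using \<kappa> exp_ge_add_one_self[of \<kappa>] unfolding E_def by linarith+
    have D: "1 \<le> D" using m1 \<kappa> by (simp add: D_def)
    have k4: "real k ^ 4 = \<kappa>\<^sup>2" and k6: "real k ^ 6 = \<kappa> ^ 3" by (simp_all add: \<kappa>_def flip: power_mult)
    have y': "real y = 8 * \<kappa>" by (simp add: y \<kappa>_def)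
    have e2: "exp (2 * \<kappa>) = E\<^sup>2" by (simp add: E_def exp_double)
    have kE: "\<kappa>\<^sup>2 \<le> E\<^sup>2" "\<kappa> ^ 3 \<le> E ^ 3" using \<kappa> E by (auto intro!: power_mono)
    have E25: "E\<^sup>2 \<le> E ^ 5" using E(1) by (intro power_increasing) auto
    have ED: "1 \<le> E ^ 5 * D" using mult_mono[of 1 "E ^ 5" 1 D] D E(1) by simp
    have mb: "meanb \<theta> k \<le> D * m2"
    proof -
      have "0 < 1 - (1 + \<theta>) / 2" using th by simp
      moreover have "w powr (- (2 * a)) = exp (2 * (- ln w) * a)" if "0 < w" for w a :: real using that by (simp add: powr_def)
      ultimately have "(1 - (1 + \<theta>) / 2) powr (- (2 * real k)) = exp (2 * m1 * real k)" unfolding m1_def by blast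
      also have "\<dots> \<le> D" unfolding D_def using kk m1 by (simp only: exp_le_cancel_iff) (intro mult_left_mono, auto)
      finally have "(1 - (1 + \<theta>) / 2) powr (- (2 * real k)) * m2 \<le> D * m2" using m2 by (intro mult_right_mono) auto
      then show ?thesis by (simp only: meanb_def m2_def times_divide_eq_right mult_1_right)
    qed
    have 1: "2 * real y ^ 2 * meanb \<theta> k + 240 * real k ^ 4 * sq_sum \<le> E ^ 5 * D * h1"
    proof -
      have y2: "2 * real y ^ 2 = 128 * \<kappa>\<^sup>2" unfolding y' power_mult_distrib by simp
      have "0 \<le> meanb \<theta> k" unfolding meanb_def using q by (intro divide_nonneg_nonneg powr_ge_zero) linarith
      then have "2 * real y ^ 2 * meanb \<theta> k \<le> 128 * E\<^sup>2 * (D * m2)"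
        unfolding y2 using kE mb by (intro mult_mono) auto
      also have "\<dots> \<le> 128 * E ^ 5 * (D * m2)" using E25 D m2 by (intro mult_right_mono) auto
      finally have a: "2 * real y ^ 2 * meanb \<theta> k \<le> 128 * E ^ 5 * (D * m2)" .
      have "240 * real k ^ 4 * sq_sum \<le> 240 * (E ^ 5 * D) * sq_sum"
      proof -
        have "\<kappa>\<^sup>2 \<le> E ^ 5 * 1" using kE(1) E25 by simp
        also have "\<dots> \<le> E ^ 5 * D" using D E by (intro mult_left_mono) auto
        finally show ?thesis unfolding k4 using sq by (intro mult_right_mono) auto
      qed
      then show ?thesis using a by (simp add: h1_def algebra_simps)
    qed
    have 2: "2 * (\<kappa> * (24 * b * theta_err y * (64 * real k ^ 6))) \<le> E ^ 5 * D * h3"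
    proof -
      have c0: "0 \<le> c" using sq by (simp add: c_def)
      have "ln (real y) \<le> real y" using \<kappa> by (intro ln_bound) (simp add: y')
      then have "theta_err y \<le> c + 8 * \<kappa>" by (simp add: theta_err_def c_def y')
      also have "\<dots> \<le> c * E + 8 * E" using E c0 by (intro add_mono mult_left_mono) (auto simp: mult_le_cancel_left1)
      finally have te: "theta_err y \<le> (c + 8) * E" by (simp add: algebra_simps)
      have "1 \<le> y" using k by (simp add: y)
      from theta_err_ge1[OF this] have te0: "0 \<le> theta_err y" by simp
      have "2 * (\<kappa> * (24 * b * theta_err y * (64 * real k ^ 6))) \<le> 2 * (E * (24 * b * ((c + 8) * E) * (64 * E ^ 3)))"
        unfolding k6 using E te te0 b c0 \<kappa> kE by (intro mult_left_mono mult_mono) auto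
      also have "\<dots> = E ^ 5 * 1 * h3" by (simp add: h3_def numeral_eq_Suc)
      also have "\<dots> \<le> E ^ 5 * D * h3" using D E h by (intro mult_right_mono mult_left_mono) auto
      finally show ?thesis .
    qed
    have "exp (2 * real k ^ 2) * (2 * real y ^ 2 * meanb \<theta> k + 240 * real k ^ 4 * sq_sum)
        + 1 + 2 * (real k ^ 2 * (exp (2 * real k ^ 2) * (24 * b * theta_err y * (64 * real k ^ 6))))
      = E\<^sup>2 * (2 * real y ^ 2 * meanb \<theta> k + 240 * real k ^ 4 * sq_sum) + 1 + E\<^sup>2 * (2 * (\<kappa> * (24 * b * theta_err y * (64 * real k ^ 6))))"
      unfolding \<kappa>_def[symmetric] e2 by simp
    also have "\<dots> \<le> E\<^sup>2 * (E ^ 5 * D * h1) + E\<^sup>2 * (E ^ 5 * D) + E\<^sup>2 * (E ^ 5 * D * h3)"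
    proof (intro add_mono mult_left_mono 1 2)
      show "1 \<le> E\<^sup>2 * (E ^ 5 * D)" using mult_mono[of 1 "E\<^sup>2" 1 "E ^ 5 * D"] ED E(1) by (simp add: one_le_power)
    qed auto
    also have "\<dots> = E ^ 7 * D * H" by (simp add: H_def algebra_simps flip: power_add)
    also have "\<dots> \<le> E ^ 7 * D * exp (H * \<kappa>)"
    proof -
      have "H \<le> H * \<kappa>" using \<kappa> h by (simp add: H_def mult_le_cancel_left1)
      also have "\<dots> \<le> exp (H * \<kappa>)" using exp_ge_add_one_self[of "H * \<kappa>"] by linarith
      finally show ?thesis using D E by (intro mult_left_mono) auto
    qed
    also have "\<dots> = exp ((7 + 2 * m1 + H) * \<kappa>)"
    proof -
      have "E ^ 7 = exp (7 * \<kappa>)" unfolding E_def using exp_of_nat_mult[of 7 \<kappa>] by simp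
      then show ?thesis by (simp add: D_def exp_add[symmetric] algebra_simps)
    qed
    finally have X: "exp (2 * real k ^ 2) * (2 * real y ^ 2 * meanb \<theta> k + 240 * real k ^ 4 * sq_sum)
        + 1 + 2 * (real k ^ 2 * (exp (2 * real k ^ 2) * (24 * b * theta_err y * (64 * real k ^ 6)))) \<le> exp ((7 + 2 * m1 + H) * \<kappa>)" (is "?X \<le> _") .
    have "K ^ (k\<^sup>2) = exp (\<kappa> * ln K)" 
    proof -
      have "K ^ (k\<^sup>2) = exp (ln K) ^ (k\<^sup>2)" using K by simp
      also have "\<dots> = exp (\<kappa> * ln K)" unfolding exp_of_nat_mult[symmetric] by (simp add: \<kappa>_def)
      finally show ?thesis .
    qed
    then have "exp (16 * real k ^ 2 / (1 - \<theta>)) * exp (real k ^ 2) * ?X * K ^ (k\<^sup>2) = exp (16 * real k ^ 2 / (1 - \<theta>)) * exp (real k ^ 2) * ?X * exp (\<kappa> * ln K)"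
      by (rule arg_cong)
    also have "\<dots> \<le> exp (16 * real k ^ 2 / (1 - \<theta>)) * exp (real k ^ 2) * exp ((7 + 2 * m1 + H) * \<kappa>) * exp (\<kappa> * ln K)"
      by (intro mult_right_mono mult_left_mono X mult_nonneg_nonneg exp_ge_zero)
    also have "\<dots> = exp (C * real k ^ 2)"
    proof -
      have "exp (16 * x / t) * exp x * exp (b * x) * exp (x * c) = exp ((16 / t + 1 + b + c) * x)" for t x b c :: real
        by (simp only: exp_add[symmetric] distrib_right mult_1 times_divide_eq_left mult.commute[of x c])
      then show ?thesis unfolding C_def \<kappa>_def by blast
    qed
    finally show "exp (16 * real k ^ 2 / (1 - \<theta>)) * exp (real k ^ 2) * ?X * K ^ (k\<^sup>2) \<le> exp (C * real k ^ 2)" .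
  qed
qed

section \<open>The case rho = 0 and the conclusion\<close>

lemma bigOmega_eq_0: "1 \<le> n \<Longrightarrow> bigOmega n = 0 \<longleftrightarrow> n = 1"
  by (auto simp: bigOmega_def prime_factorization_empty_iff)

text \<open>Since 0^0 = 1 and Omega(n) = 0 for n = 1 only, the Dirichlet polynomial is the constant
  1.\<close>

lemma moment_S_0: assumes N: "1 \<le> N" shows "moment_S k 0 N = 1"
proof -
  have d: "dirpoly N 0 t = 1" for t
  proof -
    have "dirpoly N 0 t = (\<Sum>n=1..N. if n = 1 then 1 else 0)"
      unfolding dirpoly_def
    proof (intro sum.cong refl)
      fix n assume n: "n \<in> {1..N}"
      show "complex_of_real (0 ^ bigOmega n * (1 - ln (real n) / ln (real N))) / (of_nat n) powr (1/2 + \<i> * complex_of_real t) = (if n = 1 then 1 else 0)"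
      proof (cases "n = 1")
        case True
        have "bigOmega 1 = 0" by (simp add: bigOmega_def)
        then show ?thesis unfolding True by simp
      next
        case False
        then have "bigOmega n \<noteq> 0" using n bigOmega_eq_0[of n] by simp
        then have "(0::real) ^ bigOmega n = 0" by (rule zero_power[OF neq0_conv[THEN iffD1]])
        then show ?thesis using False by (simp only: mult_zero_left of_real_0 div_0 if_False)
      qed
    qed
    also have "\<dots> = 1" using N by simp
    finally show ?thesis .
  qed
  have I: "integral {0..T} (\<lambda>t. cmod (dirpoly N 0 t) ^ (2 * k)) = T" if "0 < T" for T
    using that by (simp only: d norm_one power_one) simp
  have "\<forall>\<^sub>F T in at_top. (1::real) = 1 / T * integral {0..T} (\<lambda>t. cmod (dirpoly N 0 t) ^ (2 * k))"
    using eventually_gt_at_top[of 0] by eventually_elim (simp only: I, simp)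
  then have "((\<lambda>T::real. 1 / T * integral {0..T} (\<lambda>t. cmod (dirpoly N 0 t) ^ (2 * k))) \<longlongrightarrow> 1) at_top"
    by (rule Lim_transform_eventually[OF tendsto_const])
  then show ?thesis unfolding moment_S_def by (rule tendsto_Lim[OF trivial_limit_at_top_linorder])
qed

lemma a_const_0: "a_const k 0 = 1"
proof -
  have X: "(\<Sum>j. real (dk_pp k j) ^ 2 * 0 ^ (2 * j) / real p ^ j) = 1" for p
  proof -
    have "(\<Sum>j. real (dk_pp k j) ^ 2 * 0 ^ (2 * j) / real p ^ j) = (\<Sum>j\<in>{0}. real (dk_pp k j) ^ 2 * 0 ^ (2 * j) / real p ^ j)"
      by (rule suminf_finite) auto
    then show ?thesis by (simp add: dk_pp_def)
  qed
  have "a_const k 0 = (\<Prod>p. if prime p then (1 - 1 / real p) powr 0 * 1 else 1)" by (simp only: a_const_def X zero_power2 mult_zero_right)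
  also have "(\<lambda>p::nat. if prime p then (1 - 1 / real p) powr 0 * 1 else 1) = (\<lambda>p. 1)"
    by (auto dest: prime_gt_1_nat)
  finally show ?thesis by simp
qed

text \<open>Here L is log N, and ln L bounds k^2. After ln L >= 1 the conditions serve, in this
  order, the hypotheses \<open>h2\<close>, \<open>h3\<close>, \<open>h4\<close> and
  \<open>yN\<close> of \<open>error_bound\<close>.\<close>

lemma eventually_large:
  fixes c d :: real
  shows "\<forall>\<^sub>F L in at_top. 1 \<le> ln L \<and> 2 * ln L * (8 * ln L + c) \<le> L \<and> 16 * (ln L)\<^sup>2 \<le> exp L
    \<and> exp (6 * ln L * (ln L + d)) * (16 * (ln L)\<^sup>2) * L \<le> exp L \<and> 8 * ln L \<le> exp L"
  by (intro eventually_conj; real_asymp)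

theorem theorem2:
  fixes \<delta> :: real
  assumes "\<delta> > 0"
  shows "\<exists>C>0. \<forall>\<eta> :: nat \<Rightarrow> real. \<eta> \<longlonglongrightarrow> 0 \<longrightarrow>
    (\<exists>N0. \<forall>N\<ge>N0. \<forall>k::nat. \<forall>\<rho>::real.
       1 \<le> k \<and> real k \<le> \<eta> N * sqrt (ln (ln (real N))) \<and> 0 \<le> \<rho> \<and> \<rho> \<le> sqrt (2 - \<delta>) \<longrightarrow>
       \<bar>moment_S k \<rho> N - a_const k \<rho> * gamma_const k \<rho> * ln (real N) powr (real k ^ 2 * \<rho> ^ 2)\<bar>
         \<le> C * ln (real N) powr (real k ^ 2 * \<rho> ^ 2 - 1/2) *
            exp (- (real k ^ 2 * \<rho> ^ 2 * ln (real k)) - real k ^ 2 * \<rho> ^ 2 * ln (ln (real k))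
                 + C * real k ^ 2))"
proof -
  \<comment> \<open>Chosen so that rho^2 <= 2 theta^2. If delta >= 2 then sqrt (2 - delta) is at
    most 0, which forces rho = 0, and any theta in (0, 1) will do.\<close>
  define \<theta> where "\<theta> = (if \<delta> < 2 then sqrt (1 - \<delta> / 2) else 1 / 2)"
  have th: "0 < \<theta>" "\<theta> < 1" using assms by (auto simp: \<theta>_def)
  \<comment> \<open>\<open>B1\<close> and \<open>K0\<close> contain neither z nor y, so an arbitrary
    instance names these constants before N, k and rho are given.\<close>
  interpret one: rough_window 1 1 2 "ln (real 2)" by unfold_locales auto
  obtain C1 where C1: "0 < C1" and CB: "\<And>k y. 1 \<le> k \<Longrightarrow> y = 8 * k ^ 2 \<Longrightarrow>
    exp (16 * real k ^ 2 / (1 - \<theta>)) * exp (real k ^ 2) * (exp (2 * real k ^ 2) * (2 * real y ^ 2 * meanb \<theta> k + 240 * real k ^ 4 * sq_sum)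
        + 1 + 2 * (real k ^ 2 * (exp (2 * real k ^ 2) * (24 * one.B1 * theta_err y * (64 * real k ^ 6))))) * one.K0 ^ (k\<^sup>2) \<le> exp (C1 * real k ^ 2)"
    by (rule const_bound[OF th less_imp_le[OF one.B1_pos] one.K0_ge1]) blast
  \<comment> \<open>C appears both in the exponent and as a leading factor, hence the maximum with
    1.\<close>
  define C where "C = max 1 C1"
  have C: "1 \<le> C" "C1 \<le> C" by (auto simp: C_def)
  show ?thesis
  proof (intro exI[of _ C] conjI allI impI)
    show "0 < C" using C by linarith
    fix \<eta> :: "nat \<Rightarrow> real" assume "\<eta> \<longlonglongrightarrow> 0"
    then have "\<forall>\<^sub>F N in sequentially. \<eta> N < 1" by (rule order_tendstoD) simp
    moreover have "filterlim (\<lambda>N. ln (real N)) at_top sequentially"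
      by (rule filterlim_compose[OF ln_at_top filterlim_real_sequentially])
    note eventually_compose_filterlim[OF eventually_large[of "2 + 4 * sq_sum" "1 + inv_sq_sum"] this]
    ultimately have "\<forall>\<^sub>F N in sequentially. \<eta> N < 1 \<and> 2 \<le> N \<and> 1 \<le> ln (ln (real N)) 
      \<and> 2 * ln (ln (real N)) * (8 * ln (ln (real N)) + (2 + 4 * sq_sum)) \<le> ln (real N) \<and> 16 * (ln (ln (real N)))\<^sup>2 \<le> exp (ln (real N))
      \<and> exp (6 * ln (ln (real N)) * (ln (ln (real N)) + (1 + inv_sq_sum))) * (16 * (ln (ln (real N)))\<^sup>2) * ln (real N) \<le> exp (ln (real N))
      \<and> 8 * ln (ln (real N)) \<le> exp (ln (real N))"
      using eventually_ge_at_top[of 2] by (intro eventually_conj) (auto elim: eventually_mono)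
    then obtain N0 where N0: "\<And>N. N0 \<le> N \<Longrightarrow> \<eta> N < 1 \<and> 2 \<le> N \<and> 1 \<le> ln (ln (real N)) 
      \<and> 2 * ln (ln (real N)) * (8 * ln (ln (real N)) + (2 + 4 * sq_sum)) \<le> ln (real N) \<and> 16 * (ln (ln (real N)))\<^sup>2 \<le> exp (ln (real N))
      \<and> exp (6 * ln (ln (real N)) * (ln (ln (real N)) + (1 + inv_sq_sum))) * (16 * (ln (ln (real N)))\<^sup>2) * ln (real N) \<le> exp (ln (real N))
      \<and> 8 * ln (ln (real N)) \<le> exp (ln (real N))"
      unfolding eventually_sequentially by blast
    show "\<exists>N0. \<forall>N\<ge>N0. \<forall>k::nat. \<forall>\<rho>::real.
       1 \<le> k \<and> real k \<le> \<eta> N * sqrt (ln (ln (real N))) \<and> 0 \<le> \<rho> \<and> \<rho> \<le> sqrt (2 - \<delta>) \<longrightarrow>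
       \<bar>moment_S k \<rho> N - a_const k \<rho> * gamma_const k \<rho> * ln (real N) powr (real k ^ 2 * \<rho> ^ 2)\<bar>
         \<le> C * ln (real N) powr (real k ^ 2 * \<rho> ^ 2 - 1/2) *
            exp (- (real k ^ 2 * \<rho> ^ 2 * ln (real k)) - real k ^ 2 * \<rho> ^ 2 * ln (ln (real k)) + C * real k ^ 2)"
    proof (intro exI[of _ N0] allI impI, elim conjE)
      fix N k :: nat and \<rho> :: real
      assume NN: "N0 \<le> N" and k: "1 \<le> k" and k\<eta>: "real k \<le> \<eta> N * sqrt (ln (ln (real N)))" and \<rho>: "0 \<le> \<rho>" "\<rho> \<le> sqrt (2 - \<delta>)"
      define L where "L = ln (real N)"
      note big = N0[OF NN, folded L_def]
      have N2: "2 \<le> N" using big by blast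
      then have eL: "exp L = real N" by (simp add: L_def)
      have l: "1 \<le> ln L" using big by blast
      have L0: "0 < L" using N2 by (simp add: L_def)
      have L1: "1 \<le> L" using l L0 by (smt (verit) ln_le_zero_iff)
      show "\<bar>moment_S k \<rho> N - a_const k \<rho> * gamma_const k \<rho> * ln (real N) powr (real k ^ 2 * \<rho> ^ 2)\<bar>
         \<le> C * ln (real N) powr (real k ^ 2 * \<rho> ^ 2 - 1/2) *
            exp (- (real k ^ 2 * \<rho> ^ 2 * ln (real k)) - real k ^ 2 * \<rho> ^ 2 * ln (ln (real k)) + C * real k ^ 2)"
      proof (cases "\<rho> = 0")
        case True
        have "gamma_const k 0 = 1" by (simp add: gamma_const_def)
        then show ?thesis using True C L0 N2 by (simp add: moment_S_0 a_const_0 L_def)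
      next
        case False
        then have \<rho>0: "0 < \<rho>" using \<rho> by simp
        then have "0 < sqrt (2 - \<delta>)" using \<rho> by linarith
        then have \<delta>2: "\<delta> < 2" by simp
        define z where "z = \<rho>\<^sup>2"
        have "\<rho>\<^sup>2 \<le> (sqrt (2 - \<delta>))\<^sup>2" using \<rho> by (intro power_mono) auto
        also have "\<dots> = 2 * \<theta>\<^sup>2" using \<delta>2 assms by (simp add: \<theta>_def)
        finally have z\<theta>: "z \<le> 2 * \<theta>\<^sup>2" by (simp add: z_def)
        have "\<theta>\<^sup>2 < 1" using th by (simp add: abs_square_less_1)
        then have z: "0 < z" "z \<le> 2" using z\<theta> \<rho>0 by (auto simp: z_def)
        define \<kappa> where "\<kappa> = real k ^ 2"
        have k1: "1 \<le> real k" using k by simp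
        have kk: "real k \<le> \<kappa>" unfolding \<kappa>_def power2_eq_square using mult_left_mono[OF k1, of "real k"] by simp
        \<comment> \<open>The growth condition on k is used in the form k^2 <= log log N, which
          follows once eta N < 1.\<close>
        have "\<eta> N * sqrt (ln L) \<le> 1 * sqrt (ln L)" using big l by (intro mult_right_mono) (auto intro: less_imp_le)
        then have "real k \<le> sqrt (ln L)" using k\<eta>[folded L_def] by linarith
        then have "\<kappa> \<le> (sqrt (ln L))\<^sup>2" unfolding \<kappa>_def by (intro power_mono) auto
        then have \<kappa>: "\<kappa> \<le> ln L" using l by simp
        define y where "y = 8 * k ^ 2"
        have y': "real y = 8 * \<kappa>" by (simp add: y_def \<kappa>_def)
        have y1: "1 \<le> y" using k by (simp add: y_def)
        interpret W: rough_window z y N L by unfold_locales (use z y1 N2 L_def in auto)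
        have yN: "y \<le> N"
        proof -
          have "real y \<le> 8 * ln L" using \<kappa> by (simp add: y')
          also have "\<dots> \<le> real N" using big eL by simp
          finally show ?thesis by simp
        qed
        have h2: "2 * real k * (ln (real y) + (2 + 4 * sq_sum)) \<le> L"
        proof -
          have "ln (real y) \<le> real y" using y1 by (intro ln_bound) simp
          then have "ln (real y) + (2 + 4 * sq_sum) \<le> 8 * ln L + (2 + 4 * sq_sum)" using \<kappa> by (simp add: y')
          moreover have "0 \<le> ln (real y) + (2 + 4 * sq_sum)" using y1 sq_sum_nonneg by simp
          ultimately have "2 * real k * (ln (real y) + (2 + 4 * sq_sum)) \<le> 2 * ln L * (8 * ln L + (2 + 4 * sq_sum))"
            using kk \<kappa> l by (intro mult_mono) auto
          also have "\<dots> \<le> L" using big by blast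
          finally show ?thesis .
        qed
        have k4: "real k ^ 4 = \<kappa>\<^sup>2" by (simp add: \<kappa>_def flip: power_mult)
        have \<kappa>2: "\<kappa>\<^sup>2 \<le> (ln L)\<^sup>2" using \<kappa> kk k1 by (intro power_mono) auto
        have h3: "16 * real k ^ 4 \<le> real N" using \<kappa>2 big eL by (simp add: k4)
        \<comment> \<open>\<open>wt\<close> to the power k^2 is at most exp(O((log log N)^2)), far
          below N.\<close>
        have h4: "W.wt N ^ (k\<^sup>2) * (16 * real k ^ 4) * L \<le> real N"
        proof -
          have S0: "0 \<le> (\<Sum>p\<in>PA y N. lam p)" by (intro sum_nonneg) (auto dest: PAD intro: less_imp_le)
          have "(\<Sum>p\<in>PA y N. lam p) \<le> (\<Sum>p\<in>pr N. lam p)" by (rule sum_mono2) (auto simp: PA_def dest: prD intro!: less_imp_le[OF lam_pos])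
          also have "\<dots> \<le> 3 * (ln L + (1 + inv_sq_sum))" by (rule sum_lam_le[OF L_def L1])
          finally have S: "(\<Sum>p\<in>PA y N. lam p) \<le> 3 * (ln L + (1 + inv_sq_sum))" .
          have "W.wt N ^ (k\<^sup>2) = exp (\<kappa> * (z * (\<Sum>p\<in>PA y N. lam p)))"
            unfolding W.wt_def exp_of_nat_mult[symmetric] by (simp add: \<kappa>_def)
          also have "\<dots> \<le> exp (ln L * (2 * (3 * (ln L + (1 + inv_sq_sum)))))"
            unfolding exp_le_cancel_iff using \<kappa> z S S0 l kk by (intro mult_mono) auto
          also have "\<dots> = exp (6 * ln L * (ln L + (1 + inv_sq_sum)))" by (simp add: algebra_simps)
          finally have "W.wt N ^ (k\<^sup>2) * (16 * real k ^ 4) * L \<le> exp (6 * ln L * (ln L + (1 + inv_sq_sum))) * (16 * (ln L)\<^sup>2) * L"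
            unfolding k4 using \<kappa>2 L0 W.wt_pos[of N] by (intro mult_mono) auto
          also have "\<dots> \<le> real N" using big eL by simp
          finally show ?thesis .
        qed
        let ?B = "L / (real k * ln (real y))"
        let ?P = "exp (16 * real k ^ 2 / (1 - \<theta>)) * exp (real k ^ 2) * (exp (2 * real k ^ 2) * (2 * real y ^ 2 * meanb \<theta> k + 240 * real k ^ 4 * sq_sum)
        + 1 + 2 * (real k ^ 2 * (exp (2 * real k ^ 2) * (24 * one.B1 * theta_err y * (64 * real k ^ 6)))))"
        note Rb = W.R_bounds[OF k y_def yN h2]
        let ?lk = "ln (real k) + ln (ln (real k))"
        \<comment> \<open>For k = 1 both logarithms are 0, because ln 0 = 0, and the claim is 1 <=
          ln y. For k > 1 it is ln k <= ln y.\<close>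
        have lk: "exp ?lk \<le> real k * ln (real y)"
        proof (cases "k = 1")
          case True
          then show ?thesis using Rb(4) by simp
        next
          case False
          then have k2: "1 < real k" using k by simp
          then have "exp ?lk = real k * ln (real k)" by (simp add: exp_add)
          also have "\<dots> \<le> real k * ln (real y)" using kk k2 y' by (intro mult_left_mono ln_mono) auto
          finally show ?thesis .
        qed
        have Bz: "(?B powr z) ^ (k\<^sup>2) \<le> L powr (\<kappa> * z) * exp (- (\<kappa> * z * ?lk))"
        proof -
          have B0: "0 < ?B" using Rb(3) by linarith
          have "0 < real k * ln (real y)" using lk exp_gt_zero[of ?lk] by linarith
          then have "?B \<le> L / exp ?lk" using lk L0 by (intro divide_left_mono mult_pos_pos[OF _ exp_gt_zero]) auto
          then have "?B powr (\<kappa> * z) \<le> (L / exp ?lk) powr (\<kappa> * z)" using B0 z kk k1 by (intro powr_mono2) auto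
          also have "\<dots> = L powr (\<kappa> * z) * exp (- (\<kappa> * z * ?lk))"
          proof -
            have "(L / exp w) powr a = L powr a * exp (- (a * w))" for w a :: real
            proof -
              have "ln (L / exp w) = ln L - w" using L0 by (simp add: ln_div)
              moreover have "0 < L / exp w" using L0 by simp
              ultimately have "(L / exp w) powr a = exp (a * (ln L - w))" by (simp only: powr_def less_imp_neq[symmetric] if_False)
              then show ?thesis using L0 by (simp only: powr_def less_imp_neq[symmetric] if_False right_diff_distrib exp_diff exp_minus divide_inverse)
            qed
            then show ?thesis .
          qed
          also have "?B powr (\<kappa> * z) = (?B powr z) ^ (k\<^sup>2)"
          proof -
            have "b powr (\<kappa> * z) = (b powr z) ^ (k\<^sup>2)" if "0 < b" for b
            proof -
              have "(b powr z) ^ (k\<^sup>2) = (b powr z) powr (real (k\<^sup>2))" using that by (subst powr_realpow) auto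
              also have "\<dots> = b powr (z * \<kappa>)" by (simp add: powr_powr \<kappa>_def)
              finally show ?thesis by (simp only: mult.commute)
            qed
            from this[OF B0] show ?thesis .
          qed
          finally show ?thesis .
        qed
        have P: "?P * one.K0 ^ (k\<^sup>2) \<le> exp (C1 * real k ^ 2)" by (rule CB[OF k y_def])
        have "\<bar>moment_S k \<rho> N - a_const k \<rho> * gamma_const k \<rho> * L powr (real k ^ 2 * \<rho> ^ 2)\<bar> \<le> ?P * (1 / L * (one.K0 * ?B powr z) ^ (k\<^sup>2))"
          by (rule W.error_bound[OF k y_def yN h2 h3 h4 z_def \<rho>0 th z\<theta>])
        also have "\<dots> = (?P * one.K0 ^ (k\<^sup>2)) * (1 / L * (?B powr z) ^ (k\<^sup>2))" by (simp only: power_mult_distrib mult.assoc mult.left_commute)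
        also have "\<dots> \<le> exp (C1 * real k ^ 2) * (1 / L * (L powr (\<kappa> * z) * exp (- (\<kappa> * z * ?lk))))"
          using P Bz L0 by (intro mult_mono) auto
        also have "1 / L * (L powr (\<kappa> * z) * exp (- (\<kappa> * z * ?lk))) = L powr (\<kappa> * z - 1) * exp (- (\<kappa> * z * ?lk))"
          using L0 by (simp add: powr_diff)
        \<comment> \<open>The saving obtained is 1/L; as L >= 1 it implies the stated
          L^(-1/2).\<close>
        also have "exp (C1 * real k ^ 2) * (L powr (\<kappa> * z - 1) * exp (- (\<kappa> * z * ?lk))) \<le> (C * exp (C * real k ^ 2)) * (L powr (\<kappa> * z - 1/2) * exp (- (\<kappa> * z * ?lk)))"
        proof (intro mult_mono)
          have "exp (C1 * real k ^ 2) \<le> 1 * exp (C * real k ^ 2)" using C by (simp add: mult_right_mono)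
          also have "\<dots> \<le> C * exp (C * real k ^ 2)" using C by (intro mult_right_mono) auto
          finally show "exp (C1 * real k ^ 2) \<le> C * exp (C * real k ^ 2)" .
          show "L powr (\<kappa> * z - 1) \<le> L powr (\<kappa> * z - 1/2)" using L1 by (intro powr_mono) auto
        qed (use C in auto)
        also have "\<dots> = C * L powr (\<kappa> * z - 1/2) * (exp (- (\<kappa> * z * ?lk)) * exp (C * real k ^ 2))" by simp
        also have "exp (- (\<kappa> * z * ?lk)) * exp (C * real k ^ 2) = exp (- (real k ^ 2 * \<rho> ^ 2 * ln (real k)) - real k ^ 2 * \<rho> ^ 2 * ln (ln (real k)) + C * real k ^ 2)"
          unfolding exp_add[symmetric] by (simp add: \<kappa>_def z_def algebra_simps)
        finally show ?thesis by (simp only: L_def \<kappa>_def z_def)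
      qed
    qed
  qed
qed

end
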